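(* All coefficients of the quantum Berezinian $B_q(L^{\pm}(z))$, regarded as a formal power series in $z^{\mp1}$, belong to the center of $\mathrm{U}_q(\widehat{\mathfrak{gl}}_{M|N})$.
   Context: Let $M,N\ge 0$ be integers with $M\ne N$. The base field is $\mathbb{C}(q)$ ($q$ is not a root of unity). For $1\le i\le M+N$ put $\bar i=0$ if $i\le M$ and $\bar i=1$ if $i>M$, and $q_i=q^{1-2\bar i}$. $\mathbb{C}^{M|N}$ is the superspace with basis $e_i$ of parity $\bar i$, and $E_{ij}\in\mathrm{End}\,\mathbb{C}^{M|N}$ are the matrix units (of parity $\bar i+\bar j$). Tensor products of superalgebras are graded: $(a\otimes b)(a'\otimes b')=(-1)^{|b||a'|}aa'\otimes bb'$. Put $R(z,w)=\sum_i (zq_i-wq_i^{-1})E_{ii}\otimes E_{ii}+(z-w)\sum_{i\ne j}E_{ii}\otimes E_{jj}+z\sum_{i<j}(q_j-q_j^{-1})E_{ij}\otimes E_{ji}+w\sum_{i>j}(q_j-q_j^{-1})E_{ij}\otimes E_{ji}$, $\overline R(x)=R(x,1)/(xq-q^{-1})$ and $R(x)=f(x)\overline R(x)$, where $f(x)=1+\sum_{k\ge1}f_kx^{-k}$ is the formal series uniquely determined by $f(xq^{2N-2M})=f(x)\frac{(1-xq^{-2})(1-xq^{2N-2M+2})}{(1-x)(1-xq^{2N-2M})}$; $R(x)$ is expanded in powers of $x^{-1}$. $\mathrm{U}_q(\widehat{\mathfrak{gl}}_{M|N})$ is the superalgebra over $\mathbb{C}(q)$ generated by $l_{ij}^{\pm(r)}$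 ($1\le i,j\le M+N$, $r\ge 0$, parity $\bar i+\bar j$) and an invertible central even element $q^c$. Put $l_{ij}^{\pm}(z)=\sum_{r\ge0}l_{ij}^{\pm(r)}z^{\mp r}$, $L^{\pm}(z)=\sum_{i,j}l^{\pm}_{ij}(z)\otimes E_{ij}$, and let $L_a^\pm(z)$ denote $L^\pm(z)$ acting in the $a$-th copy of $\mathrm{End}\,\mathbb{C}^{M|N}$. The defining relations are: $l_{ji}^{+(0)}=l_{ij}^{-(0)}=0$ for $i<j$; $l_{ii}^{-(0)}l_{ii}^{+(0)}=l_{ii}^{+(0)}l_{ii}^{-(0)}=1$; $R(z/w)L_1^{\pm}(z)L_2^{\pm}(w)=L_2^{\pm}(w)L_1^{\pm}(z)R(z/w)$; $R(zq^{c}/w)L_1^{+}(z)L_2^{-}(w)=L_2^{-}(w)L_1^{+}(z)R(zq^{-c}/w)$. Inverses of matrices such as $L^\pm(z)$ are taken in $\mathrm{U}_q(\widehat{\mathfrak{gl}}_{M|N})\otimes\mathrm{End}\,\mathbb{C}^{M|N}$, and $A_{ij}$ denotes the coefficient of $E_{ij}$ in $A$. The quantum Berezinian is $$B_q(L^{\pm}(z))=\sum_{\sigma\in S_M}(-q)^{-l(\sigma)}L^{\pm}(z)_{\sigma(1),1}\cdots L^{\pm}(zq^{2M-2})_{\sigma(M),M}\sum_{\tau\in S_N}(-q)^{-l(\tau)}\bigl(L^{\pm}(zq^{2M-2})^{-1}\bigr)_{M+1,M+\tau(1)}\cdots\bigl(L^{\pm}(zq^{2M-2N})^{-1}\bigr)_{M+N,M+\tau(N)},$$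 where in the first product the $j$-th factor has argument $zq^{2j-2}$, in the second product the $k$-th factor has argument $zq^{2M-2k}$, and $l$ is the length function on permutations. *)

theory Defs
  imports
    "HOL-Computational_Algebra.Formal_Power_Series"
    "HOL-Computational_Algebra.Fraction_Field"
    "HOL-Computational_Algebra.Polynomial"
    "HOL-Library.Poly_Mapping"
    "HOL-Library.Type_Length"
    "HOL-Library.Numeral_Type"
    "HOL-Combinatorics.Permutations"
begin

section \<open>The base field and the R-matrix\<close>

type_synonym Cq = "complex poly fract"

definition qvar :: Cq where
  "qvar = Fract [:0, 1:] 1"

definition parity :: "nat \<Rightarrow> nat \<Rightarrow> nat" where
  "parity M i = (if i \<le> M then 0 else 1)"

definition qi :: "nat \<Rightarrow> nat \<Rightarrow> Cq" where
  "qi M i = qvar powi (1 - 2 * int (parity M i))"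

text \<open>The coefficient of \<open>E\<^sub>i\<^sub>j \<otimes> E\<^sub>k\<^sub>l\<close> in \<open>R(z,w)\<close>; the variables \<open>z\<close> and \<open>w\<close>
  take values in formal power series over the base field.\<close>

definition Rzw :: "nat \<Rightarrow> Cq fps \<Rightarrow> Cq fps \<Rightarrow> nat \<Rightarrow> nat \<Rightarrow> nat \<Rightarrow> nat \<Rightarrow> Cq fps" where
  "Rzw M z w i j k l =
     (if i = j \<and> k = l then
        (if i = k then z * fps_const (qi M i) - w * fps_const (inverse (qi M i)) else z - w)
      else if i = l \<and> j = k then
        (if i < j then z else w) * fps_const (qi M j - inverse (qi M j))
      else 0)"

text \<open>Series in \<open>x\<^sup>-\<^sup>1\<close> are represented by power series in \<open>fps_X\<close>, which stands for
  \<open>x\<^sup>-\<^sup>1\<close>. Since \<open>R(z,w)\<close> is homogeneous of degree one, dividing numerator and denominator of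
  \<open>R(x,1) / (x q - q\<^sup>-\<^sup>1)\<close> by \<open>x\<close> gives \<open>R(1,x\<^sup>-\<^sup>1) / (q - q\<^sup>-\<^sup>1 x\<^sup>-\<^sup>1)\<close>.\<close>

definition Rbar :: "nat \<Rightarrow> nat \<Rightarrow> nat \<Rightarrow> nat \<Rightarrow> nat \<Rightarrow> Cq fps" where
  "Rbar M i j k l =
     Rzw M 1 fps_X i j k l / (fps_const qvar - fps_const (inverse qvar) * fps_X)"

text \<open>With \<open>t = x\<^sup>-\<^sup>1\<close>, replacing \<open>x\<close> by \<open>x q\<^bsup>2N-2M\<^esup>\<close> means
  replacing \<open>t\<close> by \<open>q\<^bsup>2M-2N\<^esup> t\<close>, and the rational function in the functional equation is
  multiplied by \<open>t\<^sup>2 / t\<^sup>2\<close>. The solution is unique when \<open>M\<close> and \<open>N\<close> differ.\<close>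

definition fser :: "nat \<Rightarrow> nat \<Rightarrow> Cq fps" where
  "fser M N = (THE f. fps_nth f 0 = 1 \<and>
     fps_compose f (fps_const (qvar powi (2 * int M - 2 * int N)) * fps_X) =
       f * (((fps_X - fps_const (qvar powi (-2)))
              * (fps_X - fps_const (qvar powi (2 * int N - 2 * int M + 2))))
            / ((fps_X - 1) * (fps_X - fps_const (qvar powi (2 * int N - 2 * int M))))))"

text \<open>The coefficient of \<open>x\<^sup>-\<^sup>p E\<^sub>i\<^sub>j \<otimes> E\<^sub>k\<^sub>l\<close> in \<open>R(x) = f(x) Rbar(x)\<close>.\<close>

definition Rcoeff :: "nat \<Rightarrow> nat \<Rightarrow> nat \<Rightarrow> nat \<Rightarrow> nat \<Rightarrow> nat \<Rightarrow> nat \<Rightarrow> Cq" where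
  "Rcoeff M N p i j k l = fps_nth (fser M N * Rbar M i j k l) p"


section \<open>The free algebra on the generators\<close>

datatype sgn = Plus | Minus

datatype gen = Lgen sgn nat nat nat | Qc | QcInv

datatype 'a fmon = Fmon (letters: "'a list")

instantiation fmon :: (type) monoid_add
begin

definition zero_fmon :: "'a fmon" where
  "0 = Fmon []"

definition plus_fmon :: "'a fmon \<Rightarrow> 'a fmon \<Rightarrow> 'a fmon" where
  "v + w = Fmon (letters v @ letters w)"

instance
  by standard (simp_all add: zero_fmon_def plus_fmon_def)

end

text \<open>The monoid algebra of the free monoid, with concatenation written additively as required by
  \<^theory>\<open>HOL-Library.Poly_Mapping\<close>.\<close>

type_synonym free = "gen fmon \<Rightarrow>\<^sub>0 Cq"

definition fscal :: "Cq \<Rightarrow> free" where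
  "fscal c = Poly_Mapping.single 0 c"

definition fgen :: "gen \<Rightarrow> free" where
  "fgen g = Poly_Mapping.single (Fmon [g]) 1"


section \<open>Graded tensor products with matrix superalgebras\<close>

text \<open>An element of \<open>A \<otimes> End \<otimes> End\<close> is given by its coefficients \<open>X i j k l\<close> of
  \<open>E\<^sub>i\<^sub>j \<otimes> E\<^sub>k\<^sub>l\<close>, and an element of \<open>A \<otimes> End\<close> by its coefficients \<open>X i j\<close> of
  \<open>E\<^sub>i\<^sub>j\<close>, with indices in \<open>{1..M+N}\<close>. The products below are those of the graded tensor
  product for even elements, that is, when each coefficient is homogeneous of the same parity as
  the matrix unit it multiplies; the Koszul sign is then determined by the indices:
  \[ (x \otimes E_{ij} \otimes E_{kl})(y \otimes E_{jm} \otimes E_{ln}) =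
     (-1)^{|y|(|E_{ij}| + |E_{kl}|) + |E_{kl}||E_{jm}|}\, xy \otimes E_{im} \otimes E_{kn},
     \quad |y| = |E_{jm}| + |E_{ln}|. \]
  \<open>R\<close>, \<open>L\<^sup>\<plusminus>\<close> and the inverse of \<open>L\<^sup>\<plusminus>\<close> are even: the generator \<open>l\<^sub>i\<^sub>j\<^sup>\<plusminus>\<^sup>(\<^sup>r\<^sup>)\<close>
  has the parity of \<open>E\<^sub>i\<^sub>j\<close>, while \<open>q\<^sup>c\<close> and scalars are even.\<close>

definition eparity :: "nat \<Rightarrow> nat \<Rightarrow> nat \<Rightarrow> nat" where
  "eparity M i j = parity M i + parity M j"

definition tmul ::
  "nat \<Rightarrow> nat \<Rightarrow> (nat \<Rightarrow> nat \<Rightarrow> nat \<Rightarrow> nat \<Rightarrow> 'a::ring_1) \<Rightarrow> (nat \<Rightarrow> nat \<Rightarrow> nat \<Rightarrow> nat \<Rightarrow> 'a)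
     \<Rightarrow> (nat \<Rightarrow> nat \<Rightarrow> nat \<Rightarrow> nat \<Rightarrow> 'a)" where
  "tmul M N X Y i m k n =
     (\<Sum>j = 1..M+N. \<Sum>l = 1..M+N.
        (-1) ^ ((eparity M j m + eparity M l n) * (eparity M i j + eparity M k l)
                 + eparity M k l * eparity M j m)
        * (X i j k l * Y j m l n))"

definition smul ::
  "nat \<Rightarrow> nat \<Rightarrow> (nat \<Rightarrow> nat \<Rightarrow> 'a::ring_1) \<Rightarrow> (nat \<Rightarrow> nat \<Rightarrow> 'a) \<Rightarrow> (nat \<Rightarrow> nat \<Rightarrow> 'a)" where
  "smul M N X Y i k =
     (\<Sum>j = 1..M+N. (-1) ^ (eparity M j k * eparity M i j) * (X i j * Y j k))"

definition sone :: "nat \<Rightarrow> nat \<Rightarrow> (nat \<Rightarrow> nat \<Rightarrow> 'a::ring_1)" where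
  "sone M N i j = (if i = j \<and> i \<in> {1..M+N} then 1 else 0)"

text \<open>Coefficients outside the index range are set to 0, so that the inverse is unique.\<close>

definition sinv :: "nat \<Rightarrow> nat \<Rightarrow> (nat \<Rightarrow> nat \<Rightarrow> 'a::ring_1) \<Rightarrow> (nat \<Rightarrow> nat \<Rightarrow> 'a)" where
  "sinv M N X = (THE Y.
     (\<forall>i j. i \<notin> {1..M+N} \<or> j \<notin> {1..M+N} \<longrightarrow> Y i j = 0) \<and>
     (\<forall>i\<in>{1..M+N}. \<forall>j\<in>{1..M+N}.
        smul M N X Y i j = sone M N i j \<and> smul M N Y X i j = sone M N i j))"


section \<open>The defining relations\<close>

text \<open>The coefficient of \<open>z\<^sup>n\<close> (\<open>n\<close> an integer) in \<open>l\<^sub>i\<^sub>j\<^sup>s(z)\<close>.\<close>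

fun lcoeff :: "sgn \<Rightarrow> nat \<Rightarrow> nat \<Rightarrow> int \<Rightarrow> free" where
  "lcoeff Plus i j n = (if n \<le> 0 then fgen (Lgen Plus i j (nat (- n))) else 0)"
| "lcoeff Minus i j n = (if n \<ge> 0 then fgen (Lgen Minus i j (nat n)) else 0)"

definition L1 :: "sgn \<Rightarrow> int \<Rightarrow> nat \<Rightarrow> nat \<Rightarrow> nat \<Rightarrow> nat \<Rightarrow> free" where
  "L1 s n i j k l = (if k = l then lcoeff s i j n else 0)"

definition L2 :: "sgn \<Rightarrow> int \<Rightarrow> nat \<Rightarrow> nat \<Rightarrow> nat \<Rightarrow> nat \<Rightarrow> free" where
  "L2 s n i j k l = (if i = j then lcoeff s k l n else 0)"

definition qcpow :: "int \<Rightarrow> free" where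
  "qcpow e = (if e \<ge> 0 then fgen Qc ^ nat e else fgen QcInv ^ nat (- e))"

text \<open>The coefficient of \<open>x\<^sup>-\<^sup>p\<close> in \<open>R(x q\<^bsup>ec\<^esup>)\<close>.\<close>

definition Rc :: "nat \<Rightarrow> nat \<Rightarrow> int \<Rightarrow> nat \<Rightarrow> nat \<Rightarrow> nat \<Rightarrow> nat \<Rightarrow> nat \<Rightarrow> free" where
  "Rc M N e p i j k l = fscal (Rcoeff M N p i j k l) * qcpow (- e * int p)"

text \<open>The coefficient of \<open>z\<^sup>a w\<^sup>b E\<^sub>i\<^sub>j \<otimes> E\<^sub>k\<^sub>l\<close> in
  \[ R(zq^{ec}/w) L_1^s(z) L_2^t(w) - L_2^t(w) L_1^s(z) R(zq^{-ec}/w). \]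
  The term of \<open>R\<close> with \<open>(z/w)\<^sup>-\<^sup>p\<close> meets the coefficient of \<open>z\<^bsup>a+p\<^esup>\<close> in \<open>L\<^sub>1\<close> and of
  \<open>w\<^bsup>b-p\<^esup>\<close> in \<open>L\<^sub>2\<close>. For the sign pairs \<open>++\<close>, \<open>--\<close> and \<open>+-\<close> these vanish when
  \<open>p > \<bar>a\<bar> + \<bar>b\<bar>\<close>, so the sum is the whole coefficient.\<close>

definition rll ::
  "nat \<Rightarrow> nat \<Rightarrow> sgn \<Rightarrow> sgn \<Rightarrow> int \<Rightarrow> int \<Rightarrow> int \<Rightarrow> nat \<Rightarrow> nat \<Rightarrow> nat \<Rightarrow> nat \<Rightarrow> free" where
  "rll M N s t e a b i j k l =
     (\<Sum>p\<le>nat (\<bar>a\<bar> + \<bar>b\<bar>).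
        tmul M N (Rc M N e p) (tmul M N (L1 s (a + int p)) (L2 t (b - int p))) i j k l
      - tmul M N (tmul M N (L2 t (b - int p)) (L1 s (a + int p))) (Rc M N (- e) p) i j k l)"

text \<open>The type of generators contains \<open>l\<^sub>i\<^sub>j\<^sup>\<plusminus>\<^sup>(\<^sup>r\<^sup>)\<close>
  for all natural numbers \<open>i, j\<close>; those with an index outside \<open>{1..M+N}\<close> are removed by
  \<open>out_of_range\<close>.\<close>

inductive_set rels :: "nat \<Rightarrow> nat \<Rightarrow> free set" for M N :: nat where
  out_of_range: "i \<notin> {1..M+N} \<or> j \<notin> {1..M+N} \<Longrightarrow> fgen (Lgen s i j r) \<in> rels M N"
| qc_inv: "fgen Qc * fgen QcInv - 1 \<in> rels M N"
| qc_inv': "fgen QcInv * fgen Qc - 1 \<in> rels M N"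
| qc_central: "fgen Qc * fgen g - fgen g * fgen Qc \<in> rels M N"
| upper: "1 \<le> i \<Longrightarrow> i < j \<Longrightarrow> j \<le> M + N \<Longrightarrow> fgen (Lgen Plus j i 0) \<in> rels M N"
| lower: "1 \<le> i \<Longrightarrow> i < j \<Longrightarrow> j \<le> M + N \<Longrightarrow> fgen (Lgen Minus i j 0) \<in> rels M N"
| diag: "i \<in> {1..M+N} \<Longrightarrow> fgen (Lgen Minus i i 0) * fgen (Lgen Plus i i 0) - 1 \<in> rels M N"
| diag': "i \<in> {1..M+N} \<Longrightarrow> fgen (Lgen Plus i i 0) * fgen (Lgen Minus i i 0) - 1 \<in> rels M N"
| rll_same: "i \<in> {1..M+N} \<Longrightarrow> j \<in> {1..M+N} \<Longrightarrow> k \<in> {1..M+N} \<Longrightarrow> l \<in> {1..M+N} \<Longrightarrow>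
    rll M N s s 0 a b i j k l \<in> rels M N"
| rll_mixed: "i \<in> {1..M+N} \<Longrightarrow> j \<in> {1..M+N} \<Longrightarrow> k \<in> {1..M+N} \<Longrightarrow> l \<in> {1..M+N} \<Longrightarrow>
    rll M N Plus Minus 1 a b i j k l \<in> rels M N"

text \<open>The two-sided ideal generated by the relations. It is stable under the action of the base
  field because the scalars \<open>fscal c\<close> belong to the free algebra.\<close>

inductive_set rel_ideal :: "nat \<Rightarrow> nat \<Rightarrow> free set" for M N :: nat where
  zero: "0 \<in> rel_ideal M N"
| step: "x \<in> rel_ideal M N \<Longrightarrow> y \<in> rels M N \<Longrightarrow> x + u * y * v \<in> rel_ideal M N"

lemma rel_ideal_add: "x \<in> rel_ideal M N \<Longrightarrow> y \<in> rel_ideal M N \<Longrightarrow> x + y \<in> rel_ideal M N"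
  by (rotate_tac, induction rule: rel_ideal.induct)
    (auto simp flip: add.assoc intro: rel_ideal.intros)

lemma rel_ideal_mult: "x \<in> rel_ideal M N \<Longrightarrow> a * x * b \<in> rel_ideal M N"
proof (induction rule: rel_ideal.induct)
  case (step x y u v)
  have "a * (x + u * y * v) * b = a * x * b + (a * u) * y * (v * b)"
    by (simp add: algebra_simps)
  with step show ?case
    by (metis rel_ideal.step)
qed (auto intro: rel_ideal.intros)

lemma rel_ideal_mult_left: "x \<in> rel_ideal M N \<Longrightarrow> a * x \<in> rel_ideal M N"
  using rel_ideal_mult[of x M N a 1] by simp

lemma rel_ideal_mult_right: "x \<in> rel_ideal M N \<Longrightarrow> x * b \<in> rel_ideal M N"
  using rel_ideal_mult[of x M N 1 b] by simp

lemma rel_ideal_uminus: "x \<in> rel_ideal M N \<Longrightarrow> - x \<in> rel_ideal M N"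
  using rel_ideal_mult[of x M N "-1" 1] by simp


section \<open>The counit, and properness of the ideal\<close>

definition ccoeff :: "nat \<Rightarrow> nat \<Rightarrow> gen \<Rightarrow> Cq" where
  "ccoeff M N g = (case g of Lgen s i j r \<Rightarrow> if i = j \<and> i \<in> {1..M+N} \<and> r = 0 then 1 else 0 | _ \<Rightarrow> 1)"

definition cword :: "nat \<Rightarrow> nat \<Rightarrow> gen fmon \<Rightarrow> Cq" where
  "cword M N w = prod_list (map (ccoeff M N) (letters w))"

definition counit :: "nat \<Rightarrow> nat \<Rightarrow> free \<Rightarrow> Cq" where
  "counit M N x = (\<Sum>w\<in>Poly_Mapping.keys x. Poly_Mapping.lookup x w * cword M N w)"

lemma counit_superset:
  assumes "finite S" "Poly_Mapping.keys x \<subseteq> S"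
  shows "counit M N x = (\<Sum>w\<in>S. Poly_Mapping.lookup x w * cword M N w)"
  unfolding counit_def using assms
  by (intro sum.mono_neutral_left) (auto simp: in_keys_iff)

lemma counit_single: "counit M N (Poly_Mapping.single w c) = c * cword M N w"
  by (subst counit_superset[where S = "{w}"]) auto

lemma counit_zero [simp]: "counit M N 0 = 0"
  by (simp add: counit_def)

lemma counit_one [simp]: "counit M N 1 = 1"
  by (simp add: counit_single cword_def zero_fmon_def flip: single_one)

lemma counit_add: "counit M N (x + y) = counit M N x + counit M N y"
proof -
  let ?S = "Poly_Mapping.keys x \<union> Poly_Mapping.keys y"
  have "Poly_Mapping.keys (x + y) \<subseteq> ?S" by (rule Poly_Mapping.keys_add)
  then show ?thesis
    by (simp add: counit_superset[where S = ?S] lookup_add distrib_right sum.distrib)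
qed

lemma counit_sum: "counit M N (sum h A) = (\<Sum>a\<in>A. counit M N (h a))"
  by (induction A rule: infinite_finite_induct) (auto simp: counit_add)

lemma cword_add: "cword M N (v + w) = cword M N v * cword M N w"
  by (simp add: cword_def plus_fmon_def)

lemma free_expand:
  "(x::free) = (\<Sum>w\<in>Poly_Mapping.keys x. Poly_Mapping.single w (Poly_Mapping.lookup x w))"
  by (rule poly_mapping_eqI)
    (auto simp: lookup_sum lookup_single when_def in_keys_iff)

lemma counit_mult: "counit M N (x * y) = counit M N x * counit M N y"
proof -
  have "x * y = (\<Sum>v\<in>Poly_Mapping.keys x. \<Sum>w\<in>Poly_Mapping.keys y.
      Poly_Mapping.single (v + w) (Poly_Mapping.lookup x v * Poly_Mapping.lookup y w))"
    by (subst free_expand[of x], subst free_expand[of y]) (simp add: sum_product mult_single)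
  then have "counit M N (x * y) = (\<Sum>v\<in>Poly_Mapping.keys x. \<Sum>w\<in>Poly_Mapping.keys y.
      Poly_Mapping.lookup x v * cword M N v * (Poly_Mapping.lookup y w * cword M N w))"
    by (simp add: counit_sum counit_single cword_add mult_ac)
  then show ?thesis
    by (simp add: counit_def sum_product)
qed

lemma counit_uminus: "counit M N (- x) = - counit M N x"
  using counit_add[of M N x "- x"] by (simp add: eq_neg_iff_add_eq_0 add.commute)

lemma counit_diff: "counit M N (x - y) = counit M N x - counit M N y"
  using counit_add[of M N x "- y"] by (simp add: counit_uminus)

lemma counit_power: "counit M N (x ^ n) = counit M N x ^ n"
  by (induction n) (auto simp: counit_mult)

lemma counit_gen: "counit M N (fgen g) = ccoeff M N g"
  by (simp add: fgen_def counit_single cword_def)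

lemma counit_tmul:
  "counit M N (tmul M' N' X Y i m k n) =
     tmul M' N' (\<lambda>i j k l. counit M N (X i j k l)) (\<lambda>i j k l. counit M N (Y i j k l)) i m k n"
  by (simp add: tmul_def counit_sum counit_mult counit_power counit_uminus)

lemma tmul_id_left:
  fixes X Y :: "nat \<Rightarrow> nat \<Rightarrow> nat \<Rightarrow> nat \<Rightarrow> 'a::comm_ring_1"
  assumes "i \<in> {1..M+N}" "k \<in> {1..M+N}"
    and "\<And>i' k' j' l'. i' \<in> {1..M+N} \<Longrightarrow> k' \<in> {1..M+N} \<Longrightarrow>
       X i' j' k' l' = (if i' = j' \<and> k' = l' then c else 0)"
  shows "tmul M N X Y i m k n = c * Y i m k n"
proof -
  let ?A = "{1..M+N}"
  have "tmul M N X Y i m k n = (\<Sum>j\<in>?A. \<Sum>l\<in>?A.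
      if j = i then if l = k then c * Y i m k n else 0 else 0)"
    unfolding tmul_def
  proof (intro sum.cong refl)
    fix j l assume "j \<in> ?A" "l \<in> ?A"
    then have Z: "X i j k l = (if j = i \<and> l = k then c else 0)"
      using assms(1,2) by (subst assms(3)) auto
    show "(-1) ^ ((eparity M j m + eparity M l n) * (eparity M i j + eparity M k l)
        + eparity M k l * eparity M j m) * (X i j k l * Y j m l n) =
      (if j = i then if l = k then c * Y i m k n else 0 else 0)"
      unfolding Z by (auto simp: eparity_def mult.commute simp flip: mult_2)
  qed
  also have "\<dots> = (\<Sum>j\<in>?A. if j = i then c * Y i m k n else 0)"
  proof (intro sum.cong refl)
    fix j
    show "(\<Sum>l\<in>?A. if j = i then if l = k then c * Y i m k n else 0 else 0) =
        (if j = i then c * Y i m k n else 0)"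
      using assms(2) by (cases "j = i") simp_all
  qed
  also have "\<dots> = c * Y i m k n"
    using assms(1) by simp
  finally show ?thesis .
qed

lemma tmul_id_right:
  fixes X Y :: "nat \<Rightarrow> nat \<Rightarrow> nat \<Rightarrow> nat \<Rightarrow> 'a::comm_ring_1"
  assumes "m \<in> {1..M+N}" "n \<in> {1..M+N}"
    and "\<And>i' k' j' l'. i' \<in> {1..M+N} \<Longrightarrow> k' \<in> {1..M+N} \<Longrightarrow>
       Y i' j' k' l' = (if i' = j' \<and> k' = l' then c else 0)"
  shows "tmul M N X Y i m k n = c * X i m k n"
proof -
  let ?A = "{1..M+N}"
  have "tmul M N X Y i m k n = (\<Sum>j\<in>?A. \<Sum>l\<in>?A.
      if j = m then if l = n then c * X i m k n else 0 else 0)"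
    unfolding tmul_def
  proof (intro sum.cong refl)
    fix j l assume "j \<in> ?A" "l \<in> ?A"
    then have Z: "Y j m l n = (if j = m \<and> l = n then c else 0)"
      using assms(1,2) by (subst assms(3)) auto
    show "(-1) ^ ((eparity M j m + eparity M l n) * (eparity M i j + eparity M k l)
        + eparity M k l * eparity M j m) * (X i j k l * Y j m l n) =
      (if j = m then if l = n then c * X i m k n else 0 else 0)"
      unfolding Z by (auto simp: eparity_def mult.commute simp flip: mult_2)
  qed
  also have "\<dots> = (\<Sum>j\<in>?A. if j = m then c * X i m k n else 0)"
  proof (intro sum.cong refl)
    fix j
    show "(\<Sum>l\<in>?A. if j = m then if l = n then c * X i m k n else 0 else 0) =
        (if j = m then c * X i m k n else 0)"
      using assms(2) by (cases "j = m") simp_all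
  qed
  also have "\<dots> = c * X i m k n"
    using assms(1) by simp
  finally show ?thesis .
qed

lemma counit_lcoeff:
  "counit M N (lcoeff s i j n) = (if i = j \<and> i \<in> {1..M+N} \<and> n = 0 then 1 else 0)"
  by (cases s) (auto simp: counit_gen ccoeff_def)

lemma counit_Rc: "counit M N (Rc M N e p i j k l) = Rcoeff M N p i j k l"
proof -
  have "cword M N 0 = 1" by (simp add: cword_def zero_fmon_def)
  then show ?thesis
    by (simp add: Rc_def counit_mult fscal_def counit_single qcpow_def counit_power counit_gen
        ccoeff_def)
qed

lemma counit_rll:
  assumes "i \<in> {1..M+N}" "j \<in> {1..M+N}" "k \<in> {1..M+N}" "l \<in> {1..M+N}"
  shows "counit M N (rll M N s t e a b i j k l) = 0"
proof -
  let ?E = "counit M N"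
  have *: "?E (tmul M N (Rc M N e p) (tmul M N (L1 s x) (L2 t y)) i j k l) =
       ?E (tmul M N (tmul M N (L2 t y) (L1 s x)) (Rc M N (- e) p) i j k l)" for p x y
  proof -
    let ?c = "if x = 0 \<and> y = 0 then 1 else 0 :: Cq"
    have A: "?E (tmul M N (L1 s x) (L2 t y) i' j' k' l') =
        (if i' = j' \<and> k' = l' then ?c else 0)"
      if "i' \<in> {1..M+N}" "k' \<in> {1..M+N}" for i' j' k' l'
      unfolding counit_tmul
      by (subst tmul_id_left[where c = "if x = 0 then 1 else 0"])
        (use that in \<open>auto simp: L1_def L2_def counit_lcoeff\<close>)
    have B: "?E (tmul M N (L2 t y) (L1 s x) i' j' k' l') =
        (if i' = j' \<and> k' = l' then ?c else 0)"
      if "i' \<in> {1..M+N}" "k' \<in> {1..M+N}" for i' j' k' l'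
      unfolding counit_tmul
      by (subst tmul_id_left[where c = "if y = 0 then 1 else 0"])
        (use that in \<open>auto simp: L1_def L2_def counit_lcoeff\<close>)
    have "?E (tmul M N (Rc M N e p) (tmul M N (L1 s x) (L2 t y)) i j k l)
        = ?c * ?E (Rc M N e p i j k l)"
      unfolding counit_tmul[of M N M N "Rc M N e p"]
      by (rule tmul_id_right) (use assms A in simp_all)
    moreover have "?E (tmul M N (tmul M N (L2 t y) (L1 s x)) (Rc M N (- e) p) i j k l)
        = ?c * ?E (Rc M N (- e) p i j k l)"
      unfolding counit_tmul[of M N M N _ "Rc M N (- e) p"]
      by (rule tmul_id_left) (use assms B in simp_all)
    ultimately show ?thesis
      by (simp only: counit_Rc)
  qed
  show ?thesis
    by (simp add: rll_def counit_sum counit_diff *)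
qed

lemma counit_rels: "x \<in> rels M N \<Longrightarrow> counit M N x = 0"
  by (induction rule: rels.induct)
    (auto simp: counit_gen counit_diff counit_mult ccoeff_def counit_rll)

lemma counit_rel_ideal: "x \<in> rel_ideal M N \<Longrightarrow> counit M N x = 0"
  by (induction rule: rel_ideal.induct) (auto simp: counit_add counit_mult counit_rels)

lemma one_notin_rel_ideal: "1 \<notin> rel_ideal M N"
  using counit_rel_ideal by fastforce


section \<open>The quantum affine superalgebra\<close>

text \<open>The numbers \<open>M\<close> and \<open>N\<close> are the lengths of the type parameters. The class
  \<^class>\<open>len0\<close> admits every natural number, including 0, as a length.\<close>

quotient_type (overloaded) ('m, 'n) uq =
  free / "\<lambda>x y. x - y \<in> rel_ideal LENGTH('m::len0) LENGTH('n::len0)"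
proof (rule equivpI)
  show "reflp (\<lambda>x y. x - y \<in> rel_ideal LENGTH('m) LENGTH('n))"
    by (auto intro!: reflpI rel_ideal.zero)
  show "symp (\<lambda>x y. x - y \<in> rel_ideal LENGTH('m) LENGTH('n))"
    by (rule sympI) (use rel_ideal_uminus in fastforce)
  show "transp (\<lambda>x y. x - y \<in> rel_ideal LENGTH('m) LENGTH('n))"
  proof (rule transpI)
    fix x y z :: free
    assume "x - y \<in> rel_ideal LENGTH('m) LENGTH('n)" "y - z \<in> rel_ideal LENGTH('m) LENGTH('n)"
    then have "(x - y) + (y - z) \<in> rel_ideal LENGTH('m) LENGTH('n)"
      by (rule rel_ideal_add)
    then show "x - z \<in> rel_ideal LENGTH('m) LENGTH('n)"
      by simp
  qed
qed

instantiation uq :: (len0, len0) ring_1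
begin

lift_definition zero_uq :: "('a, 'b) uq" is 0 .
lift_definition one_uq :: "('a, 'b) uq" is 1 .

lift_definition plus_uq :: "('a, 'b) uq \<Rightarrow> ('a, 'b) uq \<Rightarrow> ('a, 'b) uq" is "(+)"
proof -
  fix x x' y y' :: free
  assume "x - x' \<in> rel_ideal LENGTH('a) LENGTH('b)" "y - y' \<in> rel_ideal LENGTH('a) LENGTH('b)"
  then have "(x - x') + (y - y') \<in> rel_ideal LENGTH('a) LENGTH('b)"
    by (rule rel_ideal_add)
  then show "(x + y) - (x' + y') \<in> rel_ideal LENGTH('a) LENGTH('b)"
    by (simp add: algebra_simps)
qed

lift_definition uminus_uq :: "('a, 'b) uq \<Rightarrow> ('a, 'b) uq" is uminus
proof -
  fix x x' :: free
  assume "x - x' \<in> rel_ideal LENGTH('a) LENGTH('b)"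
  then have "- (x - x') \<in> rel_ideal LENGTH('a) LENGTH('b)"
    by (rule rel_ideal_uminus)
  then show "- x - - x' \<in> rel_ideal LENGTH('a) LENGTH('b)"
    by simp
qed

lift_definition minus_uq :: "('a, 'b) uq \<Rightarrow> ('a, 'b) uq \<Rightarrow> ('a, 'b) uq" is "(-)"
proof -
  fix x x' y y' :: free
  assume "x - x' \<in> rel_ideal LENGTH('a) LENGTH('b)" "y - y' \<in> rel_ideal LENGTH('a) LENGTH('b)"
  then have "(x - x') + - (y - y') \<in> rel_ideal LENGTH('a) LENGTH('b)"
    by (intro rel_ideal_add rel_ideal_uminus)
  then show "(x - y) - (x' - y') \<in> rel_ideal LENGTH('a) LENGTH('b)"
    by (simp add: algebra_simps)
qed

lift_definition times_uq :: "('a, 'b) uq \<Rightarrow> ('a, 'b) uq \<Rightarrow> ('a, 'b) uq" is "(*)"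
proof -
  fix x x' y y' :: free
  assume "x - x' \<in> rel_ideal LENGTH('a) LENGTH('b)" "y - y' \<in> rel_ideal LENGTH('a) LENGTH('b)"
  then have "(x - x') * y + x' * (y - y') \<in> rel_ideal LENGTH('a) LENGTH('b)"
    by (intro rel_ideal_add rel_ideal_mult_left rel_ideal_mult_right)
  then show "x * y - x' * y' \<in> rel_ideal LENGTH('a) LENGTH('b)"
    by (simp add: algebra_simps)
qed

instance
proof
  fix a b c :: "('a, 'b) uq"
  show "a + b + c = a + (b + c)"
    by transfer (simp add: add.assoc rel_ideal.zero)
  show "a + b = b + a"
    by transfer (simp add: add.commute rel_ideal.zero)
  show "0 + a = a"
    by transfer (simp add: rel_ideal.zero)
  show "- a + a = 0"
    by transfer (simp add: rel_ideal.zero)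
  show "a - b = a + - b"
    by transfer (simp add: rel_ideal.zero)
  show "a * b * c = a * (b * c)"
    by transfer (simp add: mult.assoc rel_ideal.zero)
  show "(a + b) * c = a * c + b * c"
    by transfer (simp add: distrib_right rel_ideal.zero)
  show "a * (b + c) = a * b + a * c"
    by transfer (simp add: distrib_left rel_ideal.zero)
  show "1 * a = a"
    by transfer (simp add: rel_ideal.zero)
  show "a * 1 = a"
    by transfer (simp add: rel_ideal.zero)
  show "(0::('a, 'b) uq) \<noteq> 1"
    by transfer (use rel_ideal_uminus one_notin_rel_ideal in fastforce)
qed

end

lift_definition uscal :: "Cq \<Rightarrow> ('m::len0, 'n::len0) uq" is fscal .

lift_definition ul :: "sgn \<Rightarrow> nat \<Rightarrow> nat \<Rightarrow> nat \<Rightarrow> ('m::len0, 'n::len0) uq" is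
  "\<lambda>s i j r. fgen (Lgen s i j r)" .

text \<open>No sign rule is needed: on even elements, such as the coefficients of the Berezinian, ordinary
  and graded commutation agree.\<close>

definition center :: "'a::ring_1 set" where
  "center = {c. \<forall>x. c * x = x * c}"


section \<open>The quantum Berezinian\<close>

text \<open>The matrix \<open>L\<^sup>\<plusminus>(z q\<^sup>d)\<close>, with entries power series in \<open>z\<^sup>\<minusplus>\<^sup>1\<close>; in the
  coefficient of \<open>z\<^bsup>\<minusplus>r\<^esup>\<close> the shift produces the scalar \<open>q\<^bsup>\<minusplus>dr\<^esup>\<close>.\<close>

fun zexp :: "sgn \<Rightarrow> nat \<Rightarrow> int" where
  "zexp Plus r = - int r"
| "zexp Minus r = int r"

definition Lmat :: "sgn \<Rightarrow> int \<Rightarrow> nat \<Rightarrow> nat \<Rightarrow> ('m::len0, 'n::len0) uq fps" where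
  "Lmat s d i j = Abs_fps (\<lambda>r. uscal (qvar powi (d * zexp s r)) * ul s i j r)"

definition Linv :: "sgn \<Rightarrow> int \<Rightarrow> nat \<Rightarrow> nat \<Rightarrow> ('m::len0, 'n::len0) uq fps" where
  "Linv s d = sinv LENGTH('m) LENGTH('n) (Lmat s d)"

definition perm_length :: "nat \<Rightarrow> (nat \<Rightarrow> nat) \<Rightarrow> nat" where
  "perm_length n \<sigma> = card {(i, j). 1 \<le> i \<and> i < j \<and> j \<le> n \<and> \<sigma> j < \<sigma> i}"

definition perm_coeff :: "nat \<Rightarrow> (nat \<Rightarrow> nat) \<Rightarrow> ('m::len0, 'n::len0) uq fps" where
  "perm_coeff n \<sigma> = fps_const (uscal ((- qvar) powi (- int (perm_length n \<sigma>))))"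

definition berezinian :: "sgn \<Rightarrow> ('m::len0, 'n::len0) uq fps" where
  "berezinian s =
     (let M = LENGTH('m); N = LENGTH('n) in
      (\<Sum>\<sigma> | \<sigma> permutes {1..M}.
         perm_coeff M \<sigma> * prod_list (map (\<lambda>j. Lmat s (2 * int j - 2) (\<sigma> j) j) [1..<Suc M]))
    * (\<Sum>\<tau> | \<tau> permutes {1..N}.
         perm_coeff N \<tau>
         * prod_list (map (\<lambda>k. Linv s (2 * int M - 2 * int k) (M + k) (M + \<tau> k)) [1..<Suc N])))"

end

(*
Write D and E for the two factors of the Berezinian and L, K for the matrix generating the algebra
at another spectral parameter and its inverse. The columns of D are antisymmetric in a quantum
sense, so D behaves like a quantum determinant and intertwines with the even block of L by fusion
of the R-matrices. For an entry of L in an even row and an odd column the correction terms coming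
from D and from E cancel, because the two factors meet at a common argument, at which the rows of
L are orthogonal to the columns of K. Passing to the opposite algebra and transposing reverses the
order of the arguments and preserves the RLL relations as well as D and E, which gives the entries
in even columns. The odd block of K commutes with D and E up to a scalar, and it determines the odd
block of L through the equations L K = K L = 1.

All these commutations hold up to a scalar series. For relations of the same sign it cancels since
both sides carry the same one; for mixed signs the functional equation of f shows that it is a
constant, which is not affected by the shifts by the central charge.
*)
theory Submission
  imports Defs "HOL-Library.Function_Algebras"
begin

section \<open>Quantum minors in the ungraded setting\<close>

section \<open>Lists over a finite set\<close>

text \<open>What shapes the proof is that in the mixed relation the two sides carry scalars through
  different maps: \<open>s\<close> inserts q^c and \<open>s'\<close> inserts q^(-c). A common factor
  can be cancelled only if both maps agree on it, as they do on constants. So commutations are kept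
  in the form \<open>s a * (D * x) = s' a * (x * D)\<close>, and the product of all factors picked
  up along D and E has to be evaluated. It becomes constant because the shifts of D and E together
  span the dilation by q^(2M-2N) in the functional equation of f. E is a quantum determinant as
  well: the odd block of the inverse matrix, transposed, satisfies an ungraded RTT relation with q
  inverted and the order of indices reversed. Hence orders and parameters stay abstract, and one
  determinant argument serves D, E and their images in the opposite ring. That D and E survive the
  reversal of arguments is not visible from their definition, which antisymmetrises rows only.
  Antisymmetrising the columns too gives an expression insensitive to the order of arguments; it
  differs from the original by a quantum factorial, which is nonzero in C(q).\<close>

definition lists_on :: "'i set \<Rightarrow> nat \<Rightarrow> 'i list set" where
  "lists_on A n = {xs. length xs = n \<and> set xs \<subseteq> A}"

lemma lists_on_0 [simp]: "lists_on A 0 = {[]}"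
  by (auto simp: lists_on_def)

lemma finite_lists_on [simp]: "finite A \<Longrightarrow> finite (lists_on A n)"
  using finite_lists_length_eq[of A n] by (simp add: lists_on_def conj_commute)

lemma lists_onD: "xs \<in> lists_on A n \<Longrightarrow> length xs = n" "xs \<in> lists_on A n \<Longrightarrow> set xs \<subseteq> A"
  by (auto simp: lists_on_def)

lemma sum_lists_append:
  assumes "finite A"
  shows "(\<Sum>xs\<in>lists_on A (m + n). f xs) = (\<Sum>ys\<in>lists_on A m. \<Sum>zs\<in>lists_on A n. f (ys @ zs))"
proof -
  have "(\<Sum>ys\<in>lists_on A m. \<Sum>zs\<in>lists_on A n. f (ys @ zs)) =
      (\<Sum>(ys, zs)\<in>lists_on A m \<times> lists_on A n. f (ys @ zs))"
    by (rule sum.cartesian_product)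
  also have "\<dots> = (\<Sum>xs\<in>lists_on A (m + n). f xs)"
    by (rule sum.reindex_bij_witness[where i = "\<lambda>xs. (take m xs, drop m xs)" and j = "\<lambda>(ys, zs). ys @ zs"])
      (auto simp: lists_on_def dest: in_set_takeD in_set_dropD)
  finally show ?thesis ..
qed

lemma sum_lists_1: "(\<Sum>xs\<in>lists_on A (Suc 0). f xs) = (\<Sum>x\<in>A. f [x])"
  by (rule sum.reindex_bij_witness[where i = "\<lambda>x. [x]" and j = hd])
    (auto simp: lists_on_def length_Suc_conv)

lemma sum_lists_Suc:
  assumes "finite A"
  shows "(\<Sum>xs\<in>lists_on A (Suc n). f xs) = (\<Sum>x\<in>A. \<Sum>xs\<in>lists_on A n. f (x # xs))"
  using sum_lists_append[OF assms, of f "Suc 0" n] by (simp add: sum_lists_1)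

lemma sum_lists_snoc:
  assumes "finite A"
  shows "(\<Sum>xs\<in>lists_on A (Suc n). f xs) = (\<Sum>xs\<in>lists_on A n. \<Sum>x\<in>A. f (xs @ [x]))"
  using sum_lists_append[OF assms, of f n "Suc 0"] by (simp add: sum_lists_1)

text \<open>Singles out two neighbouring letters, because the relations used later,
  \<open>antisym_pair\<close> and \<open>sym_pair\<close>, involve two adjacent factors of a
  product.\<close>

lemma sum_lists_split_pair:
  assumes "finite A"
  shows "(\<Sum>xs\<in>lists_on A (m + Suc (Suc n)). f xs) =
    (\<Sum>ys\<in>lists_on A m. \<Sum>zs\<in>lists_on A n. \<Sum>r\<in>A. \<Sum>s\<in>A. f (ys @ r # s # zs))"
proof -
  have swap: "(\<Sum>r\<in>A. \<Sum>s\<in>A. \<Sum>zs\<in>lists_on A n. g r s zs) = (\<Sum>zs\<in>lists_on A n. \<Sum>r\<in>A. \<Sum>s\<in>A. g r s zs)" for g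
  proof -
    have "(\<Sum>r\<in>A. \<Sum>s\<in>A. \<Sum>zs\<in>lists_on A n. g r s zs) = (\<Sum>r\<in>A. \<Sum>zs\<in>lists_on A n. \<Sum>s\<in>A. g r s zs)"
      by (intro sum.cong refl sum.swap)
    also have "\<dots> = (\<Sum>zs\<in>lists_on A n. \<Sum>r\<in>A. \<Sum>s\<in>A. g r s zs)"
      by (rule sum.swap)
    finally show ?thesis .
  qed
  show ?thesis
    unfolding sum_lists_append[OF assms, of f m "Suc (Suc n)"]
    by (simp add: sum_lists_Suc[OF assms] swap)
qed

section \<open>Inversions and antisymmetric functions\<close>

text \<open>The order is a parameter because the results are used for increasing and for decreasing
  order of indices; the latter governs the odd block and the opposite ring.\<close>

locale index_order =
  fixes lt :: "'i \<Rightarrow> 'i \<Rightarrow> bool" (infix "\<prec>" 50)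
  assumes irrefl: "\<not> x \<prec> x"
    and trans: "x \<prec> y \<Longrightarrow> y \<prec> z \<Longrightarrow> x \<prec> z"
    and total: "x \<noteq> y \<Longrightarrow> x \<prec> y \<or> y \<prec> x"
begin

lemma asym: "x \<prec> y \<Longrightarrow> \<not> y \<prec> x"
  using irrefl trans by blast

text \<open>Prepares the use of relations that are stated for an ordered pair of rows: an unordered
  pair contributes its two arrangements together.\<close>

lemma sum_pairs:
  fixes h :: "'i \<Rightarrow> 'i \<Rightarrow> 'v::comm_monoid_add"
  assumes "finite A" "\<And>r. r \<in> A \<Longrightarrow> h r r = 0"
  shows "(\<Sum>r\<in>A. \<Sum>s\<in>A. h r s) = (\<Sum>(r, s)\<in>{(r, s)\<in>A \<times> A. r \<prec> s}. h r s + h s r)"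
proof -
  let ?L = "{(r, s)\<in>A \<times> A. r \<prec> s}" and ?G = "{(r, s)\<in>A \<times> A. s \<prec> r}" and ?E = "{(r, s)\<in>A \<times> A. r = s}"
  have fin: "finite ?L" "finite ?G" "finite ?E"
    by (rule finite_subset[of _ "A \<times> A"]; use assms in auto)+
  have split: "A \<times> A = ?E \<union> (?L \<union> ?G)"
    by (auto; metis total)
  have "?E \<inter> (?L \<union> ?G) = {}" "?L \<inter> ?G = {}"
    using irrefl asym by auto
  then have "(\<Sum>(r, s)\<in>A \<times> A. h r s) =
      (\<Sum>(r, s)\<in>?E. h r s) + ((\<Sum>(r, s)\<in>?L. h r s) + (\<Sum>(r, s)\<in>?G. h r s))"
    by (subst split) (simp only: fin sum.union_disjoint finite_Un simp_thms)
  moreover have "(\<Sum>(r, s)\<in>?E. h r s) = 0"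
    by (rule sum.neutral) (use assms in auto)
  moreover have "(\<Sum>(r, s)\<in>?G. h r s) = (\<Sum>(r, s)\<in>?L. h s r)"
    by (rule sum.reindex_bij_witness[where i = "\<lambda>(x, y). (y, x)" and j = "\<lambda>(x, y). (y, x)"]) auto
  ultimately show ?thesis
    by (simp add: sum.cartesian_product sum.distrib case_prod_beta)
qed

fun inversions :: "'i list \<Rightarrow> nat" where
  "inversions [] = 0"
| "inversions (x # xs) = length (filter (\<lambda>y. y \<prec> x) xs) + inversions xs"

lemma inversions_swap:
  "r \<prec> s \<Longrightarrow> inversions (ys @ s # r # zs) = Suc (inversions (ys @ r # s # zs))"
  by (induction ys) (auto dest: asym)

lemma inversions_sorted: "sorted_wrt (\<prec>) xs \<Longrightarrow> inversions xs = 0"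
  by (induction xs) (auto simp: filter_empty_conv dest: asym)

lemma sorted_distinct_list: "sorted_wrt (\<prec>) xs \<Longrightarrow> distinct xs"
  by (induction xs) (use irrefl in auto)

text \<open>The q-sign of a word, set to 0 on words with a repeated letter, so that sums over
  permutations can be written as sums over all words.\<close>

definition wt :: "'k::comm_ring_1 \<Rightarrow> 'i list \<Rightarrow> 'k" where
  "wt t xs = (if distinct xs then (-t) ^ inversions xs else 0)"

lemma wt_swap: "r \<prec> s \<Longrightarrow> wt t (ys @ s # r # zs) = - t * wt t (ys @ r # s # zs)"
  by (auto simp: wt_def inversions_swap)

lemma wt_sorted: "sorted_wrt (\<prec>) xs \<Longrightarrow> wt t xs = 1"
  by (simp add: wt_def inversions_sorted sorted_distinct_list)

lemma wt_repeat: "\<not> distinct xs \<Longrightarrow> wt t xs = 0"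
  by (simp add: wt_def)

lemma sorted_unique:
  "sorted_wrt (\<prec>) xs \<Longrightarrow> sorted_wrt (\<prec>) ys \<Longrightarrow> set xs = set ys \<Longrightarrow> xs = ys"
proof (induction xs arbitrary: ys)
  case (Cons x xs)
  then obtain y ys' where ys: "ys = y # ys'"
    by (cases ys) auto
  have "x = y"
    using Cons.prems asym unfolding ys by (metis insert_iff list.simps(15) sorted_wrt.simps(2))
  moreover have "x \<notin> set xs" "y \<notin> set ys'"
    using Cons.prems irrefl unfolding ys by auto
  ultimately have "set xs = set ys'"
    using Cons.prems(3) unfolding ys by auto
  then show ?case
    using Cons \<open>x = y\<close> unfolding ys by auto
qed auto

lemma descent:
  assumes "\<not> sorted_wrt (\<prec>) xs"
  obtains ys x y zs where "xs = ys @ x # y # zs" "\<not> x \<prec> y"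
proof -
  have "\<not> successively (\<prec>) xs"
    using assms successively_conv_sorted_wrt[of "(\<prec>)" xs] trans by (auto simp: transp_def)
  then have "\<exists>ys x y zs. xs = ys @ x # y # zs \<and> \<not> x \<prec> y"
  proof (induction xs rule: induct_list012)
    case (3 x y zs)
    show ?case
    proof (cases "x \<prec> y")
      case True
      then obtain ys a b zs' where "y # zs = ys @ a # b # zs'" "\<not> a \<prec> b"
        using 3 by auto
      then show ?thesis
        by (intro exI[of _ "x # ys"]) auto
    next
      case False
      then show ?thesis
        by (intro exI[of _ "[]"]) auto
    qed
  qed auto
  then show ?thesis
    using that by blast
qed

text \<open>Bubble sort: removing an adjacent descent lowers the number of inversions by one and
  costs the factor \<open>- t\<close>, exactly as for \<open>wt\<close>. The only sorted word of
  length \<open>card A\<close> is \<open>C0\<close>. The module is left open so that values may lie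
  in a ring or among column vectors.\<close>

lemma antisymmetric_normal_form:
  fixes sm :: "'k::comm_ring_1 \<Rightarrow> 'v::ab_group_add \<Rightarrow> 'v" and \<phi> :: "'i list \<Rightarrow> 'v"
  assumes "module sm" and A: "finite A"
    and swap: "\<And>ys c d zs. ys @ d # c # zs \<in> lists_on A (card A) \<Longrightarrow> c \<prec> d \<Longrightarrow>
      \<phi> (ys @ d # c # zs) = sm (- t) (\<phi> (ys @ c # d # zs))"
    and rep: "\<And>ys c zs. ys @ c # c # zs \<in> lists_on A (card A) \<Longrightarrow> \<phi> (ys @ c # c # zs) = 0"
    and C0: "sorted_wrt (\<prec>) C0" "set C0 = A"
    and "xs \<in> lists_on A (card A)"
  shows "\<phi> xs = sm (wt t xs) (\<phi> C0)"
  using assms(7)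
proof (induction "inversions xs" arbitrary: xs rule: less_induct)
  case less
  interpret module sm by fact
  show ?case
  proof (cases "sorted_wrt (\<prec>) xs")
    case True
    then have "distinct xs"
      by (rule sorted_distinct_list)
    then have "set xs = A"
      using less.prems A by (intro card_subset_eq) (auto simp: lists_on_def distinct_card)
    then have "xs = C0"
      using True C0 by (intro sorted_unique) auto
    then show ?thesis
      using C0 by (simp add: wt_sorted)
  next
    case False
    then obtain ys x y zs where xs: "xs = ys @ x # y # zs" "\<not> x \<prec> y"
      by (rule descent)
    show ?thesis
    proof (cases "x = y")
      case True
      then show ?thesis
        using xs rep less.prems by (simp add: wt_repeat)
    next
      case ne: False
      then have "y \<prec> x"
        using xs total by blast
      then have "\<phi> xs = sm (- t) (\<phi> (ys @ y # x # zs))"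
        using swap less.prems unfolding xs by blast
      also have "\<phi> (ys @ y # x # zs) = sm (wt t (ys @ y # x # zs)) (\<phi> C0)"
        by (rule less.hyps)
          (use less.prems \<open>y \<prec> x\<close> in \<open>auto simp: xs inversions_swap lists_on_def\<close>)
      also have "sm (- t) \<dots> = sm (wt t xs) (\<phi> C0)"
        using \<open>y \<prec> x\<close> by (simp add: xs wt_swap)
      finally show ?thesis .
    qed
  qed
qed

end

section \<open>Antisymmetrised products of operators\<close>

text \<open>Operators instead of ring elements, so that one argument covers both the entries of a
  matrix over a ring and the entries of the R-matrix, which are matrices themselves.\<close>

fun op_prod :: "('e \<Rightarrow> 'i \<Rightarrow> 'i \<Rightarrow> 'v \<Rightarrow> 'v) \<Rightarrow> 'e list \<Rightarrow> 'i list \<Rightarrow> 'i list \<Rightarrow> 'v \<Rightarrow> 'v" where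
  "op_prod T (e # es) (r # rs) (c # cs) v = T e r c (op_prod T es rs cs v)"
| "op_prod T _ _ _ v = v"

lemma op_prod_append:
  "length rs1 = length es1 \<Longrightarrow> length cs1 = length es1 \<Longrightarrow>
    op_prod T (es1 @ es2) (rs1 @ rs2) (cs1 @ cs2) v =
    op_prod T es1 rs1 cs1 (op_prod T es2 rs2 cs2 v)"
proof (induction es1 arbitrary: rs1 cs1)
  case (Cons e es1)
  then show ?case
    by (cases rs1; cases cs1) auto
qed auto

context index_order
begin

text \<open>A q-minor antisymmetrised over the row word only; antisymmetry in the column word is
  then a theorem.\<close>

definition op_minor ::
  "('k::comm_ring_1 \<Rightarrow> 'v::ab_group_add \<Rightarrow> 'v) \<Rightarrow> 'k \<Rightarrow> 'i set \<Rightarrow> ('e \<Rightarrow> 'i \<Rightarrow> 'i \<Rightarrow> 'v \<Rightarrow> 'v)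
     \<Rightarrow> 'e list \<Rightarrow> 'i list \<Rightarrow> 'v \<Rightarrow> 'v" where
  "op_minor sm t A T es cs v = (\<Sum>rs\<in>lists_on A (length es). sm (wt t rs) (op_prod T es rs cs v))"

text \<open>What two adjacent factors must satisfy for their row-antisymmetrised product to vanish
  on equal columns and to gain \<open>- t\<close> when two columns are exchanged.\<close>

definition antisym_pair ::
  "('k::comm_ring_1 \<Rightarrow> 'v::ab_group_add \<Rightarrow> 'v) \<Rightarrow> 'k \<Rightarrow> 'i set \<Rightarrow> ('i \<Rightarrow> 'i \<Rightarrow> 'v \<Rightarrow> 'v)
     \<Rightarrow> ('i \<Rightarrow> 'i \<Rightarrow> 'v \<Rightarrow> 'v) \<Rightarrow> bool" where
  "antisym_pair sm t A X Y \<longleftrightarrow> (\<forall>r\<in>A. \<forall>s\<in>A. r \<prec> s \<longrightarrow>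
     (\<forall>c\<in>A. \<forall>v. X r c (Y s c v) = sm t (X s c (Y r c v))) \<and>
     (\<forall>c\<in>A. \<forall>d\<in>A. c \<prec> d \<longrightarrow> (\<forall>v. X r d (Y s c v) - sm t (X s d (Y r c v)) =
        sm (- t) (X r c (Y s d v) - sm t (X s c (Y r d v))))))"

lemma module_hom_op_prod:
  fixes sm :: "'k::comm_ring_1 \<Rightarrow> 'v::ab_group_add \<Rightarrow> 'v"
  assumes "module sm" "\<And>e r c. module_hom sm sm (T e r c)"
  shows "module_hom sm sm (op_prod T es rs cs)"
proof (induction es arbitrary: rs cs)
  case Nil
  then show ?case
    using module.module_hom_ident[OF assms(1)] by simp
next
  case (Cons e es)
  show ?case
  proof (cases "rs = [] \<or> cs = []")
    case True
    then have "op_prod T (e # es) rs cs = (\<lambda>v. v)"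
      by (cases rs; cases cs) auto
    then show ?thesis
      using module.module_hom_ident[OF assms(1)] by simp
  next
    case False
    then obtain r rs' c cs' where "rs = r # rs'" "cs = c # cs'"
      by (auto simp: neq_Nil_conv)
    then show ?thesis
      using module_hom_compose[OF Cons[of rs' cs'] assms(2)[of e r c]] by (simp add: o_def)
  qed
qed

text \<open>Equal rows at the two chosen positions have weight 0, and exchanging distinct ones
  multiplies the weight by \<open>- t\<close>. The sum therefore groups into 2 by 2 q-minors of the
  two neighbouring factors.\<close>

lemma op_minor_pairs:
  fixes sm :: "'k::comm_ring_1 \<Rightarrow> 'v::ab_group_add \<Rightarrow> 'v"
  assumes sm: "module sm" and hom: "\<And>e r c. module_hom sm sm (T e r c)" and A: "finite A"
    and len: "length cs1 = length es1" "length cs2 = length es2"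
  shows "op_minor sm t A T (es1 @ e # f # es2) (cs1 @ c # d # cs2) v =
    (\<Sum>ys\<in>lists_on A (length es1). \<Sum>zs\<in>lists_on A (length es2). \<Sum>(r, s)\<in>{(r, s)\<in>A \<times> A. r \<prec> s}.
       sm (wt t (ys @ r # s # zs)) (op_prod T es1 ys cs1
         (T e r c (T f s d (op_prod T es2 zs cs2 v)) - sm t (T e s c (T f r d (op_prod T es2 zs cs2 v))))))"
    (is "_ = (\<Sum>ys\<in>_. \<Sum>zs\<in>_. ?rhs ys zs)")
proof -
  interpret module sm by fact
  have "op_minor sm t A T (es1 @ e # f # es2) (cs1 @ c # d # cs2) v =
      (\<Sum>ys\<in>lists_on A (length es1). \<Sum>zs\<in>lists_on A (length es2). \<Sum>r\<in>A. \<Sum>s\<in>A.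
        sm (wt t (ys @ r # s # zs)) (op_prod T (es1 @ e # f # es2) (ys @ r # s # zs) (cs1 @ c # d # cs2) v))"
    unfolding op_minor_def using sum_lists_split_pair[OF A] by simp
  also have "\<dots> = (\<Sum>ys\<in>lists_on A (length es1). \<Sum>zs\<in>lists_on A (length es2). ?rhs ys zs)"
  proof (intro sum.cong refl)
    fix ys zs assume "ys \<in> lists_on A (length es1)" "zs \<in> lists_on A (length es2)"
    then have l: "length ys = length es1"
      by (auto simp: lists_on_def)
    interpret P: module_hom sm sm "op_prod T es1 ys cs1"
      by (rule module_hom_op_prod) fact+
    let ?w = "op_prod T es2 zs cs2 v"
    let ?h = "\<lambda>r s. sm (wt t (ys @ r # s # zs)) (op_prod T (es1 @ e # f # es2) (ys @ r # s # zs) (cs1 @ c # d # cs2) v)"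
    have "(\<Sum>r\<in>A. \<Sum>s\<in>A. ?h r s) = (\<Sum>(r, s)\<in>{(r, s)\<in>A \<times> A. r \<prec> s}. ?h r s + ?h s r)"
      using A by (rule sum_pairs) (simp add: wt_repeat)
    also have "\<dots> = ?rhs ys zs"
    proof (intro sum.cong refl, clarify)
      fix r s assume "r \<prec> s"
      then have "?h s r = sm (wt t (ys @ r # s # zs)) (sm (- t) (op_prod T es1 ys cs1 (T e s c (T f r d ?w))))"
        using l len by (simp add: wt_swap op_prod_append mult.commute)
      moreover have "?h r s = sm (wt t (ys @ r # s # zs)) (op_prod T es1 ys cs1 (T e r c (T f s d ?w)))"
        using l len by (simp add: op_prod_append)
      ultimately show "?h r s + ?h s r = sm (wt t (ys @ r # s # zs)) (op_prod T es1 ys cs1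
         (T e r c (T f s d ?w) - sm t (T e s c (T f r d ?w))))"
        by (simp add: P.diff P.scale scale_right_diff_distrib)
    qed
    finally show "(\<Sum>r\<in>A. \<Sum>s\<in>A. ?h r s) = ?rhs ys zs" .
  qed
  finally show ?thesis .
qed

lemma op_minor_swap:
  fixes sm :: "'k::comm_ring_1 \<Rightarrow> 'v::ab_group_add \<Rightarrow> 'v"
  assumes sm: "module sm" and hom: "\<And>e r c. module_hom sm sm (T e r c)" and A: "finite A"
    and len: "length cs1 = length es1" "length cs2 = length es2"
    and anti: "antisym_pair sm t A (T e) (T f)" and cd: "c \<in> A" "d \<in> A" "c \<prec> d"
  shows "op_minor sm t A T (es1 @ e # f # es2) (cs1 @ d # c # cs2) v =
    sm (- t) (op_minor sm t A T (es1 @ e # f # es2) (cs1 @ c # d # cs2) v)"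
proof -
  interpret module sm by fact
  show ?thesis
    unfolding op_minor_pairs[OF sm hom A len] scale_sum_right
  proof (intro sum.cong refl, clarify)
    fix ys zs r s assume rs: "r \<in> A" "s \<in> A" "r \<prec> s"
    interpret P: module_hom sm sm "op_prod T es1 ys cs1"
      by (rule module_hom_op_prod) fact+
    let ?w = "op_prod T es2 zs cs2 v"
    have "T e r d (T f s c ?w) - sm t (T e s d (T f r c ?w)) =
        sm (- t) (T e r c (T f s d ?w) - sm t (T e s c (T f r d ?w)))"
      using anti rs cd unfolding antisym_pair_def by blast
    then show "sm (wt t (ys @ r # s # zs)) (op_prod T es1 ys cs1
         (T e r d (T f s c ?w) - sm t (T e s d (T f r c ?w)))) =
      sm (- t) (sm (wt t (ys @ r # s # zs)) (op_prod T es1 ys cs1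
         (T e r c (T f s d ?w) - sm t (T e s c (T f r d ?w)))))"
      by (simp only: P.scale scale_scale mult.commute)
  qed
qed

lemma op_minor_repeat:
  fixes sm :: "'k::comm_ring_1 \<Rightarrow> 'v::ab_group_add \<Rightarrow> 'v"
  assumes sm: "module sm" and hom: "\<And>e r c. module_hom sm sm (T e r c)" and A: "finite A"
    and len: "length cs1 = length es1" "length cs2 = length es2"
    and anti: "antisym_pair sm t A (T e) (T f)" and c: "c \<in> A"
  shows "op_minor sm t A T (es1 @ e # f # es2) (cs1 @ c # c # cs2) v = 0"
proof -
  interpret module sm by fact
  show ?thesis
    unfolding op_minor_pairs[OF sm hom A len]
  proof (intro sum.neutral ballI, clarify)
    fix ys zs r s assume rs: "r \<in> A" "s \<in> A" "r \<prec> s"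
    interpret P: module_hom sm sm "op_prod T es1 ys cs1"
      by (rule module_hom_op_prod) fact+
    let ?w = "op_prod T es2 zs cs2 v"
    have "T e r c (T f s c ?w) = sm t (T e s c (T f r c ?w))"
      using anti rs c unfolding antisym_pair_def by blast
    then show "sm (wt t (ys @ r # s # zs)) (op_prod T es1 ys cs1
         (T e r c (T f s c ?w) - sm t (T e s c (T f r c ?w)))) = 0"
      by simp
  qed
qed

theorem op_minor_normal_form:
  fixes sm :: "'k::comm_ring_1 \<Rightarrow> 'v::ab_group_add \<Rightarrow> 'v"
  assumes sm: "module sm" and hom: "\<And>e r c. module_hom sm sm (T e r c)" and A: "finite A"
    and es: "length es = card A" "successively (\<lambda>e f. antisym_pair sm t A (T e) (T f)) es"
    and C0: "sorted_wrt (\<prec>) C0" "set C0 = A" and xs: "xs \<in> lists_on A (card A)"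
  shows "op_minor sm t A T es xs v = sm (wt t xs) (op_minor sm t A T es C0 v)"
proof -
  \<comment> \<open>Cuts the list of arguments at the same place as the column word, so that an
    adjacent pair of columns meets an adjacent pair of factors.\<close>
  have split: "\<exists>es1 e f es2. es = es1 @ e # f # es2 \<and> length ys = length es1 \<and> length zs = length es2
      \<and> antisym_pair sm t A (T e) (T f)"
    if "ys @ c # d # zs \<in> lists_on A (card A)" for ys zs c d
  proof -
    have l: "length es = length ys + Suc (Suc (length zs))"
      using that es by (simp add: lists_on_def)
    then obtain e f es2 where *: "drop (length ys) es = e # f # es2"
      by (metis add_diff_cancel_left' length_Suc_conv length_drop)
    then have e: "es = take (length ys) es @ e # f # es2"
      by (metis append_take_drop_id)
    have "length es2 = length zs"
      using * l by (metis Suc_inject add_diff_cancel_left' length_Cons length_drop)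
    moreover have "antisym_pair sm t A (T e) (T f)"
      using es(2) by (subst (asm) e) (simp add: successively_append_iff)
    ultimately show ?thesis
      using e l by (intro exI[of _ "take (length ys) es"] exI[of _ e] exI[of _ f] exI[of _ es2]) simp
  qed
  show ?thesis
  proof (rule antisymmetric_normal_form[OF sm A _ _ C0 xs])
    fix ys c d zs assume *: "ys @ d # c # zs \<in> lists_on A (card A)" "c \<prec> d"
    show "op_minor sm t A T es (ys @ d # c # zs) v = sm (- t) (op_minor sm t A T es (ys @ c # d # zs) v)"
      using split[OF *(1)] *
      by (elim exE conjE, simp only:, intro op_minor_swap[OF sm hom A]) (auto simp: lists_on_def)
  next
    fix ys c zs assume *: "ys @ c # c # zs \<in> lists_on A (card A)"
    show "op_minor sm t A T es (ys @ c # c # zs) v = 0"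
      using split[OF *] *
      by (elim exE conjE, simp only:, intro op_minor_repeat[OF sm hom A]) (auto simp: lists_on_def)
  qed
qed

end

section \<open>Central scalars\<close>

text \<open>Scalars act through a map into the centre rather than a fixed embedding, since the mixed
  relation involves two such maps at once.\<close>

locale central_hom =
  fixes s :: "'k::comm_ring_1 \<Rightarrow> 'a::ring_1"
  assumes one [simp]: "s 1 = 1"
    and add: "s (a + b) = s a + s b"
    and mult: "s (a * b) = s a * s b"
    and central: "s a * x = x * s a"
begin

lemma zero [simp]: "s 0 = 0"
  using add[of 0 0] by simp

lemma uminus: "s (- a) = - s a"
  using add[of a "- a"] by (simp add: eq_neg_iff_add_eq_0 add.commute)

lemma sum: "s (\<Sum>x\<in>A. f x) = (\<Sum>x\<in>A. s (f x))"
  by (induction A rule: infinite_finite_induct) (auto simp: add)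

lemma power: "s (a ^ n) = s a ^ n"
  by (induction n) (auto simp: mult)

lemma swap: "x * (s a * y) = s a * (x * y)"
  by (metis central mult.assoc)

lemma fuse: "s a * (s b * x) = s (a * b) * x"
  by (simp add: mult mult.assoc)

lemma module: "module (\<lambda>k v. s k * v)"
  by standard (auto simp: add mult algebra_simps)

lemma module_hom: "module_hom (\<lambda>k v. s k * v) (\<lambda>k v. s k * v) ((*) x)"
  by (rule module_hom.intro[OF module module], standard) (auto simp: distrib_left swap)

end

section \<open>Antisymmetrised products in a ring\<close>

fun ring_prod :: "('e \<Rightarrow> 'i \<Rightarrow> 'i \<Rightarrow> 'a::ring_1) \<Rightarrow> 'e list \<Rightarrow> 'i list \<Rightarrow> 'i list \<Rightarrow> 'a" where
  "ring_prod T (e # es) (r # rs) (c # cs) = T e r c * ring_prod T es rs cs"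
| "ring_prod T _ _ _ = 1"

lemma op_prod_ring: "op_prod (\<lambda>e r c v. T e r c * v) es rs cs v = ring_prod T es rs cs * v"
  by (induction T es rs cs rule: ring_prod.induct) (auto simp: mult.assoc)

lemma ring_prod_append:
  "length rs1 = length es1 \<Longrightarrow> length cs1 = length es1 \<Longrightarrow>
    ring_prod T (es1 @ es2) (rs1 @ rs2) (cs1 @ cs2) =
    ring_prod T es1 rs1 cs1 * ring_prod T es2 rs2 cs2"
proof (induction es1 arbitrary: rs1 cs1)
  case (Cons e es1)
  then show ?case
    by (cases rs1; cases cs1) (auto simp: mult.assoc)
qed auto

context index_order
begin

definition ring_minor ::
  "('k::comm_ring_1 \<Rightarrow> 'a::ring_1) \<Rightarrow> 'k \<Rightarrow> 'i set \<Rightarrow> ('e \<Rightarrow> 'i \<Rightarrow> 'i \<Rightarrow> 'a) \<Rightarrow> 'e list \<Rightarrow> 'i list \<Rightarrow> 'a" where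
  "ring_minor s t A T es cs = (\<Sum>rs\<in>lists_on A (length es). s (wt t rs) * ring_prod T es rs cs)"

lemma op_minor_ring:
  "op_minor (\<lambda>k v. s k * v) t A (\<lambda>e r c v. T e r c * v) es cs v = ring_minor s t A T es cs * v"
  by (simp add: op_minor_def ring_minor_def op_prod_ring sum_distrib_right mult.assoc)

definition antisym_ring :: "('k::comm_ring_1 \<Rightarrow> 'a::ring_1) \<Rightarrow> 'k \<Rightarrow> 'i set \<Rightarrow> ('i \<Rightarrow> 'i \<Rightarrow> 'a) \<Rightarrow> ('i \<Rightarrow> 'i \<Rightarrow> 'a) \<Rightarrow> bool" where
  "antisym_ring s t A X Y \<longleftrightarrow> (\<forall>r\<in>A. \<forall>q\<in>A. r \<prec> q \<longrightarrow>
     (\<forall>c\<in>A. X r c * Y q c = s t * (X q c * Y r c)) \<and>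
     (\<forall>c\<in>A. \<forall>d\<in>A. c \<prec> d \<longrightarrow> X r d * Y q c - s t * (X q d * Y r c) =
        - s t * (X r c * Y q d - s t * (X q c * Y r d))))"

lemma antisym_ring_pair:
  assumes "central_hom s" "antisym_ring s t A X Y"
  shows "antisym_pair (\<lambda>k v. s k * v) t A (\<lambda>r c v. X r c * v) (\<lambda>r c v. Y r c * v)"
proof -
  interpret central_hom s by fact
  show ?thesis
    unfolding antisym_pair_def
  proof (intro ballI impI conjI allI)
    fix r q c v assume *: "r \<in> A" "q \<in> A" "r \<prec> q" "c \<in> A"
    then have "X r c * Y q c * v = s t * (X q c * Y r c) * v"
      using assms(2) unfolding antisym_ring_def by metis
    then show "X r c * (Y q c * v) = s t * (X q c * (Y r c * v))"
      by (simp add: mult.assoc)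
    fix d assume "d \<in> A" "c \<prec> d"
    then have "(X r d * Y q c - s t * (X q d * Y r c)) * v =
        - s t * (X r c * Y q d - s t * (X q c * Y r d)) * v"
      using assms(2) * unfolding antisym_ring_def by metis
    then show "X r d * (Y q c * v) - s t * (X q d * (Y r c * v)) =
        s (- t) * (X r c * (Y q d * v) - s t * (X q c * (Y r d * v)))"
      by (simp add: algebra_simps uminus)
  qed
qed

theorem ring_minor_normal_form:
  assumes s: "central_hom s" and A: "finite A"
    and es: "length es = card A" "successively (\<lambda>e f. antisym_ring s t A (T e) (T f)) es"
    and C0: "sorted_wrt (\<prec>) C0" "set C0 = A" and xs: "xs \<in> lists_on A (card A)"
  shows "ring_minor s t A T es xs = s (wt t xs) * ring_minor s t A T es C0"
proof -
  interpret central_hom s by fact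
  have "successively (\<lambda>e f. antisym_pair (\<lambda>k v. s k * v) t A (\<lambda>r c v. T e r c * v) (\<lambda>r c v. T f r c * v)) es"
    using es(2) by (rule successively_mono) (use antisym_ring_pair[OF s] in auto)
  from op_minor_normal_form[OF module module_hom A es(1) this C0 xs, of 1]
  show ?thesis
    by (simp add: op_minor_ring)
qed

end

section \<open>The quadratic relations of an ordinary RTT algebra\<close>

context index_order
begin

text \<open>\<open>diag\<close> and \<open>exch\<close> are the entries of the R-matrix of gl_n,
  with \<open>p'\<close> as the inverse of \<open>p\<close>; \<open>ortt\<close> is the relation R
  X_1 Y_2 = Y_2 X_1 R in components.\<close>

definition diag :: "'k::comm_ring_1 \<Rightarrow> 'k \<Rightarrow> 'k \<Rightarrow> 'k \<Rightarrow> 'i \<Rightarrow> 'i \<Rightarrow> 'k" where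
  "diag p p' z w i k = (if i = k then z * p - w * p' else z - w)"

definition exch :: "'k::comm_ring_1 \<Rightarrow> 'k \<Rightarrow> 'k \<Rightarrow> 'k \<Rightarrow> 'i \<Rightarrow> 'i \<Rightarrow> 'k" where
  "exch p p' z w i k = (if i = k then 0 else (p - p') * (if i \<prec> k then z else w))"

definition ortt :: "('k::comm_ring_1 \<Rightarrow> 'a::ring_1) \<Rightarrow> ('k \<Rightarrow> 'a) \<Rightarrow> 'i set \<Rightarrow> 'k \<Rightarrow> 'k \<Rightarrow> 'k \<Rightarrow> 'k \<Rightarrow> 'k
    \<Rightarrow> ('i \<Rightarrow> 'i \<Rightarrow> 'a) \<Rightarrow> ('i \<Rightarrow> 'i \<Rightarrow> 'a) \<Rightarrow> bool" where
  "ortt s s' A p p' g z w X Y \<longleftrightarrow> (\<forall>i\<in>A. \<forall>m\<in>A. \<forall>k\<in>A. \<forall>n\<in>A.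
     s (g * diag p p' z w i k) * (X i m * Y k n) + s (g * exch p p' z w i k) * (X k m * Y i n) =
     s' (g * diag p p' z w m n) * (Y k n * X i m) + s' (g * exch p p' z w n m) * (Y k m * X i n))"

text \<open>At \<open>w = z * p * p\<close> the entries of \<open>diag\<close> with equal indices
  vanish and R degenerates to a multiple of a q-antisymmetriser; the RTT relation then expresses
  antisymmetry of the product.\<close>

lemma ortt_antisym:
  assumes s: "central_hom s" and pp: "p * p' = 1" and l: "l * (p - p') = 1"
    and XY: "ortt s s A p p' 1 z (z * p * p) X Y" and u: "u * z = 1"
  shows "antisym_ring s p' A X Y"
proof -
  interpret central_hom s by fact
  let ?d = "diag p p' z (z * p * p)" and ?x = "exch p p' z (z * p * p)"
  \<comment> \<open>Normalises the entries with distinct indices to 1: there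
    \<open>?d i k = z * (1 - p * p) = - z * p * (p - p')\<close>.\<close>
  define \<kappa> where "\<kappa> = - (l * u * p')"
  have zero: "?d i i = 0" for i
  proof -
    have "?d i i = z * p * (1 - p * p')"
      by (simp add: diag_def algebra_simps)
    then show ?thesis
      using pp by simp
  qed
  have d1: "\<kappa> * ?d i k = 1" if "i \<noteq> k" for i k
  proof -
    have "\<kappa> * ?d i k = (l * (p * (p * p') - p')) * (u * z)"
      using that by (simp add: diag_def \<kappa>_def algebra_simps)
    then show ?thesis
      using pp l u by simp
  qed
  have x1: "\<kappa> * ?x i k = - p'" if "i \<prec> k" for i k
  proof -
    have "i \<noteq> k"
      using that irrefl by auto
    then have "\<kappa> * ?x i k = - p' * (l * (p - p')) * (u * z)"
      using that by (simp add: exch_def \<kappa>_def algebra_simps)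
    then show ?thesis
      using l u by simp
  qed
  have x2: "\<kappa> * ?x k i = - p" if "i \<prec> k" for i k
  proof -
    have "i \<noteq> k"
      using that irrefl by auto
    then have "\<kappa> * ?x k i = - (p * (p * p')) * (l * (p - p')) * (u * z)"
      using that asym[OF that] by (simp add: exch_def \<kappa>_def algebra_simps)
    then show ?thesis
      using pp l u by simp
  qed
  have xx: "?x i i = 0" for i
    by (simp add: exch_def)
  have main: "s (\<kappa> * ?d i k) * (X i m * Y k n) + s (\<kappa> * ?x i k) * (X k m * Y i n) =
     s (\<kappa> * ?d m n) * (Y k n * X i m) + s (\<kappa> * ?x n m) * (Y k m * X i n)"
    if "i \<in> A" "m \<in> A" "k \<in> A" "n \<in> A" for i m k n
  proof -
    have "s \<kappa> * (s (?d i k) * (X i m * Y k n) + s (?x i k) * (X k m * Y i n)) =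
      s \<kappa> * (s (?d m n) * (Y k n * X i m) + s (?x n m) * (Y k m * X i n))"
      using XY that unfolding ortt_def by simp
    then show ?thesis
      by (simp add: mult distrib_left mult.assoc)
  qed
  show ?thesis
    unfolding antisym_ring_def
  proof (intro ballI impI conjI)
    fix r q c assume *: "r \<in> A" "q \<in> A" "r \<prec> q" "c \<in> A"
    have rq: "r \<noteq> q"
      using * irrefl by auto
    have "X r c * Y q c + s (- p') * (X q c * Y r c) = 0"
      using main[of r c q c] * rq by (simp add: d1 x1 zero xx)
    then show "X r c * Y q c = s p' * (X q c * Y r c)"
      by (simp add: uminus)
    fix d assume "d \<in> A" "c \<prec> d"
    then have cd: "c \<noteq> d"
      using irrefl by auto
    have 1: "X r c * Y q d + s (- p') * (X q c * Y r d) = Y q d * X r c + s (- p) * (Y q c * X r d)"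
      using main[of r c q d] * rq \<open>d \<in> A\<close> \<open>c \<prec> d\<close> cd by (simp add: d1 x1 x2)
    have 2: "X r d * Y q c + s (- p') * (X q d * Y r c) = Y q c * X r d + s (- p') * (Y q d * X r c)"
      using main[of r d q c] * rq \<open>d \<in> A\<close> \<open>c \<prec> d\<close> cd by (simp add: d1 x1)
    have "s p' * s p = 1"
      using pp by (simp add: mult.commute flip: mult)
    \<comment> \<open>The right-hand side of 1 times \<open>- p'\<close> is the right-hand side of
      2, because \<open>p' * p = 1\<close>; this relates the two left-hand sides.\<close>
    then have "- s p' * (Y q d * X r c + s (- p) * (Y q c * X r d)) = Y q c * X r d + s (- p') * (Y q d * X r c)"
      by (simp add: right_diff_distrib uminus mult.assoc[symmetric])
    then show "X r d * Y q c - s p' * (X q d * Y r c) = - s p' * (X r c * Y q d - s p' * (X q c * Y r d))"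
      using 1 2 by (simp add: uminus)
  qed
qed

text \<open>Entry \<open>(l, l')\<close> of the matrix \<open>r_op e r c\<close> is the coefficient of
  \<open>E\<^sub>r\<^sub>c \<otimes> E\<^bsub>ll'\<^esub>\<close> in \<open>R\<close>.\<close>

definition r_op :: "'k::comm_ring_1 \<Rightarrow> 'k \<Rightarrow> ('e \<Rightarrow> 'k) \<Rightarrow> ('e \<Rightarrow> 'k) \<Rightarrow> 'k \<Rightarrow> 'e \<Rightarrow> 'i \<Rightarrow> 'i \<Rightarrow> ('i \<Rightarrow> 'k) \<Rightarrow> ('i \<Rightarrow> 'k)" where
  "r_op p p' g z w e r c v = (\<lambda>l. if r = c then g e * diag p p' (z e) w r l * v l
     else if l = c then g e * exch p p' (z e) w r c * v r else 0)"

text \<open>The entries of R obey the same antisymmetry as the generators of an RTT algebra, an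
  instance of the Yang-Baxter equation; here it is checked entry by entry.\<close>

lemma r_op_antisym:
  fixes p :: "'k::comm_ring_1"
  assumes pp: "p * p' = 1" and z: "z f = z e * p * p"
  shows "antisym_pair (\<lambda>k v l. k * v l) p' A (r_op p p' g z w e) (r_op p p' g z w f)"
proof -
  have p1: "p * (p' * x) = x" "p' * (p * x) = x" for x
    using pp by (metis mult.assoc mult.commute mult_1)+
  show ?thesis
    unfolding antisym_pair_def
  proof (intro ballI impI conjI allI ext)
    fix r q c l and v :: "'i \<Rightarrow> 'k" assume *: "r \<prec> q"
    then have n: "r \<noteq> q" "\<not> q \<prec> r"
      using irrefl asym by auto
    show "r_op p p' g z w e r c (r_op p p' g z w f q c v) l =
        p' * r_op p p' g z w e q c (r_op p p' g z w f r c v) l"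
      using n * pp by (auto simp: r_op_def diag_def exch_def z algebra_simps p1)
    fix d assume cd: "c \<prec> d"
    then have m: "c \<noteq> d" "\<not> d \<prec> c"
      using irrefl asym by auto
    \<comment> \<open>Coincidences between a row and a column force these comparisons, which decide
      between \<open>z\<close> and \<open>w\<close> in \<open>exch\<close>.\<close>
    have t: "r = d \<Longrightarrow> \<not> q \<prec> c" "q = c \<Longrightarrow> r \<prec> d"
      using * cd trans asym by blast+
    show "(r_op p p' g z w e r d (r_op p p' g z w f q c v) - (\<lambda>l. p' * r_op p p' g z w e q d (r_op p p' g z w f r c v) l)) l =
        - p' * (r_op p p' g z w e r c (r_op p p' g z w f q d v) - (\<lambda>l. p' * r_op p p' g z w e q c (r_op p p' g z w f r d v) l)) l"
      using n m * cd t
      by (cases "c = r"; cases "c = q"; cases "d = r"; cases "d = q"; cases "l = c"; cases "l = d")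
        (simp_all add: r_op_def diag_def exch_def z algebra_simps p1)
  qed
qed


lemma module_fun: "module (\<lambda>(k::'k::comm_ring_1) (v::'i \<Rightarrow> 'k) l. k * v l)"
  by standard (auto simp: algebra_simps fun_eq_iff)

lemma module_hom_r_op:
  "module_hom (\<lambda>k v l. k * v l) (\<lambda>k v l. k * v l) (r_op p p' g z (w::'k::comm_ring_1) e r c)"
  by (rule module_hom.intro[OF module_fun module_fun], standard)
    (auto simp: r_op_def fun_eq_iff algebra_simps)

definition unitv :: "'i \<Rightarrow> 'i \<Rightarrow> 'k::comm_ring_1" where
  "unitv j = (\<lambda>l. if l = j then 1 else 0)"

text \<open>A basis vector whose index meets no row and no column is hit by no exchange term, so
  each factor only scales it by \<open>g e * (z e - w)\<close>.\<close>

lemma op_prod_r_op_fresh: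
  assumes "length rs = length es" "length cs = length es" "j \<notin> set rs" "j \<notin> set cs"
  shows "op_prod (r_op p p' g z w) es rs cs (unitv j) =
    (\<lambda>l. (if rs = cs then \<Prod>e\<leftarrow>es. g e * (z e - w) else 0) * unitv j l)"
  using assms
proof (induction es arbitrary: rs cs)
  case Nil
  then show ?case by (auto simp: unitv_def)
next
  case (Cons e es)
  then obtain r rs' c cs' where [simp]: "rs = r # rs'" "cs = c # cs'"
    by (metis length_Suc_conv)
  have IH: "op_prod (r_op p p' g z w) es rs' cs' (unitv j) =
    (\<lambda>l. (if rs' = cs' then \<Prod>e\<leftarrow>es. g e * (z e - w) else 0) * unitv j l)"
    using Cons by auto
  have eq: "op_prod (r_op p p' g z w) (e # es) rs cs (unitv j) = r_op p p' g z w e r c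
    (\<lambda>l. (if rs' = cs' then \<Prod>e\<leftarrow>es. g e * (z e - w) else 0) * unitv j l)"
    by (simp add: IH)
  show ?case
    unfolding eq using Cons.prems by (auto simp: r_op_def unitv_def diag_def fun_eq_iff)
qed

lemma sum_fun_apply: "(\<Sum>x\<in>A. f x) l = (\<Sum>x\<in>A. f x l)"
  by (induction A rule: infinite_finite_induct) auto

text \<open>With \<open>j\<close> as last column, the factor acting first on \<open>unitv j\<close>
  leaves only the row \<open>j\<close>. A second \<open>j\<close> among the rows has weight 0, so
  the other factors see a fresh index.\<close>

lemma r_op_minor_snoc:
  fixes p :: "'k::comm_ring_1"
  assumes A: "finite A" and j: "j \<in> A" "j \<notin> set cs" "cs \<in> lists_on A (length es)"
  shows "op_minor (\<lambda>k v l. k * v l) t A (r_op p p' g z w) (es @ [e]) (cs @ [j]) (unitv j) =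
    (\<lambda>l. wt t (cs @ [j]) * (g e * (z e * p - w * p') * (\<Prod>e\<leftarrow>es. g e * (z e - w))) * unitv j l)"
proof
  fix l
  interpret sm: module "\<lambda>(k::'k::comm_ring_1) (v::'i \<Rightarrow> 'k) l. k * v l"
    by (rule module_fun)
  let ?R = "r_op p p' g z w" and ?P = "\<Prod>e\<leftarrow>es. g e * (z e - w)"
  have last: "?R e r j (unitv j) = (if r = j then (\<lambda>l. g e * (z e * p - w * p') * unitv j l) else 0)" for r
    by (auto simp: r_op_def unitv_def diag_def exch_def fun_eq_iff)
  have len: "length cs = length es"
    using j by (simp add: lists_on_def)
  have "op_minor (\<lambda>k v l. k * v l) t A ?R (es @ [e]) (cs @ [j]) (unitv j) l =
      (\<Sum>rs\<in>lists_on A (length es). \<Sum>r\<in>A. wt t (rs @ [r]) *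
        op_prod ?R (es @ [e]) (rs @ [r]) (cs @ [j]) (unitv j) l)"
    by (simp add: op_minor_def sum_lists_snoc[OF A] sum_fun_apply)
  also have "\<dots> = (\<Sum>rs\<in>lists_on A (length es). \<Sum>r\<in>A. if r = j then if rs = cs then
        wt t (cs @ [j]) * (g e * (z e * p - w * p') * ?P) * unitv j l else 0 else 0)"
  proof (intro sum.cong refl)
    fix rs r assume rs: "rs \<in> lists_on A (length es)"
    then have lr: "length rs = length es"
      by (simp add: lists_on_def)
    interpret P: module_hom "\<lambda>(k::'k) (v::'i \<Rightarrow> 'k) l. k * v l" "\<lambda>k v l. k * v l" "op_prod ?R es rs cs"
      by (rule module_hom_op_prod[OF module_fun module_hom_r_op])
    have "op_prod ?R (es @ [e]) (rs @ [r]) (cs @ [j]) (unitv j) = op_prod ?R es rs cs (?R e r j (unitv j))"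
      using lr len by (simp add: op_prod_append)
    also have "\<dots> = (if r = j then (\<lambda>l. g e * (z e * p - w * p') * op_prod ?R es rs cs (unitv j) l) else 0)"
      by (simp add: last P.scale)
    finally have *: "op_prod ?R (es @ [e]) (rs @ [r]) (cs @ [j]) (unitv j) l =
      (if r = j then g e * (z e * p - w * p') * op_prod ?R es rs cs (unitv j) l else 0)"
      by simp
    show "wt t (rs @ [r]) * op_prod ?R (es @ [e]) (rs @ [r]) (cs @ [j]) (unitv j) l =
      (if r = j then if rs = cs then wt t (cs @ [j]) * (g e * (z e * p - w * p') * ?P) * unitv j l else 0 else 0)"
    proof (cases "j \<in> set rs")
      case True
      then have "rs \<noteq> cs" "r = j \<Longrightarrow> wt t (rs @ [r]) = 0"
        using j by (auto simp: wt_repeat)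
      then show ?thesis
        by (auto simp: *)
    next
      case False
      then have "op_prod ?R es rs cs (unitv j) = (\<lambda>l. (if rs = cs then ?P else 0) * unitv j l)"
        using lr len j by (intro op_prod_r_op_fresh)
      then show ?thesis
        by (simp add: *)
    qed
  qed
  also have "\<dots> = wt t (cs @ [j]) * (g e * (z e * p - w * p') * ?P) * unitv j l"
    using A j by simp
  finally show "op_minor (\<lambda>k v l. k * v l) t A ?R (es @ [e]) (cs @ [j]) (unitv j) l = \<dots>" .
qed

lemma wt_unit:
  assumes "p * p' = 1" "distinct xs"
  shows "\<exists>u. u * wt p' xs = 1"
proof -
  have "(-p) ^ n * (-p') ^ n = 1" for n
    using assms(1) by (simp flip: power_mult_distrib)
  then show ?thesis
    using assms(2) by (auto simp: wt_def)
qed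

text \<open>The q-determinant of R is a scalar: it is read off at a column word ending in
  \<open>j\<close>, and antisymmetry carries the value to \<open>C0\<close> because weights of
  distinct words are units.\<close>

lemma r_op_minor:
  fixes p :: "'k::comm_ring_1"
  assumes A: "finite A" and pp: "p * p' = 1" and es: "length es = card A" "es \<noteq> []"
    and z: "successively (\<lambda>e f. z f = z e * p * p) es"
    and C0: "sorted_wrt (\<prec>) C0" "set C0 = A" and j: "j \<in> A"
  shows "op_minor (\<lambda>k v l. k * v l) p' A (r_op p p' g z w) es C0 (unitv j) =
    (\<lambda>l. g (last es) * (z (last es) * p - w * p') * (\<Prod>e\<leftarrow>butlast es. g e * (z e - w)) * unitv j l)"
proof -
  let ?F = "\<lambda>C. op_minor (\<lambda>k v l. k * v l) p' A (r_op p p' g z w) es C (unitv j)"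
  let ?a = "g (last es) * (z (last es) * p - w * p') * (\<Prod>e\<leftarrow>butlast es. g e * (z e - w))"
  have "distinct C0"
    using C0 by (simp add: sorted_distinct_list)
  define cs where "cs = filter (\<lambda>x. x \<noteq> j) C0"
  have cs: "set cs = A - {j}" "distinct cs"
    using C0 \<open>distinct C0\<close> by (auto simp: cs_def)
  then have lcs: "length cs = card A - 1"
    using j A by (metis card_Diff_singleton distinct_card)
  have pos: "card A > 0"
    using j A card_gt_0_iff by blast
  have C: "cs @ [j] \<in> lists_on A (card A)" and cs': "cs \<in> lists_on A (length (butlast es))"
    using cs lcs j pos es by (auto simp: lists_on_def)
  have d: "distinct (cs @ [j])"
    using cs by simp
  have "successively (\<lambda>e f. antisym_pair (\<lambda>k v l. k * v l) p' A (r_op p p' g z w e) (r_op p p' g z w f)) es"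
    using z by (rule successively_mono) (rule r_op_antisym[OF pp])
  from op_minor_normal_form[OF module_fun module_hom_r_op A es(1) this C0 C]
  have "?F (cs @ [j]) = (\<lambda>l. wt p' (cs @ [j]) * ?F C0 l)" .
  moreover have "?F (cs @ [j]) = (\<lambda>l. wt p' (cs @ [j]) * ?a * unitv j l)"
    using r_op_minor_snoc[OF A j, of cs "butlast es" p' p p' g z w "last es"] cs cs' es by simp
  ultimately have eq: "wt p' (cs @ [j]) * ?F C0 l = wt p' (cs @ [j]) * ?a * unitv j l" for l
    by metis
  obtain u where u: "u * wt p' (cs @ [j]) = 1"
    using wt_unit[OF pp d] by blast
  show ?thesis
  proof
    fix l
    have "u * wt p' (cs @ [j]) * ?F C0 l = u * wt p' (cs @ [j]) * ?a * unitv j l"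
      using eq[of l] by (simp add: mult.assoc)
    then show "?F C0 l = ?a * unitv j l"
      by (simp add: u)
  qed
qed

text \<open>Fusion: \<open>\<mu>\<close> crosses the product one factor at a time, each time by one
  RTT relation, and the R-matrices accumulate in \<open>op_prod\<close>.\<close>

lemma intertwine:
  fixes T :: "'e \<Rightarrow> 'i \<Rightarrow> 'i \<Rightarrow> 'a::ring_1"
  assumes s: "central_hom s" and s': "central_hom s'" and A: "finite A"
    and T: "\<And>e. e \<in> set es \<Longrightarrow> ortt s s' A p p' (g e) (z e) w (T e) \<mu>"
    and len: "length rs = length es" "length cs = length es" "set rs \<subseteq> A" "set cs \<subseteq> A"
    and ij: "i \<in> A" "j \<in> A"
  shows "(\<Sum>q\<in>lists_on A (length es). \<Sum>l\<in>A. s (op_prod (r_op p p' g z w) es rs q (unitv l) i) * (ring_prod T es q cs * \<mu> l j)) =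
    (\<Sum>q\<in>lists_on A (length es). \<Sum>l\<in>A. s' (op_prod (r_op p p' g z w) es q cs (unitv j) l) * (\<mu> i l * ring_prod T es rs q))"
  using T len ij
proof (induction es arbitrary: rs cs i)
  case Nil
  interpret s: central_hom s by fact
  interpret s': central_hom s' by fact
  have "(\<Sum>l\<in>A. s (unitv l i) * \<mu> l j) = (\<Sum>l\<in>A. if l = i then \<mu> i j else 0)"
    by (intro sum.cong) (auto simp: unitv_def)
  moreover have "(\<Sum>l\<in>A. s' (unitv j l) * \<mu> i l) = (\<Sum>l\<in>A. if l = j then \<mu> i j else 0)"
    by (intro sum.cong) (auto simp: unitv_def)
  ultimately show ?case
    using Nil A by simp
next
  case (Cons e es)
  interpret s: central_hom s by fact
  interpret s': central_hom s' by fact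
  obtain r rs' c cs' where [simp]: "rs = r # rs'" "cs = c # cs'"
    using Cons.prems by (metis length_Suc_conv)
  let ?R = "r_op p p' g z w" and ?d = "diag p p' (z e) w" and ?x = "exch p p' (z e) w"
  let ?L = "lists_on A (length es)"
  have mem: "r \<in> A" "c \<in> A" "i \<in> A" "j \<in> A"
    using Cons.prems by auto
  define lhs where "lhs k = (\<Sum>q\<in>?L. \<Sum>l\<in>A. s (op_prod ?R es rs' q (unitv l) k) * (ring_prod T es q cs' * \<mu> l j))" for k
  define rhs where "rhs k = (\<Sum>q\<in>?L. \<Sum>l\<in>A. s' (op_prod ?R es q cs' (unitv j) l) * (\<mu> k l * ring_prod T es rs' q))" for k
  have IH: "lhs k = rhs k" if "k \<in> A" for k
    unfolding lhs_def rhs_def using Cons.prems that by (intro Cons.IH) auto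
  have xx: "?x k k = 0" for k
    by (simp add: exch_def)
  note swaps = s.swap[where x = "T _ _ _"] s'.swap[where x = "T _ _ _"] s'.swap[where x = "\<mu> _ _"]
    s.fuse s'.fuse mult.assoc
  \<comment> \<open>The outermost R-matrix has only diagonal and exchange entries, so
    \<open>q0 = r\<close> and \<open>q0 = i\<close> survive; if they coincide, \<open>exch\<close>
    is 0 and nothing is counted twice.\<close>
  have left: "(\<Sum>q0\<in>A. s (op_prod ?R (e # es) rs (q0 # q) (unitv l) i) * (ring_prod T (e # es) (q0 # q) cs * \<mu> l j)) =
      s (g e * ?d r i) * (T e r c * (s (op_prod ?R es rs' q (unitv l) i) * (ring_prod T es q cs' * \<mu> l j))) +
      s (g e * ?x r i) * (T e i c * (s (op_prod ?R es rs' q (unitv l) r) * (ring_prod T es q cs' * \<mu> l j)))" for q l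
  proof -
    have "(\<Sum>q0\<in>A. s (op_prod ?R (e # es) rs (q0 # q) (unitv l) i) * (ring_prod T (e # es) (q0 # q) cs * \<mu> l j)) =
      (\<Sum>q0\<in>A. (if q0 = r then s (g e * ?d r i) * (T e r c * (s (op_prod ?R es rs' q (unitv l) i) * (ring_prod T es q cs' * \<mu> l j))) else 0)
        + (if q0 = i then s (g e * ?x r i) * (T e i c * (s (op_prod ?R es rs' q (unitv l) r) * (ring_prod T es q cs' * \<mu> l j))) else 0))"
      by (intro sum.cong refl) (auto simp: r_op_def swaps xx)
    then show ?thesis
      using A mem by (simp add: sum.distrib)
  qed
  have right: "(\<Sum>q0\<in>A. \<Sum>l\<in>A. s' (op_prod ?R (e # es) (q0 # q) cs (unitv j) l) * (\<mu> i l * ring_prod T (e # es) rs (q0 # q))) =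
      (\<Sum>l\<in>A. s' (op_prod ?R es q cs' (unitv j) l) *
        (s' (g e * ?d c l) * (\<mu> i l * T e r c) + s' (g e * ?x l c) * (\<mu> i c * T e r l)) * ring_prod T es rs' q)" for q
  proof -
    have "(\<Sum>q0\<in>A. \<Sum>l\<in>A. s' (op_prod ?R (e # es) (q0 # q) cs (unitv j) l) * (\<mu> i l * ring_prod T (e # es) rs (q0 # q))) =
      (\<Sum>q0\<in>A. \<Sum>l\<in>A. (if q0 = c then s' (op_prod ?R es q cs' (unitv j) l) * (s' (g e * ?d c l) * (\<mu> i l * T e r c)) * ring_prod T es rs' q else 0)
        + (if l = c then s' (op_prod ?R es q cs' (unitv j) q0) * (s' (g e * ?x q0 c) * (\<mu> i c * T e r q0)) * ring_prod T es rs' q else 0))"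
      by (intro sum.cong refl) (auto simp: r_op_def swaps xx mult.commute[of "op_prod _ _ _ _ _ _"])
    also have "\<dots> = (\<Sum>q0\<in>A. \<Sum>l\<in>A. if q0 = c then s' (op_prod ?R es q cs' (unitv j) l) * (s' (g e * ?d c l) * (\<mu> i l * T e r c)) * ring_prod T es rs' q else 0)
        + (\<Sum>q0\<in>A. s' (op_prod ?R es q cs' (unitv j) q0) * (s' (g e * ?x q0 c) * (\<mu> i c * T e r q0)) * ring_prod T es rs' q)"
      using A mem by (simp add: sum.distrib)
    also have "(\<Sum>q0\<in>A. \<Sum>l\<in>A. if q0 = c then s' (op_prod ?R es q cs' (unitv j) l) * (s' (g e * ?d c l) * (\<mu> i l * T e r c)) * ring_prod T es rs' q else 0)
      = (\<Sum>l\<in>A. s' (op_prod ?R es q cs' (unitv j) l) * (s' (g e * ?d c l) * (\<mu> i l * T e r c)) * ring_prod T es rs' q)"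
      using A mem by (subst sum.swap) simp
    finally show ?thesis
      by (simp add: distrib_left distrib_right sum.distrib)
  qed
  have swap3: "(\<Sum>q0\<in>A. \<Sum>q\<in>?L. \<Sum>l\<in>A. f q0 q l) = (\<Sum>q\<in>?L. \<Sum>l\<in>A. \<Sum>q0\<in>A. f q0 q l)" for f :: "'i \<Rightarrow> 'i list \<Rightarrow> 'i \<Rightarrow> 'a"
    by (rule HOL.trans[OF sum.swap]) (intro sum.cong refl sum.swap)
  have "(\<Sum>q\<in>lists_on A (length (e # es)). \<Sum>l\<in>A. s (op_prod ?R (e # es) rs q (unitv l) i) * (ring_prod T (e # es) q cs * \<mu> l j))
      = (\<Sum>q\<in>?L. \<Sum>l\<in>A. \<Sum>q0\<in>A. s (op_prod ?R (e # es) rs (q0 # q) (unitv l) i) * (ring_prod T (e # es) (q0 # q) cs * \<mu> l j))"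
    unfolding list.size add_0_right add_Suc_right sum_lists_Suc[OF A] swap3 by simp
  also have "\<dots> = s (g e * ?d r i) * (T e r c * lhs i) + s (g e * ?x r i) * (T e i c * lhs r)"
    unfolding left lhs_def by (simp add: sum.distrib sum_distrib_left)
  also have "\<dots> = s (g e * ?d r i) * (T e r c * rhs i) + s (g e * ?x r i) * (T e i c * rhs r)"
    using IH mem by simp
  also have "\<dots> = (\<Sum>q\<in>?L. \<Sum>l\<in>A. s' (op_prod ?R es q cs' (unitv j) l) *
      (s (g e * ?d r i) * (T e r c * \<mu> i l) + s (g e * ?x r i) * (T e i c * \<mu> r l)) * ring_prod T es rs' q)"
    unfolding rhs_def
    by (simp add: sum_distrib_left sum.distrib distrib_left distrib_right mult.assoc s'.swap)
  also have "\<dots> = (\<Sum>q\<in>?L. \<Sum>l\<in>A. s' (op_prod ?R es q cs' (unitv j) l) *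
      (s' (g e * ?d c l) * (\<mu> i l * T e r c) + s' (g e * ?x l c) * (\<mu> i c * T e r l)) * ring_prod T es rs' q)"
    using Cons.prems(1)[of e] mem unfolding ortt_def by (intro sum.cong refl) simp
  also have "\<dots> = (\<Sum>q\<in>?L. \<Sum>q0\<in>A. \<Sum>l\<in>A. s' (op_prod ?R (e # es) (q0 # q) cs (unitv j) l) * (\<mu> i l * ring_prod T (e # es) rs (q0 # q)))"
    unfolding right ..
  also have "\<dots> = (\<Sum>q\<in>lists_on A (length (e # es)). \<Sum>l\<in>A. s' (op_prod ?R (e # es) q cs (unitv j) l) * (\<mu> i l * ring_prod T (e # es) rs q))"
    unfolding list.size add_0_right add_Suc_right sum_lists_Suc[OF A] by (rule sum.swap)
  finally show ?case .
qed

text \<open>The rows in \<open>intertwine\<close> are antisymmetrised. On the left this turns the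
  product of R-matrices into the scalar \<open>a\<close> and leaves \<open>D\<close>. On the right
  it first turns the product of the \<open>T e\<close> into a multiple of \<open>D\<close>, and the
  remaining weights turn the product of R-matrices into the same \<open>a\<close>.\<close>

theorem qdet_commute:
  fixes T :: "'e \<Rightarrow> 'i \<Rightarrow> 'i \<Rightarrow> 'a::ring_1" and p :: "'k::comm_ring_1"
  assumes s: "central_hom s" and s': "central_hom s'" and A: "finite A"
    and pp: "p * p' = 1" "s p' = s' p'"
    and es: "length es = card A" "es \<noteq> []"
    and z: "successively (\<lambda>e f. z f = z e * p * p) es"
    and anti: "successively (\<lambda>e f. antisym_ring s p' A (T e) (T f)) es"
    and T: "\<And>e. e \<in> set es \<Longrightarrow> ortt s s' A p p' (g e) (z e) w (T e) \<mu>"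
    and C0: "sorted_wrt (\<prec>) C0" "set C0 = A"
    and ij: "i \<in> A" "j \<in> A"
  defines "a \<equiv> g (last es) * (z (last es) * p - w * p') * (\<Prod>e\<leftarrow>butlast es. g e * (z e - w))"
    and "D \<equiv> ring_minor s p' A T es C0"
  shows "s a * (D * \<mu> i j) = s' a * (\<mu> i j * D)"
proof -
  interpret s: central_hom s by fact
  interpret s': central_hom s' by fact
  let ?R = "r_op p p' g z w" and ?L = "lists_on A (length es)"
  have lC: "length C0 = length es"
    using C0 es by (metis distinct_card sorted_distinct_list)
  have C0L: "C0 \<in> ?L"
    using C0 lC by (simp add: lists_on_def)
  have wt: "s' (wt p' q) = s (wt p' q)" for q
    using pp(2) by (simp add: wt_def s.power s'.power s.uminus s'.uminus)
  have alpha: "(\<Sum>rs\<in>?L. wt p' rs * op_prod ?R es rs q (unitv l) i) = (if l = i then wt p' q * a else 0)"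
    if "q \<in> ?L" "l \<in> A" for q l i
  proof -
    have "successively (\<lambda>e f. antisym_pair (\<lambda>k v l. k * v l) p' A (?R e) (?R f)) es"
      using z by (rule successively_mono) (rule r_op_antisym[OF pp(1)])
    from op_minor_normal_form[OF module_fun module_hom_r_op A es(1) this C0, of q]
    have "op_minor (\<lambda>k v l. k * v l) p' A ?R es q (unitv l) = (\<lambda>i. wt p' q * (a * unitv l i))"
      using that r_op_minor[OF A pp(1) es z C0 that(2), of g w] es by (simp add: a_def)
    then show ?thesis
      by (auto simp: op_minor_def sum_fun_apply fun_eq_iff mult.assoc unitv_def)
  qed
  have nf: "ring_minor s p' A T es q = s (wt p' q) * D" if "q \<in> ?L" for q
    unfolding D_def using ring_minor_normal_form[OF s A es(1) anti C0] that es by simp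
  have swap3: "(\<Sum>rs\<in>?L. \<Sum>q\<in>?L. \<Sum>l\<in>A. f rs q l) = (\<Sum>q\<in>?L. \<Sum>l\<in>A. \<Sum>rs\<in>?L. f rs q l)" for f :: "'i list \<Rightarrow> 'i list \<Rightarrow> 'i \<Rightarrow> 'a"
    by (rule HOL.trans[OF sum.swap]) (intro sum.cong refl sum.swap)
  have "(\<Sum>rs\<in>?L. s (wt p' rs) * (\<Sum>q\<in>?L. \<Sum>l\<in>A. s (op_prod ?R es rs q (unitv l) i) * (ring_prod T es q C0 * \<mu> l j)))
      = (\<Sum>q\<in>?L. \<Sum>l\<in>A. s (\<Sum>rs\<in>?L. wt p' rs * op_prod ?R es rs q (unitv l) i) * (ring_prod T es q C0 * \<mu> l j))"
    unfolding sum_distrib_left swap3 by (simp add: s.sum s.mult sum_distrib_right mult.assoc)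
  also have "\<dots> = (\<Sum>q\<in>?L. \<Sum>l\<in>A. if l = i then s (wt p' q * a) * (ring_prod T es q C0 * \<mu> i j) else 0)"
    by (intro sum.cong refl) (auto simp: alpha)
  also have "\<dots> = s a * (D * \<mu> i j)"
    using A ij by (simp add: D_def ring_minor_def sum_distrib_left sum_distrib_right s.fuse
        mult.commute[of a] mult.assoc)
  finally have 1: "(\<Sum>rs\<in>?L. s (wt p' rs) * (\<Sum>q\<in>?L. \<Sum>l\<in>A. s (op_prod ?R es rs q (unitv l) i) * (ring_prod T es q C0 * \<mu> l j)))
      = s a * (D * \<mu> i j)" .
  have "(\<Sum>rs\<in>?L. s (wt p' rs) * (\<Sum>q\<in>?L. \<Sum>l\<in>A. s' (op_prod ?R es q C0 (unitv j) l) * (\<mu> i l * ring_prod T es rs q)))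
      = (\<Sum>q\<in>?L. \<Sum>l\<in>A. s' (op_prod ?R es q C0 (unitv j) l) * (\<mu> i l * ring_minor s p' A T es q))"
    unfolding sum_distrib_left swap3 ring_minor_def by (simp add: s.swap sum_distrib_left)
  also have "\<dots> = (\<Sum>q\<in>?L. \<Sum>l\<in>A. s' (wt p' q * op_prod ?R es q C0 (unitv j) l) * (\<mu> i l * D))"
    by (intro sum.cong refl) (simp add: nf s'.swap[where x = "\<mu> _ _"] s'.fuse mult.commute[of "wt _ _"] flip: wt)
  also have "\<dots> = (\<Sum>l\<in>A. s' (\<Sum>q\<in>?L. wt p' q * op_prod ?R es q C0 (unitv j) l) * (\<mu> i l * D))"
    by (subst sum.swap) (simp add: s'.sum sum_distrib_right)
  also have "\<dots> = (\<Sum>l\<in>A. if l = j then s' a * (\<mu> i j * D) else 0)"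
    using C0(1) C0L ij by (intro sum.cong refl) (auto simp: alpha wt_sorted)
  also have "\<dots> = s' a * (\<mu> i j * D)"
    using A ij by simp
  finally have 2: "(\<Sum>rs\<in>?L. s (wt p' rs) * (\<Sum>q\<in>?L. \<Sum>l\<in>A. s' (op_prod ?R es q C0 (unitv j) l) * (\<mu> i l * ring_prod T es rs q)))
      = s' a * (\<mu> i j * D)" .
  have "(\<Sum>rs\<in>?L. s (wt p' rs) * (\<Sum>q\<in>?L. \<Sum>l\<in>A. s (op_prod ?R es rs q (unitv l) i) * (ring_prod T es q C0 * \<mu> l j))) =
    (\<Sum>rs\<in>?L. s (wt p' rs) * (\<Sum>q\<in>?L. \<Sum>l\<in>A. s' (op_prod ?R es q C0 (unitv j) l) * (\<mu> i l * ring_prod T es rs q)))"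
    using C0 lC ij by (intro sum.cong refl arg_cong2[where f = "(*)"] intertwine[OF s s' A T])
      (auto simp: lists_on_def)
  then show ?thesis
    using 1 2 by simp
qed

end

section \<open>Opposite rings\<close>

text \<open>A separate type, so that every result about rings applies verbatim to the reversed
  multiplication.\<close>

datatype 'a opp = Opp (unopp: 'a)

instantiation opp :: (ring_1) ring_1
begin

definition "0 = Opp 0"
definition "1 = Opp 1"
definition "x + y = Opp (unopp x + unopp y)"
definition "x - y = Opp (unopp x - unopp y)"
definition "- x = Opp (- unopp x)"
definition "x * y = Opp (unopp y * unopp x)"

instance
  by standard
    (auto simp: zero_opp_def one_opp_def plus_opp_def minus_opp_def uminus_opp_def times_opp_def
      algebra_simps)

end

lemma unopp_simps [simp]:
  "unopp 0 = 0" "unopp 1 = 1" "unopp (x + y) = unopp x + unopp y"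
  "unopp (x - y) = unopp x - unopp y" "unopp (- x) = - unopp x" "unopp (x * y) = unopp y * unopp x"
  by (simp_all add: zero_opp_def one_opp_def plus_opp_def minus_opp_def uminus_opp_def times_opp_def)

lemma opp_eq_iff: "x = y \<longleftrightarrow> unopp x = unopp y"
  by (metis opp.collapse)

lemma unopp_sum: "unopp (\<Sum>x\<in>A. f x) = (\<Sum>x\<in>A. unopp (f x))"
  by (induction A rule: infinite_finite_induct) auto

lemma central_hom_opp:
  assumes "central_hom s"
  shows "central_hom (\<lambda>k. Opp (s k))"
proof -
  interpret central_hom s by fact
  show ?thesis
  proof
    show "Opp (s (a * b)) = Opp (s a) * Opp (s b)" for a b
      by (simp add: opp_eq_iff mult.commute[of a] mult)
    show "Opp (s a) * x = x * Opp (s a)" for a x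
      using central[of a "unopp x"] by (simp add: opp_eq_iff)
  qed (simp_all add: opp_eq_iff add)
qed

section \<open>Reversing the order of the arguments\<close>

lemma index_order_flip: "index_order lt \<Longrightarrow> index_order (\<lambda>x y. lt y x)"
  unfolding index_order_def by blast

context index_order
begin

text \<open>Antisymmetrised over rows and columns. Transposition exchanges the two, so this
  expression, unlike \<open>ring_minor\<close>, can be compared with its analogue in the opposite
  ring.\<close>

definition sandwich ::
  "('k::comm_ring_1 \<Rightarrow> 'a::ring_1) \<Rightarrow> 'k \<Rightarrow> 'i set \<Rightarrow> ('e \<Rightarrow> 'i \<Rightarrow> 'i \<Rightarrow> 'a) \<Rightarrow> 'e list \<Rightarrow> 'a" where
  "sandwich s t A T es = (\<Sum>rs\<in>lists_on A (length es). \<Sum>cs\<in>lists_on A (length es).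
     s (wt t rs * wt t cs) * ring_prod T es rs cs)"

text \<open>For two factors and a two-element index set this is \<open>sandwich\<close>.\<close>

definition mixed_minor ::
  "('k::comm_ring_1 \<Rightarrow> 'a::ring_1) \<Rightarrow> 'k \<Rightarrow> ('i \<Rightarrow> 'i \<Rightarrow> 'a) \<Rightarrow> ('i \<Rightarrow> 'i \<Rightarrow> 'a) \<Rightarrow> 'i \<Rightarrow> 'i \<Rightarrow> 'i \<Rightarrow> 'i \<Rightarrow> 'a" where
  "mixed_minor s t X Y r q c d = X r c * Y q d - s t * (X q c * Y r d) - s t * (X r d * Y q c)
     + s (t * t) * (X q d * Y r c)"

definition sym_pair :: "('k::comm_ring_1 \<Rightarrow> 'a::ring_1) \<Rightarrow> 'k \<Rightarrow> 'i set \<Rightarrow> ('i \<Rightarrow> 'i \<Rightarrow> 'a) \<Rightarrow> ('i \<Rightarrow> 'i \<Rightarrow> 'a) \<Rightarrow> bool" where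
  "sym_pair s t A X Y \<longleftrightarrow> (\<forall>r\<in>A. \<forall>q\<in>A. \<forall>c\<in>A. \<forall>d\<in>A. r \<prec> q \<longrightarrow> c \<prec> d \<longrightarrow>
     mixed_minor s t X Y r q c d = mixed_minor s t Y X r q c d)"

text \<open>R acts on q-antisymmetric tensors by the scalar \<open>p * w - p' * z\<close>.
  Antisymmetrising the RTT relation on both sides and dividing by this scalar exchanges the two
  matrices.\<close>

lemma ortt_sym_pair:
  assumes s: "central_hom s" and pp: "p * p' = 1" and u: "u * (p * w - p' * z) = 1"
    and XY: "ortt s s A p p' 1 z w X Y"
  shows "sym_pair s p' A X Y"
  unfolding sym_pair_def
proof (intro ballI impI)
  interpret central_hom s by fact
  fix r q c d assume *: "r \<in> A" "q \<in> A" "c \<in> A" "d \<in> A" "r \<prec> q" "c \<prec> d"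
  then have n: "r \<noteq> q" "c \<noteq> d" "\<not> q \<prec> r" "\<not> d \<prec> c"
    using irrefl asym by auto
  have E: "s (a * diag p p' z w i k) * (X i m * Y k n) + s (a * exch p p' z w i k) * (X k m * Y i n) =
     s (a * diag p p' z w m n) * (Y k n * X i m) + s (a * exch p p' z w n m) * (Y k m * X i n)"
    if "i \<in> A" "m \<in> A" "k \<in> A" "n \<in> A" for i m k n a
  proof -
    have "s a * (s (diag p p' z w i k) * (X i m * Y k n) + s (exch p p' z w i k) * (X k m * Y i n)) =
      s a * (s (diag p p' z w m n) * (Y k n * X i m) + s (exch p p' z w n m) * (Y k m * X i n))"
      using XY that unfolding ortt_def by simp
    then show ?thesis
      by (simp add: distrib_left fuse)
  qed
  define \<rho> where "\<rho> = p * w - p' * z"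
  have p1: "p * (p' * x) = x" for x
    using pp by (metis mult.assoc mult_1)
  have k: "(p - p') * w + - p' * (z - w) = \<rho>" "- p' * ((p - p') * z) + (z - w) = - p' * \<rho>"
    "p' * p' * (z - w) + - p' * ((p - p') * w) = - p' * \<rho>"
    "p' * p' * ((p - p') * z) + - p' * (z - w) = p' * p' * \<rho>"
    by (simp_all add: \<rho>_def algebra_simps p1)
  let ?X = "s ((p - p') * w + - p' * (z - w)) * (X r c * Y q d) + s (- p' * ((p - p') * z) + (z - w)) * (X q c * Y r d)
    + s (p' * p' * (z - w) + - p' * ((p - p') * w)) * (X r d * Y q c) + s (p' * p' * ((p - p') * z) + - p' * (z - w)) * (X q d * Y r c)"
  let ?Y = "s ((p - p') * w + - p' * (z - w)) * (Y r c * X q d) + s (p' * p' * (z - w) + - p' * ((p - p') * w)) * (Y q c * X r d)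
    + s (- p' * ((p - p') * z) + (z - w)) * (Y r d * X q c) + s (p' * p' * ((p - p') * z) + - p' * (z - w)) * (Y q d * X r c)"
  \<comment> \<open>The multipliers of the four relations are the q-signs of the order of columns
    times those of the reversed order of rows, reversed because R exchanges the rows.\<close>
  have 1: "s (- p' * (z - w)) * (X r c * Y q d) + s (- p' * ((p - p') * z)) * (X q c * Y r d) =
      s (- p' * (z - w)) * (Y q d * X r c) + s (- p' * ((p - p') * w)) * (Y q c * X r d)"
    using E[of r c q d "- p'"] * n by (simp add: diag_def exch_def)
  have 2: "s (p' * p' * (z - w)) * (X r d * Y q c) + s (p' * p' * ((p - p') * z)) * (X q d * Y r c) =
      s (p' * p' * (z - w)) * (Y q c * X r d) + s (p' * p' * ((p - p') * z)) * (Y q d * X r c)"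
    using E[of r d q c "p' * p'"] * n by (simp add: diag_def exch_def)
  have 3: "s (z - w) * (X q c * Y r d) + s ((p - p') * w) * (X r c * Y q d) =
      s (z - w) * (Y r d * X q c) + s ((p - p') * w) * (Y r c * X q d)"
    using E[of q c r d 1] * n by (simp add: diag_def exch_def)
  have 4: "s (- p' * (z - w)) * (X q d * Y r c) + s (- p' * ((p - p') * w)) * (X r d * Y q c) =
      s (- p' * (z - w)) * (Y r c * X q d) + s (- p' * ((p - p') * z)) * (Y r d * X q c)"
    using E[of q d r c "- p'"] * n by (simp add: diag_def exch_def)
  have "?X = ?Y"
    using arg_cong2[of _ _ _ _ "(+)", OF arg_cong2[of _ _ _ _ "(+)", OF 1 2] arg_cong2[of _ _ _ _ "(+)", OF 3 4]]
    unfolding add distrib_right by (simp only: add_ac)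
  then have "s \<rho> * mixed_minor s p' X Y r q c d = s \<rho> * mixed_minor s p' Y X r q c d"
    unfolding k
    by (simp add: mixed_minor_def distrib_left right_diff_distrib fuse uminus mult.commute[of \<rho>])
  then have "s (u * \<rho>) * mixed_minor s p' X Y r q c d = s (u * \<rho>) * mixed_minor s p' Y X r q c d"
    by (simp add: mult mult.assoc)
  then show "mixed_minor s p' X Y r q c d = mixed_minor s p' Y X r q c d"
    using u by (simp add: \<rho>_def)
qed

lemma ring_minor_pairs:
  assumes s: "central_hom s" and A: "finite A"
    and len: "length cs1 = length es1" "length cs2 = length es2"
  shows "ring_minor s t A T (es1 @ e # f # es2) (cs1 @ c # d # cs2) -
      s t * ring_minor s t A T (es1 @ e # f # es2) (cs1 @ d # c # cs2) =
    (\<Sum>ys\<in>lists_on A (length es1). \<Sum>zs\<in>lists_on A (length es2). \<Sum>(r, q)\<in>{(r, q)\<in>A \<times> A. r \<prec> q}.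
       s (wt t (ys @ r # q # zs)) *
         (ring_prod T es1 ys cs1 * mixed_minor s t (T e) (T f) r q c d * ring_prod T es2 zs cs2))"
proof -
  interpret central_hom s by fact
  have *: "ring_minor s t A T (es1 @ e # f # es2) (cs1 @ c # d # cs2) =
    (\<Sum>ys\<in>lists_on A (length es1). \<Sum>zs\<in>lists_on A (length es2). \<Sum>(r, q)\<in>{(r, q)\<in>A \<times> A. r \<prec> q}.
       s (wt t (ys @ r # q # zs)) * (ring_prod T es1 ys cs1 *
         ((T e r c * T f q d - s t * (T e q c * T f r d)) * ring_prod T es2 zs cs2)))" for c d
    using op_minor_pairs[OF module module_hom A len, of t T e f c d 1]
    by (simp add: op_minor_ring op_prod_ring left_diff_distrib mult.assoc)
  show ?thesis
    unfolding * sum_distrib_left sum_subtractf[symmetric]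
  proof (intro sum.cong refl, clarify)
    fix ys zs r q
    let ?w = "wt t (ys @ r # q # zs)" and ?P = "ring_prod T es1 ys cs1" and ?Q = "ring_prod T es2 zs cs2"
    have move: "s t * (s ?w * (?P * (Y * ?Q))) = s ?w * (?P * ((s t * Y) * ?Q))" for Y
      by (simp only: mult.assoc swap[where x = ?P] fuse mult.commute[of t])
    have "mixed_minor s t (T e) (T f) r q c d =
        (T e r c * T f q d - s t * (T e q c * T f r d)) - s t * (T e r d * T f q c - s t * (T e q d * T f r c))"
      by (simp add: mixed_minor_def right_diff_distrib fuse)
    then show "s ?w * (?P * ((T e r c * T f q d - s t * (T e q c * T f r d)) * ?Q)) -
        s t * (s ?w * (?P * ((T e r d * T f q c - s t * (T e q d * T f r c)) * ?Q))) =
      s ?w * (?P * mixed_minor s t (T e) (T f) r q c d * ?Q)"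
      unfolding move by (simp only: left_diff_distrib right_diff_distrib mult.assoc)
  qed
qed

lemma sandwich_pairs:
  assumes s: "central_hom s" and A: "finite A"
  shows "sandwich s t A T (es1 @ e # f # es2) =
    (\<Sum>ys\<in>lists_on A (length es1). \<Sum>zs\<in>lists_on A (length es2). \<Sum>(c, d)\<in>{(c, d)\<in>A \<times> A. c \<prec> d}.
       s (wt t (ys @ c # d # zs)) * (ring_minor s t A T (es1 @ e # f # es2) (ys @ c # d # zs) -
         s t * ring_minor s t A T (es1 @ e # f # es2) (ys @ d # c # zs)))"
proof -
  interpret central_hom s by fact
  let ?es = "es1 @ e # f # es2"
  have "sandwich s t A T ?es = (\<Sum>cs\<in>lists_on A (length es1 + Suc (Suc (length es2))).
      s (wt t cs) * ring_minor s t A T ?es cs)"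
    unfolding sandwich_def ring_minor_def
    by (subst sum.swap) (simp add: sum_distrib_left fuse mult.commute)
  also have "\<dots> = (\<Sum>ys\<in>lists_on A (length es1). \<Sum>zs\<in>lists_on A (length es2). \<Sum>c\<in>A. \<Sum>d\<in>A.
      s (wt t (ys @ c # d # zs)) * ring_minor s t A T ?es (ys @ c # d # zs))"
    by (rule sum_lists_split_pair[OF A])
  also have "\<dots> = (\<Sum>ys\<in>lists_on A (length es1). \<Sum>zs\<in>lists_on A (length es2). \<Sum>(c, d)\<in>{(c, d)\<in>A \<times> A. c \<prec> d}.
       s (wt t (ys @ c # d # zs)) * (ring_minor s t A T ?es (ys @ c # d # zs) -
         s t * ring_minor s t A T ?es (ys @ d # c # zs)))"
    by (intro sum.cong refl, subst sum_pairs[OF A], simp add: wt_repeat, intro sum.cong refl, clarify)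
      (simp add: wt_swap right_diff_distrib fuse uminus mult.commute)
  finally show ?thesis .
qed

text \<open>Two neighbouring factors enter the doubly antisymmetrised product only through
  \<open>mixed_minor\<close>, which is symmetric in them.\<close>

lemma sandwich_swap:
  assumes s: "central_hom s" and A: "finite A" and sym: "sym_pair s t A (T e) (T f)"
  shows "sandwich s t A T (es1 @ e # f # es2) = sandwich s t A T (es1 @ f # e # es2)"
  unfolding sandwich_pairs[OF s A]
proof (intro sum.cong refl, clarify)
  fix ys zs c d
  assume *: "ys \<in> lists_on A (length es1)" "zs \<in> lists_on A (length es2)" "c \<in> A" "d \<in> A" "c \<prec> d"
  then have len: "length ys = length es1" "length zs = length es2"
    by (auto simp: lists_on_def)
  show "s (wt t (ys @ c # d # zs)) * (ring_minor s t A T (es1 @ e # f # es2) (ys @ c # d # zs) -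
         s t * ring_minor s t A T (es1 @ e # f # es2) (ys @ d # c # zs)) =
    s (wt t (ys @ c # d # zs)) * (ring_minor s t A T (es1 @ f # e # es2) (ys @ c # d # zs) -
         s t * ring_minor s t A T (es1 @ f # e # es2) (ys @ d # c # zs))"
    unfolding ring_minor_pairs[OF s A len] using sym *
    by (intro sum.cong refl arg_cong2[where f = "(*)"]) (auto simp: sym_pair_def)
qed

lemma sandwich_move:
  assumes s: "central_hom s" and A: "finite A" and "\<forall>f\<in>set fs. sym_pair s t A (T e) (T f)"
  shows "sandwich s t A T (es1 @ e # fs @ es2) = sandwich s t A T (es1 @ fs @ e # es2)"
  using assms(3)
proof (induction fs arbitrary: es1)
  case (Cons f fs)
  have "sandwich s t A T (es1 @ e # f # fs @ es2) = sandwich s t A T (es1 @ f # e # fs @ es2)"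
    using Cons.prems by (intro sandwich_swap[OF s A]) auto
  also have "\<dots> = sandwich s t A T ((es1 @ [f]) @ fs @ e # es2)"
    using Cons.IH[of "es1 @ [f]"] Cons.prems by simp
  finally show ?case by simp
qed simp

lemma sandwich_rev:
  assumes s: "central_hom s" and A: "finite A"
    and "sorted_wrt (\<lambda>e f. sym_pair s t A (T e) (T f)) es"
  shows "sandwich s t A T (es1 @ es) = sandwich s t A T (es1 @ rev es)"
  using assms(3)
proof (induction es arbitrary: es1)
  case (Cons e es)
  have "sandwich s t A T (es1 @ e # es) = sandwich s t A T (es1 @ e # rev es)"
    using Cons.IH[of "es1 @ [e]"] Cons.prems by simp
  also have "\<dots> = sandwich s t A T (es1 @ rev es @ [e])"
    using sandwich_move[OF s A, of "rev es" t T e es1 "[]"] Cons.prems by simp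
  finally show ?case by simp
qed simp

lemma inversions_rev: "inversions (rev xs) = index_order.inversions (\<lambda>x y. y \<prec> x) xs"
proof -
  interpret rv: index_order "\<lambda>x y. y \<prec> x"
    by (rule index_order_flip) unfold_locales
  have snoc: "inversions (xs @ [x]) = inversions xs + length (filter (\<lambda>y. x \<prec> y) xs)" for xs x
    by (induction xs) auto
  show ?thesis
  proof (induction xs)
    case (Cons x xs)
    have "length (filter (\<lambda>y. x \<prec> y) (rev xs)) = length (filter (\<lambda>y. x \<prec> y) xs)"
      by (simp only: rev_filter[symmetric] length_rev)
    then show ?case
      using Cons by (simp add: snoc)
  qed simp
qed

lemma wt_rev: "wt t (rev xs) = index_order.wt (\<lambda>x y. y \<prec> x) t xs"
proof -
  interpret rv: index_order "\<lambda>x y. y \<prec> x"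
    by (rule index_order_flip) unfold_locales
  show ?thesis
    by (simp add: wt_def rv.wt_def inversions_rev)
qed

lemma ring_prod_opp:
  "length rs = length es \<Longrightarrow> length cs = length es \<Longrightarrow>
    unopp (ring_prod (\<lambda>e i j. Opp (T e j i)) es cs rs) = ring_prod T (rev es) (rev rs) (rev cs)"
proof (induction es arbitrary: rs cs)
  case (Cons e es)
  then show ?case
    by (cases rs; cases cs) (auto simp: ring_prod_append)
qed auto

lemma bij_rev_lists: "bij_betw rev (lists_on A n) (lists_on A n)"
  by (rule bij_betwI[where g = rev]) (auto simp: lists_on_def)

text \<open>The columns are already antisymmetric, so the second antisymmetrisation only multiplies
  by the sum of squared weights, a quantum factorial.\<close>

lemma sandwich_normal_form:
  assumes s: "central_hom s" and A: "finite A"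
    and es: "length es = card A" "successively (\<lambda>e f. antisym_ring s t A (T e) (T f)) es"
    and C0: "sorted_wrt (\<prec>) C0" "set C0 = A"
  shows "sandwich s t A T es = s (\<Sum>cs\<in>lists_on A (card A). wt t cs * wt t cs) * ring_minor s t A T es C0"
proof -
  interpret central_hom s by fact
  have "sandwich s t A T es = (\<Sum>cs\<in>lists_on A (card A). s (wt t cs) * ring_minor s t A T es cs)"
    unfolding sandwich_def ring_minor_def es(1)
    by (subst sum.swap) (simp add: sum_distrib_left fuse mult.commute)
  also have "\<dots> = (\<Sum>cs\<in>lists_on A (card A). s (wt t cs * wt t cs) * ring_minor s t A T es C0)"
    using ring_minor_normal_form[OF s A es C0] by (intro sum.cong refl) (simp add: fuse)
  finally show ?thesis
    by (simp add: sum sum_distrib_right)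
qed

text \<open>The opposite ring reverses the factors, and transposition turns antisymmetrised rows
  into antisymmetrised columns. Both minors are multiples of \<open>sandwich\<close>, whose
  arguments may be reversed, by the same quantum factorial.\<close>

theorem ring_minor_opp:
  fixes T :: "'e \<Rightarrow> 'i \<Rightarrow> 'i \<Rightarrow> 'a::ring_1"
  assumes s: "central_hom s" and A: "finite A"
    and es: "length es = card A" "successively (\<lambda>e f. antisym_ring s t A (T e) (T f)) es"
    and es': "successively (\<lambda>e f. index_order.antisym_ring (\<lambda>x y. y \<prec> x) (\<lambda>k. Opp (s k)) t A
      (\<lambda>i j. Opp (T e j i)) (\<lambda>i j. Opp (T f j i))) es"
    and sym: "sorted_wrt (\<lambda>e f. sym_pair s t A (T e) (T f)) es"
    and C0: "sorted_wrt (\<prec>) C0" "set C0 = A"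
    and u: "u * (\<Sum>cs\<in>lists_on A (card A). wt t cs * wt t cs) = 1"
  shows "unopp (index_order.ring_minor (\<lambda>x y. y \<prec> x) (\<lambda>k. Opp (s k)) t A (\<lambda>e i j. Opp (T e j i)) es (rev C0))
    = ring_minor s t A T es C0"
proof -
  interpret central_hom s by fact
  interpret rv: index_order "\<lambda>x y. y \<prec> x"
    by (rule index_order_flip) unfold_locales
  let ?T = "\<lambda>e i j. Opp (T e j i)" and ?s = "\<lambda>k. Opp (s k)" and ?L = "lists_on A (length es)"
  let ?n = "\<Sum>cs\<in>lists_on A (card A). wt t cs * wt t cs"
  have "unopp (rv.sandwich ?s t A ?T es) = (\<Sum>cs\<in>?L. \<Sum>rs\<in>?L. s (wt t (rev cs) * wt t (rev rs)) *
      ring_prod T (rev es) (rev rs) (rev cs))"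
    by (auto simp: rv.sandwich_def unopp_sum wt_rev ring_prod_opp central[where x = "ring_prod _ _ _ _", symmetric]
        lists_on_def intro!: sum.cong)
  also have "\<dots> = (\<Sum>cs\<in>?L. \<Sum>rs\<in>?L. s (wt t cs * wt t rs) * ring_prod T (rev es) rs cs)"
    by (subst sum.reindex_bij_betw[OF bij_rev_lists, symmetric],
        subst (2) sum.reindex_bij_betw[OF bij_rev_lists, symmetric]) simp
  also have "\<dots> = sandwich s t A T (rev es)"
    unfolding sandwich_def by (subst sum.swap) (simp add: mult.commute)
  also have "\<dots> = sandwich s t A T es"
    using sandwich_rev[OF s A sym, of "[]"] by simp
  finally have 1: "unopp (rv.sandwich ?s t A ?T es) = sandwich s t A T es" .
  have n: "(\<Sum>cs\<in>lists_on A (card A). rv.wt t cs * rv.wt t cs) = ?n"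
    by (subst (2) sum.reindex_bij_betw[OF bij_rev_lists, symmetric]) (simp add: wt_rev)
  have "rv.sandwich ?s t A ?T es = ?s ?n * rv.ring_minor ?s t A ?T es (rev C0)"
    using rv.sandwich_normal_form[OF central_hom_opp[OF s] A es(1) es', of "rev C0"] C0
    by (simp add: n sorted_wrt_rev)
  then have "s ?n * unopp (rv.ring_minor ?s t A ?T es (rev C0)) = s ?n * ring_minor s t A T es C0"
    using 1 sandwich_normal_form[OF s A es C0]
    by (simp add: central[where x = "unopp (rv.ring_minor _ _ _ _ _ _)", symmetric])
  then have "s (u * ?n) * unopp (rv.ring_minor ?s t A ?T es (rev C0)) = s (u * ?n) * ring_minor s t A T es C0"
    by (simp add: mult mult.assoc)
  then show ?thesis
    by (simp add: u)
qed

end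

section \<open>Moving matrix entries through the two factors D and E\<close>

section \<open>Commutation of the Berezinian with the even rows\<close>

text \<open>The scalars are collected without being cancelled, since \<open>s\<close> and
  \<open>s'\<close> may differ on them.\<close>

lemma pass_left:
  fixes T :: "'e \<Rightarrow> 'i \<Rightarrow> 'i \<Rightarrow> 'a::ring_1"
  assumes s: "central_hom s" and s': "central_hom s'"
    and T: "\<And>e r c. e \<in> set es \<Longrightarrow> r \<in> set rs \<Longrightarrow> c \<in> set cs \<Longrightarrow> s (x e) * (k * T e r c) = s' (x e) * (T e r c * k)"
    and len: "length rs = length es" "length cs = length es"
  shows "s (\<Prod>e\<leftarrow>es. x e) * (k * ring_prod T es rs cs) = s' (\<Prod>e\<leftarrow>es. x e) * (ring_prod T es rs cs * k)"
  using T len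
proof (induction es arbitrary: rs cs)
  case Nil
  interpret s: central_hom s by fact
  interpret s': central_hom s' by fact
  show ?case by simp
next
  case (Cons e es)
  interpret s: central_hom s by fact
  interpret s': central_hom s' by fact
  obtain r rs' c cs' where [simp]: "rs = r # rs'" "cs = c # cs'"
    using Cons.prems by (metis length_Suc_conv)
  let ?P = "ring_prod T es rs' cs'" and ?X = "\<Prod>e\<leftarrow>es. x e"
  have IH: "s ?X * (k * ?P) = s' ?X * (?P * k)"
    using Cons.prems by (intro Cons.IH) auto
  have "s (x e * ?X) * (k * (T e r c * ?P)) = s ?X * ((s (x e) * (k * T e r c)) * ?P)"
    by (simp add: s.fuse mult.assoc mult.commute[of ?X])
  also have "\<dots> = s' (x e) * (T e r c * (s ?X * (k * ?P)))"
    using Cons.prems(1)[of e r c] by (simp add: mult.assoc s.swap[where x = "s' _"] s.swap[where x = "T _ _ _"])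
  also have "\<dots> = s' (x e * ?X) * (T e r c * ?P * k)"
    unfolding IH by (simp add: mult.assoc s'.swap[where x = "T _ _ _"] s'.fuse)
  finally show ?case
    by simp
qed

lemma pass_right:
  fixes T :: "'e \<Rightarrow> 'i \<Rightarrow> 'i \<Rightarrow> 'a::ring_1"
  assumes s: "central_hom s" and s': "central_hom s'"
    and T: "\<And>e r c. e \<in> set es \<Longrightarrow> r \<in> set rs \<Longrightarrow> c \<in> set cs \<Longrightarrow> s (x e) * (T e r c * k) = s' (x e) * (k * T e r c)"
    and len: "length rs = length es" "length cs = length es"
  shows "s (\<Prod>e\<leftarrow>es. x e) * (ring_prod T es rs cs * k) = s' (\<Prod>e\<leftarrow>es. x e) * (k * ring_prod T es rs cs)"
  by (rule pass_left[OF s' s, symmetric]) (simp_all only: T len)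

text \<open>Here \<open>lam e\<close> and \<open>mu\<close> are the matrices \<open>L(z q\<^sup>e)\<close> and \<open>L(w)\<close>, and \<open>kk e\<close> and \<open>ka\<close> are their
  inverses; \<open>ds\<close> and \<open>js\<close> list the shifts in the two factors of the Berezinian.\<close>

locale half_berezinian = index_order lt
  for lt :: "'i \<Rightarrow> 'i \<Rightarrow> bool" (infix "\<prec>" 50) +
  fixes s s' :: "'k::comm_ring_1 \<Rightarrow> 'a::ring_1" and I J :: "'i set" and p p' :: 'k
    and lam kk :: "'e \<Rightarrow> 'i \<Rightarrow> 'i \<Rightarrow> 'a" and mu ka ka' :: "'i \<Rightarrow> 'i \<Rightarrow> 'a"
    and g h z :: "'e \<Rightarrow> 'k" and w :: 'k and ds js :: "'e list" and C0 C1 :: "'i list"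
  assumes s: "central_hom s" and s': "central_hom s'"
    and fin: "finite I" "finite J" and disj: "I \<inter> J = {}"
    and len: "length ds = card I" "length js = card J"
    and pp: "p * p' = 1" and sp: "s p' = s' p'"
    and D_antisym: "successively (\<lambda>e f. antisym_ring s p' I (lam e) (lam f)) ds"
    and E_antisym: "successively (\<lambda>e f. index_order.antisym_ring (\<lambda>x y. y \<prec> x) s p J
      (\<lambda>b r. kk e r b) (\<lambda>b r. kk f r b)) js"
    and zs: "successively (\<lambda>e f. z f = z e * p * p) ds"
    and lam_mu: "e \<in> set ds \<Longrightarrow> ortt s s' I p p' (g e) (z e) w (lam e) mu"
    and ka_lam: "e \<in> set ds \<Longrightarrow> i \<in> I \<Longrightarrow> c \<in> I \<Longrightarrow> r \<in> I \<union> J \<Longrightarrow> b \<in> J \<Longrightarrow>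
      s (g e * (z e - w)) * (ka r b * lam e i c) =
      s' (g e * diag p p' (z e) w c r) * (lam e i c * ka r b) +
      (if r = c then \<Sum>n\<in>I \<union> J - {c}. s' (g e * exch p p' (z e) w n c) * (lam e i n * ka n b) else 0)"
    and kk_mu: "e \<in> set js \<Longrightarrow> i \<in> I \<Longrightarrow> c \<in> I \<union> J \<Longrightarrow> r \<in> J \<Longrightarrow> b \<in> J \<Longrightarrow> r \<noteq> c \<Longrightarrow>
      s (h e * (w - z e)) * (kk e r b * mu i c) = s' (h e * (w - z e)) * (mu i c * kk e r b)"
    and kk_mu_diag: "e \<in> set js \<Longrightarrow> i \<in> I \<Longrightarrow> r \<in> J \<Longrightarrow> b \<in> J \<Longrightarrow>
      s (h e * (w - z e)) * (kk e r b * mu i r) =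
      - (s' (h e * (z e * p - w * p')) * (mu i r * kk e r b) +
         (\<Sum>n\<in>I \<union> J - {r}. s' (h e * exch p p' w (z e) n r) * (mu i n * kk e n b)))"
    and mu_ka: "i \<in> I \<Longrightarrow> b \<in> J \<Longrightarrow> (\<Sum>n\<in>I \<union> J. mu i n * ka n b) = 0"
    and lam_kk: "e \<in> set ds \<Longrightarrow> i \<in> I \<Longrightarrow> b \<in> J \<Longrightarrow> (\<Sum>n\<in>I \<union> J. lam e i n * kk e n b) = 0"
    and ka_inv: "a \<in> J \<Longrightarrow> c \<in> J \<Longrightarrow> (\<Sum>b\<in>J. ka a b * ka' b c) = (if a = c then 1 else 0)"
    and link: "ds \<noteq> [] \<Longrightarrow> js \<noteq> [] \<Longrightarrow> last ds = hd js"
    and C0: "sorted_wrt (\<prec>) C0" "set C0 = I" and C1: "sorted_wrt (\<lambda>x y. y \<prec> x) C1" "set C1 = J"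
begin

sublocale s: central_hom s by (rule s)
sublocale s': central_hom s' by (rule s')

sublocale rv: index_order "\<lambda>x y. y \<prec> x"
  by (rule index_order_flip) unfold_locales

definition D :: 'a where "D = ring_minor s p' I lam ds C0"
definition E :: 'a where "E = rv.ring_minor s p J (\<lambda>e b r. kk e r b) js C1"

text \<open>A fixed enumeration of the remaining indices; the q-sign that it causes is divided out
  in \<open>ND\<close> and \<open>NE\<close>.\<close>

definition rest :: "'i set \<Rightarrow> 'i \<Rightarrow> 'i list" where
  "rest A j = (SOME xs. set xs = A - {j} \<and> distinct xs)"

lemma rest: "finite A \<Longrightarrow> set (rest A j) = A - {j} \<and> distinct (rest A j)"
  unfolding rest_def by (rule someI_ex) (use finite_distinct_list[of "A - {j}"] in auto)

lemma length_rest: "finite A \<Longrightarrow> j \<in> A \<Longrightarrow> length (rest A j) = card A - 1"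
  using rest[of A j] by (metis card_Diff_singleton distinct_card)

definition x :: "'e \<Rightarrow> 'k" where "x e = g e * (z e - w)"
definition y :: "'e \<Rightarrow> 'k" where "y e = h e * (w - z e)"
text \<open>The scalar collected on the way through D and E. The diagonal factor with
  \<open>z * p - w * p'\<close> occurs once, at the last argument of D; the value 1 covers an empty
  D.\<close>

definition \<Gamma> :: 'k where
  "\<Gamma> = (if ds = [] then 1 else g (last ds) * (z (last ds) * p - w * p') * (\<Prod>e\<leftarrow>butlast ds. x e)) * (\<Prod>e\<leftarrow>js. y e)"

definition nu :: "'i \<Rightarrow> 'k" where "nu j = wt p' (rest I j @ [j])"
definition nu' :: "'i \<Rightarrow> 'k" where "nu' a = rv.wt p (a # rest J a)"

definition ui :: "'k \<Rightarrow> 'k" where "ui v = (SOME u. u * v = 1)"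

lemma ui: "\<exists>u. u * v = 1 \<Longrightarrow> ui v * v = 1"
  unfolding ui_def by (rule someI_ex)

lemma ui_nu: "j \<in> I \<Longrightarrow> ui (nu j) * nu j = 1"
  unfolding nu_def using rest[OF fin(1)] by (intro ui wt_unit[OF pp]) auto

lemma ui_nu': "a \<in> J \<Longrightarrow> ui (nu' a) * nu' a = 1"
  unfolding nu'_def using rest[OF fin(2)] pp by (intro ui rv.wt_unit[of p' p]) (auto simp: mult.commute)

text \<open>D with column \<open>j\<close> moved to the end and replaced by \<open>c\<close>,
  possibly an odd index; at the end stands the argument shared with E. Likewise \<open>Fe\<close>
  moves row \<open>a\<close> of the \<open>kk\<close> to the front, where E has the shared argument,
  and replaces it by \<open>r\<close>.\<close>

definition Fd :: "'i \<Rightarrow> 'i \<Rightarrow> 'a" where "Fd j c = ring_minor s p' I lam ds (rest I j @ [c])"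
definition Fe :: "'i \<Rightarrow> 'i \<Rightarrow> 'a" where "Fe a r = rv.ring_minor s p J (\<lambda>e b r. kk e r b) js (r # rest J a)"

lemma lists_rest: "finite A \<Longrightarrow> j \<in> A \<Longrightarrow> c \<in> A \<Longrightarrow> rest A j @ [c] \<in> lists_on A (card A)"
  "finite A \<Longrightarrow> j \<in> A \<Longrightarrow> c \<in> A \<Longrightarrow> c # rest A j \<in> lists_on A (card A)"
proof -
  assume A: "finite A" "j \<in> A" "c \<in> A"
  then have "card A > 0"
    by (metis card_gt_0_iff empty_iff)
  then have "Suc (card A - 1) = card A"
    by simp
  moreover have "set (rest A j) \<subseteq> A" "length (rest A j) = card A - 1"
    using A rest length_rest by auto
  ultimately show "rest A j @ [c] \<in> lists_on A (card A)" "c # rest A j \<in> lists_on A (card A)"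
    using A(3) by (simp_all add: lists_on_def)
qed

lemma Fd_eq: "j \<in> I \<Longrightarrow> c \<in> I \<Longrightarrow> Fd j c = (if c = j then s (nu j) * D else 0)"
proof -
  assume *: "j \<in> I" "c \<in> I"
  have "Fd j c = s (wt p' (rest I j @ [c])) * D"
    unfolding Fd_def D_def
    by (rule ring_minor_normal_form[OF s fin(1) len(1) D_antisym C0 lists_rest(1)[OF fin(1) *]])
  moreover have "c \<noteq> j \<Longrightarrow> c \<in> set (rest I j)"
    using rest[OF fin(1), of j] * by auto
  ultimately show ?thesis
    by (auto simp: nu_def wt_repeat)
qed

lemma Fe_eq: "a \<in> J \<Longrightarrow> r \<in> J \<Longrightarrow> Fe a r = (if r = a then s (nu' a) * E else 0)"
proof -
  assume *: "a \<in> J" "r \<in> J"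
  have "Fe a r = s (rv.wt p (r # rest J a)) * E"
    unfolding Fe_def E_def
    by (rule rv.ring_minor_normal_form[OF s fin(2) len(2) E_antisym C1 lists_rest(2)[OF fin(2) *]])
  moreover have "r \<noteq> a \<Longrightarrow> r \<in> set (rest J a)"
    using rest[OF fin(2), of a] * by auto
  ultimately show ?thesis
    by (auto simp: nu'_def rv.wt_repeat)
qed

text \<open>Normalised so that D and E come back when nothing is replaced. With an odd column in D,
  or an even row in E, these are the correction terms.\<close>

definition ND :: "'i \<Rightarrow> 'i \<Rightarrow> 'a" where "ND j c = s (ui (nu j)) * Fd j c"
definition NE :: "'i \<Rightarrow> 'i \<Rightarrow> 'a" where "NE a r = s (ui (nu' a)) * Fe a r"

lemma ND_eq: "j \<in> I \<Longrightarrow> c \<in> I \<Longrightarrow> ND j c = (if c = j then D else 0)"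
  by (simp add: ND_def Fd_eq s.fuse ui_nu)

lemma NE_eq: "a \<in> J \<Longrightarrow> r \<in> J \<Longrightarrow> NE a r = (if r = a then E else 0)"
  by (simp add: NE_def Fe_eq s.fuse ui_nu')

lemma ds_split: "j \<in> I \<Longrightarrow> ds = butlast ds @ [last ds] \<and> length (butlast ds) = card I - 1"
  using len(1) card_gt_0_iff[of I] fin(1) append_butlast_last_id[of ds] length_butlast[of ds] by fastforce

lemma js_split: "a \<in> J \<Longrightarrow> js = hd js # tl js \<and> length (tl js) = card J - 1"
  using len(2) card_gt_0_iff[of J] fin(2) list.collapse[of js] length_tl[of js] by fastforce

lemma Fd_expand:
  assumes "j \<in> I"
  shows "Fd j c = (\<Sum>rs\<in>lists_on I (length (butlast ds)). \<Sum>i\<in>I. s (wt p' (rs @ [i])) *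
    (ring_prod lam (butlast ds) rs (rest I j) * lam (last ds) i c))"
proof -
  obtain es e where ds: "ds = es @ [e]"
    using ds_split[OF assms] by blast
  have l: "length (rest I j) = length es"
    using ds_split[OF assms] length_rest[OF fin(1) assms] ds by simp
  have "Fd j c = (\<Sum>rs\<in>lists_on I (length es). \<Sum>i\<in>I. s (wt p' (rs @ [i])) *
    ring_prod lam (es @ [e]) (rs @ [i]) (rest I j @ [c]))"
    unfolding Fd_def unfolding ring_minor_def ds length_append_singleton by (rule sum_lists_snoc[OF fin(1)])
  also have "\<dots> = (\<Sum>rs\<in>lists_on I (length es). \<Sum>i\<in>I. s (wt p' (rs @ [i])) *
    (ring_prod lam es rs (rest I j) * lam e i c))"
    using l by (intro sum.cong refl) (simp add: lists_on_def ring_prod_append)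
  finally have eq: "Fd j c = \<dots>" .
  have "butlast ds = es" "last ds = e"
    by (simp_all add: ds)
  then show ?thesis
    by (simp only: eq)
qed

lemma Fe_expand:
  assumes "a \<in> J"
  shows "Fe a r = (\<Sum>b\<in>J. \<Sum>bs\<in>lists_on J (length (tl js)). s (rv.wt p (b # bs)) *
    (kk (hd js) r b * ring_prod (\<lambda>e b r. kk e r b) (tl js) bs (rest J a)))"
proof -
  obtain f fs where js: "js = f # fs"
    using js_split[OF assms] by blast
  show ?thesis
    unfolding Fe_def unfolding rv.ring_minor_def js by (simp add: sum_lists_Suc[OF fin(2)])
qed

abbreviation "X \<equiv> \<Prod>e\<leftarrow>butlast ds. x e"
abbreviation "Y \<equiv> \<Prod>e\<leftarrow>tl js. y e"
abbreviation "e0 \<equiv> last ds"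
abbreviation "f0 \<equiv> hd js"
abbreviation "CC \<equiv> g e0 * (z e0 * p - w * p')"

text \<open>\<open>ka j b\<close> crosses a factor without correction if the column of the factor is
  not \<open>j\<close>. Only the last factor sits in column \<open>j\<close>; there the column is
  exchanged with the row of \<open>ka\<close>.\<close>

lemma ka_Fd:
  assumes j: "j \<in> I" and b: "b \<in> J"
  shows "s (X * x e0) * (ka j b * Fd j j) =
    s' X * (s' CC * (Fd j j * ka j b) + (\<Sum>n\<in>I \<union> J - {j}. s' (g e0 * exch p p' (z e0) w n j) * (Fd j n * ka n b)))"
proof -
  let ?P = "\<lambda>rs. ring_prod lam (butlast ds) rs (rest I j)"
  have l: "length (rest I j) = length (butlast ds)"
    using ds_split[OF j] length_rest[OF fin(1) j] by simp
  have set_rest: "set (rest I j) = I - {j}"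
    using rest[OF fin(1), of j] by simp
  have "ds \<noteq> []"
    using ds_split[OF j] by force
  then have mem: "e0 \<in> set ds" "set (butlast ds) \<subseteq> set ds"
    by (auto dest: in_set_butlastD)
  have trm: "s (X * x e0) * (ka j b * (?P rs * lam e0 i j)) = s' X * (s' CC * (?P rs * lam e0 i j * ka j b) +
      (\<Sum>n\<in>I \<union> J - {j}. s' (g e0 * exch p p' (z e0) w n j) * (?P rs * lam e0 i n * ka n b)))"
    if rs: "rs \<in> lists_on I (length (butlast ds))" and i: "i \<in> I" for rs i
  proof -
    have P: "s X * (ka j b * ?P rs) = s' X * (?P rs * ka j b)"
    proof (rule pass_left[OF s s'])
      fix e r c assume "e \<in> set (butlast ds)" "r \<in> set rs" "c \<in> set (rest I j)"
      then have "e \<in> set ds" "r \<in> I" "c \<in> I" "j \<noteq> c"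
        using mem(2) lists_onD(2)[OF rs] set_rest by auto
      then show "s (x e) * (ka j b * lam e r c) = s' (x e) * (lam e r c * ka j b)"
        using ka_lam[of e r c j b] j b by (simp add: x_def diag_def)
    qed (use rs l in \<open>auto simp: lists_on_def\<close>)
    have last: "s (x e0) * (ka j b * lam e0 i j) = s' CC * (lam e0 i j * ka j b) +
        (\<Sum>n\<in>I \<union> J - {j}. s' (g e0 * exch p p' (z e0) w n j) * (lam e0 i n * ka n b))"
      using ka_lam[of e0 i j j b] mem i j b by (simp add: x_def diag_def)
    have "s (X * x e0) * (ka j b * (?P rs * lam e0 i j)) = s (x e0) * ((s X * (ka j b * ?P rs)) * lam e0 i j)"
      by (simp add: mult.assoc s.fuse mult.commute)
    also have "\<dots> = s' X * (?P rs * (s (x e0) * (ka j b * lam e0 i j)))"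
      unfolding P by (simp add: mult.assoc s.swap[where x = "s' _"] s.swap[where x = "ring_prod _ _ _ _"])
    finally show ?thesis
      unfolding last
      by (simp add: distrib_left sum_distrib_left mult.assoc s'.swap[where x = "ring_prod _ _ _ _"])
  qed
  have "s (X * x e0) * (ka j b * Fd j j) = (\<Sum>rs\<in>lists_on I (length (butlast ds)). \<Sum>i\<in>I.
      s (wt p' (rs @ [i])) * (s (X * x e0) * (ka j b * (?P rs * lam e0 i j))))"
    unfolding Fd_expand[OF j]
    by (simp add: sum_distrib_left s.swap[where x = "ka _ _"] s.fuse mult.commute)
  also have "\<dots> = (\<Sum>rs\<in>lists_on I (length (butlast ds)). \<Sum>i\<in>I.
      s (wt p' (rs @ [i])) * (s' X * (s' CC * (?P rs * lam e0 i j * ka j b) +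
      (\<Sum>n\<in>I \<union> J - {j}. s' (g e0 * exch p p' (z e0) w n j) * (?P rs * lam e0 i n * ka n b)))))"
    by (intro sum.cong refl) (simp only: trm)
  also have "\<dots> = s' X * (s' CC * (Fd j j * ka j b) + (\<Sum>n\<in>I \<union> J - {j}. s' (g e0 * exch p p' (z e0) w n j) * (Fd j n * ka n b)))"
  proof -
    have sw: "(\<Sum>rs\<in>lists_on I m. \<Sum>i\<in>I. \<Sum>n\<in>N. f rs i n) = (\<Sum>n\<in>N. \<Sum>rs\<in>lists_on I m. \<Sum>i\<in>I. f rs i n)"
      for N m and f :: "'i list \<Rightarrow> 'i \<Rightarrow> 'i \<Rightarrow> 'a"
    proof -
      have "(\<Sum>rs\<in>lists_on I m. \<Sum>i\<in>I. \<Sum>n\<in>N. f rs i n) = (\<Sum>rs\<in>lists_on I m. \<Sum>n\<in>N. \<Sum>i\<in>I. f rs i n)"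
        by (intro sum.cong refl sum.swap)
      then show ?thesis
        by (simp only: sum.swap[of _ N])
    qed
    show ?thesis
      unfolding Fd_expand[OF j]
      by (simp add: sum_distrib_left sum_distrib_right distrib_left sum.distrib mult.assoc
          s.swap[where x = "s' _"] sw)
  qed
  finally show ?thesis .
qed

lemma sum_split_even:
  assumes "j \<in> I"
  shows "(\<Sum>n\<in>I \<union> J - {j}. f n) = (\<Sum>n\<in>I - {j}. f n) + (\<Sum>a\<in>J. f a)"
proof -
  have "I \<union> J - {j} = (I - {j}) \<union> J"
    using assms disj by auto
  then show ?thesis
    using fin disj by (simp only:) (rule sum.union_disjoint; auto)
qed

lemma sum_split_odd:
  assumes "a \<in> J"
  shows "(\<Sum>n\<in>I \<union> J - {a}. f n) = (\<Sum>n\<in>I. f n) + (\<Sum>n\<in>J - {a}. f n)"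
proof -
  have "I \<union> J - {a} = I \<union> (J - {a})"
    using assms disj by auto
  then show ?thesis
    using fin disj by (simp only:) (rule sum.union_disjoint; auto)
qed

lemma sum_split: "(\<Sum>n\<in>I \<union> J. f n) = (\<Sum>n\<in>I. f n) + (\<Sum>n\<in>J. f n)"
  using fin disj by (rule sum.union_disjoint)

text \<open>Replacing column \<open>j\<close> by another even column repeats a column and gives 0,
  so only odd columns remain as corrections.\<close>

lemma ka_ND:
  assumes j: "j \<in> I" and b: "b \<in> J"
  shows "s (X * x e0) * (ka j b * D) =
    s' (X * CC) * (D * ka j b) + (\<Sum>a\<in>J. s' (X * (g e0 * exch p p' (z e0) w a j)) * (ND j a * ka a b))"
proof -
  have "s (X * x e0) * (ka j b * ND j j) = s (ui (nu j)) * (s (X * x e0) * (ka j b * Fd j j))"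
    by (simp add: ND_def s.swap[where x = "ka _ _"] s.fuse mult.commute)
  also have "\<dots> = s' X * (s' CC * (ND j j * ka j b) +
      (\<Sum>n\<in>I \<union> J - {j}. s' (g e0 * exch p p' (z e0) w n j) * (ND j n * ka n b)))"
    unfolding ka_Fd[OF assms]
    by (simp add: ND_def distrib_left sum_distrib_left mult.assoc s.swap[where x = "s' _"])
  finally show ?thesis
    using j by (simp add: ND_eq sum_split_even distrib_left sum_distrib_left s'.fuse)
qed

text \<open>An odd row of \<open>ka\<close> never coincides with one of the even columns of D, so no
  correction arises.\<close>

lemma ka_D:
  assumes a: "a \<in> J" and b: "b \<in> J"
  shows "s (\<Prod>e\<leftarrow>ds. x e) * (ka a b * D) = s' (\<Prod>e\<leftarrow>ds. x e) * (D * ka a b)"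
proof -
  have lC: "length C0 = length ds"
    using distinct_card[OF sorted_distinct_list[OF C0(1)]] C0(2) len(1) by simp
  have *: "s (\<Prod>e\<leftarrow>ds. x e) * (ka a b * ring_prod lam ds rs C0) = s' (\<Prod>e\<leftarrow>ds. x e) * (ring_prod lam ds rs C0 * ka a b)"
    if rs: "rs \<in> lists_on I (length ds)" for rs
  proof (rule pass_left[OF s s'])
    fix e r c assume "e \<in> set ds" "r \<in> set rs" "c \<in> set C0"
    moreover from this have "r \<in> I" "c \<in> I" "a \<noteq> c"
      using lists_onD(2)[OF rs] C0 a disj by auto
    ultimately show "s (x e) * (ka a b * lam e r c) = s' (x e) * (lam e r c * ka a b)"
      using ka_lam[of e r c a b] a b by (simp add: x_def diag_def)
  qed (use rs lC in \<open>auto simp: lists_on_def\<close>)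
  have "s (\<Prod>e\<leftarrow>ds. x e) * (ka a b * D) = (\<Sum>rs\<in>lists_on I (length ds). s (wt p' rs) * (s (\<Prod>e\<leftarrow>ds. x e) * (ka a b * ring_prod lam ds rs C0)))"
    unfolding D_def ring_minor_def by (simp add: sum_distrib_left s.swap[where x = "ka _ _"] s.fuse mult.commute)
  also have "\<dots> = (\<Sum>rs\<in>lists_on I (length ds). s (wt p' rs) * (s' (\<Prod>e\<leftarrow>ds. x e) * (ring_prod lam ds rs C0 * ka a b)))"
    by (intro sum.cong refl) (simp only: *)
  also have "\<dots> = s' (\<Prod>e\<leftarrow>ds. x e) * (D * ka a b)"
    unfolding D_def ring_minor_def
    by (simp add: sum_distrib_left sum_distrib_right s.swap[where x = "s' _"] mult.assoc)
  finally show ?thesis .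
qed

lemma prod_ds: "j \<in> I \<Longrightarrow> (\<Prod>e\<leftarrow>ds. x e) = X * x e0"
proof -
  assume "j \<in> I"
  then have "ds = butlast ds @ [last ds]"
    using ds_split by blast
  then have "(\<Prod>e\<leftarrow>ds. x e) = (\<Prod>e\<leftarrow>butlast ds @ [last ds]. x e)"
    by (rule arg_cong)
  then show ?thesis
    by simp
qed

lemma D_mu_even:
  assumes "i \<in> I" "j \<in> I"
  shows "s (X * CC) * (D * mu i j) = s' (X * CC) * (mu i j * D)"
proof -
  have "ds \<noteq> []"
    using assms(1) len(1) fin(1) by auto
  then show ?thesis
    using qdet_commute[OF s s' fin(1) pp sp len(1) _ zs D_antisym lam_mu C0 assms]
    unfolding D_def x_def by (simp add: mult.commute)
qed

text \<open>Multiplication by \<open>ka'\<close> on the right. It allows a statement on the odd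
  columns of \<open>mu\<close> to be proved after multiplication by the odd block of
  \<open>ka\<close>.\<close>

lemma cancel_ka:
  assumes "\<And>b. b \<in> J \<Longrightarrow> (\<Sum>a\<in>J. f a * ka a b) = (\<Sum>a\<in>J. f' a * ka a b)" "c \<in> J"
  shows "f c = f' c"
proof -
  have *: "f c = (\<Sum>b\<in>J. (\<Sum>a\<in>J. f a * ka a b) * ka' b c)" for f
  proof -
    have "(\<Sum>b\<in>J. (\<Sum>a\<in>J. f a * ka a b) * ka' b c) = (\<Sum>a\<in>J. f a * (\<Sum>b\<in>J. ka a b * ka' b c))"
      by (simp add: sum_distrib_left sum_distrib_right mult.assoc) (rule sum.swap)
    also have "\<dots> = (\<Sum>a\<in>J. if a = c then f c else 0)"
      using assms(2) by (intro sum.cong refl) (auto simp: ka_inv)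
    finally show ?thesis
      using fin assms(2) by simp
  qed
  show ?thesis
    unfolding *[of f] *[of f'] using assms(1) by (intro sum.cong refl) simp
qed

text \<open>The odd column is reached indirectly: by \<open>mu_ka\<close> the odd columns of
  \<open>mu\<close> times \<open>ka\<close> are minus the even columns times \<open>ka\<close>, and
  for even columns \<open>D_mu_even\<close> is available. Then \<open>ka\<close> is moved through D,
  which creates the terms with \<open>ND\<close>, and is cancelled.\<close>

lemma D_mu_odd:
  assumes i: "i \<in> I" and a: "a \<in> J"
  shows "s (X * CC) * (D * mu i a) = s' (X * x e0) * (mu i a * D) +
    (\<Sum>j\<in>I. s' (X * (g e0 * exch p p' (z e0) w a j)) * (mu i j * ND j a))"
proof (rule cancel_ka[OF _ a])
  fix b assume b: "b \<in> J"
  have mk: "(\<Sum>a\<in>J. mu i a * ka a b) = - (\<Sum>j\<in>I. mu i j * ka j b)"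
    using mu_ka[OF i b] by (simp add: sum_split add_eq_0_iff)
  have "(\<Sum>a\<in>J. s (X * CC) * (D * mu i a) * ka a b) = s (X * CC) * (D * (\<Sum>a\<in>J. mu i a * ka a b))"
    by (simp add: sum_distrib_left mult.assoc)
  also have "\<dots> = - (\<Sum>j\<in>I. (s (X * CC) * (D * mu i j)) * ka j b)"
    unfolding mk by (simp add: sum_distrib_left mult.assoc)
  also have "\<dots> = - (\<Sum>j\<in>I. mu i j * (s' (X * CC) * (D * ka j b)))"
    using i by (simp add: D_mu_even mult.assoc s'.swap[where x = "mu _ _"])
  also have "\<dots> = - (\<Sum>j\<in>I. mu i j * (s (X * x e0) * (ka j b * D) -
      (\<Sum>a\<in>J. s' (X * (g e0 * exch p p' (z e0) w a j)) * (ND j a * ka a b))))"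
    using b by (simp add: ka_ND)
  also have "\<dots> = s (X * x e0) * (- (\<Sum>j\<in>I. mu i j * ka j b) * D) +
      (\<Sum>j\<in>I. \<Sum>a\<in>J. s' (X * (g e0 * exch p p' (z e0) w a j)) * (mu i j * (ND j a * ka a b)))"
    by (simp add: right_diff_distrib sum_subtractf sum_distrib_left sum_distrib_right mult.assoc
        s.swap[where x = "mu _ _"] s'.swap[where x = "mu _ _"])
  also have "s (X * x e0) * (- (\<Sum>j\<in>I. mu i j * ka j b) * D) = (\<Sum>a\<in>J. mu i a * (s (X * x e0) * (ka a b * D)))"
    unfolding mk[symmetric]
    by (simp add: sum_distrib_left sum_distrib_right mult.assoc s.swap[where x = "mu _ _"])
  also have "\<dots> = (\<Sum>a\<in>J. mu i a * (s' (X * x e0) * (D * ka a b)))"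
    using ka_D[OF _ b] prod_ds[OF i] by simp
  also have "\<dots> + (\<Sum>j\<in>I. \<Sum>a\<in>J. s' (X * (g e0 * exch p p' (z e0) w a j)) * (mu i j * (ND j a * ka a b))) =
    (\<Sum>a\<in>J. (s' (X * x e0) * (mu i a * D) +
    (\<Sum>j\<in>I. s' (X * (g e0 * exch p p' (z e0) w a j)) * (mu i j * ND j a))) * ka a b)"
    by (subst sum.swap) (simp add: distrib_right sum.distrib sum_distrib_right mult.assoc s'.swap[where x = "mu _ _"])
  finally show "(\<Sum>a\<in>J. s (X * CC) * (D * mu i a) * ka a b) = \<dots>" .
qed

text \<open>Mirror image of \<open>ka_Fd\<close>: \<open>mu i a\<close> enters from the right, and
  only the first factor, the one with row \<open>a\<close>, produces corrections.\<close>

lemma Fe_mu: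
  assumes i: "i \<in> I" and a: "a \<in> J"
  shows "s (y f0 * Y) * (Fe a a * mu i a) = - (s' Y * (s' (h f0 * (z f0 * p - w * p')) * (mu i a * Fe a a) +
    (\<Sum>n\<in>I \<union> J - {a}. s' (h f0 * exch p p' w (z f0) n a) * (mu i n * Fe a n))))"
proof -
  let ?KT = "\<lambda>e b r. kk e r b" and ?C = "h f0 * (z f0 * p - w * p')"
  let ?P = "\<lambda>bs. ring_prod ?KT (tl js) bs (rest J a)" and ?L = "lists_on J (length (tl js))"
  have l: "length (rest J a) = length (tl js)"
    using js_split[OF a] length_rest[OF fin(2) a] by simp
  have set_rest: "set (rest J a) = J - {a}"
    using rest[OF fin(2), of a] by simp
  have "js \<noteq> []"
    using js_split[OF a] by force
  then have mem: "f0 \<in> set js" "set (tl js) \<subseteq> set js"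
    by (auto dest: list.set_sel(2))
  have trm: "s (y f0 * Y) * (kk f0 a b * ?P bs * mu i a) = - (s' Y * (s' ?C * (mu i a * (kk f0 a b * ?P bs)) +
      (\<Sum>n\<in>I \<union> J - {a}. s' (h f0 * exch p p' w (z f0) n a) * (mu i n * (kk f0 n b * ?P bs)))))"
    if bs: "bs \<in> ?L" and b: "b \<in> J" for bs b
  proof -
    have P: "s Y * (?P bs * mu i a) = s' Y * (mu i a * ?P bs)"
    proof (rule pass_right[OF s s'])
      fix e r c assume "e \<in> set (tl js)" "r \<in> set bs" "c \<in> set (rest J a)"
      then have "e \<in> set js" "r \<in> J" "c \<in> J" "c \<noteq> a"
        using mem(2) lists_onD(2)[OF bs] set_rest by auto
      then show "s (y e) * (kk e c r * mu i a) = s' (y e) * (mu i a * kk e c r)"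
        using kk_mu[of e i a c r] i a by (simp add: y_def)
    qed (use bs l in \<open>auto simp: lists_on_def\<close>)
    have "s (y f0 * Y) * (kk f0 a b * ?P bs * mu i a) = s (y f0) * (kk f0 a b * (s Y * (?P bs * mu i a)))"
      by (simp add: mult.assoc s.swap[where x = "kk _ _ _"] s.fuse)
    also have "\<dots> = s' Y * ((s (y f0) * (kk f0 a b * mu i a)) * ?P bs)"
      unfolding P by (simp add: mult.assoc s'.swap[where x = "kk _ _ _"] s.swap[where x = "s' _"])
    also have "s (y f0) * (kk f0 a b * mu i a) = - (s' ?C * (mu i a * kk f0 a b) +
         (\<Sum>n\<in>I \<union> J - {a}. s' (h f0 * exch p p' w (z f0) n a) * (mu i n * kk f0 n b)))"
      using kk_mu_diag[OF mem(1) i a b] by (simp add: y_def)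
    finally show ?thesis
      unfolding mult_minus_left mult_minus_right
      by (simp only: distrib_right sum_distrib_right mult.assoc)
  qed
  have "s (y f0 * Y) * (Fe a a * mu i a) = (\<Sum>b\<in>J. \<Sum>bs\<in>?L. s (rv.wt p (b # bs)) *
      (s (y f0 * Y) * (kk f0 a b * ?P bs * mu i a)))"
    unfolding Fe_expand[OF a]
    by (simp add: sum_distrib_left sum_distrib_right s.fuse mult.commute mult.assoc)
  also have "\<dots> = - (\<Sum>b\<in>J. \<Sum>bs\<in>?L. s (rv.wt p (b # bs)) * (s' Y * (s' ?C * (mu i a * (kk f0 a b * ?P bs)) +
      (\<Sum>n\<in>I \<union> J - {a}. s' (h f0 * exch p p' w (z f0) n a) * (mu i n * (kk f0 n b * ?P bs))))))"
    unfolding sum_negf[symmetric] by (intro sum.cong refl) (simp only: trm mult_minus_right)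
  also have "(\<Sum>b\<in>J. \<Sum>bs\<in>?L. s (rv.wt p (b # bs)) * (s' Y * (s' ?C * (mu i a * (kk f0 a b * ?P bs)) +
      (\<Sum>n\<in>I \<union> J - {a}. s' (h f0 * exch p p' w (z f0) n a) * (mu i n * (kk f0 n b * ?P bs)))))) =
    s' Y * (s' ?C * (mu i a * Fe a a) +
      (\<Sum>n\<in>I \<union> J - {a}. s' (h f0 * exch p p' w (z f0) n a) * (mu i n * Fe a n)))"
  proof -
    have sw: "(\<Sum>b\<in>J. \<Sum>bs\<in>lists_on J m. \<Sum>n\<in>N. f b bs n) = (\<Sum>n\<in>N. \<Sum>b\<in>J. \<Sum>bs\<in>lists_on J m. f b bs n)"
      for N m and f :: "'i \<Rightarrow> 'i list \<Rightarrow> 'i \<Rightarrow> 'a"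
    proof -
      have "(\<Sum>b\<in>J. \<Sum>bs\<in>lists_on J m. \<Sum>n\<in>N. f b bs n) = (\<Sum>b\<in>J. \<Sum>n\<in>N. \<Sum>bs\<in>lists_on J m. f b bs n)"
        by (intro sum.cong refl sum.swap)
      then show ?thesis
        by (simp only: sum.swap[of _ N])
    qed
    show ?thesis
      unfolding Fe_expand[OF a]
      by (simp add: sum_distrib_left distrib_left sum.distrib mult.assoc
          s.swap[where x = "s' _"] s.swap[where x = "mu _ _"] sw)
  qed
  finally show ?thesis .
qed

lemma E_mu_odd:
  assumes i: "i \<in> I" and a: "a \<in> J"
  shows "s (y f0 * Y) * (E * mu i a) = - (s' (Y * (h f0 * (z f0 * p - w * p'))) * (mu i a * E) +
    (\<Sum>n\<in>I. s' (Y * (h f0 * exch p p' w (z f0) n a)) * (mu i n * NE a n)))"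
proof -
  let ?H = "h f0 * (z f0 * p - w * p')" and ?x = "\<lambda>n. h f0 * exch p p' w (z f0) n a"
  have "s (y f0 * Y) * (NE a a * mu i a) = s (ui (nu' a)) * (s (y f0 * Y) * (Fe a a * mu i a))"
    by (simp add: NE_def s.fuse mult.commute mult.assoc)
  also have "\<dots> = - (s (ui (nu' a)) * (s' Y * (s' ?H * (mu i a * Fe a a) +
      (\<Sum>n\<in>I \<union> J - {a}. s' (?x n) * (mu i n * Fe a n)))))"
    unfolding Fe_mu[OF assms] by (rule mult_minus_right)
  also have "s (ui (nu' a)) * (s' Y * (s' ?H * (mu i a * Fe a a) +
      (\<Sum>n\<in>I \<union> J - {a}. s' (?x n) * (mu i n * Fe a n)))) =
    s' Y * (s' ?H * (mu i a * NE a a) + (\<Sum>n\<in>I \<union> J - {a}. s' (?x n) * (mu i n * NE a n)))"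
    by (simp add: NE_def distrib_left sum_distrib_left mult.assoc s.swap[where x = "s' _"] s.swap[where x = "mu _ _"])
  also have "(\<Sum>n\<in>I \<union> J - {a}. s' (?x n) * (mu i n * NE a n)) = (\<Sum>n\<in>I. s' (?x n) * (mu i n * NE a n))"
    using a by (simp add: sum_split_odd NE_eq)
  finally have eq: "s (y f0 * Y) * (NE a a * mu i a) =
    - (s' Y * (s' ?H * (mu i a * NE a a) + (\<Sum>n\<in>I. s' (?x n) * (mu i n * NE a n))))" .
  have "s' Y * (s' ?H * (mu i a * E) + (\<Sum>n\<in>I. s' (?x n) * (mu i n * NE a n))) =
    s' (Y * ?H) * (mu i a * E) + (\<Sum>n\<in>I. s' (Y * ?x n) * (mu i n * NE a n))"
    by (simp only: distrib_left sum_distrib_left s'.fuse)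
  moreover have "NE a a = E"
    using a by (simp add: NE_eq)
  ultimately show ?thesis
    using eq by simp
qed

lemma E_mu_even:
  assumes i: "i \<in> I" and j: "j \<in> I"
  shows "s (\<Prod>e\<leftarrow>js. y e) * (E * mu i j) = s' (\<Prod>e\<leftarrow>js. y e) * (mu i j * E)"
proof -
  let ?KT = "\<lambda>e b r. kk e r b"
  have lC: "length C1 = length js"
    using distinct_card[OF rv.sorted_distinct_list[OF C1(1)]] C1(2) len(2) by simp
  have *: "s (\<Prod>e\<leftarrow>js. y e) * (ring_prod ?KT js bs C1 * mu i j) = s' (\<Prod>e\<leftarrow>js. y e) * (mu i j * ring_prod ?KT js bs C1)"
    if bs: "bs \<in> lists_on J (length js)" for bs
  proof (rule pass_right[OF s s'])
    fix e r c assume "e \<in> set js" "r \<in> set bs" "c \<in> set C1"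
    moreover from this have "r \<in> J" "c \<in> J" "c \<noteq> j"
      using lists_onD(2)[OF bs] C1 j disj by auto
    ultimately show "s (y e) * (kk e c r * mu i j) = s' (y e) * (mu i j * kk e c r)"
      using kk_mu[of e i j c r] i j by (simp add: y_def)
  qed (use bs lC in \<open>auto simp: lists_on_def\<close>)
  have "s (\<Prod>e\<leftarrow>js. y e) * (E * mu i j) = (\<Sum>bs\<in>lists_on J (length js). s (rv.wt p bs) * (s (\<Prod>e\<leftarrow>js. y e) * (ring_prod ?KT js bs C1 * mu i j)))"
    unfolding E_def rv.ring_minor_def by (simp add: sum_distrib_left sum_distrib_right s.fuse mult.commute mult.assoc)
  also have "\<dots> = (\<Sum>bs\<in>lists_on J (length js). s (rv.wt p bs) * (s' (\<Prod>e\<leftarrow>js. y e) * (mu i j * ring_prod ?KT js bs C1)))"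
    by (intro sum.cong refl) (simp only: *)
  also have "\<dots> = s' (\<Prod>e\<leftarrow>js. y e) * (mu i j * E)"
    unfolding E_def rv.ring_minor_def
    by (simp add: sum_distrib_left sum_distrib_right s.swap[where x = "s' _"] s.swap[where x = "mu _ _"] mult.assoc)
  finally show ?thesis .
qed

text \<open>Both sides expand along the argument that \<open>D\<close> and \<open>E\<close> share, where the
  rows of \<open>lam\<close> and the columns of \<open>kk\<close> are orthogonal.\<close>

lemma D_NE:
  assumes n: "n \<in> I" and a: "a \<in> J"
  shows "D * NE a n = - (ND n a * E)"
proof -
  have ne: "ds \<noteq> []" "js \<noteq> []"
    using n a len fin by auto
  then have link': "f0 = e0" "e0 \<in> set ds"
    using link last_in_set[of ds] by simp_all
  have orth: "(\<Sum>c\<in>I \<union> J. Fd n c * kk e0 c b) = 0" if b: "b \<in> J" for b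
  proof -
    have "(\<Sum>c\<in>I \<union> J. Fd n c * kk e0 c b) = (\<Sum>rs\<in>lists_on I (length (butlast ds)). \<Sum>i\<in>I. s (wt p' (rs @ [i])) *
      (ring_prod lam (butlast ds) rs (rest I n) * (\<Sum>c\<in>I \<union> J. lam e0 i c * kk e0 c b)))"
    proof -
      have sw: "(\<Sum>c\<in>N. \<Sum>rs\<in>lists_on I m. \<Sum>i\<in>I. f rs i c) = (\<Sum>rs\<in>lists_on I m. \<Sum>i\<in>I. \<Sum>c\<in>N. f rs i c)"
        for N m and f :: "'i list \<Rightarrow> 'i \<Rightarrow> 'i \<Rightarrow> 'a"
        by (rule HOL.trans[OF sum.swap]) (intro sum.cong refl sum.swap)
      show ?thesis
        unfolding Fd_expand[OF n] by (simp add: sum_distrib_right sum_distrib_left mult.assoc sw)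
    qed
    then show ?thesis
      using lam_kk[OF link'(2) _ b] by simp
  qed
  have "(\<Sum>c\<in>I \<union> J. Fd n c * Fe a c) = (\<Sum>b\<in>J. \<Sum>bs\<in>lists_on J (length (tl js)). s (rv.wt p (b # bs)) *
      ((\<Sum>c\<in>I \<union> J. Fd n c * kk e0 c b) * ring_prod (\<lambda>e b r. kk e r b) (tl js) bs (rest J a)))"
  proof -
    have sw: "(\<Sum>c\<in>N. \<Sum>b\<in>J. \<Sum>bs\<in>lists_on J m. f b bs c) = (\<Sum>b\<in>J. \<Sum>bs\<in>lists_on J m. \<Sum>c\<in>N. f b bs c)"
      for N m and f :: "'i \<Rightarrow> 'i list \<Rightarrow> 'i \<Rightarrow> 'a"
      by (rule HOL.trans[OF sum.swap]) (intro sum.cong refl sum.swap)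
    show ?thesis
      unfolding Fe_expand[OF a] link'
      by (simp add: sum_distrib_right sum_distrib_left mult.assoc sw s.swap[where x = "Fd _ _"])
  qed
  also have "\<dots> = 0"
    by (simp add: orth)
  finally have "(\<Sum>c\<in>I. Fd n c * Fe a c) + (\<Sum>c\<in>J. Fd n c * Fe a c) = 0"
    by (simp add: sum_split)
  \<comment> \<open>In the sum over all indices only \<open>c = n\<close> and \<open>c = a\<close>
    survive; the other terms contain a minor with a repeated column or row.\<close>
  moreover have "(\<Sum>c\<in>I. Fd n c * Fe a c) = (\<Sum>c\<in>I. if c = n then Fd n n * Fe a n else 0)"
    using n by (intro sum.cong refl) (auto simp: Fd_eq)
  moreover have "(\<Sum>c\<in>J. Fd n c * Fe a c) = (\<Sum>c\<in>J. if c = a then Fd n a * Fe a a else 0)"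
    using a by (intro sum.cong refl) (auto simp: Fe_eq)
  ultimately have "Fd n n * Fe a n + Fd n a * Fe a a = 0"
    using n a fin by simp
  then have "s (ui (nu n)) * (s (ui (nu' a)) * (Fd n n * Fe a n + Fd n a * Fe a a)) = 0"
    by simp
  then have "ND n n * NE a n + ND n a * NE a a = 0"
    by (simp add: ND_def NE_def distrib_left mult.assoc s.swap[where x = "Fd _ _"])
  then show ?thesis
    using n a by (simp add: ND_eq NE_eq add_eq_0_iff)
qed

theorem DE_mu:
  assumes i: "i \<in> I" and j: "j \<in> I \<union> J"
  shows "s \<Gamma> * (D * E * mu i j) = s' \<Gamma> * (mu i j * (D * E))"
proof -
  have ne: "ds \<noteq> []"
    using i len fin by auto
  show ?thesis
  proof (cases "j \<in> I")
    case True
    let ?Y = "\<Prod>e\<leftarrow>js. y e"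
    have G: "\<Gamma> = X * CC * ?Y"
      using ne by (simp add: \<Gamma>_def mult.commute)
    have "s \<Gamma> * (D * E * mu i j) = s (X * CC) * (D * (s ?Y * (E * mu i j)))"
      by (simp add: G s.fuse mult.assoc s.swap[where x = D])
    also have "\<dots> = s' ?Y * ((s (X * CC) * (D * mu i j)) * E)"
      unfolding E_mu_even[OF i True] by (simp add: mult.assoc s'.swap[where x = D] s.swap[where x = "s' _"])
    also have "\<dots> = s' \<Gamma> * (mu i j * (D * E))"
      unfolding D_mu_even[OF i True] by (simp add: G s'.fuse mult.assoc mult.commute[of ?Y])
    finally show ?thesis .
  next
    case False
    then have a: "j \<in> J"
      using j by auto
    have js: "js = f0 # tl js"
      using js_split[OF a] by blast
    then have "(\<Prod>e\<leftarrow>js. y e) = (\<Prod>e\<leftarrow>f0 # tl js. y e)"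
      by (rule arg_cong)
    then have prod_js: "(\<Prod>e\<leftarrow>js. y e) = y f0 * Y"
      by simp
    have G: "\<Gamma> = X * CC * (y f0 * Y)"
      using ne by (simp add: \<Gamma>_def prod_js mult.commute)
    have fe: "f0 = e0"
      using link ne js by (metis list.distinct(1))
    let ?H = "h f0 * (z f0 * p - w * p')"
    have "s \<Gamma> * (D * E * mu i j) = s (X * CC) * (D * (s (y f0 * Y) * (E * mu i j)))"
      by (simp add: G s.fuse mult.assoc s.swap[where x = D])
    also have "\<dots> = - (s' (Y * ?H) * ((s (X * CC) * (D * mu i j)) * E) +
        (\<Sum>n\<in>I. s' (Y * (h f0 * exch p p' w (z f0) n j)) * ((s (X * CC) * (D * mu i n)) * NE j n)))"
      unfolding E_mu_odd[OF i a] mult_minus_right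
      by (simp only: distrib_left sum_distrib_left mult.assoc s'.swap[where x = D] s.swap[where x = "s' _"])
    also have "(\<Sum>n\<in>I. s' (Y * (h f0 * exch p p' w (z f0) n j)) * ((s (X * CC) * (D * mu i n)) * NE j n)) =
       (\<Sum>n\<in>I. s' (Y * (h f0 * exch p p' w (z f0) n j)) * ((s' (X * CC) * (mu i n * D)) * NE j n))"
      using i by (simp add: D_mu_even)
    also have "\<dots> = - (\<Sum>n\<in>I. s' (Y * (h f0 * exch p p' w (z f0) n j) * (X * CC)) * (mu i n * (ND n j * E)))"
      using a by (simp add: mult.assoc s'.fuse D_NE sum_negf)
    also have "s' (Y * ?H) * ((s (X * CC) * (D * mu i j)) * E) = s' (Y * ?H * (X * x e0)) * (mu i j * (D * E)) +
       (\<Sum>n\<in>I. s' (Y * ?H * (X * (g e0 * exch p p' (z e0) w j n))) * (mu i n * (ND n j * E)))"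
      unfolding D_mu_odd[OF i a]
      by (simp add: distrib_left distrib_right sum_distrib_left sum_distrib_right mult.assoc s'.fuse)
    also have "(\<Sum>n\<in>I. s' (Y * ?H * (X * (g e0 * exch p p' (z e0) w j n))) * (mu i n * (ND n j * E))) =
      (\<Sum>n\<in>I. s' (Y * (h f0 * exch p p' w (z f0) n j) * (X * CC)) * (mu i n * (ND n j * E)))"
    proof (rule sum.cong[OF refl])
      fix n assume "n \<in> I"
      then have "n \<noteq> j"
        using False by auto
      \<comment> \<open>The corrections from D and from E carry the same scalar: exchanging
        \<open>z\<close> with \<open>w\<close> and \<open>n\<close> with \<open>j\<close> at once
        leaves \<open>exch\<close> unchanged.\<close>
      then have "exch p p' w (z f0) n j = exch p p' (z e0) w j n"
        using total[of n j] asym by (auto simp: exch_def fe)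
      then have "Y * ?H * (X * (g e0 * exch p p' (z e0) w j n)) = Y * (h f0 * exch p p' w (z f0) n j) * (X * CC)"
        by (simp add: fe mult_ac)
      then show "s' (Y * ?H * (X * (g e0 * exch p p' (z e0) w j n))) * (mu i n * (ND n j * E)) =
        s' (Y * (h f0 * exch p p' w (z f0) n j) * (X * CC)) * (mu i n * (ND n j * E))"
        by (simp only:)
    qed
    also have "- (s' (Y * ?H * (X * x e0)) * (mu i j * (D * E)) +
        (\<Sum>n\<in>I. s' (Y * (h f0 * exch p p' w (z f0) n j) * (X * CC)) * (mu i n * (ND n j * E))) +
        - (\<Sum>n\<in>I. s' (Y * (h f0 * exch p p' w (z f0) n j) * (X * CC)) * (mu i n * (ND n j * E)))) =
      s' (- (Y * ?H * (X * x e0))) * (mu i j * (D * E))"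
      by (simp add: s'.uminus)
    \<comment> \<open>At the shared argument \<open>?H * x e0\<close> and \<open>CC * y f0\<close>
      differ only in the sign of \<open>z e0 - w\<close>.\<close>
    also have "- (Y * ?H * (X * x e0)) = \<Gamma>"
      by (simp add: G x_def y_def fe algebra_simps)
    finally show ?thesis .
  qed
qed

end

section \<open>The graded RLL relation and its consequences for inverse matrices\<close>

section \<open>The graded tensor algebra\<close>

text \<open>Koszul signs depend on exponents modulo 2 only, so identities between them become
  propositional statements about parities.\<close>

lemma neg1_cong: "(even a \<longleftrightarrow> even b) \<Longrightarrow> (-1) ^ a = ((-1) ^ b :: 'a::ring_1)"
  by (cases "even a") auto

lemma neg1_swap: "x * ((-1) ^ e * y) = (-1) ^ e * (x * y :: 'a::ring_1)"
  by (cases "even e") auto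

lemma neg1_fuse: "(-1) ^ e * ((-1) ^ f * y) = (-1) ^ (e + f) * (y :: 'a::ring_1)"
  by (simp add: power_add mult.assoc)

lemma sum_swap22:
  "(\<Sum>a\<in>A. \<Sum>b\<in>B. \<Sum>c\<in>C. \<Sum>d\<in>D. f a b c d) = (\<Sum>c\<in>C. \<Sum>d\<in>D. \<Sum>a\<in>A. \<Sum>b\<in>B. f a b c d)"
proof -
  have "(\<Sum>a\<in>A. \<Sum>b\<in>B. \<Sum>c\<in>C. \<Sum>d\<in>D. f a b c d) = (\<Sum>a\<in>A. \<Sum>c\<in>C. \<Sum>b\<in>B. \<Sum>d\<in>D. f a b c d)"
    by (rule sum.cong[OF refl], rule sum.swap)
  also have "\<dots> = (\<Sum>c\<in>C. \<Sum>a\<in>A. \<Sum>b\<in>B. \<Sum>d\<in>D. f a b c d)"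
    by (rule sum.swap)
  also have "\<dots> = (\<Sum>c\<in>C. \<Sum>a\<in>A. \<Sum>d\<in>D. \<Sum>b\<in>B. f a b c d)"
    by (rule sum.cong[OF refl], rule sum.cong[OF refl], rule sum.swap)
  also have "\<dots> = (\<Sum>c\<in>C. \<Sum>d\<in>D. \<Sum>a\<in>A. \<Sum>b\<in>B. f a b c d)"
    by (rule sum.cong[OF refl], rule sum.swap)
  finally show ?thesis .
qed

text \<open>The sign is bilinear modulo 2 in the parities of the matrix units, and the parity of a
  product of units is the sum of their parities; both bracketings thus have the same sign.\<close>

lemma tmul_assoc: "tmul M N (tmul M N X Y) Z i m k n = tmul M N X (tmul M N Y Z) i m k n"
proof -
  let ?A = "{1..M+N}" and ?e = "eparity M"
  have sign: "(-1) ^ ((?e j' m + ?e l' n) * (?e i j' + ?e k l') + ?e k l' * ?e j' m) *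
      ((-1) ^ ((?e j j' + ?e l l') * (?e i j + ?e k l) + ?e k l * ?e j j') * x) =
    (-1) ^ ((?e j m + ?e l n) * (?e i j + ?e k l) + ?e k l * ?e j m) *
      ((-1) ^ ((?e j' m + ?e l' n) * (?e j j' + ?e l l') + ?e l l' * ?e j' m) * x)"
    for j l j' l' and x :: 'a
    unfolding neg1_fuse
    by (intro arg_cong2[where f = "(*)"] neg1_cong refl) (simp add: eparity_def, argo)
  have "tmul M N (tmul M N X Y) Z i m k n = (\<Sum>j'\<in>?A. \<Sum>l'\<in>?A. \<Sum>j\<in>?A. \<Sum>l\<in>?A.
      (-1) ^ ((?e j m + ?e l n) * (?e i j + ?e k l) + ?e k l * ?e j m) *
      ((-1) ^ ((?e j' m + ?e l' n) * (?e j j' + ?e l l') + ?e l l' * ?e j' m) *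
        (X i j k l * (Y j j' l l' * Z j' m l' n))))"
    unfolding tmul_def sum_distrib_left sum_distrib_right
    by (simp only: mult.assoc sign)
  also have "\<dots> = (\<Sum>j\<in>?A. \<Sum>l\<in>?A. \<Sum>j'\<in>?A. \<Sum>l'\<in>?A.
      (-1) ^ ((?e j m + ?e l n) * (?e i j + ?e k l) + ?e k l * ?e j m) *
      ((-1) ^ ((?e j' m + ?e l' n) * (?e j j' + ?e l l') + ?e l l' * ?e j' m) *
        (X i j k l * (Y j j' l l' * Z j' m l' n))))" (is "(\<Sum>j'\<in>_. \<Sum>l'\<in>_. \<Sum>j\<in>_. \<Sum>l\<in>_. ?f j' l' j l) = _")
    by (rule sum_swap22)
  also have "\<dots> = tmul M N X (tmul M N Y Z) i m k n"
    unfolding tmul_def sum_distrib_left sum_distrib_right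
    by (simp only: mult.assoc neg1_swap[where x = "X _ _ _ _"])
  finally show ?thesis .
qed

text \<open>Arrays are compared on indices from 1 to M + N only: \<open>tmul\<close> sums over this
  range, and the unit laws fail outside it.\<close>

definition in_range :: "nat \<Rightarrow> nat \<Rightarrow> (nat \<Rightarrow> nat \<Rightarrow> nat \<Rightarrow> nat \<Rightarrow> 'a) \<Rightarrow> (nat \<Rightarrow> nat \<Rightarrow> nat \<Rightarrow> nat \<Rightarrow> 'a) \<Rightarrow> bool" where
  "in_range M N X Y \<longleftrightarrow> (\<forall>i\<in>{1..M+N}. \<forall>m\<in>{1..M+N}. \<forall>k\<in>{1..M+N}. \<forall>n\<in>{1..M+N}. X i m k n = Y i m k n)"

lemma in_range_refl: "in_range M N X X"
  by (simp add: in_range_def)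

lemma in_range_sym: "in_range M N X Y \<Longrightarrow> in_range M N Y X"
  by (simp add: in_range_def)

lemma in_range_trans [trans]: "in_range M N X Y \<Longrightarrow> in_range M N Y Z \<Longrightarrow> in_range M N X Z"
  by (simp add: in_range_def)

lemma in_range_tmul:
  "in_range M N X X' \<Longrightarrow> in_range M N Y Y' \<Longrightarrow> in_range M N (tmul M N X Y) (tmul M N X' Y')"
  by (simp add: in_range_def tmul_def)

lemma in_range_assoc:
  "in_range M N (tmul M N (tmul M N X Y) Z) (tmul M N X (tmul M N Y Z))"
  by (simp add: in_range_def tmul_assoc)

lemma sum_double_two:
  fixes f :: "nat \<Rightarrow> nat \<Rightarrow> 'a::comm_monoid_add"
  assumes A: "finite A" "i \<in> A" "k \<in> A"
    and "\<And>j l. j \<in> A \<Longrightarrow> l \<in> A \<Longrightarrow> (j, l) \<noteq> (i, k) \<Longrightarrow> (j, l) \<noteq> (k, i) \<Longrightarrow> f j l = 0"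
  shows "(\<Sum>j\<in>A. \<Sum>l\<in>A. f j l) = f i k + (if i = k then 0 else f k i)"
proof -
  have "(\<Sum>j\<in>A. \<Sum>l\<in>A. f j l) = (\<Sum>(j, l)\<in>A \<times> A. f j l)"
    by (rule sum.cartesian_product)
  also have "\<dots> = (\<Sum>(j, l)\<in>{(i, k), (k, i)}. f j l)"
    using assms by (intro sum.mono_neutral_right) auto
  also have "\<dots> = f i k + (if i = k then 0 else f k i)"
    by (cases "i = k") auto
  finally show ?thesis .
qed

text \<open>The shape of an R-matrix: only multiples of E_ii tensor E_kk and of E_ij tensor E_ji
  occur.\<close>

definition sparse :: "(nat \<Rightarrow> nat \<Rightarrow> nat \<Rightarrow> nat \<Rightarrow> 'a::zero) \<Rightarrow> bool" where
  "sparse R \<longleftrightarrow> (\<forall>i j k l. R i j k l \<noteq> 0 \<longrightarrow> (i = j \<and> k = l) \<or> (i = l \<and> j = k))"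

lemma tmul_sparse_left:
  assumes R: "sparse R" and ik: "i \<in> {1..M+N}" "k \<in> {1..M+N}"
  shows "tmul M N R X i m k n = R i i k k * X i m k n +
    (if i = k then 0 else (-1) ^ (eparity M k i * eparity M k m) * (R i k k i * X k m i n))"
proof -
  have z: "R i j k l = 0" if "(j, l) \<noteq> (i, k)" "(j, l) \<noteq> (k, i)" for j l
    using R that unfolding sparse_def by blast
  have e: "(-1) ^ a = (1 :: 'a)" if "even a" for a :: nat
    using that by simp
  show ?thesis
    unfolding tmul_def
    by (subst sum_double_two[of _ i k], use ik in simp_all)
      (auto simp: z eparity_def intro!: e arg_cong2[where f = "(*)"] neg1_cong)
qed

lemma tmul_sparse_right:
  assumes R: "sparse R" and mn: "m \<in> {1..M+N}" "n \<in> {1..M+N}"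
  shows "tmul M N X R i m k n = X i m k n * R m m n n +
    (if m = n then 0 else (-1) ^ (eparity M k m * eparity M n m) * (X i n k m * R n m m n))"
proof -
  have z: "R j m l n = 0" if "(j, l) \<noteq> (m, n)" "(j, l) \<noteq> (n, m)" for j l
    using R that unfolding sparse_def by blast
  show ?thesis
    unfolding tmul_def
    by (subst sum_double_two[of _ m n], use mn in simp_all)
      (auto simp: z eparity_def intro!: arg_cong2[where f = "(*)"] neg1_cong)
qed

definition emb1 :: "(nat \<Rightarrow> nat \<Rightarrow> 'a::zero) \<Rightarrow> nat \<Rightarrow> nat \<Rightarrow> nat \<Rightarrow> nat \<Rightarrow> 'a" where
  "emb1 X i j k l = (if k = l then X i j else 0)"

definition emb2 :: "(nat \<Rightarrow> nat \<Rightarrow> 'a::zero) \<Rightarrow> nat \<Rightarrow> nat \<Rightarrow> nat \<Rightarrow> nat \<Rightarrow> 'a" where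
  "emb2 X i j k l = (if i = j then X k l else 0)"

lemma tmul_emb1_left:
  assumes "k \<in> {1..M+N}"
  shows "tmul M N (emb1 X) Z i m k n = (\<Sum>j=1..M+N.
    (-1) ^ ((eparity M j m + eparity M k n) * eparity M i j) * (X i j * Z j m k n))"
  unfolding tmul_def
proof (intro sum.cong refl)
  fix j
  have "(\<Sum>l=1..M+N. (-1) ^ ((eparity M j m + eparity M l n) * (eparity M i j + eparity M k l) + eparity M k l * eparity M j m) *
      (emb1 X i j k l * Z j m l n)) =
    (\<Sum>l=1..M+N. if l = k then (-1) ^ ((eparity M j m + eparity M k n) * (eparity M i j + eparity M k k) + eparity M k k * eparity M j m) * (X i j * Z j m k n) else 0)"
    by (intro sum.cong refl) (auto simp: emb1_def)
  also have "\<dots> = (-1) ^ ((eparity M j m + eparity M k n) * eparity M i j) * (X i j * Z j m k n)"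
    using assms by (auto simp: eparity_def intro!: arg_cong2[where f = "(*)"] neg1_cong)
  finally show "(\<Sum>l=1..M+N. (-1) ^ ((eparity M j m + eparity M l n) * (eparity M i j + eparity M k l) + eparity M k l * eparity M j m) *
      (emb1 X i j k l * Z j m l n)) = \<dots>" .
qed

lemma tmul_emb2_left:
  assumes "i \<in> {1..M+N}"
  shows "tmul M N (emb2 X) Z i m k n = (\<Sum>l=1..M+N.
    (-1) ^ (eparity M l n * eparity M k l) * (X k l * Z i m l n))"
  unfolding tmul_def
proof (subst sum.swap, intro sum.cong refl)
  fix l
  have "(\<Sum>j=1..M+N. (-1) ^ ((eparity M j m + eparity M l n) * (eparity M i j + eparity M k l) + eparity M k l * eparity M j m) *
      (emb2 X i j k l * Z j m l n)) =
    (\<Sum>j=1..M+N. if j = i then (-1) ^ ((eparity M i m + eparity M l n) * (eparity M i i + eparity M k l) + eparity M k l * eparity M i m) * (X k l * Z i m l n) else 0)"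
    by (intro sum.cong refl) (auto simp: emb2_def)
  also have "\<dots> = (-1) ^ (eparity M l n * eparity M k l) * (X k l * Z i m l n)"
    using assms by (auto simp: eparity_def intro!: arg_cong2[where f = "(*)"] neg1_cong)
  finally show "(\<Sum>j=1..M+N. (-1) ^ ((eparity M j m + eparity M l n) * (eparity M i j + eparity M k l) + eparity M k l * eparity M j m) *
      (emb2 X i j k l * Z j m l n)) = \<dots>" .
qed

lemma tmul_emb12:
  assumes "m \<in> {1..M+N}" "k \<in> {1..M+N}"
  shows "tmul M N (emb1 X) (emb2 Y) i m k n = (-1) ^ (eparity M i m * eparity M k n) * (X i m * Y k n)"
proof -
  have "tmul M N (emb1 X) (emb2 Y) i m k n = (\<Sum>j=1..M+N. if j = m then (-1) ^ (eparity M i m * eparity M k n) * (X i m * Y k n) else 0)"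
    unfolding tmul_emb1_left[OF assms(2)]
    by (intro sum.cong refl) (auto simp: emb2_def eparity_def intro!: arg_cong2[where f = "(*)"] neg1_cong)
  then show ?thesis
    using assms by simp
qed

lemma tmul_emb21:
  assumes "i \<in> {1..M+N}" "n \<in> {1..M+N}"
  shows "tmul M N (emb2 Y) (emb1 X) i m k n = Y k n * X i m"
proof -
  have "tmul M N (emb2 Y) (emb1 X) i m k n = (\<Sum>l=1..M+N. if l = n then Y k n * X i m else 0)"
    unfolding tmul_emb2_left[OF assms(1)]
    by (intro sum.cong refl) (auto simp: emb1_def eparity_def)
  then show ?thesis
    using assms by simp
qed

definition tone :: "nat \<Rightarrow> nat \<Rightarrow> nat \<Rightarrow> nat \<Rightarrow> 'a::ring_1" where
  "tone i j k l = (if i = j \<and> k = l then 1 else 0)"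

lemma tmul_tone_left: "in_range M N (tmul M N tone X) X"
proof -
  have "sparse (tone :: nat \<Rightarrow> nat \<Rightarrow> nat \<Rightarrow> nat \<Rightarrow> 'a)"
    by (auto simp: sparse_def tone_def)
  then show ?thesis
    unfolding in_range_def by (auto simp: tmul_sparse_left tone_def)
qed

lemma tmul_tone_right: "in_range M N (tmul M N X tone) X"
proof -
  have "sparse (tone :: nat \<Rightarrow> nat \<Rightarrow> nat \<Rightarrow> nat \<Rightarrow> 'a)"
    by (auto simp: sparse_def tone_def)
  then show ?thesis
    unfolding in_range_def by (auto simp: tmul_sparse_right tone_def)
qed

definition sinverse :: "nat \<Rightarrow> nat \<Rightarrow> (nat \<Rightarrow> nat \<Rightarrow> 'a::ring_1) \<Rightarrow> (nat \<Rightarrow> nat \<Rightarrow> 'a) \<Rightarrow> bool" where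
  "sinverse M N X Y \<longleftrightarrow> (\<forall>i\<in>{1..M+N}. \<forall>j\<in>{1..M+N}.
     smul M N X Y i j = (if i = j then 1 else 0) \<and> smul M N Y X i j = (if i = j then 1 else 0))"

lemma sinverse_sym: "sinverse M N X Y \<Longrightarrow> sinverse M N Y X"
  by (simp add: sinverse_def)

lemma sinverse_emb1:
  assumes "sinverse M N X Y"
  shows "in_range M N (tmul M N (emb1 X) (emb1 Y)) tone"
  unfolding in_range_def
proof (intro ballI)
  fix i m k n assume *: "i \<in> {1..M+N}" "m \<in> {1..M+N}" "k \<in> {1..M+N}" "n \<in> {1..M+N}"
  have "tmul M N (emb1 X) (emb1 Y) i m k n = (if k = n then smul M N X Y i m else 0)"
    unfolding tmul_emb1_left[OF *(3)] smul_def
    by (auto simp: emb1_def eparity_def intro!: sum.cong arg_cong2[where f = "(*)"] neg1_cong)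
  then show "tmul M N (emb1 X) (emb1 Y) i m k n = tone i m k n"
    using assms * by (auto simp: sinverse_def tone_def)
qed

lemma sinverse_emb2:
  assumes "sinverse M N X Y"
  shows "in_range M N (tmul M N (emb2 X) (emb2 Y)) tone"
  unfolding in_range_def
proof (intro ballI)
  fix i m k n assume *: "i \<in> {1..M+N}" "m \<in> {1..M+N}" "k \<in> {1..M+N}" "n \<in> {1..M+N}"
  have "tmul M N (emb2 X) (emb2 Y) i m k n = (if i = m then smul M N X Y k n else 0)"
    unfolding tmul_emb2_left[OF *(1)] smul_def
    by (auto simp: emb2_def intro!: sum.cong)
  then show "tmul M N (emb2 X) (emb2 Y) i m k n = tone i m k n"
    using assms * by (auto simp: sinverse_def tone_def)
qed

text \<open>From L X Y = Y X R one passes to V L X = X R V by multiplying with the inverse V of Y on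
  both sides; \<open>tmul_cancel2\<close> does the same with the inverse of X.\<close>

lemma tmul_cancel:
  assumes eq: "in_range M N (tmul M N L (tmul M N X Y)) (tmul M N (tmul M N Y X) R)"
    and V: "in_range M N (tmul M N V Y) tone" "in_range M N (tmul M N Y V) tone"
  shows "in_range M N (tmul M N V (tmul M N L X)) (tmul M N X (tmul M N R V))"
proof -
  note a = in_range_assoc[of M N] and c = in_range_tmul and r = in_range_refl
  have "in_range M N (tmul M N V (tmul M N L X)) (tmul M N V (tmul M N (tmul M N L X) (tmul M N Y V)))"
    by (intro c r in_range_sym[OF in_range_trans[OF c[OF r V(2)] tmul_tone_right]])
  also have "in_range M N \<dots> (tmul M N V (tmul M N (tmul M N L (tmul M N X Y)) V))"
    by (rule c[OF r], rule in_range_trans[OF in_range_sym[OF a] c[OF a r]])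
  also have "in_range M N \<dots> (tmul M N V (tmul M N (tmul M N (tmul M N Y X) R) V))"
    by (intro c r eq)
  also have "in_range M N \<dots> (tmul M N (tmul M N V Y) (tmul M N X (tmul M N R V)))"
    by (rule in_range_trans[OF c[OF r in_range_trans[OF a a]] in_range_sym[OF a]])
  also have "in_range M N \<dots> (tmul M N X (tmul M N R V))"
    by (rule in_range_trans[OF c[OF V(1) r] tmul_tone_left])
  finally show ?thesis .
qed

lemma tmul_cancel2:
  assumes eq: "in_range M N (tmul M N V (tmul M N L X)) (tmul M N X (tmul M N R V))"
    and U: "in_range M N (tmul M N U X) tone" "in_range M N (tmul M N X U) tone"
  shows "in_range M N (tmul M N (tmul M N U V) L) (tmul M N R (tmul M N V U))"
proof -
  note a = in_range_assoc[of M N] and c = in_range_tmul and r = in_range_refl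
  have "in_range M N (tmul M N (tmul M N U V) L) (tmul M N U (tmul M N V (tmul M N L (tmul M N X U))))"
    by (rule in_range_trans[OF a c[OF r c[OF r in_range_sym[OF in_range_trans[OF c[OF r U(2)] tmul_tone_right]]]]])
  also have "in_range M N \<dots> (tmul M N U (tmul M N (tmul M N V (tmul M N L X)) U))"
    by (rule c[OF r], rule in_range_trans[OF c[OF r in_range_sym[OF a]] in_range_sym[OF a]])
  also have "in_range M N \<dots> (tmul M N U (tmul M N (tmul M N X (tmul M N R V)) U))"
    by (intro c r eq)
  also have "in_range M N \<dots> (tmul M N (tmul M N U X) (tmul M N R (tmul M N V U)))"
    by (rule in_range_trans[OF c[OF r in_range_trans[OF a c[OF r a]]] in_range_sym[OF a]])
  also have "in_range M N \<dots> (tmul M N R (tmul M N V U))"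
    by (rule in_range_trans[OF c[OF U(1) r] tmul_tone_left])
  finally show ?thesis .
qed

section \<open>The RLL relations in components\<close>

text \<open>The number q_i as \<open>p\<close> or \<open>p'\<close> according to parity;
  interchanging the two arguments gives its inverse.\<close>

definition qev :: "nat \<Rightarrow> 'k \<Rightarrow> 'k \<Rightarrow> nat \<Rightarrow> 'k" where
  "qev M p p' i = (if i \<le> M then p else p')"

definition gdiag :: "nat \<Rightarrow> 'k::comm_ring_1 \<Rightarrow> 'k \<Rightarrow> 'k \<Rightarrow> 'k \<Rightarrow> nat \<Rightarrow> nat \<Rightarrow> 'k" where
  "gdiag M p p' z w i k = (if i = k then z * qev M p p' i - w * qev M p' p i else z - w)"

locale rtt = index_order lt
  for lt :: "nat \<Rightarrow> nat \<Rightarrow> bool" (infix "\<prec>" 50) +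
  fixes M N :: nat and p p' :: "'k::comm_ring_1"
  assumes pp: "p * p' = 1"
begin

abbreviation "pr \<equiv> parity M"
abbreviation "ep \<equiv> eparity M"
abbreviation "Ix \<equiv> {1..M+N}"

definition rmat :: "'k \<Rightarrow> 'k \<Rightarrow> nat \<Rightarrow> nat \<Rightarrow> nat \<Rightarrow> nat \<Rightarrow> 'k" where
  "rmat z w i j k l = (if i = j \<and> k = l then gdiag M p p' z w i k
     else if i = l \<and> j = k then (-1) ^ pr j * exch p p' z w i j else 0)"

text \<open>\<open>R\<^sub>2\<^sub>1(w, z)\<close>, the inverse of \<open>R(z, w)\<close> up to a scalar factor.\<close>

definition rinv :: "'k \<Rightarrow> 'k \<Rightarrow> nat \<Rightarrow> nat \<Rightarrow> nat \<Rightarrow> nat \<Rightarrow> 'k" where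
  "rinv z w i j k l = (if i = j \<and> k = l then gdiag M p p' w z i k
     else if i = l \<and> j = k then (-1) ^ pr j * exch p p' z w i j else 0)"

text \<open>The scalar in the unitarity relation of R.\<close>

definition nrm :: "'k \<Rightarrow> 'k \<Rightarrow> 'k" where
  "nrm z w = (z * p - w * p') * (w * p - z * p')"

text \<open>The relation \<open>R(z, w) X\<^sub>1 Y\<^sub>2 = Y\<^sub>2 X\<^sub>1 R(z, w)\<close> up to the scalar \<open>g\<close>. The scalars enter the
  left-hand side through \<open>s\<close> and the right-hand side through \<open>s'\<close>, which accommodates the
  shifts of the spectral parameter by \<open>q\<^sup>c\<close> and \<open>q\<^bsup>-c\<^esup>\<close> in the mixed relation.\<close>

definition grll :: "('k \<Rightarrow> 'a::ring_1) \<Rightarrow> ('k \<Rightarrow> 'a) \<Rightarrow> 'k \<Rightarrow> 'k \<Rightarrow> 'k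
    \<Rightarrow> (nat \<Rightarrow> nat \<Rightarrow> 'a) \<Rightarrow> (nat \<Rightarrow> nat \<Rightarrow> 'a) \<Rightarrow> bool" where
  "grll s s' g z w X Y \<longleftrightarrow> (\<forall>i\<in>Ix. \<forall>m\<in>Ix. \<forall>k\<in>Ix. \<forall>n\<in>Ix.
     (-1) ^ (ep i m * ep k n) * (s (g * gdiag M p p' z w i k) * (X i m * Y k n)) +
     (-1) ^ (pr k * pr m + pr k * pr n + pr m * pr n) * (s (g * exch p p' z w i k) * (X k m * Y i n)) =
     s' (g * gdiag M p p' z w m n) * (Y k n * X i m) +
     (-1) ^ (pr k * pr m + pr k * pr n + pr m * pr n) * (s' (g * exch p p' z w n m) * (Y k m * X i n)))"

definition sarr :: "('k \<Rightarrow> 'a::ring_1) \<Rightarrow> 'k \<Rightarrow> (nat \<Rightarrow> nat \<Rightarrow> nat \<Rightarrow> nat \<Rightarrow> 'k) \<Rightarrow> (nat \<Rightarrow> nat \<Rightarrow> nat \<Rightarrow> nat \<Rightarrow> 'a)" where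
  "sarr s g R i j k l = s (g * R i j k l)"

lemma sparse_rmat: "central_hom s \<Longrightarrow> sparse (sarr s g (rmat z w))" "central_hom s \<Longrightarrow> sparse (sarr s g (rinv z w))"
proof -
  assume "central_hom s"
  then interpret central_hom s .
  show "sparse (sarr s g (rmat z w))" "sparse (sarr s g (rinv z w))"
    by (auto simp: sparse_def sarr_def rmat_def rinv_def split: if_splits)
qed

lemma exch_refl: "exch p p' z w i i = 0"
  by (simp add: exch_def)

lemma rmat_simps:
  "rmat z w i i k k = gdiag M p p' z w i k" "i \<noteq> k \<Longrightarrow> rmat z w i k k i = (-1) ^ pr k * exch p p' z w i k"
  "rinv z w i i k k = gdiag M p p' w z i k" "i \<noteq> k \<Longrightarrow> rinv z w i k k i = (-1) ^ pr k * exch p p' z w i k"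
  by (auto simp: rmat_def rinv_def)

lemma s_neg1: "central_hom s \<Longrightarrow> s (g * ((-1) ^ e * x)) = (-1) ^ e * s (g * x)"
proof -
  assume "central_hom s"
  then interpret central_hom s .
  show ?thesis
    by (cases "even e") (auto simp: uminus)
qed

lemma grll_lhs:
  assumes s: "central_hom s" and "i \<in> Ix" "m \<in> Ix" "k \<in> Ix" "n \<in> Ix"
  shows "tmul M N (sarr s g (rmat z w)) (tmul M N (emb1 X) (emb2 Y)) i m k n =
     (-1) ^ (ep i m * ep k n) * (s (g * gdiag M p p' z w i k) * (X i m * Y k n)) +
     (-1) ^ (pr k * pr m + pr k * pr n + pr m * pr n) * (s (g * exch p p' z w i k) * (X k m * Y i n))"
proof -
  interpret central_hom s by fact
  show ?thesis
  proof (cases "i = k")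
    case True
    then show ?thesis
      using assms by (simp add: tmul_sparse_left[OF sparse_rmat(1)[OF s]] tmul_emb12 rmat_simps exch_refl sarr_def neg1_swap[where x = "s _"])
  next
    case False
    have "(-1) ^ (ep k i * ep k m) * ((-1) ^ pr k * (s (g * exch p p' z w i k) * ((-1) ^ (ep k m * ep i n) * (X k m * Y i n)))) =
      (-1) ^ (pr k * pr m + pr k * pr n + pr m * pr n) * (s (g * exch p p' z w i k) * (X k m * Y i n))"
      unfolding neg1_swap[where x = "s _"] neg1_fuse
      by (intro arg_cong2[where f = "(*)"] neg1_cong refl) (simp add: eparity_def, argo)
    then show ?thesis
      using assms False by (simp add: tmul_sparse_left[OF sparse_rmat(1)[OF s]] tmul_emb12 rmat_simps sarr_def
          neg1_swap[where x = "s _"] s_neg1[OF s] mult.assoc)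
  qed
qed

lemma grll_rhs:
  assumes s: "central_hom s" and "i \<in> Ix" "m \<in> Ix" "k \<in> Ix" "n \<in> Ix"
  shows "tmul M N (tmul M N (emb2 Y) (emb1 X)) (sarr s g (rmat z w)) i m k n =
     s (g * gdiag M p p' z w m n) * (Y k n * X i m) +
     (-1) ^ (pr k * pr m + pr k * pr n + pr m * pr n) * (s (g * exch p p' z w n m) * (Y k m * X i n))"
proof -
  interpret central_hom s by fact
  have c: "x * y * s a = s a * (x * y)" for x y a
    by (simp add: central)
  show ?thesis
  proof (cases "m = n")
    case True
    then show ?thesis
      using assms by (simp add: tmul_sparse_right[OF sparse_rmat(1)[OF s]] tmul_emb21 rmat_simps exch_refl sarr_def c)
  next
    case False
    have "(-1) ^ (ep k m * ep n m) * ((-1) ^ pr m * (s (g * exch p p' z w n m) * (Y k m * X i n))) =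
      (-1) ^ (pr k * pr m + pr k * pr n + pr m * pr n) * (s (g * exch p p' z w n m) * (Y k m * X i n))"
      unfolding neg1_fuse
      by (intro arg_cong2[where f = "(*)"] neg1_cong refl) (simp add: eparity_def, argo)
    then show ?thesis
      using assms False by (simp add: tmul_sparse_right[OF sparse_rmat(1)[OF s]] tmul_emb21 rmat_simps sarr_def
          s_neg1[OF s] neg1_swap[where x = "Y k m * X i n"] c)
  qed
qed

lemma grll_array:
  assumes "central_hom s" "central_hom s'"
  shows "grll s s' g z w X Y \<longleftrightarrow> in_range M N
    (tmul M N (sarr s g (rmat z w)) (tmul M N (emb1 X) (emb2 Y)))
    (tmul M N (tmul M N (emb2 Y) (emb1 X)) (sarr s' g (rmat z w)))"
  unfolding in_range_def grll_def
  by (intro ball_cong refl) (simp only: grll_lhs[OF assms(1)] grll_rhs[OF assms(2)])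

lemma ep_even: "i \<le> M \<Longrightarrow> k \<le> M \<Longrightarrow> ep i k = 0"
  by (simp add: eparity_def parity_def)

lemma pr_even: "i \<le> M \<Longrightarrow> pr i = 0" and pr_odd: "M < i \<Longrightarrow> pr i = 1"
  by (simp_all add: parity_def)

lemma grll_ortt_even:
  assumes "grll s s' g z w X Y"
  shows "ortt s s' {1..M} p p' g z w X Y"
  unfolding ortt_def
proof (intro ballI)
  fix i m k n assume *: "i \<in> {1..M}" "m \<in> {1..M}" "k \<in> {1..M}" "n \<in> {1..M}"
  have "gdiag M p p' z w a b = diag p p' z w a b" if "a \<in> {1..M}" for a b
    using that by (simp add: gdiag_def diag_def qev_def)
  then show "s (g * diag p p' z w i k) * (X i m * Y k n) + s (g * exch p p' z w i k) * (X k m * Y i n) =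
     s' (g * diag p p' z w m n) * (Y k n * X i m) + s' (g * exch p p' z w n m) * (Y k m * X i n)"
    using assms[unfolded grll_def, rule_format, of i m k n] * by (simp add: ep_even pr_even)
qed

text \<open>Reversing the product and transposing interchange the two sides of the relation, hence
  also \<open>s\<close> and \<open>s'\<close>. The indices of \<open>exch\<close> are interchanged
  as well, which the reversed order undoes.\<close>

lemma grll_opp:
  fixes X Y :: "nat \<Rightarrow> nat \<Rightarrow> 'a::ring_1"
  assumes s: "central_hom s" and s': "central_hom s'" and XY: "grll s s' g z w X Y"
  shows "rtt.grll (\<lambda>x y. y \<prec> x) M N p p' (\<lambda>k. Opp (s' k)) (\<lambda>k. Opp (s k)) g z w (\<lambda>i j. Opp (X j i)) (\<lambda>i j. Opp (Y j i))"
proof -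
  interpret rv: rtt "\<lambda>x y. y \<prec> x" M N p p'
    by (rule rtt.intro[OF index_order_flip rtt_axioms.intro[OF pp]]) unfold_locales
  interpret s: central_hom s by fact
  interpret s': central_hom s' by fact
  have ex: "rv.exch p p' z w a b = exch p p' z w b a" for a b
    using total[of a b] asym[of a b] asym[of b a] by (auto simp: rv.exch_def exch_def)
  have c: "x * s a = s a * x" "x * s' a = s' a * x" for x a
    by (simp_all add: s.central s'.central)
  have un: "x * unopp ((-1) ^ e) = (-1) ^ e * x" for e and x :: 'a
    by (cases "even e") auto
  show ?thesis
    unfolding rv.grll_def
  proof (intro ballI)
    fix i m k n assume *: "i \<in> Ix" "m \<in> Ix" "k \<in> Ix" "n \<in> Ix"
    let ?e = "ep i m * ep k n" and ?t = "pr k * pr m + pr k * pr n + pr m * pr n"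
      and ?t' = "pr n * pr i + pr n * pr k + pr i * pr k"
    have e: "?e = ep m i * ep n k"
      by (simp add: eparity_def add.commute)
    have eq: "(-1) ^ ?e * (s (g * gdiag M p p' z w m n) * (X m i * Y n k)) +
        (-1) ^ ?t' * (s (g * exch p p' z w m n) * (X n i * Y m k)) =
      s' (g * gdiag M p p' z w i k) * (Y n k * X m i) +
        (-1) ^ ?t' * (s' (g * exch p p' z w k i) * (Y n i * X m k))"
      using XY * unfolding grll_def e by blast
    have f: "(-1) ^ (?e + ?e) = (1 :: 'a)"
      by simp
    have t: "(-1) ^ (?e + ?t') = ((-1) ^ ?t :: 'a)"
      by (rule neg1_cong) (simp add: eparity_def, argo)
    have "s (g * gdiag M p p' z w m n) * (X m i * Y n k) +
        (-1) ^ ?t * (s (g * exch p p' z w m n) * (X n i * Y m k)) =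
      (-1) ^ ?e * (s' (g * gdiag M p p' z w i k) * (Y n k * X m i)) +
        (-1) ^ ?t * (s' (g * exch p p' z w k i) * (Y n i * X m k))"
      using arg_cong[OF eq, of "\<lambda>x. (-1) ^ ?e * x"] unfolding distrib_left neg1_fuse f t by simp
    then show "(-1) ^ ?e * (Opp (s' (g * gdiag M p p' z w i k)) * (Opp (X m i) * Opp (Y n k))) +
       (-1) ^ ?t * (Opp (s' (g * rv.exch p p' z w i k)) * (Opp (X m k) * Opp (Y n i))) =
       Opp (s (g * gdiag M p p' z w m n)) * (Opp (Y n k) * Opp (X m i)) +
       (-1) ^ ?t * (Opp (s (g * rv.exch p p' z w n m)) * (Opp (Y m k) * Opp (X n i)))"
      unfolding opp_eq_iff by (simp add: un ex c)
  qed
qed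

lemma nrm_gdiag:
  "gdiag M p p' z w i i * gdiag M p p' w z i i = nrm z w"
  "i \<noteq> k \<Longrightarrow> gdiag M p p' z w i k * gdiag M p p' w z i k + exch p p' z w i k * exch p p' z w k i = nrm z w"
proof -
  show "gdiag M p p' z w i i * gdiag M p p' w z i i = nrm z w"
    by (simp add: gdiag_def qev_def nrm_def algebra_simps)
  assume ik: "i \<noteq> k"
  have p1: "p * (p' * x) = x" for x
    using pp by (metis mult.assoc mult_1)
  have "exch p p' z w i k * exch p p' z w k i = (p - p') * (p - p') * (z * w)"
    using ik total[of i k] asym[of i k] asym[of k i] by (auto simp: exch_def algebra_simps)
  then show "gdiag M p p' z w i k * gdiag M p p' w z i k + exch p p' z w i k * exch p p' z w k i = nrm z w"
    using ik by (simp add: gdiag_def nrm_def algebra_simps p1)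
qed

lemma tmul_hom:
  assumes "central_hom s"
  shows "s (tmul M N A B i m k n) = tmul M N (\<lambda>i j k l. s (A i j k l)) (\<lambda>i j k l. s (B i j k l)) i m k n"
proof -
  interpret central_hom s by fact
  have "s ((-1) ^ e) = (-1) ^ e" for e
    by (cases "even e") (auto simp: uminus)
  then show ?thesis
    by (simp add: tmul_def sum mult)
qed

text \<open>Unitarity of R. It is checked over the scalars, where entries commute, and carried into
  the ring by \<open>tmul_hom\<close>.\<close>

lemma rinv_rmat_scalar:
  assumes "i \<in> Ix" "m \<in> Ix" "k \<in> Ix" "n \<in> Ix"
  shows "tmul M N (rinv z w) (rmat z w) i m k n = nrm z w * tone i m k n"
    "tmul M N (rmat z w) (rinv z w) i m k n = nrm z w * tone i m k n"
proof -
  have id: "central_hom (\<lambda>x :: 'k. x)"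
    by standard (auto simp: mult.commute)
  have sp: "sparse (rinv z w)" "sparse (rmat z w)"
    using sparse_rmat[OF id, of 1 z w] by (simp_all add: sarr_def[abs_def])
  have off: "gdiag M p p' z w i k = z - w" "gdiag M p p' w z i k = w - z" "gdiag M p p' z w k i = z - w"
    "gdiag M p p' w z k i = w - z" if "i \<noteq> k" for i k
    using that by (auto simp: gdiag_def)
  have sg: "(-1) ^ pr i * ((-1) ^ pr k * (x * (y * (-1) ^ (ep k i * ep k i)))) = x * (y :: 'k)" for i k x y
    by (auto simp: eparity_def parity_def)
  have ekk: "(-1) ^ (a * ep k k) = (1 :: 'k)" for a k
    by (simp add: eparity_def)
  note nd = nrm_gdiag(1)[of z w] nrm_gdiag(2)[of _ _ z w]
  show "tmul M N (rinv z w) (rmat z w) i m k n = nrm z w * tone i m k n"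
  proof (cases "i = k")
    case True
    then show ?thesis
      using assms nd(1)[of i] by (auto simp: tmul_sparse_left[OF sp(1)] rmat_def rinv_def tone_def mult.commute exch_refl)
  next
    case False
    then show ?thesis
      unfolding tmul_sparse_left[OF sp(1) assms(1,3)] rmat_simps(3) rmat_simps(4)[OF False]
      using nd(2)[OF False] False
      by (cases "m = i \<and> n = k"; cases "m = k \<and> n = i")
        (auto simp: rmat_def tone_def sg ekk off mult.commute[of "gdiag _ _ _ _ _ _ _"] algebra_simps)
  qed
  show "tmul M N (rmat z w) (rinv z w) i m k n = nrm z w * tone i m k n"
  proof (cases "i = k")
    case True
    then show ?thesis
      using assms nd(1)[of i] by (auto simp: tmul_sparse_left[OF sp(2)] rmat_def rinv_def tone_def mult.commute exch_refl)
  next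
    case False
    then show ?thesis
      unfolding tmul_sparse_left[OF sp(2) assms(1,3)] rmat_simps(1) rmat_simps(2)[OF False]
      using nd(2)[OF False] False
      by (cases "m = i \<and> n = k"; cases "m = k \<and> n = i")
        (auto simp: rinv_def tone_def sg ekk off mult.commute[of "gdiag _ _ _ _ _ _ _"] algebra_simps)
  qed
qed

lemma rinv_rmat:
  assumes s: "central_hom s"
  shows "in_range M N (tmul M N (sarr s 1 (rinv z w)) (sarr s g (rmat z w))) (sarr s (g * nrm z w) tone)"
    "in_range M N (tmul M N (sarr s g (rmat z w)) (sarr s 1 (rinv z w))) (sarr s (g * nrm z w) tone)"
proof -
  interpret central_hom s by fact
  have *: "tmul M N (\<lambda>i j k l. s (g * A i j k l)) B i m k n = s g * tmul M N (\<lambda>i j k l. s (A i j k l)) B i m k n"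
    "tmul M N B (\<lambda>i j k l. s (g * A i j k l)) i m k n = s g * tmul M N B (\<lambda>i j k l. s (A i j k l)) i m k n"
    for A B i m k n
    by (simp_all add: tmul_def mult sum_distrib_left mult.assoc neg1_swap[where x = "s _"] swap[where x = "B _ _ _ _"])
  show "in_range M N (tmul M N (sarr s 1 (rinv z w)) (sarr s g (rmat z w))) (sarr s (g * nrm z w) tone)"
    "in_range M N (tmul M N (sarr s g (rmat z w)) (sarr s 1 (rinv z w))) (sarr s (g * nrm z w) tone)"
    unfolding in_range_def sarr_def[abs_def] *
    by (simp_all add: rinv_rmat_scalar mult mult.assoc flip: tmul_hom[OF s])
qed

lemma tmul_scalar:
  assumes "central_hom s" "i \<in> Ix" "m \<in> Ix" "k \<in> Ix" "n \<in> Ix"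
  shows "tmul M N (sarr s c tone) Z i m k n = s c * Z i m k n"
    "tmul M N Z (sarr s c tone) i m k n = s c * Z i m k n"
proof -
  interpret central_hom s by fact
  have "sparse (sarr s c tone)"
    by (auto simp: sparse_def sarr_def tone_def)
  then show "tmul M N (sarr s c tone) Z i m k n = s c * Z i m k n"
    "tmul M N Z (sarr s c tone) i m k n = s c * Z i m k n"
    using assms by (auto simp: tmul_sparse_left tmul_sparse_right sarr_def tone_def central)
qed

text \<open>Multiplying the relation by the inverse of R on both sides exchanges the roles of X_1
  Y_2 and Y_2 X_1; after flipping the tensor factors it is the relation for Y and X. The scalar
  \<open>h\<close> inverts what unitarity leaves behind.\<close>

theorem grll_swap:
  fixes X Y :: "nat \<Rightarrow> nat \<Rightarrow> 'a::ring_1"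
  assumes s: "central_hom s" and s': "central_hom s'" and XY: "grll s s' g z w X Y"
    and h: "h * (g * nrm z w) = 1"
  shows "grll s s' h w z Y X"
proof -
  interpret s: central_hom s by fact
  interpret s': central_hom s' by fact
  let ?L = "sarr s g (rmat z w)" and ?R = "sarr s' g (rmat z w)"
  let ?Li = "sarr s 1 (rinv z w)" and ?Ri = "sarr s' 1 (rinv z w)"
  let ?P = "tmul M N (emb1 X) (emb2 Y)" and ?Q = "tmul M N (emb2 Y) (emb1 X)"
  note a = in_range_assoc[of M N] and cg = in_range_tmul and r = in_range_refl
  have "in_range M N (tmul M N (sarr s (g * nrm z w) tone) (tmul M N ?P ?Ri)) (tmul M N (tmul M N ?Li ?L) (tmul M N ?P ?Ri))"
    by (rule cg[OF in_range_sym[OF rinv_rmat(1)[OF s]] r])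
  also have "in_range M N \<dots> (tmul M N ?Li (tmul M N (tmul M N ?L ?P) ?Ri))"
    by (rule in_range_trans[OF a cg[OF r in_range_sym[OF a]]])
  also have "in_range M N \<dots> (tmul M N ?Li (tmul M N (tmul M N ?Q ?R) ?Ri))"
    by (intro cg r XY[unfolded grll_array[OF s s']])
  also have "in_range M N \<dots> (tmul M N (tmul M N ?Li ?Q) (tmul M N ?R ?Ri))"
    by (rule in_range_trans[OF cg[OF r a] in_range_sym[OF a]])
  also have "in_range M N \<dots> (tmul M N (tmul M N ?Li ?Q) (sarr s' (g * nrm z w) tone))"
    by (rule cg[OF r rinv_rmat(2)[OF s']])
  finally have main: "s (g * nrm z w) * tmul M N ?P ?Ri i m k n = s' (g * nrm z w) * tmul M N ?Li ?Q i m k n"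
    if "i \<in> Ix" "m \<in> Ix" "k \<in> Ix" "n \<in> Ix" for i m k n
    using that unfolding in_range_def by (simp add: tmul_scalar[OF s] tmul_scalar[OF s'])
  \<comment> \<open>The scalar stands under \<open>s\<close> on one side and under \<open>s'\<close>
    on the other, so cancelling it takes both images of \<open>h\<close>.\<close>
  have main': "s' h * tmul M N ?P ?Ri i m k n = s h * tmul M N ?Li ?Q i m k n"
    if "i \<in> Ix" "m \<in> Ix" "k \<in> Ix" "n \<in> Ix" for i m k n
  proof -
    have "s' h * (s h * (s (g * nrm z w) * tmul M N ?P ?Ri i m k n)) = s' h * (s h * (s' (g * nrm z w) * tmul M N ?Li ?Q i m k n))"
      using main[OF that] by simp
    then have "s' h * (s (h * (g * nrm z w)) * tmul M N ?P ?Ri i m k n) = s h * (s' (h * (g * nrm z w)) * tmul M N ?Li ?Q i m k n)"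
      by (simp add: s.fuse s'.fuse s.swap[where x = "s' _"])
    then show ?thesis
      by (simp add: h)
  qed
  have ex: "exch p p' w z k i = exch p p' z w i k" for k i
    using total[of i k] asym[of i k] asym[of k i] by (auto simp: exch_def)
  show ?thesis
    unfolding grll_def
  proof (intro ballI)
    fix k n i m assume *: "k \<in> Ix" "n \<in> Ix" "i \<in> Ix" "m \<in> Ix"
    let ?e = "ep k n * ep i m" and ?t = "pr i * pr n + pr i * pr m + pr n * pr m"
    have com: "gdiag M p p' w z a b = gdiag M p p' w z b a" for a b
      by (simp add: gdiag_def)
    have cs: "x * s' a = s' a * x" for x a
      by (simp add: s'.central)
    have one: "(-1) ^ e * ((-1) ^ e * x) = (x :: 'a)" for e x
      by (simp add: neg1_fuse)
    have n1: "s' ((-1) ^ a * x) = (-1) ^ a * s' x" "s ((-1) ^ a * x) = (-1) ^ a * s x" for a x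
      using s_neg1[OF s', of 1 a x] s_neg1[OF s, of 1 a x] by simp_all
    have A: "(-1) ^ ?e * (s' h * tmul M N ?P ?Ri i m k n) =
      s' (h * gdiag M p p' w z n m) * (X i m * Y k n) + (-1) ^ ?t * (s' (h * exch p p' w z m n) * (X i n * Y k m))"
    proof (cases "m = n")
      case True
      have "tmul M N ?P ?Ri i m k n = (-1) ^ ?e * (s' (gdiag M p p' w z m n) * (X i m * Y k n))"
        using * True by (simp add: tmul_sparse_right[OF sparse_rmat(2)[OF s']] tmul_emb12 rmat_simps sarr_def
            mult.assoc s'.central[symmetric] mult.commute[of "ep k n"] neg1_swap[where x = "s' _"])
      then show ?thesis
        using True by (simp add: neg1_swap[where x = "s' _"] one s'.fuse com[of m n] exch_refl)
    next
      case False
      have "tmul M N ?P ?Ri i m k n = (-1) ^ ?e * (s' (gdiag M p p' w z m n) * (X i m * Y k n)) +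
        (-1) ^ (ep k m * ep n m + (ep i n * ep k m + pr m)) * (s' (exch p p' w z m n) * (X i n * Y k m))"
        using * False
        by (simp add: tmul_sparse_right[OF sparse_rmat(2)[OF s']] tmul_emb12 rmat_simps sarr_def n1 ex[of m n]
            mult.assoc mult.commute[of "ep k n"] neg1_swap[where x = "X _ _"] neg1_swap[where x = "Y _ _"]
            s'.swap[where x = "X _ _"] s'.central[where x = "Y _ _", symmetric] power_add)
      moreover have "(-1) ^ (?e + (ep k m * ep n m + (ep i n * ep k m + pr m))) = ((-1) ^ ?t :: 'a)"
        by (rule neg1_cong) (simp add: eparity_def, argo)
      ultimately show ?thesis
        by (simp add: distrib_left neg1_swap[where x = "s' _"] one s'.fuse com[of m n] neg1_fuse)
    qed
    have B: "(-1) ^ ?e * (s h * tmul M N ?Li ?Q i m k n) =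
      (-1) ^ ?e * (s (h * gdiag M p p' w z k i) * (Y k n * X i m)) + (-1) ^ ?t * (s (h * exch p p' w z k i) * (Y i n * X k m))"
    proof (cases "i = k")
      case True
      then show ?thesis
        using * by (simp add: tmul_sparse_left[OF sparse_rmat(2)[OF s]] tmul_emb21 rmat_simps sarr_def s.fuse exch_refl)
    next
      case False
      have "tmul M N ?Li ?Q i m k n = s (gdiag M p p' w z i k) * (Y k n * X i m) +
        (-1) ^ (ep k i * ep k m + pr k) * (s (exch p p' w z k i) * (Y i n * X k m))"
        using * False
        by (simp add: tmul_sparse_left[OF sparse_rmat(2)[OF s]] tmul_emb21 rmat_simps sarr_def n1 ex[of k i]
            mult.assoc power_add)
      moreover have "(-1) ^ (?e + (ep k i * ep k m + pr k)) = ((-1) ^ ?t :: 'a)"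
        by (rule neg1_cong) (simp add: eparity_def, argo)
      ultimately show ?thesis
        by (simp add: distrib_left neg1_swap[where x = "s _"] s.fuse com[of i k] neg1_fuse)
    qed
    show "(-1) ^ ?e * (s (h * gdiag M p p' w z k i) * (Y k n * X i m)) + (-1) ^ ?t * (s (h * exch p p' w z k i) * (Y i n * X k m)) =
      s' (h * gdiag M p p' w z n m) * (X i m * Y k n) + (-1) ^ ?t * (s' (h * exch p p' w z m n) * (X i n * Y k m))"
      using main'[of i m k n] * unfolding A[symmetric] B[symmetric] by simp
  qed
qed

text \<open>The inverse V of Y brings R between V and X. As the row \<open>i\<close> is even and the
  column \<open>b\<close> odd, the left-hand side has no exchange term and R contributes only
  \<open>z - w\<close>.\<close>

lemma grll_KL:
  fixes X Y :: "nat \<Rightarrow> nat \<Rightarrow> 'a::ring_1"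
  assumes s: "central_hom s" and s': "central_hom s'" and XY: "grll s s' g z w X Y"
    and V: "sinverse M N Y V" and i: "i \<in> {1..M}" and b: "b \<in> {M+1..M+N}" and c: "c \<in> Ix" and r: "r \<in> Ix"
  shows "s (g * (z - w)) * (V r b * X i c) =
    (-1) ^ (ep r b * ep i c) * (s' (g * gdiag M p p' z w c r) * (X i c * V r b)) +
    (if r = c then \<Sum>n\<in>Ix - {c}. s' (g * ((-1) ^ pr c * exch p p' z w n c)) * (X i n * V n b) else 0)"
proof -
  interpret s: central_hom s by fact
  interpret s': central_hom s' by fact
  have i': "i \<in> Ix" "i \<le> M" and b': "b \<in> Ix" "M < b" and ib: "i \<noteq> b"
    using i b by auto
  let ?L = "sarr s g (rmat z w)" and ?R = "sarr s' g (rmat z w)"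
  have *: "in_range M N (tmul M N (emb2 V) (tmul M N ?L (emb1 X))) (tmul M N (emb1 X) (tmul M N ?R (emb2 V)))"
    by (rule tmul_cancel[OF XY[unfolded grll_array[OF s s']]])
      (rule sinverse_emb2[OF V] sinverse_emb2[OF sinverse_sym[OF V]])+
  have "tmul M N (emb2 V) (tmul M N ?L (emb1 X)) i c r b = (\<Sum>l\<in>Ix. if l = b then s (g * (z - w)) * (V r b * X i c) else 0)"
    unfolding tmul_emb2_left[OF i'(1)]
  proof (intro sum.cong refl)
    fix l assume l: "l \<in> Ix"
    show "(-1) ^ (ep l b * ep r l) * (V r l * tmul M N ?L (emb1 X) i c l b) = (if l = b then s (g * (z - w)) * (V r b * X i c) else 0)"
      using l i' ib by (auto simp: tmul_sparse_left[OF sparse_rmat(1)[OF s]] emb1_def rmat_simps sarr_def gdiag_def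
          s.swap[where x = "V _ _"] eparity_def)
  qed
  then have lhs: "tmul M N (emb2 V) (tmul M N ?L (emb1 X)) i c r b = s (g * (z - w)) * (V r b * X i c)"
    using b' by simp
  have "tmul M N (emb1 X) (tmul M N ?R (emb2 V)) i c r b = (\<Sum>j\<in>Ix.
      (if j = c then (-1) ^ (ep r b * ep i c) * (s' (g * gdiag M p p' z w c r) * (X i c * V r b)) else 0) +
      (if r = c \<and> j \<noteq> c then s' (g * ((-1) ^ pr c * exch p p' z w j c)) * (X i j * V j b) else 0))"
    unfolding tmul_emb1_left[OF r]
  proof (intro sum.cong refl)
    fix j assume j: "j \<in> Ix"
    have sg: "(-1) ^ ((ep j r + ep r b) * ep i j) = (1 :: 'a)" 
      using i' b' by (auto simp: eparity_def parity_def)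
    show "(-1) ^ ((ep j c + ep r b) * ep i j) * (X i j * tmul M N ?R (emb2 V) j c r b) =
      (if j = c then (-1) ^ (ep r b * ep i c) * (s' (g * gdiag M p p' z w c r) * (X i c * V r b)) else 0) +
      (if r = c \<and> j \<noteq> c then s' (g * ((-1) ^ pr c * exch p p' z w j c)) * (X i j * V j b) else 0)"
    proof (cases "j = c")
      case True
      have "(-1) ^ ((ep c c + ep r b) * ep i c) = ((-1) ^ (ep r b * ep i c) :: 'a)"
        by (rule neg1_cong) (simp add: eparity_def)
      then show ?thesis
        using True c r by (simp add: tmul_sparse_left[OF sparse_rmat(1)[OF s']] emb2_def rmat_simps sarr_def s'.swap[where x = "X _ _"])
    next
      case False
      then show ?thesis
        using j r sg by (auto simp: tmul_sparse_left[OF sparse_rmat(1)[OF s']] emb2_def rmat_simps sarr_def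
            s'.swap[where x = "X _ _"] eparity_def)
    qed
  qed
  also have "\<dots> = (-1) ^ (ep r b * ep i c) * (s' (g * gdiag M p p' z w c r) * (X i c * V r b)) +
    (if r = c then \<Sum>n\<in>Ix - {c}. s' (g * ((-1) ^ pr c * exch p p' z w n c)) * (X i n * V n b) else 0)"
  proof -
    have "(\<Sum>j\<in>Ix. if j \<noteq> c then f j else 0) = (\<Sum>n\<in>Ix - {c}. f n)" for f :: "nat \<Rightarrow> 'a"
      by (rule sum.mono_neutral_cong_right) auto
    then show ?thesis
      using c by (simp add: sum.distrib)
  qed
  finally show ?thesis
    using * i' b' c r lhs unfolding in_range_def by simp
qed

text \<open>Inverting both matrices reverses the relation. On odd indices q_i is inverted and
  exchange terms change sign; transposition and the reversed order then restore the ungraded form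
  with \<open>p\<close> and \<open>p'\<close> interchanged.\<close>

lemma grll_KK:
  fixes X Y :: "nat \<Rightarrow> nat \<Rightarrow> 'a::ring_1"
  assumes s: "central_hom s" and s': "central_hom s'" and XY: "grll s s' g z w X Y"
    and U: "sinverse M N X U" and V: "sinverse M N Y V"
  shows "index_order.ortt (\<lambda>x y. y \<prec> x) s s' {M+1..M+N} p' p g z w (\<lambda>i j. U j i) (\<lambda>i j. V j i)"
proof -
  interpret rv: index_order "\<lambda>x y. y \<prec> x"
    by (rule index_order_flip) unfold_locales
  interpret s: central_hom s by fact
  interpret s': central_hom s' by fact
  let ?L = "sarr s g (rmat z w)" and ?R = "sarr s' g (rmat z w)"
  have *: "in_range M N (tmul M N (tmul M N (emb1 U) (emb2 V)) ?L) (tmul M N ?R (tmul M N (emb2 V) (emb1 U)))"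
    by (rule tmul_cancel2[OF tmul_cancel[OF XY[unfolded grll_array[OF s s']]]])
      (rule sinverse_emb2[OF V] sinverse_emb2[OF sinverse_sym[OF V]] sinverse_emb1[OF U] sinverse_emb1[OF sinverse_sym[OF U]])+
  have ex: "exch p p' z w k i = - rv.exch p' p z w i k" for i k
    by (auto simp: exch_def rv.exch_def algebra_simps)
  show ?thesis
    unfolding rv.ortt_def
  proof (intro ballI)
    fix i m k n assume J: "i \<in> {M+1..M+N}" "m \<in> {M+1..M+N}" "k \<in> {M+1..M+N}" "n \<in> {M+1..M+N}"
    then have r: "i \<in> Ix" "m \<in> Ix" "k \<in> Ix" "n \<in> Ix"
      by auto
    have gd: "gdiag M p p' z w a b = rv.diag p' p z w a b" if "a \<in> {M+1..M+N}" for a b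
      using that by (simp add: gdiag_def rv.diag_def qev_def)
    have e: "even (ep a b)" if "a \<in> {M+1..M+N}" "b \<in> {M+1..M+N}" for a b
      using that by (simp add: eparity_def pr_odd)
    have po: "(-1) ^ pr a = (-1 :: 'k)" if "a \<in> {M+1..M+N}" for a
      using that by (simp add: pr_odd)
    have c: "x * s a = s a * x" for x a
      by (simp add: s.central)
    have "tmul M N (tmul M N (emb1 U) (emb2 V)) ?L m i n k =
      s (g * rv.diag p' p z w i k) * (U m i * V n k) + s (g * rv.exch p' p z w i k) * (U m k * V n i)"
    proof (cases "i = k")
      case True
      then show ?thesis
        using r J by (simp add: tmul_sparse_right[OF sparse_rmat(1)[OF s]] tmul_emb12 e rmat_simps sarr_def gd rv.exch_def c)
    next
      case False
      then show ?thesis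
        using r J by (simp add: tmul_sparse_right[OF sparse_rmat(1)[OF s]] tmul_emb12 e rmat_simps sarr_def gd ex po c)
    qed
    moreover have "tmul M N ?R (tmul M N (emb2 V) (emb1 U)) m i n k =
      s' (g * rv.diag p' p z w m n) * (V n k * U m i) + s' (g * rv.exch p' p z w n m) * (V m k * U n i)"
    proof (cases "m = n")
      case True
      then show ?thesis
        using r J by (simp add: tmul_sparse_left[OF sparse_rmat(1)[OF s']] tmul_emb21 e rmat_simps sarr_def gd rv.exch_def)
    next
      case False
      then show ?thesis
        using r J by (simp add: tmul_sparse_left[OF sparse_rmat(1)[OF s']] tmul_emb21 e rmat_simps sarr_def gd ex po)
    qed
    ultimately show "s (g * rv.diag p' p z w i k) * (U m i * V n k) + s (g * rv.exch p' p z w i k) * (U m k * V n i) =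
      s' (g * rv.diag p' p z w m n) * (V n k * U m i) + s' (g * rv.exch p' p z w n m) * (V m k * U n i)"
      using * r unfolding in_range_def by simp
  qed
qed

end

unbundle fps_syntax

section \<open>Generating series, and the defining relations coefficient by coefficient\<close>

section \<open>Formal series in two variables\<close>

text \<open>Multiplies the variable by \<open>c\<close>; shifts of a spectral parameter by powers of
  q act in this way.\<close>

definition dil :: "'q::field \<Rightarrow> 'q fps \<Rightarrow> 'q fps" where
  "dil c F = Abs_fps (\<lambda>n. c ^ n * F $ n)"

lemma dil_mult: "dil c (F * G) = dil c F * dil c G"
proof (rule fps_ext)
  fix n
  have "dil c (F * G) $ n = (\<Sum>i=0..n. c ^ n * (F $ i * G $ (n - i)))"
    by (simp add: dil_def fps_mult_nth sum_distrib_left)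
  also have "\<dots> = (\<Sum>i=0..n. c ^ i * F $ i * (c ^ (n - i) * G $ (n - i)))"
  proof (rule sum.cong[OF refl])
    fix i assume "i \<in> {0..n}"
    then have "c ^ n = c ^ i * c ^ (n - i)"
      by (simp flip: power_add)
    then show "c ^ n * (F $ i * G $ (n - i)) = c ^ i * F $ i * (c ^ (n - i) * G $ (n - i))"
      by simp
  qed
  finally show "dil c (F * G) $ n = (dil c F * dil c G) $ n"
    by (simp add: dil_def fps_mult_nth)
qed

lemma dil_simps [simp]: "dil c 1 = 1" "dil c (F + G) = dil c F + dil c G" "dil c (F - G) = dil c F - dil c G"
  "dil c (fps_const a) = fps_const a" "dil c fps_X = fps_const c * fps_X"
  by (auto simp: fps_eq_iff dil_def algebra_simps)

text \<open>Substitutes the product of the inner and the outer variable.\<close>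

definition tsub :: "'q::field fps \<Rightarrow> 'q fps fps" where
  "tsub G = Abs_fps (\<lambda>m. Abs_fps (\<lambda>n. if m = n then G $ m else 0))"

definition kc :: "'q::field \<Rightarrow> 'q fps fps" where
  "kc c = fps_const (fps_const c)"

lemma tsub_mult: "tsub (F * G) = tsub F * tsub G"
proof (rule fps_ext, rule fps_ext)
  fix m n
  have "(tsub F * tsub G) $ m $ n = (\<Sum>i=0..m. \<Sum>j=0..n. (if i = j then F $ i else 0) * (if m - i = n - j then G $ (m - i) else 0))"
    by (simp add: fps_mult_nth fps_sum_nth tsub_def)
  also have "\<dots> = (\<Sum>i=0..m. if m = n then F $ i * G $ (m - i) else 0)"
  proof (rule sum.cong[OF refl])
    fix i assume i: "i \<in> {0..m}"
    have "(\<Sum>j=0..n. (if i = j then F $ i else 0) * (if m - i = n - j then G $ (m - i) else 0)) =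
      (\<Sum>j=0..n. if j = i then F $ i * (if m - i = n - i then G $ (m - i) else 0) else 0)"
      by (intro sum.cong) auto
    also have "\<dots> = (if m = n then F $ i * G $ (m - i) else 0)"
      using i by auto
    finally show "(\<Sum>j=0..n. (if i = j then F $ i else 0) * (if m - i = n - j then G $ (m - i) else 0)) = \<dots>" .
  qed
  also have "\<dots> = tsub (F * G) $ m $ n"
    by (simp add: tsub_def fps_mult_nth)
  finally show "tsub (F * G) $ m $ n = (tsub F * tsub G) $ m $ n" ..
qed

lemma tsub_simps [simp]: "tsub (F + G) = tsub F + tsub G" "tsub (F - G) = tsub F - tsub G" "tsub (fps_const a) = kc a"
  "tsub 1 = 1"
  by (auto simp: fps_eq_iff tsub_def kc_def)

lemma kc_simps: "kc 1 = 1" "kc 0 = 0" "kc (a + b) = kc a + kc b" "kc (a * b) = kc a * kc b" "kc (a - b) = kc a - kc b" "kc (- a) = - kc a"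
  by (simp_all add: kc_def fps_const_mult[symmetric] fps_const_add[symmetric] fps_const_sub[symmetric] fps_const_neg[symmetric]
      del: fps_const_mult fps_const_add fps_const_sub fps_const_neg)

definition Zv :: "'q::field fps fps" where "Zv = fps_const fps_X"

text \<open>Two commuting variables are modelled by iterated power series, and the embeddings place
  a generating series in the inner or the outer one. A coefficient of a product of both is then a
  product of two single coefficients.\<close>

definition emb_in :: "'u::ring_1 fps \<Rightarrow> 'u fps fps" where "emb_in f = fps_const f"
definition emb_out :: "'u::ring_1 fps \<Rightarrow> 'u fps fps" where "emb_out g = Abs_fps (\<lambda>m. fps_const (g $ m))"

lemma emb_nth: "(emb_in f * emb_out g) $ m $ n = f $ n * g $ m" "(emb_out g * emb_in f) $ m $ n = g $ m * f $ n"
  by (simp_all add: emb_in_def emb_out_def)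

locale qc_ring = usc: central_hom usc
  for usc :: "'q::field \<Rightarrow> 'u::ring_1" +
  fixes qc :: "int \<Rightarrow> 'u"
  assumes qc_0: "qc 0 = 1" and qc_add: "qc (a + b) = qc a * qc b" and qc_central: "qc a * x = x * qc a"
begin

text \<open>Multiplies the inner variable by q^(-\<epsilon> c). As x^(-1) is the product of both
  variables, this is the passage from R(x) to R(x q^(\<epsilon> c)).\<close>

definition sc :: "int \<Rightarrow> 'q fps fps \<Rightarrow> 'u fps fps" where
  "sc \<epsilon> F = Abs_fps (\<lambda>m. Abs_fps (\<lambda>n. usc (F $ m $ n) * qc (- \<epsilon> * int n)))"

lemma sc_nth: "sc \<epsilon> F $ m $ n = usc (F $ m $ n) * qc (- \<epsilon> * int n)"
  by (simp add: sc_def)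

lemma prod_nth: "(F * G) $ m $ n = (\<Sum>i=0..m. \<Sum>j=0..n. F $ i $ j * G $ (m - i) $ (n - j))"
  for F G :: "'x::ring_1 fps fps"
  by (simp add: fps_mult_nth fps_sum_nth)

lemma sc_hom: "central_hom (sc \<epsilon>)"
proof
  show "sc \<epsilon> 1 = 1"
    by (auto simp: fps_eq_iff sc_nth qc_0)
  show "sc \<epsilon> (a + b) = sc \<epsilon> a + sc \<epsilon> b" for a b
    by (auto simp: fps_eq_iff sc_nth usc.add distrib_right)
  show "sc \<epsilon> (a * b) = sc \<epsilon> a * sc \<epsilon> b" for a b
  proof (rule fps_ext, rule fps_ext)
    fix m n
    have "sc \<epsilon> (a * b) $ m $ n = (\<Sum>i=0..m. \<Sum>j=0..n. usc (a $ i $ j * b $ (m - i) $ (n - j)) * qc (- \<epsilon> * int n))"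
      by (simp add: sc_nth prod_nth usc.sum sum_distrib_right)
    also have "\<dots> = (\<Sum>i=0..m. \<Sum>j=0..n. sc \<epsilon> a $ i $ j * sc \<epsilon> b $ (m - i) $ (n - j))"
    proof (intro sum.cong refl)
      fix i j assume "j \<in> {0..n}"
      then have e: "- \<epsilon> * int n = - \<epsilon> * int j + - \<epsilon> * int (n - j)"
        by (simp add: algebra_simps of_nat_diff)
      show "usc (a $ i $ j * b $ (m - i) $ (n - j)) * qc (- \<epsilon> * int n) = sc \<epsilon> a $ i $ j * sc \<epsilon> b $ (m - i) $ (n - j)"
        unfolding e sc_nth by (simp only: qc_add usc.mult mult.assoc usc.swap[where x = "qc _"])
    qed
    finally show "sc \<epsilon> (a * b) $ m $ n = (sc \<epsilon> a * sc \<epsilon> b) $ m $ n"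
      by (simp add: prod_nth)
  qed
  show "sc \<epsilon> a * x = x * sc \<epsilon> a" for a x
  proof (rule fps_ext, rule fps_ext)
    fix m n
    have "(sc \<epsilon> a * x) $ m $ n = (\<Sum>i=0..m. \<Sum>j=0..n. x $ (m - i) $ (n - j) * sc \<epsilon> a $ i $ j)"
    proof -
      have "usc u * qc v * y = y * (usc u * qc v)" for u v y
        using qc_central[of v y] usc.swap[of y u "qc v"] by (simp add: mult.assoc)
      then show ?thesis
        by (simp add: prod_nth sc_nth)
    qed
    also have "\<dots> = (\<Sum>i=0..m. \<Sum>j=0..n. x $ i $ j * sc \<epsilon> a $ (m - i) $ (n - j))"
      by (rule sum.reindex_bij_witness[where i = "\<lambda>i. m - i" and j = "\<lambda>i. m - i"], simp, simp, simp, simp)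
        (rule sum.reindex_bij_witness[where i = "\<lambda>i. n - i" and j = "\<lambda>i. n - i"], auto)
    finally show "(sc \<epsilon> a * x) $ m $ n = (x * sc \<epsilon> a) $ m $ n"
      by (simp add: prod_nth)
  qed
qed

text \<open>On constants all maps \<open>sc \<epsilon>\<close> agree; the cancellation in the mixed
  case rests on this.\<close>

lemma sc_kc: "sc \<epsilon> (kc c) = fps_const (fps_const (usc c))"
  by (auto simp: fps_eq_iff sc_nth kc_def qc_0)

lemma sc_tsub_mult_nth:
  "(sc \<epsilon> (tsub G) * H) $ m $ n = (\<Sum>p\<le>min m n. usc (G $ p) * qc (- \<epsilon> * int p) * H $ (m - p) $ (n - p))"
proof -
  have "(sc \<epsilon> (tsub G) * H) $ m $ n = (\<Sum>i=0..m. \<Sum>j=0..n. if j = i then usc (G $ i) * qc (- \<epsilon> * int i) * H $ (m - i) $ (n - i) else 0)"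
    unfolding prod_nth by (intro sum.cong refl) (auto simp: sc_nth tsub_def)
  also have "\<dots> = (\<Sum>i=0..m. if i \<le> n then usc (G $ i) * qc (- \<epsilon> * int i) * H $ (m - i) $ (n - i) else 0)"
    by (intro sum.cong refl) simp
  also have "\<dots> = (\<Sum>p\<le>min m n. usc (G $ p) * qc (- \<epsilon> * int p) * H $ (m - p) $ (n - p))"
    by (rule sum.mono_neutral_cong_right) auto
  finally show ?thesis .
qed

lemma sc_linear_mult_nth:
  "(sc \<epsilon> (fps_X * kc a + Zv * kc b) * H) $ m $ n =
    (if m = 0 then 0 else usc a * H $ (m - 1) $ n) + (if n = 0 then 0 else usc b * qc (- \<epsilon>) * H $ m $ (n - 1))"
proof -
  interpret S: central_hom "sc \<epsilon>" by (rule sc_hom)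
  have X: "sc \<epsilon> fps_X = fps_X"
    by (auto simp: fps_eq_iff sc_nth fps_X_def qc_0)
  have Z: "sc \<epsilon> Zv = fps_const (fps_const (qc (- \<epsilon>)) * fps_X)"
    by (auto simp: fps_eq_iff sc_nth Zv_def fps_X_def)
  have "(sc \<epsilon> (fps_X * kc a + Zv * kc b) * H) = fps_const (fps_const (usc a)) * (fps_X * H) +
      fps_const (fps_const (usc b)) * (fps_const (fps_const (qc (- \<epsilon>)) * fps_X) * H)"
    using S.central[of "kc a" fps_X] S.central[of "kc b" "sc \<epsilon> Zv"]
    by (simp add: S.add S.mult sc_kc X Z distrib_right mult.assoc[symmetric])
  then show ?thesis
    by (cases m; cases n) (auto simp: mult.assoc)
qed

definition udil :: "'q \<Rightarrow> 'u fps \<Rightarrow> 'u fps" where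
  "udil c f = Abs_fps (\<lambda>n. usc (c ^ n) * f $ n)"

lemma udil_nth: "udil c f $ n = usc (c ^ n) * f $ n"
  by (simp add: udil_def)

text \<open>The entries of R(z, w) are linear forms in z and w: \<open>ga\<close> and
  \<open>gb\<close> are the coefficients on the diagonal, \<open>xa\<close> and \<open>xb\<close>
  those of the exchange entries.\<close>

definition ga :: "nat \<Rightarrow> 'q \<Rightarrow> 'q \<Rightarrow> nat \<Rightarrow> nat \<Rightarrow> 'q" where "ga M q q' i k = (if i = k then qev M q q' i else 1)"
definition gb :: "nat \<Rightarrow> 'q \<Rightarrow> 'q \<Rightarrow> nat \<Rightarrow> nat \<Rightarrow> 'q" where "gb M q q' i k = (if i = k then - qev M q' q i else - 1)"
definition xa :: "'q \<Rightarrow> 'q \<Rightarrow> nat \<Rightarrow> nat \<Rightarrow> 'q" where "xa q q' i k = (if i < k then q - q' else 0)"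
definition xb :: "'q \<Rightarrow> 'q \<Rightarrow> nat \<Rightarrow> nat \<Rightarrow> 'q" where "xb q q' i k = (if k < i then q - q' else 0)"

end

interpretation nat_order: index_order "(<) :: nat \<Rightarrow> nat \<Rightarrow> bool"
  by unfold_locales auto

context qc_ring
begin

lemma gdiag_linear: "gdiag M (kc q) (kc q') z w i k = z * kc (ga M q q' i k) + w * kc (gb M q q' i k)"
  by (auto simp: gdiag_def ga_def gb_def qev_def kc_simps)

lemma exch_linear: "nat_order.exch (kc q) (kc q') z w i k = z * kc (xa q q' i k) + w * kc (xb q q' i k)"
  by (auto simp: nat_order.exch_def xa_def xb_def kc_simps)

text \<open>The four terms of the RLL relation in a fixed degree: \<open>\<phi> a b u v\<close> and \<open>\<psi> a b u v\<close>
  stand for coefficients of \<open>u v\<close> and \<open>v u\<close>, multiplied by the scalar \<open>a z + b w\<close>.\<close>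

definition rel4 :: "nat \<Rightarrow> 'q \<Rightarrow> 'q \<Rightarrow> nat \<Rightarrow> nat \<Rightarrow> nat \<Rightarrow> nat
    \<Rightarrow> ('q \<Rightarrow> 'q \<Rightarrow> 'u fps \<Rightarrow> 'u fps \<Rightarrow> 'u) \<Rightarrow> ('q \<Rightarrow> 'q \<Rightarrow> 'u fps \<Rightarrow> 'u fps \<Rightarrow> 'u)
    \<Rightarrow> (nat \<Rightarrow> nat \<Rightarrow> 'u fps) \<Rightarrow> (nat \<Rightarrow> nat \<Rightarrow> 'u fps) \<Rightarrow> bool" where
  "rel4 M q q' i m k n \<phi> \<psi> f g \<longleftrightarrow>
    (-1) ^ (eparity M i m * eparity M k n) * \<phi> (ga M q q' i k) (gb M q q' i k) (f i m) (g k n) +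
    (-1) ^ (parity M k * parity M m + parity M k * parity M n + parity M m * parity M n) *
      \<phi> (xa q q' i k) (xb q q' i k) (f k m) (g i n) =
    \<psi> (ga M q q' m n) (gb M q q' m n) (f i m) (g k n) +
    (-1) ^ (parity M k * parity M m + parity M k * parity M n + parity M m * parity M n) *
      \<psi> (xa q q' n m) (xb q q' n m) (f i n) (g k m)"

text \<open>Reduces an identity of two-variable series to one identity per bidegree. The factor
  \<open>\<kappa>\<close>, common to the four terms of a bidegree, absorbs the powers of q that come
  from a shift.\<close>

lemma grll_series:
  assumes qq: "q * q' = 1"
    and left: "\<And>a b i m k n \<mu> \<nu>. (s (G * (z * kc a + w * kc b)) * (X i m * Y k n)) $ \<mu> $ \<nu> = usc (\<kappa> \<mu> \<nu>) * \<phi> \<mu> \<nu> a b (f i m) (g k n)"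
    and right: "\<And>a b i m k n \<mu> \<nu>. (s' (G * (z * kc a + w * kc b)) * (Y k n * X i m)) $ \<mu> $ \<nu> = usc (\<kappa> \<mu> \<nu>) * \<psi> \<mu> \<nu> a b (f i m) (g k n)"
    and rel: "\<And>\<mu> \<nu> i m k n. i \<in> {1..M+N} \<Longrightarrow> m \<in> {1..M+N} \<Longrightarrow> k \<in> {1..M+N} \<Longrightarrow> n \<in> {1..M+N} \<Longrightarrow>
      rel4 M q q' i m k n (\<phi> \<mu> \<nu>) (\<psi> \<mu> \<nu>) f g"
  shows "rtt.grll (<) M N (kc q) (kc q') s s' G z w X Y"
proof -
  interpret r: rtt "(<)" M N "kc q" "kc q'"
    by unfold_locales (simp add: qq kc_simps flip: kc_simps(4))
  have neg: "((-1) ^ e * F) $ \<mu> $ \<nu> = (-1) ^ e * F $ \<mu> $ \<nu>" for e \<mu> \<nu> and F :: "'u fps fps"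
    by (cases "even e") auto
  have comm: "(-1) ^ e * (usc a * x) = usc a * ((-1) ^ e * x)" for e a x
    by (cases "even e") auto
  show ?thesis
    unfolding r.grll_def gdiag_linear exch_linear
  proof (intro ballI fps_ext)
    fix i m k n \<mu> \<nu> assume "i \<in> {1..M+N}" "m \<in> {1..M+N}" "k \<in> {1..M+N}" "n \<in> {1..M+N}"
    note fact = rel[OF this, of \<mu> \<nu>, unfolded rel4_def, THEN arg_cong, of "\<lambda>x. usc (\<kappa> \<mu> \<nu>) * x", unfolded distrib_left]
    show "((-1) ^ (r.ep i m * r.ep k n) * (s (G * (z * kc (ga M q q' i k) + w * kc (gb M q q' i k))) * (X i m * Y k n)) +
        (-1) ^ (r.pr k * r.pr m + r.pr k * r.pr n + r.pr m * r.pr n) *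
        (s (G * (z * kc (xa q q' i k) + w * kc (xb q q' i k))) * (X k m * Y i n))) $ \<mu> $ \<nu> =
       (s' (G * (z * kc (ga M q q' m n) + w * kc (gb M q q' m n))) * (Y k n * X i m) +
        (-1) ^ (r.pr k * r.pr m + r.pr k * r.pr n + r.pr m * r.pr n) *
        (s' (G * (z * kc (xa q q' n m) + w * kc (xb q q' n m))) * (Y k m * X i n))) $ \<mu> $ \<nu>"
      unfolding fps_add_nth neg left right comm by (rule fact)
  qed
qed

text \<open>A coefficient of G0 (a + b x^(-1)) times a product of two matrix entries;
  \<open>p\<close> is the exponent of x^(-1).\<close>

definition conv :: "'q fps \<Rightarrow> int \<Rightarrow> 'q \<Rightarrow> 'q \<Rightarrow> (nat \<Rightarrow> 'u) \<Rightarrow> nat \<Rightarrow> 'u" where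
  "conv G0 \<epsilon> a b P l = (\<Sum>p\<le>l. usc ((G0 * (fps_const a + fps_const b * fps_X)) $ p) * qc (- \<epsilon> * int p) * P p)"

lemma sc_tsub_dil_nth:
  assumes "\<And>\<mu> \<nu>. P $ \<mu> $ \<nu> = usc (c ^ \<nu>) * P0 \<mu> \<nu>"
  shows "(sc \<epsilon> (tsub (dil c H)) * P) $ \<mu> $ \<nu> =
    usc (c ^ \<nu>) * (\<Sum>p\<le>min \<mu> \<nu>. usc (H $ p) * qc (- \<epsilon> * int p) * P0 (\<mu> - p) (\<nu> - p))"
proof -
  have "usc (dil c H $ p) * qc (- \<epsilon> * int p) * (usc (c ^ (\<nu> - p)) * x) = usc (c ^ \<nu>) * (usc (H $ p) * qc (- \<epsilon> * int p) * x)"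
    if "p \<le> \<nu>" for p x
  proof -
    have "c ^ \<nu> = c ^ p * c ^ (\<nu> - p)"
      using that by (simp flip: power_add)
    then have e: "c ^ p * (H $ p * c ^ (\<nu> - p)) = c ^ \<nu> * H $ p"
      by (simp only: mult_ac)
    show ?thesis
      by (simp add: dil_def mult.assoc usc.swap[where x = "qc _"] usc.fuse e)
  qed
  then show ?thesis
    unfolding sc_tsub_mult_nth assms sum_distrib_left by (intro sum.cong refl) auto
qed

text \<open>The inner variable belongs to the matrix whose spectral parameter is shifted by a
  power of \<open>q\<close>, the outer variable to the other one; \<open>x\<^sup>-\<^sup>1\<close> is the product of both.\<close>

theorem grll_mixed_in:
  assumes qq: "q * q' = 1" and c: "c * c' = 1"
    and rel: "\<And>\<mu> \<nu> i m k n. i \<in> {1..M+N} \<Longrightarrow> m \<in> {1..M+N} \<Longrightarrow> k \<in> {1..M+N} \<Longrightarrow> n \<in> {1..M+N} \<Longrightarrow>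
      rel4 M q q' i m k n (\<lambda>a b u v. conv G0 1 a b (\<lambda>p. u $ (\<nu> - p) * v $ (\<mu> - p)) (min \<mu> \<nu>))
        (\<lambda>a b u v. conv G0 (- 1) a b (\<lambda>p. v $ (\<mu> - p) * u $ (\<nu> - p)) (min \<mu> \<nu>)) f g"
  shows "rtt.grll (<) M N (kc q) (kc q') (sc 1) (sc (- 1)) (kc c * tsub (dil c G0)) (kc c') (tsub fps_X)
    (\<lambda>i j. emb_in (udil c (f i j))) (\<lambda>i j. emb_out (g i j))"
proof (rule grll_series[OF qq _ _ rel])
  \<comment> \<open>The parameters are normalised to z = c' and w = x^(-1). The factor
    \<open>c\<close> then makes the linear form equal to a + b x^(-1) dilated by \<open>c\<close>,
    so that a single dilated series remains.\<close>
  have G: "kc c * tsub (dil c G0) * (kc c' * kc a + tsub fps_X * kc b) =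
      tsub (dil c (G0 * (fps_const a + fps_const b * fps_X)))" for a b
  proof -
    have "kc c * kc c' = 1"
      using c by (metis kc_simps(1,4))
    then have e: "kc c * (kc c' * x) = x" for x
      by (simp add: mult.assoc[symmetric])
    show ?thesis
      by (simp add: dil_mult tsub_mult algebra_simps e)
  qed
  show "(sc 1 (kc c * tsub (dil c G0) * (kc c' * kc a + tsub fps_X * kc b)) *
      (emb_in (udil c (f i m)) * emb_out (g k n))) $ \<mu> $ \<nu> =
    usc (c ^ \<nu>) * conv G0 1 a b (\<lambda>p. f i m $ (\<nu> - p) * g k n $ (\<mu> - p)) (min \<mu> \<nu>)" for a b i m k n \<mu> \<nu>
    unfolding G conv_def by (rule sc_tsub_dil_nth) (simp add: emb_nth udil_nth mult.assoc)
  show "(sc (- 1) (kc c * tsub (dil c G0) * (kc c' * kc a + tsub fps_X * kc b)) *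
      (emb_out (g k n) * emb_in (udil c (f i m)))) $ \<mu> $ \<nu> =
    usc (c ^ \<nu>) * conv G0 (- 1) a b (\<lambda>p. g k n $ (\<mu> - p) * f i m $ (\<nu> - p)) (min \<mu> \<nu>)" for a b i m k n \<mu> \<nu>
    unfolding G conv_def by (rule sc_tsub_dil_nth) (simp add: emb_nth udil_nth usc.swap)
qed

theorem grll_mixed_out:
  assumes qq: "q * q' = 1"
    and rel: "\<And>\<mu> \<nu> i m k n. i \<in> {1..M+N} \<Longrightarrow> m \<in> {1..M+N} \<Longrightarrow> k \<in> {1..M+N} \<Longrightarrow> n \<in> {1..M+N} \<Longrightarrow>
      rel4 M q q' i m k n (\<lambda>a b u v. conv G0 1 a b (\<lambda>p. u $ (\<mu> - p) * v $ (\<nu> - p)) (min \<mu> \<nu>))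
        (\<lambda>a b u v. conv G0 (- 1) a b (\<lambda>p. v $ (\<nu> - p) * u $ (\<mu> - p)) (min \<mu> \<nu>)) f g"
  shows "rtt.grll (<) M N (kc q) (kc q') (sc 1) (sc (- 1)) (tsub (dil c G0)) 1 (kc c * tsub fps_X)
    (\<lambda>i j. emb_out (f i j)) (\<lambda>i j. emb_in (udil c (g i j)))"
proof (rule grll_series[OF qq _ _ rel])
  have G: "tsub (dil c G0) * (1 * kc a + kc c * tsub fps_X * kc b) =
      tsub (dil c (G0 * (fps_const a + fps_const b * fps_X)))" for a b
    by (simp add: dil_mult tsub_mult algebra_simps)
  show "(sc 1 (tsub (dil c G0) * (1 * kc a + kc c * tsub fps_X * kc b)) *
      (emb_out (f i m) * emb_in (udil c (g k n)))) $ \<mu> $ \<nu> =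
    usc (c ^ \<nu>) * conv G0 1 a b (\<lambda>p. f i m $ (\<mu> - p) * g k n $ (\<nu> - p)) (min \<mu> \<nu>)" for a b i m k n \<mu> \<nu>
    unfolding G conv_def by (rule sc_tsub_dil_nth) (simp add: emb_nth udil_nth usc.swap)
  show "(sc (- 1) (tsub (dil c G0) * (1 * kc a + kc c * tsub fps_X * kc b)) *
      (emb_in (udil c (g k n)) * emb_out (f i m))) $ \<mu> $ \<nu> =
    usc (c ^ \<nu>) * conv G0 (- 1) a b (\<lambda>p. g k n $ (\<nu> - p) * f i m $ (\<mu> - p)) (min \<mu> \<nu>)" for a b i m k n \<mu> \<nu>
    unfolding G conv_def by (rule sc_tsub_dil_nth) (simp add: emb_nth udil_nth mult.assoc)
qed

text \<open>The coefficient in bidegree \<open>(\<mu>, \<nu>)\<close> after multiplication by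
  \<open>a\<close> times the outer plus \<open>b\<close> times the inner variable.\<close>

definition lin :: "'q \<Rightarrow> 'q \<Rightarrow> (nat \<Rightarrow> nat \<Rightarrow> 'u) \<Rightarrow> nat \<Rightarrow> nat \<Rightarrow> 'u" where
  "lin a b P \<mu> \<nu> = (if \<mu> = 0 then 0 else usc a * P (\<mu> - 1) \<nu>) + (if \<nu> = 0 then 0 else usc b * P \<mu> (\<nu> - 1))"

lemma sc0_linear_nth:
  assumes "\<And>\<mu> \<nu>. P $ \<mu> $ \<nu> = usc (c ^ \<nu>) * P0 \<mu> \<nu>" and c: "c * c' = 1"
  shows "(sc 0 (1 * (kc c' * fps_X * kc a + Zv * kc b)) * P) $ \<mu> $ \<nu> = usc (c' * c ^ \<nu>) * lin a b P0 \<mu> \<nu>"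
    "(sc 0 (1 * (Zv * kc b + kc c' * fps_X * kc a)) * P) $ \<mu> $ \<nu> = usc (c' * c ^ \<nu>) * lin a b P0 \<mu> \<nu>"
    "(sc 0 (1 * (kc c * Zv * kc b + fps_X * kc a)) * P) $ \<mu> $ \<nu> = usc (c ^ \<nu>) * lin a b P0 \<mu> \<nu>"
    "(sc 0 (1 * (fps_X * kc a + kc c * Zv * kc b)) * P) $ \<mu> $ \<nu> = usc (c ^ \<nu>) * lin a b P0 \<mu> \<nu>"
proof -
  have e: "kc x * fps_X * kc y = fps_X * kc (x * y)" "kc x * Zv * kc y = Zv * kc (x * y)" for x y :: 'q
    by (simp_all add: kc_simps mult_ac)
  have cc: "c * (c' * x) = x" for x
    using c by (simp add: mult.assoc[symmetric])
  have L: "(sc 0 (fps_X * kc x + Zv * kc y) * P) $ \<mu> $ \<nu> = (if \<mu> = 0 then 0 else usc (x * c ^ \<nu>) * P0 (\<mu> - 1) \<nu>) +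
      (if \<nu> = 0 then 0 else usc (y * c ^ (\<nu> - 1)) * P0 \<mu> (\<nu> - 1))" for x y
    unfolding sc_linear_mult_nth by (simp add: qc_0 assms(1) usc.fuse)
  have 1: "usc (c' * c ^ \<nu>) * lin a b P0 \<mu> \<nu> = (if \<mu> = 0 then 0 else usc (c' * a * c ^ \<nu>) * P0 (\<mu> - 1) \<nu>) +
      (if \<nu> = 0 then 0 else usc (b * c ^ (\<nu> - 1)) * P0 \<mu> (\<nu> - 1))"
    by (cases \<nu>) (auto simp: lin_def distrib_left usc.fuse mult_ac cc)
  have 2: "usc (c ^ \<nu>) * lin a b P0 \<mu> \<nu> = (if \<mu> = 0 then 0 else usc (a * c ^ \<nu>) * P0 (\<mu> - 1) \<nu>) +
      (if \<nu> = 0 then 0 else usc (c * b * c ^ (\<nu> - 1)) * P0 \<mu> (\<nu> - 1))"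
    by (cases \<nu>) (auto simp: lin_def distrib_left usc.fuse mult_ac)
  show "(sc 0 (1 * (kc c' * fps_X * kc a + Zv * kc b)) * P) $ \<mu> $ \<nu> = usc (c' * c ^ \<nu>) * lin a b P0 \<mu> \<nu>"
    "(sc 0 (1 * (Zv * kc b + kc c' * fps_X * kc a)) * P) $ \<mu> $ \<nu> = usc (c' * c ^ \<nu>) * lin a b P0 \<mu> \<nu>"
    "(sc 0 (1 * (kc c * Zv * kc b + fps_X * kc a)) * P) $ \<mu> $ \<nu> = usc (c ^ \<nu>) * lin a b P0 \<mu> \<nu>"
    "(sc 0 (1 * (fps_X * kc a + kc c * Zv * kc b)) * P) $ \<mu> $ \<nu> = usc (c ^ \<nu>) * lin a b P0 \<mu> \<nu>"
    unfolding mult_1 e add.commute[of "Zv * _"] L 1 2 by (rule refl)+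
qed

text \<open>Positive series run in z^(-1) and w^(-1). Since R(z, w) is homogeneous of degree one,
  multiplying by z^(-1) w^(-1) replaces z by w^(-1) and w by z^(-1): each matrix gets the variable
  of the other as its parameter.\<close>

theorem grll_plus:
  assumes qq: "q * q' = 1" and c: "c * c' = 1"
    and rel: "\<And>\<mu> \<nu> i m k n. i \<in> {1..M+N} \<Longrightarrow> m \<in> {1..M+N} \<Longrightarrow> k \<in> {1..M+N} \<Longrightarrow> n \<in> {1..M+N} \<Longrightarrow>
      rel4 M q q' i m k n (\<lambda>a b u v. lin a b (\<lambda>\<mu> \<nu>. u $ \<nu> * v $ \<mu>) \<mu> \<nu>) (\<lambda>a b u v. lin a b (\<lambda>\<mu> \<nu>. v $ \<mu> * u $ \<nu>) \<mu> \<nu>) f f"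
  shows "rtt.grll (<) M N (kc q) (kc q') (sc 0) (sc 0) 1 (kc c' * fps_X) Zv
      (\<lambda>i j. emb_in (udil c (f i j))) (\<lambda>i j. emb_out (f i j))"
    "rtt.grll (<) M N (kc q) (kc q') (sc 0) (sc 0) 1 Zv (kc c' * fps_X)
      (\<lambda>i j. emb_out (f i j)) (\<lambda>i j. emb_in (udil c (f i j)))"
proof -
  show "rtt.grll (<) M N (kc q) (kc q') (sc 0) (sc 0) 1 (kc c' * fps_X) Zv
      (\<lambda>i j. emb_in (udil c (f i j))) (\<lambda>i j. emb_out (f i j))"
    by (rule grll_series[where \<kappa> = "\<lambda>\<mu> \<nu>. c' * c ^ \<nu>" and \<phi> = "\<lambda>\<mu> \<nu> a b u v. lin a b (\<lambda>\<mu> \<nu>. u $ \<nu> * v $ \<mu>) \<mu> \<nu>"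
        and \<psi> = "\<lambda>\<mu> \<nu> a b u v. lin a b (\<lambda>\<mu> \<nu>. v $ \<mu> * u $ \<nu>) \<mu> \<nu>", OF qq
        sc0_linear_nth(1)[OF _ c] sc0_linear_nth(1)[OF _ c] rel])
      (simp_all add: emb_nth udil_nth mult.assoc usc.swap)
  have sw: "lin a b P \<mu> \<nu> = lin b a (\<lambda>\<mu> \<nu>. P \<nu> \<mu>) \<nu> \<mu>" for a b P \<mu> \<nu>
    by (simp add: lin_def)
  show "rtt.grll (<) M N (kc q) (kc q') (sc 0) (sc 0) 1 Zv (kc c' * fps_X)
      (\<lambda>i j. emb_out (f i j)) (\<lambda>i j. emb_in (udil c (f i j)))"
  proof (rule grll_series[where \<kappa> = "\<lambda>\<mu> \<nu>. c' * c ^ \<nu>" and \<phi> = "\<lambda>\<mu> \<nu> b a u v. lin a b (\<lambda>\<mu> \<nu>. u $ \<mu> * v $ \<nu>) \<mu> \<nu>"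
        and \<psi> = "\<lambda>\<mu> \<nu> b a u v. lin a b (\<lambda>\<mu> \<nu>. v $ \<nu> * u $ \<mu>) \<mu> \<nu>", OF qq
        sc0_linear_nth(2)[OF _ c] sc0_linear_nth(2)[OF _ c]])
    fix \<mu> \<nu> i m k n assume "i \<in> {1..M+N}" "m \<in> {1..M+N}" "k \<in> {1..M+N}" "n \<in> {1..M+N}"
    from rel[OF this, of \<nu> \<mu>]
    show "rel4 M q q' i m k n (\<lambda>b a u v. lin a b (\<lambda>\<mu> \<nu>. u $ \<mu> * v $ \<nu>) \<mu> \<nu>) (\<lambda>b a u v. lin a b (\<lambda>\<mu> \<nu>. v $ \<nu> * u $ \<mu>) \<mu> \<nu>) f f"
      unfolding sw[of _ _ _ \<nu> \<mu>] .
  qed (simp_all add: emb_nth udil_nth mult.assoc usc.swap)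
qed

text \<open>Negative series run in z and w themselves, so each parameter is the variable of its own
  matrix; hence \<open>lin b a\<close> in place of \<open>lin a b\<close>.\<close>

theorem grll_minus:
  assumes qq: "q * q' = 1" and c: "c * c' = 1"
    and rel: "\<And>\<mu> \<nu> i m k n. i \<in> {1..M+N} \<Longrightarrow> m \<in> {1..M+N} \<Longrightarrow> k \<in> {1..M+N} \<Longrightarrow> n \<in> {1..M+N} \<Longrightarrow>
      rel4 M q q' i m k n (\<lambda>a b u v. lin b a (\<lambda>\<mu> \<nu>. u $ \<nu> * v $ \<mu>) \<mu> \<nu>) (\<lambda>a b u v. lin b a (\<lambda>\<mu> \<nu>. v $ \<mu> * u $ \<nu>) \<mu> \<nu>) f f"
  shows "rtt.grll (<) M N (kc q) (kc q') (sc 0) (sc 0) 1 (kc c * Zv) fps_X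
      (\<lambda>i j. emb_in (udil c (f i j))) (\<lambda>i j. emb_out (f i j))"
    "rtt.grll (<) M N (kc q) (kc q') (sc 0) (sc 0) 1 fps_X (kc c * Zv)
      (\<lambda>i j. emb_out (f i j)) (\<lambda>i j. emb_in (udil c (f i j)))"
proof -
  show "rtt.grll (<) M N (kc q) (kc q') (sc 0) (sc 0) 1 (kc c * Zv) fps_X
      (\<lambda>i j. emb_in (udil c (f i j))) (\<lambda>i j. emb_out (f i j))"
    by (rule grll_series[where \<kappa> = "\<lambda>\<mu> \<nu>. c ^ \<nu>" and \<phi> = "\<lambda>\<mu> \<nu> a b u v. lin b a (\<lambda>\<mu> \<nu>. u $ \<nu> * v $ \<mu>) \<mu> \<nu>"
        and \<psi> = "\<lambda>\<mu> \<nu> a b u v. lin b a (\<lambda>\<mu> \<nu>. v $ \<mu> * u $ \<nu>) \<mu> \<nu>", OF qq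
        sc0_linear_nth(3)[OF _ c] sc0_linear_nth(3)[OF _ c] rel])
      (simp_all add: emb_nth udil_nth mult.assoc usc.swap)
  have sw: "lin a b P \<mu> \<nu> = lin b a (\<lambda>\<mu> \<nu>. P \<nu> \<mu>) \<nu> \<mu>" for a b P \<mu> \<nu>
    by (simp add: lin_def)
  show "rtt.grll (<) M N (kc q) (kc q') (sc 0) (sc 0) 1 fps_X (kc c * Zv)
      (\<lambda>i j. emb_out (f i j)) (\<lambda>i j. emb_in (udil c (f i j)))"
  proof (rule grll_series[where \<kappa> = "\<lambda>\<mu> \<nu>. c ^ \<nu>" and \<phi> = "\<lambda>\<mu> \<nu> a b u v. lin a b (\<lambda>\<mu> \<nu>. u $ \<mu> * v $ \<nu>) \<mu> \<nu>"
        and \<psi> = "\<lambda>\<mu> \<nu> a b u v. lin a b (\<lambda>\<mu> \<nu>. v $ \<nu> * u $ \<mu>) \<mu> \<nu>", OF qq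
        sc0_linear_nth(4)[OF _ c] sc0_linear_nth(4)[OF _ c]])
    fix \<mu> \<nu> i m k n assume "i \<in> {1..M+N}" "m \<in> {1..M+N}" "k \<in> {1..M+N}" "n \<in> {1..M+N}"
    from rel[OF this, of \<nu> \<mu>]
    show "rel4 M q q' i m k n (\<lambda>a b u v. lin a b (\<lambda>\<mu> \<nu>. u $ \<mu> * v $ \<nu>) \<mu> \<nu>) (\<lambda>a b u v. lin a b (\<lambda>\<mu> \<nu>. v $ \<nu> * u $ \<mu>) \<mu> \<nu>) f f"
      unfolding sw[of _ _ _ \<nu> \<mu>] .
  qed (simp_all add: emb_nth udil_nth mult.assoc usc.swap)
qed

end

section \<open>The algebra and its defining relations\<close>

lemma abs_uq_eq_0: "x \<in> rels LENGTH('m::len0) LENGTH('n::len0) \<Longrightarrow> (abs_uq x :: ('m, 'n) uq) = 0"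
  using rel_ideal.step[OF rel_ideal.zero, of x "LENGTH('m)" "LENGTH('n)" 1 1]
  by (simp add: zero_uq_def uq.abs_eq_iff)

lemma abs_uq_add: "abs_uq (x + y) = abs_uq x + abs_uq y"
  and abs_uq_mult: "abs_uq (x * y) = abs_uq x * abs_uq y"
  and abs_uq_diff: "abs_uq (x - y) = abs_uq x - abs_uq y"
  and abs_uq_uminus: "abs_uq (- x) = - abs_uq x"
  by (simp_all add: plus_uq.abs_eq times_uq.abs_eq minus_uq.abs_eq uminus_uq.abs_eq)

lemma abs_uq_01: "abs_uq 0 = 0" "abs_uq 1 = 1"
  by (simp_all add: zero_uq_def one_uq_def)

lemma abs_uq_sum: "abs_uq (\<Sum>x\<in>A. f x) = (\<Sum>x\<in>A. abs_uq (f x))"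
  by (induction A rule: infinite_finite_induct) (auto simp: abs_uq_add abs_uq_01)

lemma abs_uq_neg1: "abs_uq ((-1) ^ e) = (-1) ^ e"
  by (induction e) (auto simp: abs_uq_mult abs_uq_01 abs_uq_uminus)

lemma abs_uq_tmul:
  "abs_uq (tmul M N X Y i m k n) = tmul M N (\<lambda>i j k l. abs_uq (X i j k l)) (\<lambda>i j k l. abs_uq (Y i j k l)) i m k n"
  by (simp add: tmul_def abs_uq_sum abs_uq_mult abs_uq_neg1)

lemma fscal_simps: "fscal 1 = 1" "fscal (a + b) = fscal a + fscal b" "fscal (a * b) = fscal a * fscal b"
  by (simp_all add: fscal_def single_one single_add mult_single)

lemma fscal_central: "fscal a * x = x * fscal a"
proof -
  have "fscal a * (\<Sum>w\<in>A. Poly_Mapping.single w (f w)) = (\<Sum>w\<in>A. Poly_Mapping.single w (f w)) * fscal a" for A f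
    by (simp add: fscal_def sum_distrib_left sum_distrib_right mult_single mult.commute)
  then show ?thesis
    using free_expand[of x] by metis
qed

lemma uscal_hom: "central_hom uscal"
proof
  show "uscal 1 = 1"
    by (simp add: uscal.abs_eq fscal_simps abs_uq_01)
  show "uscal (a + b) = uscal a + uscal b" "uscal (a * b) = uscal a * uscal b" for a b
    by (simp_all add: uscal.abs_eq fscal_simps abs_uq_add abs_uq_mult)
  show "uscal a * x = x * uscal a" for a x
    by (induction x rule: uq.abs_induct) (simp add: uscal.abs_eq fscal_central flip: abs_uq_mult)
qed

lemma free_induct [case_names scal gen add mult]:
  assumes "\<And>c. P (fscal c)" "\<And>g. P (fgen g)" "\<And>x y. P x \<Longrightarrow> P y \<Longrightarrow> P (x + y)" "\<And>x y. P x \<Longrightarrow> P y \<Longrightarrow> P (x * y)"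
  shows "P x"
proof -
  have w: "P (Poly_Mapping.single (Fmon w) 1)" for w
  proof (induction w)
    case Nil
    then show ?case
      using assms(1)[of 1] by (simp add: fscal_def zero_fmon_def)
  next
    case (Cons g w)
    have "Poly_Mapping.single (Fmon (g # w)) 1 = fgen g * Poly_Mapping.single (Fmon w) 1"
      by (simp add: fgen_def mult_single plus_fmon_def)
    then show ?case
      using assms(2,4) Cons by simp
  qed
  have c: "P (Poly_Mapping.single v c)" for v c
  proof -
    have "Poly_Mapping.single v c = fscal c * Poly_Mapping.single (Fmon (letters v)) 1"
      by (simp add: fscal_def mult_single)
    then show ?thesis
      using assms(1,4) w by metis
  qed
  have "P (\<Sum>v\<in>A. Poly_Mapping.single v (f v))" for A :: "gen fmon set" and f
    by (induction A rule: infinite_finite_induct) (use assms(1)[of 0] in \<open>auto simp: fscal_def intro: assms(3) c\<close>)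
  then show ?thesis
    using free_expand[of x] by metis
qed

lemma uq_commute_gens:
  fixes c :: "('m::len0, 'n::len0) uq"
  assumes "\<And>g. c * abs_uq (fgen g) = abs_uq (fgen g) * c"
  shows "c * x = x * c"
proof (induction x rule: uq.abs_induct)
  case (1 y)
  interpret central_hom "uscal :: Cq \<Rightarrow> ('m, 'n) uq"
    by (rule uscal_hom)
  show ?case
  proof (induction y rule: free_induct)
    case (scal a)
    then show ?case
      using central[of a c] by (simp add: uscal.abs_eq)
  next
    case (mult x y)
    then show ?case
      by (simp add: abs_uq_mult) (metis mult.assoc)
  qed (simp_all add: assms abs_uq_add algebra_simps)
qed

definition qcu :: "int \<Rightarrow> ('m::len0, 'n::len0) uq" where
  "qcu e = abs_uq (qcpow e)"

lemma two_sided_powers: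
  fixes x y :: "'a::monoid_mult"
  assumes "x * y = 1" "y * x = 1"
  defines "pw \<equiv> \<lambda>e::int. if e \<ge> 0 then x ^ nat e else y ^ nat (- e)"
  shows "pw (a + b) = pw a * pw b"
proof -
  have up: "pw (a + 1) = pw a * x" for a
  proof (cases "a \<ge> 0")
    case True
    then have "nat (a + 1) = Suc (nat a)" by simp
    then show ?thesis
      using True by (simp add: pw_def power_Suc2 del: power_Suc)
  next
    case False
    then have "nat (- a) = Suc (nat (- (a + 1)))" by simp
    then have "pw a * x = y ^ nat (- (a + 1)) * (y * x)"
      using False by (simp add: pw_def power_Suc2 mult.assoc del: power_Suc)
    then show ?thesis
      using False assms(2) by (cases "a = -1") (auto simp: pw_def)
  qed
  have down: "pw (a - 1) = pw a * y" for a
    using up[of "a - 1"] assms(1) by (simp add: mult.assoc)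
  show ?thesis
  proof (induction b rule: int_induct[where k = 0])
    case base
    then show ?case by (simp add: pw_def)
  next
    case (step1 b)
    then show ?case
      using up[of "a + b"] up[of b] by (simp add: mult.assoc add.assoc)
  next
    case (step2 b)
    then show ?case
      using down[of "a + b"] down[of b] by (simp add: mult.assoc add_diff_eq)
  qed
qed

lemma abs_uq_power: "abs_uq (x ^ n) = abs_uq x ^ n"
  by (induction n) (auto simp: abs_uq_mult abs_uq_01)

lemma qc_gens:
  "abs_uq (fgen Qc) * abs_uq (fgen QcInv) = 1" "abs_uq (fgen QcInv) * abs_uq (fgen Qc) = 1"
  "abs_uq (fgen Qc) * x = x * abs_uq (fgen Qc)" "abs_uq (fgen QcInv) * x = x * abs_uq (fgen QcInv)"
proof -
  show inv: "abs_uq (fgen Qc) * abs_uq (fgen QcInv) = 1" "abs_uq (fgen QcInv) * abs_uq (fgen Qc) = 1"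
    using abs_uq_eq_0[OF rels.qc_inv] abs_uq_eq_0[OF rels.qc_inv'] by (simp_all add: abs_uq_diff abs_uq_mult abs_uq_01)
  show c: "abs_uq (fgen Qc) * x = x * abs_uq (fgen Qc)" for x
    by (rule uq_commute_gens) (use abs_uq_eq_0[OF rels.qc_central] in \<open>simp add: abs_uq_diff abs_uq_mult\<close>)
  show "abs_uq (fgen QcInv) * x = x * abs_uq (fgen QcInv)"
  proof -
    have "abs_uq (fgen QcInv) * x = abs_uq (fgen QcInv) * (x * abs_uq (fgen Qc)) * abs_uq (fgen QcInv)"
      by (simp add: mult.assoc inv)
    also have "\<dots> = (abs_uq (fgen QcInv) * abs_uq (fgen Qc)) * x * abs_uq (fgen QcInv)"
      by (simp only: c[of x, symmetric] mult.assoc)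
    finally show ?thesis
      by (simp add: inv)
  qed
qed

lemma qcu_if: "qcu e = (if e \<ge> 0 then abs_uq (fgen Qc) ^ nat e else abs_uq (fgen QcInv) ^ nat (- e))"
  by (simp add: qcu_def qcpow_def abs_uq_power)

interpretation uq: qc_ring "uscal :: Cq \<Rightarrow> ('m::len0, 'n::len0) uq" qcu
proof -
  interpret central_hom "uscal :: Cq \<Rightarrow> ('m, 'n) uq" by (rule uscal_hom)
  show "qc_ring (uscal :: Cq \<Rightarrow> ('m, 'n) uq) qcu"
  proof
    show "qcu 0 = (1 :: ('m, 'n) uq)" by (simp add: qcu_if)
    show "qcu (a + b) = qcu a * (qcu b :: ('m, 'n) uq)" for a b
      unfolding qcu_if by (rule two_sided_powers) (rule qc_gens)+
    have p: "x ^ n * y = y * x ^ n" if "\<And>y. x * y = y * x" for x y :: "('m, 'n) uq" and n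
    proof (induction n)
      case (Suc n)
      have "x ^ Suc n * y = x * (y * x ^ n)"
        using Suc by (simp add: mult.assoc)
      then show ?case
        using that[of y] by (simp add: mult.assoc[symmetric])
    qed simp
    show "qcu a * x = x * (qcu a :: ('m, 'n) uq)" for a x
      unfolding qcu_if by (auto intro: p qc_gens)
  qed
qed

lemma qvar_nonzero: "qvar \<noteq> 0"
  by (simp add: qvar_def Zero_fract_def eq_fract)

abbreviation "qinv \<equiv> inverse qvar"

lemma qvar_inv: "qvar * qinv = 1"
  using qvar_nonzero by simp

lemma qi_eq: "qi M i = qev M qvar qinv i" "inverse (qi M i) = qev M qinv qvar i"
  by (simp_all add: qi_def parity_def qev_def)

section \<open>Relations between coefficients\<close>

context qc_ring
begin

text \<open>Evaluates both sides of RLL for a single coefficient of R. Such coefficients contain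
  powers of q^c, so of the entries only centrality is assumed.\<close>

lemma tmul_rc_left:
  assumes R: "sparse R" and d: "\<And>i k. R i i k k = d i k" and x: "\<And>i k. i \<noteq> k \<Longrightarrow> R i k k i = (-1) ^ parity M k * x i k" "\<And>i. x i i = 0"
    and c: "\<And>i k. d i k \<in> center" "\<And>i k. x i k \<in> center"
    and ix: "i \<in> {1..M+N}" "m \<in> {1..M+N}" "k \<in> {1..M+N}" "n \<in> {1..M+N}"
  shows "tmul M N R (tmul M N (emb1 X) (emb2 Y)) i m k n =
     (-1) ^ (eparity M i m * eparity M k n) * (d i k * (X i m * Y k n)) +
     (-1) ^ (parity M k * parity M m + parity M k * parity M n + parity M m * parity M n) * (x i k * (X k m * Y i n :: 'u))"
    "tmul M N (tmul M N (emb2 Y) (emb1 X)) R i m k n =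
     d m n * (Y k n * X i m) +
     (-1) ^ (parity M k * parity M m + parity M k * parity M n + parity M m * parity M n) * (x n m * (Y k m * X i n))"
proof -
  have e: "a * ((-1) ^ e * y) = (-1) ^ e * (a * y)" "y * a = a * y" if "a \<in> center" for a y :: 'u and e
    using that by (auto simp: center_def neg1_swap)
  show "tmul M N R (tmul M N (emb1 X) (emb2 Y)) i m k n =
     (-1) ^ (eparity M i m * eparity M k n) * (d i k * (X i m * Y k n)) +
     (-1) ^ (parity M k * parity M m + parity M k * parity M n + parity M m * parity M n) * (x i k * (X k m * Y i n))"
  proof (cases "i = k")
    case True
    then show ?thesis
      using ix by (simp add: tmul_sparse_left[OF R] tmul_emb12 d x e[OF c(1)])
  next
    case False
    have "(-1) ^ (eparity M k i * eparity M k m) * ((-1) ^ parity M k * (x i k * ((-1) ^ (eparity M k m * eparity M i n) * (X k m * Y i n)))) =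
      (-1) ^ (parity M k * parity M m + parity M k * parity M n + parity M m * parity M n) * (x i k * (X k m * Y i n))"
      unfolding e(1)[OF c(2)] neg1_fuse
      by (intro arg_cong2[where f = "(*)"] neg1_cong refl) (simp add: eparity_def, argo)
    then show ?thesis
      using ix False by (simp add: tmul_sparse_left[OF R] tmul_emb12 d x e(1)[OF c(1)] mult.assoc)
  qed
  show "tmul M N (tmul M N (emb2 Y) (emb1 X)) R i m k n =
     d m n * (Y k n * X i m) +
     (-1) ^ (parity M k * parity M m + parity M k * parity M n + parity M m * parity M n) * (x n m * (Y k m * X i n))"
  proof (cases "m = n")
    case True
    then show ?thesis
      using ix by (simp add: tmul_sparse_right[OF R] tmul_emb21 d x e(2)[OF c(1), of "Y k n * X i m"] e(2)[OF c(1), of "Y k n * X i n"])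
  next
    case False
    have "(-1) ^ (eparity M k m * eparity M n m) * ((Y k m * X i n) * ((-1) ^ parity M m * x n m)) =
      (-1) ^ (parity M k * parity M m + parity M k * parity M n + parity M m * parity M n) * (x n m * (Y k m * X i n))"
      unfolding neg1_swap[where x = "Y k m * X i n"] e(2)[OF c(2), of "Y k m * X i n"] neg1_fuse
      by (intro arg_cong2[where f = "(*)"] neg1_cong refl) (simp add: eparity_def, argo)
    then show ?thesis
      using ix False by (simp add: tmul_sparse_right[OF R] tmul_emb21 d x e(2)[OF c(1), of "Y k n * X i m"])
  qed
qed

text \<open>The difference of the two sides of \<open>rel4\<close>. It is linear in
  \<open>\<phi>\<close> and \<open>\<psi>\<close> and can therefore be summed over the powers of
  x.\<close>

definition reld :: "nat \<Rightarrow> 'q \<Rightarrow> 'q \<Rightarrow> nat \<Rightarrow> nat \<Rightarrow> nat \<Rightarrow> nat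
    \<Rightarrow> ('q \<Rightarrow> 'q \<Rightarrow> 'u fps \<Rightarrow> 'u fps \<Rightarrow> 'u) \<Rightarrow> ('q \<Rightarrow> 'q \<Rightarrow> 'u fps \<Rightarrow> 'u fps \<Rightarrow> 'u)
    \<Rightarrow> (nat \<Rightarrow> nat \<Rightarrow> 'u fps) \<Rightarrow> (nat \<Rightarrow> nat \<Rightarrow> 'u fps) \<Rightarrow> 'u" where
  "reld M q q' i m k n \<phi> \<psi> f g =
    ((-1) ^ (eparity M i m * eparity M k n) * \<phi> (ga M q q' i k) (gb M q q' i k) (f i m) (g k n) +
    (-1) ^ (parity M k * parity M m + parity M k * parity M n + parity M m * parity M n) *
      \<phi> (xa q q' i k) (xb q q' i k) (f k m) (g i n)) -
    (\<psi> (ga M q q' m n) (gb M q q' m n) (f i m) (g k n) +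
    (-1) ^ (parity M k * parity M m + parity M k * parity M n + parity M m * parity M n) *
      \<psi> (xa q q' n m) (xb q q' n m) (f i n) (g k m))"

lemma rel4_reld: "rel4 M q q' i m k n \<phi> \<psi> f g \<longleftrightarrow> reld M q q' i m k n \<phi> \<psi> f g = 0"
  by (simp add: rel4_def reld_def)

lemma reld_sum:
  "reld M q q' i m k n (\<lambda>a b u v. \<Sum>p\<in>A. usc (c p) * \<phi> p a b u v) (\<lambda>a b u v. \<Sum>p\<in>A. usc (c p) * \<psi> p a b u v) f g =
    (\<Sum>p\<in>A. usc (c p) * reld M q q' i m k n (\<phi> p) (\<psi> p) f g)"
proof -
  have e: "usc a * ((-1) ^ e * y) = (-1) ^ e * (usc a * y)" for a e y
    by (simp add: neg1_swap)
  show ?thesis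
    unfolding reld_def by (simp add: sum_distrib_left sum.distrib sum_subtractf algebra_simps e)
qed

lemma reld_zero: "reld M q q' i m k n (\<lambda>a b u v. 0) (\<lambda>a b u v. 0) f g = 0"
  by (simp add: reld_def)

end

text \<open>The common prefactor: R(x) is \<open>g0\<close> times R(1, x^(-1)).\<close>

definition g0 :: "nat \<Rightarrow> nat \<Rightarrow> Cq fps" where
  "g0 M N = fser M N * inverse (fps_const qvar - fps_const qinv * fps_X)"

lemma Rcoeff_simps:
  "Rcoeff M N p i i k k = (g0 M N * (fps_const (uq.ga M qvar qinv i k) + fps_const (uq.gb M qvar qinv i k) * fps_X)) $ p"
  "i \<noteq> k \<Longrightarrow> Rcoeff M N p i k k i = (-1) ^ parity M k * (g0 M N * (fps_const (uq.xa qvar qinv i k) + fps_const (uq.xb qvar qinv i k) * fps_X)) $ p"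
  "Rcoeff M N p i j k l \<noteq> 0 \<Longrightarrow> (i = j \<and> k = l) \<or> (i = l \<and> j = k)"
proof -
  have d: "F / (fps_const qvar - fps_const qinv * fps_X) = F * inverse (fps_const qvar - fps_const qinv * fps_X)" for F
    by (rule fps_divide_unit) (simp add: qvar_nonzero)
  show "Rcoeff M N p i i k k = (g0 M N * (fps_const (uq.ga M qvar qinv i k) + fps_const (uq.gb M qvar qinv i k) * fps_X)) $ p"
  proof -
    have "Rzw M 1 fps_X i i k k = fps_const (uq.ga M qvar qinv i k) + fps_const (uq.gb M qvar qinv i k) * fps_X"
      by (auto simp: Rzw_def uq.ga_def uq.gb_def qi_eq(2) simp flip: fps_const_neg) (simp_all add: qi_eq(1))
    then show ?thesis
      unfolding Rcoeff_def Rbar_def d g0_def by (simp only: mult_ac)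
  qed
  show "Rcoeff M N p i k k i = (-1) ^ parity M k * (g0 M N * (fps_const (uq.xa qvar qinv i k) + fps_const (uq.xb qvar qinv i k) * fps_X)) $ p"
    if "i \<noteq> k"
  proof -
    have "Rzw M 1 fps_X i k k i = fps_const ((-1) ^ parity M k) * (fps_const (uq.xa qvar qinv i k) + fps_const (uq.xb qvar qinv i k) * fps_X)"
      using that by (auto simp: Rzw_def uq.xa_def uq.xb_def qi_eq(1) qev_def parity_def simp flip: fps_const_neg fps_const_sub)
    then have "fser M N * Rbar M i k k i = fps_const ((-1) ^ parity M k) * (g0 M N * (fps_const (uq.xa qvar qinv i k) + fps_const (uq.xb qvar qinv i k) * fps_X))"
      unfolding Rbar_def d g0_def by (simp only: mult_ac)
    then show ?thesis
      by (simp only: Rcoeff_def fps_mult_left_const_nth)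
  qed
  show "(i = j \<and> k = l) \<or> (i = l \<and> j = k)" if "Rcoeff M N p i j k l \<noteq> 0"
  proof (rule ccontr)
    assume "\<not> ?thesis"
    then have n: "\<not> (i = j \<and> k = l)" "\<not> (i = l \<and> j = k)"
      by blast+
    have z: "Rzw M 1 fps_X i j k l = 0"
      by (simp only: Rzw_def n if_False)
    have "Rcoeff M N p i j k l = 0"
      unfolding Rcoeff_def Rbar_def d z by simp
    with that show False ..
  qed
qed

text \<open>The coefficient of z^n for every integer n, with 0 outside the support of the
  series.\<close>

definition scoef :: "sgn \<Rightarrow> 'u::zero fps \<Rightarrow> int \<Rightarrow> 'u" where
  "scoef s u n = (case s of Plus \<Rightarrow> if n \<le> 0 then u $ nat (- n) else 0 | Minus \<Rightarrow> if n \<ge> 0 then u $ nat n else 0)"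

definition Lser :: "sgn \<Rightarrow> nat \<Rightarrow> nat \<Rightarrow> ('m::len0, 'n::len0) uq fps" where
  "Lser s i j = Abs_fps (ul s i j)"

lemma abs_uq_lcoeff: "abs_uq (lcoeff s i j n) = scoef s (Lser s i j) n"
  by (cases s) (auto simp: scoef_def Lser_def ul.abs_eq abs_uq_01)

lemma rll_reld:
  fixes s t :: sgn
  assumes ix: "i \<in> {1..LENGTH('m::len0)+LENGTH('n::len0)}" "m \<in> {1..LENGTH('m)+LENGTH('n)}"
      "k \<in> {1..LENGTH('m)+LENGTH('n)}" "n \<in> {1..LENGTH('m)+LENGTH('n)}"
  shows "abs_uq (rll LENGTH('m) LENGTH('n) s t e a b i m k n) =
    uq.reld LENGTH('m) qvar qinv i m k n
     (\<lambda>a' b' u v. \<Sum>p\<le>nat (\<bar>a\<bar> + \<bar>b\<bar>). uscal ((g0 LENGTH('m) LENGTH('n) * (fps_const a' + fps_const b' * fps_X)) $ p) * qcu (- e * int p) *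
        (scoef s u (a + int p) * scoef t v (b - int p)))
     (\<lambda>a' b' u v. \<Sum>p\<le>nat (\<bar>a\<bar> + \<bar>b\<bar>). uscal ((g0 LENGTH('m) LENGTH('n) * (fps_const a' + fps_const b' * fps_X)) $ p) * qcu (e * int p) *
        (scoef t v (b - int p) * scoef s u (a + int p)))
     (Lser s) (Lser t :: nat \<Rightarrow> nat \<Rightarrow> ('m, 'n) uq fps)"
proof -
  let ?M = "LENGTH('m)" and ?N = "LENGTH('n)"
  define G where "G = (\<lambda>a' b' p. (g0 ?M ?N * (fps_const a' + fps_const b' * fps_X)) $ p)"
  define co where "co = (\<lambda>e a' b' p. (uscal (G a' b' p) * qcu (- e * int p) :: ('m, 'n) uq))"
  have cen: "co e a' b' p \<in> center" for e a' b' p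
    unfolding co_def center_def
    by (simp only: mult.assoc uq.qc_central[of "- e * int p"] uq.usc.swap mem_Collect_eq simp_thms)
  have R: "sparse (\<lambda>i j k l. abs_uq (Rc ?M ?N e p i j k l) :: ('m, 'n) uq)" for e p
    unfolding sparse_def
  proof (intro allI impI)
    fix i j k l assume "(abs_uq (Rc ?M ?N e p i j k l) :: ('m, 'n) uq) \<noteq> 0"
    then have "Rcoeff ?M ?N p i j k l \<noteq> 0"
      by (auto simp: Rc_def fscal_def abs_uq_01)
    then show "(i = j \<and> k = l) \<or> (i = l \<and> j = k)"
      by (rule Rcoeff_simps(3))
  qed
  have Rd: "(abs_uq (Rc ?M ?N e p i i k k) :: ('m, 'n) uq) = co e (uq.ga ?M qvar qinv i k) (uq.gb ?M qvar qinv i k) p" for e p i k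
    by (simp add: Rc_def Rcoeff_simps abs_uq_mult co_def G_def qcu_def uscal.abs_eq)
  have Rx: "(abs_uq (Rc ?M ?N e p i k k i) :: ('m, 'n) uq) = (-1) ^ parity ?M k * co e (uq.xa qvar qinv i k) (uq.xb qvar qinv i k) p"
    if "i \<noteq> k" for e p i k
  proof -
    have "uscal ((-1) ^ d * x) = (-1) ^ d * (uscal x :: ('m, 'n) uq)" for d x
      by (simp add: uq.usc.mult uq.usc.power uq.usc.uminus)
    then show ?thesis
      using that by (simp add: Rc_def Rcoeff_simps abs_uq_mult co_def G_def qcu_def mult.assoc flip: uscal.abs_eq)
  qed
  have R0: "co e (uq.xa qvar qinv i i) (uq.xb qvar qinv i i) p = 0" for e i p
    by (simp add: co_def G_def uq.xa_def uq.xb_def)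
  have e12: "(\<lambda>i j k l. abs_uq (L1 s x i j k l)) = emb1 (\<lambda>i j. scoef s (Lser s i j) x :: ('m, 'n) uq)"
    "(\<lambda>i j k l. abs_uq (L2 s x i j k l)) = emb2 (\<lambda>i j. scoef s (Lser s i j) x :: ('m, 'n) uq)" for s x
    by (auto simp: fun_eq_iff L1_def L2_def emb1_def emb2_def abs_uq_lcoeff abs_uq_01)
  have "(abs_uq (rll ?M ?N s t e a b i m k n) :: ('m, 'n) uq) = (\<Sum>p\<le>nat (\<bar>a\<bar> + \<bar>b\<bar>). uscal 1 * uq.reld ?M qvar qinv i m k n
     (\<lambda>a' b' u v. co e a' b' p * (scoef s u (a + int p) * scoef t v (b - int p)))
     (\<lambda>a' b' u v. co (- e) a' b' p * (scoef t v (b - int p) * scoef s u (a + int p))) (Lser s) (Lser t))"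
    unfolding rll_def abs_uq_sum abs_uq_diff
  proof (rule sum.cong[OF refl], rule arg_cong2[where f = "(-)", THEN HOL.trans])
    fix p
    show "abs_uq (tmul ?M ?N (Rc ?M ?N e p) (tmul ?M ?N (L1 s (a + int p)) (L2 t (b - int p))) i m k n) =
      (-1) ^ (eparity ?M i m * eparity ?M k n) * (co e (uq.ga ?M qvar qinv i k) (uq.gb ?M qvar qinv i k) p * (scoef s (Lser s i m) (a + int p) * scoef t (Lser t k n) (b - int p))) +
     (-1) ^ (parity ?M k * parity ?M m + parity ?M k * parity ?M n + parity ?M m * parity ?M n) *
      (co e (uq.xa qvar qinv i k) (uq.xb qvar qinv i k) p * (scoef s (Lser s k m) (a + int p) * scoef t (Lser t i n) (b - int p) :: ('m, 'n) uq))"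
      unfolding abs_uq_tmul e12 by (rule uq.tmul_rc_left(1)[OF R Rd Rx R0 cen cen ix])
    show "abs_uq (tmul ?M ?N (tmul ?M ?N (L2 t (b - int p)) (L1 s (a + int p))) (Rc ?M ?N (- e) p) i m k n) =
      co (- e) (uq.ga ?M qvar qinv m n) (uq.gb ?M qvar qinv m n) p * (scoef t (Lser t k n) (b - int p) * scoef s (Lser s i m) (a + int p)) +
     (-1) ^ (parity ?M k * parity ?M m + parity ?M k * parity ?M n + parity ?M m * parity ?M n) *
      (co (- e) (uq.xa qvar qinv n m) (uq.xb qvar qinv n m) p * (scoef t (Lser t k m) (b - int p) * scoef s (Lser s i n) (a + int p) :: ('m, 'n) uq))"
      unfolding abs_uq_tmul e12 by (rule uq.tmul_rc_left(2)[OF R Rd Rx R0 cen cen ix])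
  qed (simp add: uq.reld_def)
  also have "\<dots> = uq.reld ?M qvar qinv i m k n
     (\<lambda>a' b' u v. \<Sum>p\<le>nat (\<bar>a\<bar> + \<bar>b\<bar>). uscal 1 * (co e a' b' p * (scoef s u (a + int p) * scoef t v (b - int p))))
     (\<lambda>a' b' u v. \<Sum>p\<le>nat (\<bar>a\<bar> + \<bar>b\<bar>). uscal 1 * (co (- e) a' b' p * (scoef t v (b - int p) * scoef s u (a + int p)))) (Lser s) (Lser t)"
    by (rule uq.reld_sum[symmetric])
  finally show ?thesis
    by (simp add: co_def G_def)
qed

text \<open>The defining relation in degree \<open>- x\<close> of z and \<open>y\<close> of w. The
  positive series requires \<open>p \<le> x\<close> and the negative one \<open>p \<le> y\<close>,
  which cuts the sum down to \<open>min x y\<close>.\<close>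

theorem mixed_rel4:
  assumes ix: "i \<in> {1..LENGTH('m::len0)+LENGTH('n::len0)}" "m \<in> {1..LENGTH('m)+LENGTH('n)}"
      "k \<in> {1..LENGTH('m)+LENGTH('n)}" "n \<in> {1..LENGTH('m)+LENGTH('n)}"
  shows "uq.rel4 LENGTH('m) qvar qinv i m k n
     (\<lambda>a b u v. uq.conv (g0 LENGTH('m) LENGTH('n)) 1 a b (\<lambda>p. u $ (x - p) * v $ (y - p)) (min x y))
     (\<lambda>a b u v. uq.conv (g0 LENGTH('m) LENGTH('n)) (-1) a b (\<lambda>p. v $ (y - p) * u $ (x - p)) (min x y))
     (Lser Plus) (Lser Minus :: nat \<Rightarrow> nat \<Rightarrow> ('m, 'n) uq fps)"
proof -
  let ?M = "LENGTH('m)" and ?N = "LENGTH('n)"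
  let ?P = "nat (\<bar>- int x\<bar> + \<bar>int y\<bar>)"
  have z: "scoef Plus u (- int x + int p) = (if p \<le> x then u $ (x - p) else 0)"
    "scoef Minus v (int y - int p) = (if p \<le> y then v $ (y - p) else 0)" for u v :: "('m, 'n) uq fps" and p
  proof -
    have "nat (int a - int b) = a - b" for a b by simp
    then show "scoef Plus u (- int x + int p) = (if p \<le> x then u $ (x - p) else 0)"
      "scoef Minus v (int y - int p) = (if p \<le> y then v $ (y - p) else 0)"
      by (auto simp: scoef_def)
  qed
  have s: "(\<Sum>p\<le>?P. f p * (scoef Plus u (- int x + int p) * scoef Minus v (int y - int p))) = (\<Sum>p\<le>min x y. f p * (u $ (x - p) * v $ (y - p)))"
    "(\<Sum>p\<le>?P. f p * (scoef Minus v (int y - int p) * scoef Plus u (- int x + int p))) = (\<Sum>p\<le>min x y. f p * (v $ (y - p) * u $ (x - p)))"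
    for f and u v :: "('m, 'n) uq fps"
    unfolding z by (auto intro!: sum.mono_neutral_cong_right split: if_splits)
  show ?thesis
    using abs_uq_eq_0[OF rels.rll_mixed[OF ix, of "- int x" "int y"]]
    unfolding rll_reld[OF ix] uq.rel4_reld s uq.conv_def by simp
qed

text \<open>Divides a relation by the invertible series \<open>G\<close>. Along a line of fixed
  \<open>a + b\<close> the system is triangular with \<open>G $ 0\<close> on the diagonal, and
  beyond the support of the generating series everything vanishes, which starts the
  induction.\<close>

lemma sgn_vanish:
  fixes Z :: "int \<Rightarrow> int \<Rightarrow> ('m::len0, 'n::len0) uq"
  assumes rel: "\<And>a b. (\<Sum>p\<le>nat (\<bar>a\<bar> + \<bar>b\<bar>). uscal (G $ p) * Z (a + int p) (b - int p)) = 0" and G: "G $ 0 \<noteq> 0"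
    and z: "\<And>a b. (case s of Plus \<Rightarrow> a | Minus \<Rightarrow> - b) > 0 \<Longrightarrow> Z a b = 0"
  shows "Z a b = 0"
proof -
  define r where "r = (\<lambda>a b. (case s of Plus \<Rightarrow> a | Minus \<Rightarrow> - b) :: int)"
  show ?thesis
  proof (induction "nat (1 - r a b)" arbitrary: a b rule: less_induct)
    case less
    show ?case
    proof (cases "r a b > 0")
      case True
      then show ?thesis using z by (simp add: r_def)
    next
      case False
      have "Z (a + int p) (b - int p) = 0" if "p \<noteq> 0" for p
        using that False by (intro less) (auto simp: r_def split: sgn.splits)
      then have "(\<Sum>p\<le>nat (\<bar>a\<bar> + \<bar>b\<bar>). uscal (G $ p) * Z (a + int p) (b - int p)) = (\<Sum>p\<le>nat (\<bar>a\<bar> + \<bar>b\<bar>). if p = 0 then uscal (G $ 0) * Z a b else 0)"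
        by (intro sum.cong) auto
      then have "uscal (G $ 0) * Z a b = 0"
        using rel[of a b] by simp
      then have "uscal (inverse (G $ 0)) * (uscal (G $ 0) * Z a b) = 0"
        by simp
      then show ?thesis
        using G by (simp add: uq.usc.fuse)
    qed
  qed
qed

text \<open>Moves the factor \<open>a + b * fps_X\<close> from the scalar series to the entries by
  shifting the summation index; the boundary term is the one assumed to be 0.\<close>

lemma conv_linear:
  fixes C :: "nat \<Rightarrow> ('m::len0, 'n::len0) uq"
  assumes "C (Suc P) = 0"
  shows "(\<Sum>p\<le>P. uscal ((G * (fps_const a + fps_const b * fps_X)) $ p) * C p) =
    (\<Sum>p\<le>P. uscal (G $ p) * (uscal a * C p + uscal b * C (Suc p)))"
proof -
  have n: "(G * (fps_const a + fps_const b * fps_X)) $ p = a * G $ p + b * (if p = 0 then 0 else G $ (p - 1))" for p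
    by (simp add: distrib_left mult.commute[of G] mult.assoc)
  have "(\<Sum>p\<le>P. uscal (b * (if p = 0 then 0 else G $ (p - 1))) * C p) = (\<Sum>p\<le>P. uscal (G $ p) * (uscal b * C (Suc p)))"
  proof (cases P)
    case (Suc Q)
    have "(\<Sum>p\<le>P. uscal (b * (if p = 0 then 0 else G $ (p - 1))) * C p) = (\<Sum>p\<le>Q. uscal (b * G $ p) * C (Suc p))"
      unfolding Suc by (subst sum.atMost_Suc_shift) simp
    also have "\<dots> = (\<Sum>p\<le>P. uscal (G $ p) * (uscal b * C (Suc p)))"
      using assms by (simp add: Suc uq.usc.fuse mult.commute)
    finally show ?thesis .
  qed (use assms in simp)
  then show ?thesis
    unfolding n uq.usc.add distrib_right by (simp add: distrib_left sum.distrib uq.usc.fuse mult.commute)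
qed

text \<open>For equal signs both sides contain the same series \<open>g0\<close>, so it can be
  divided out; what remains are relations with the linear entries of R(z, w).\<close>

lemma same_reld:
  assumes ix: "i \<in> {1..LENGTH('m::len0)+LENGTH('n::len0)}" "m \<in> {1..LENGTH('m)+LENGTH('n)}"
      "k \<in> {1..LENGTH('m)+LENGTH('n)}" "n \<in> {1..LENGTH('m)+LENGTH('n)}"
    and g: "g0 LENGTH('m) LENGTH('n) $ 0 \<noteq> 0"
  shows "uq.reld LENGTH('m) qvar qinv i m k n
     (\<lambda>a' b' u v. uscal a' * (scoef s u a * scoef s v b) + uscal b' * (scoef s u (a + 1) * scoef s v (b - 1)))
     (\<lambda>a' b' u v. uscal a' * (scoef s v b * scoef s u a) + uscal b' * (scoef s v (b - 1) * scoef s u (a + 1)))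
     (Lser s) (Lser s :: nat \<Rightarrow> nat \<Rightarrow> ('m, 'n) uq fps) = 0"
proof (rule sgn_vanish[where s = s and G = "g0 LENGTH('m) LENGTH('n)" and a = a and b = b and
    Z = "\<lambda>a b. uq.reld LENGTH('m) qvar qinv i m k n
     (\<lambda>a' b' u v. uscal a' * (scoef s u a * scoef s v b) + uscal b' * (scoef s u (a + 1) * scoef s v (b - 1)))
     (\<lambda>a' b' u v. uscal a' * (scoef s v b * scoef s u a) + uscal b' * (scoef s v (b - 1) * scoef s u (a + 1)))
     (Lser s) (Lser s :: nat \<Rightarrow> nat \<Rightarrow> ('m, 'n) uq fps)"])
  have v: "scoef s u a * scoef s v b = 0" "scoef s v b * scoef s u a = 0"
    if "(case s of Plus \<Rightarrow> a | Minus \<Rightarrow> - b) > 0" for u v :: "('m, 'n) uq fps" and a b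
    using that by (cases s; simp add: scoef_def)+
  show "uq.reld LENGTH('m) qvar qinv i m k n
     (\<lambda>a' b' u v. uscal a' * (scoef s u a * scoef s v b) + uscal b' * (scoef s u (a + 1) * scoef s v (b - 1)))
     (\<lambda>a' b' u v. uscal a' * (scoef s v b * scoef s u a) + uscal b' * (scoef s v (b - 1) * scoef s u (a + 1)))
     (Lser s) (Lser s :: nat \<Rightarrow> nat \<Rightarrow> ('m, 'n) uq fps) = 0" if "(case s of Plus \<Rightarrow> a | Minus \<Rightarrow> - b) > 0" for a b
  proof -
    have "(case s of Plus \<Rightarrow> a + 1 | Minus \<Rightarrow> - (b - 1)) > 0"
      using that by (cases s) auto
    then show ?thesis
      using that by (simp add: v uq.reld_def)
  qed
  fix a b :: int
  let ?P = "nat (\<bar>a\<bar> + \<bar>b\<bar>)"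
  \<comment> \<open>One step past the summation bound one of the two series has left its
    support.\<close>
  have z: "scoef s u (a + int (Suc ?P)) * scoef s v (b - int (Suc ?P)) = 0"
    "scoef s v (b - int (Suc ?P)) * scoef s u (a + int (Suc ?P)) = 0" for u v :: "('m, 'n) uq fps"
    by (rule v; cases s; simp)+
  note cl = conv_linear[where C = "\<lambda>p. scoef s u (a + int p) * scoef s v (b - int p)" for u v, OF z(1)]
    conv_linear[where C = "\<lambda>p. scoef s v (b - int p) * scoef s u (a + int p)" for u v, OF z(2)]
  have "0 = uq.reld LENGTH('m) qvar qinv i m k n
     (\<lambda>a' b' u v. \<Sum>p\<le>?P. uscal ((g0 LENGTH('m) LENGTH('n) * (fps_const a' + fps_const b' * fps_X)) $ p) *
        (scoef s u (a + int p) * scoef s v (b - int p)))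
     (\<lambda>a' b' u v. \<Sum>p\<le>?P. uscal ((g0 LENGTH('m) LENGTH('n) * (fps_const a' + fps_const b' * fps_X)) $ p) *
        (scoef s v (b - int p) * scoef s u (a + int p)))
     (Lser s) (Lser s :: nat \<Rightarrow> nat \<Rightarrow> ('m, 'n) uq fps)"
    using abs_uq_eq_0[OF rels.rll_same[OF ix, of s a b]] unfolding rll_reld[OF ix] by (simp add: uq.qc_0)
  also have "\<dots> = (\<Sum>p\<le>?P. uscal (g0 LENGTH('m) LENGTH('n) $ p) * uq.reld LENGTH('m) qvar qinv i m k n
     (\<lambda>a' b' u v. uscal a' * (scoef s u (a + int p) * scoef s v (b - int p)) + uscal b' * (scoef s u (a + int (Suc p)) * scoef s v (b - int (Suc p))))
     (\<lambda>a' b' u v. uscal a' * (scoef s v (b - int p) * scoef s u (a + int p)) + uscal b' * (scoef s v (b - int (Suc p)) * scoef s u (a + int (Suc p))))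
     (Lser s) (Lser s :: nat \<Rightarrow> nat \<Rightarrow> ('m, 'n) uq fps))"
    unfolding cl(1,2) by (rule uq.reld_sum)
  finally show "(\<Sum>p\<le>?P. uscal (g0 LENGTH('m) LENGTH('n) $ p) * uq.reld LENGTH('m) qvar qinv i m k n
     (\<lambda>a' b' u v. uscal a' * (scoef s u (a + int p) * scoef s v (b - int p)) + uscal b' * (scoef s u (a + int p + 1) * scoef s v (b - int p - 1)))
     (\<lambda>a' b' u v. uscal a' * (scoef s v (b - int p) * scoef s u (a + int p)) + uscal b' * (scoef s v (b - int p - 1) * scoef s u (a + int p + 1)))
     (Lser s) (Lser s :: nat \<Rightarrow> nat \<Rightarrow> ('m, 'n) uq fps)) = 0"
    by (simp add: algebra_simps)
qed (use g in auto)

theorem plus_rel4: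
  assumes ix: "i \<in> {1..LENGTH('m::len0)+LENGTH('n::len0)}" "m \<in> {1..LENGTH('m)+LENGTH('n)}"
      "k \<in> {1..LENGTH('m)+LENGTH('n)}" "n \<in> {1..LENGTH('m)+LENGTH('n)}"
    and g: "g0 LENGTH('m) LENGTH('n) $ 0 \<noteq> 0"
  shows "uq.rel4 LENGTH('m) qvar qinv i m k n (\<lambda>a b u v. uq.lin a b (\<lambda>\<mu> \<nu>. u $ \<nu> * v $ \<mu>) \<mu> \<nu>) (\<lambda>a b u v. uq.lin a b (\<lambda>\<mu> \<nu>. v $ \<mu> * u $ \<nu>) \<mu> \<nu>)
    (Lser Plus) (Lser Plus :: nat \<Rightarrow> nat \<Rightarrow> ('m, 'n) uq fps)"
proof -
  have n: "nat (int a - 1) = a - 1" "0 < a \<Longrightarrow> 0 \<le> int a - 1" for a by auto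
  \<comment> \<open>The offset by one arises because \<open>g0\<close> multiplies R(1, w/z), which
    is R(z, w) divided by z.\<close>
  show ?thesis
    using same_reld[OF ix g, of Plus "- int \<nu>" "1 - int \<mu>"] unfolding uq.rel4_reld
    by (elim back_subst[where P = "\<lambda>x. x = 0"], intro arg_cong2[where f = "\<lambda>\<phi> \<psi>. uq.reld LENGTH('m) qvar qinv i m k n \<phi> \<psi> (Lser Plus) (Lser Plus)"] ext)
      (auto simp: scoef_def uq.lin_def n)
qed

theorem minus_rel4:
  assumes ix: "i \<in> {1..LENGTH('m::len0)+LENGTH('n::len0)}" "m \<in> {1..LENGTH('m)+LENGTH('n)}"
      "k \<in> {1..LENGTH('m)+LENGTH('n)}" "n \<in> {1..LENGTH('m)+LENGTH('n)}"
    and g: "g0 LENGTH('m) LENGTH('n) $ 0 \<noteq> 0"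
  shows "uq.rel4 LENGTH('m) qvar qinv i m k n (\<lambda>a b u v. uq.lin b a (\<lambda>\<mu> \<nu>. u $ \<nu> * v $ \<mu>) \<mu> \<nu>) (\<lambda>a b u v. uq.lin b a (\<lambda>\<mu> \<nu>. v $ \<mu> * u $ \<nu>) \<mu> \<nu>)
    (Lser Minus) (Lser Minus :: nat \<Rightarrow> nat \<Rightarrow> ('m, 'n) uq fps)"
proof -
  have n: "nat (int a - 1) = a - 1" "0 < a \<Longrightarrow> 0 \<le> int a - 1" for a by auto
  show ?thesis
    using same_reld[OF ix g, of Minus "int \<nu> - 1" "int \<mu>"] unfolding uq.rel4_reld
    by (elim back_subst[where P = "\<lambda>x. x = 0"], intro arg_cong2[where f = "\<lambda>\<phi> \<psi>. uq.reld LENGTH('m) qvar qinv i m k n \<phi> \<psi> (Lser Minus) (Lser Minus)"] ext)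
      (auto simp: scoef_def uq.lin_def n add.commute)
qed

section \<open>Inverting L and specialising its arguments\<close>

section \<open>Inverse matrices\<close>

context index_order
begin

lemma fps_inverse_exists:
  fixes f :: "'u::ring_1 fps"
  assumes "y * f $ 0 = 1" "f $ 0 * y = 1"
  shows "\<exists>g. g * f = 1 \<and> f * g = 1"
proof -
  have l: "fps_left_inverse f y * f = 1" and r: "f * fps_right_inverse f y = 1"
    using assms by (simp_all add: fps_left_inverse fps_right_inverse)
  have "fps_left_inverse f y * f * fps_right_inverse f y = fps_left_inverse f y"
    by (simp add: mult.assoc r)
  then have "fps_left_inverse f y = fps_right_inverse f y"
    by (simp add: l)
  then show ?thesis
    using l r by metis
qed

text \<open>A condition on constant terms alone: the relations for the zero modes supply it, and it
  suffices for invertibility over formal series.\<close>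

definition triangular :: "'i set \<Rightarrow> ('i \<Rightarrow> 'i \<Rightarrow> 'u::ring_1 fps) \<Rightarrow> bool" where
  "triangular A X \<longleftrightarrow> (\<forall>i\<in>A. \<forall>j\<in>A. i \<prec> j \<longrightarrow> X i j $ 0 = 0) \<and> (\<forall>i\<in>A. \<exists>y. y * X i i $ 0 = 1 \<and> X i i $ 0 * y = 1)"

text \<open>Eliminates an arbitrary index \<open>a\<close>. If \<open>i\<close> precedes or equals
  \<open>j\<close>, then \<open>i\<close> precedes \<open>a\<close> or \<open>a\<close> precedes
  \<open>j\<close>; in both cases the correction has no constant term.\<close>

lemma triangular_schur:
  assumes X: "triangular (insert a B) X" and a: "a \<notin> B"
  shows "triangular B (\<lambda>i j. X i j - X i a * b * X a j)"
proof -
  have z: "X i a $ 0 = 0 \<or> X a j $ 0 = 0" if "i \<in> B" "j \<in> B" "i = j \<or> i \<prec> j" for i j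
  proof (cases "i \<prec> a")
    case True
    then show ?thesis using X that by (auto simp: triangular_def)
  next
    case False
    have "a \<prec> i"
      using False that a total[of i a] by auto
    then have "a \<prec> j"
      using that trans[of a i j] by auto
    then show ?thesis using X that by (auto simp: triangular_def)
  qed
  show ?thesis
    unfolding triangular_def
  proof (intro conjI ballI impI)
    fix i j assume "i \<in> B" "j \<in> B" "i \<prec> j"
    then show "(X i j - X i a * b * X a j) $ 0 = 0"
      using z[of i j] X by (auto simp: triangular_def)
  next
    fix i assume "i \<in> B"
    then have "(X i i - X i a * b * X a i) $ 0 = X i i $ 0"
      using z[of i i] by auto
    then show "\<exists>y. y * (X i i - X i a * b * X a i) $ 0 = 1 \<and> (X i i - X i a * b * X a i) $ 0 * y = 1"
      using X \<open>i \<in> B\<close> by (simp add: triangular_def)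
  qed
qed

text \<open>Gaussian elimination by Schur complements. Over a noncommutative ring, left and right
  systems are solved separately and the solutions compared afterwards.\<close>

lemma triangular_solve_right:
  assumes "finite A" "triangular A X"
  shows "\<exists>y. \<forall>i\<in>A. (\<Sum>j\<in>A. X i j * y j) = v i"
  using assms
proof (induction A arbitrary: X v rule: finite_induct)
  case (insert a B)
  obtain b where b: "b * X a a = 1" "X a a * b = 1"
    using insert.prems fps_inverse_exists unfolding triangular_def by blast
  obtain y where y: "(\<Sum>j\<in>B. (X i j - X i a * b * X a j) * y j) = v i - X i a * b * v a" if "i \<in> B" for i
    using insert.IH[OF triangular_schur[OF insert.prems insert.hyps(2)], of b "\<lambda>i. v i - X i a * b * v a"] by blast
  define ya where "ya = b * (v a - (\<Sum>j\<in>B. X a j * y j))"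
  define y' where "y' = (\<lambda>j. if j = a then ya else y j)"
  have s: "(\<Sum>j\<in>insert a B. X i j * y' j) = X i a * ya + (\<Sum>j\<in>B. X i j * y j)" for i
  proof -
    have "(\<Sum>j\<in>B. X i j * y' j) = (\<Sum>j\<in>B. X i j * y j)"
      using insert.hyps by (intro sum.cong) (auto simp: y'_def)
    then show ?thesis
      using insert.hyps by (simp add: y'_def)
  qed
  have "X a a * ya + (\<Sum>j\<in>B. X a j * y j) = v a"
    by (simp add: ya_def mult.assoc[symmetric] b)
  moreover have "X i a * ya + (\<Sum>j\<in>B. X i j * y j) = v i" if "i \<in> B" for i
    using y[OF that] by (simp add: ya_def left_diff_distrib right_diff_distrib sum_subtractf sum_distrib_left mult.assoc algebra_simps)
  ultimately show ?case
    by (intro exI[of _ y']) (auto simp: s)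
qed simp

lemma triangular_solve_left:
  assumes "finite A" "triangular A X"
  shows "\<exists>y. \<forall>k\<in>A. (\<Sum>j\<in>A. y j * X j k) = v k"
  using assms
proof (induction A arbitrary: X v rule: finite_induct)
  case (insert a B)
  obtain b where b: "b * X a a = 1" "X a a * b = 1"
    using insert.prems fps_inverse_exists unfolding triangular_def by blast
  obtain y where y: "(\<Sum>j\<in>B. y j * (X j k - X j a * b * X a k)) = v k - v a * b * X a k" if "k \<in> B" for k
    using insert.IH[OF triangular_schur[OF insert.prems insert.hyps(2)], of b "\<lambda>k. v k - v a * b * X a k"] by blast
  define ya where "ya = (v a - (\<Sum>j\<in>B. y j * X j a)) * b"
  define y' where "y' = (\<lambda>j. if j = a then ya else y j)"
  have s: "(\<Sum>j\<in>insert a B. y' j * X j k) = ya * X a k + (\<Sum>j\<in>B. y j * X j k)" for k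
  proof -
    have "(\<Sum>j\<in>B. y' j * X j k) = (\<Sum>j\<in>B. y j * X j k)"
      using insert.hyps by (intro sum.cong) (auto simp: y'_def)
    then show ?thesis
      using insert.hyps by (simp add: y'_def)
  qed
  have "ya * X a a + (\<Sum>j\<in>B. y j * X j a) = v a"
    by (simp add: ya_def mult.assoc b)
  moreover have "ya * X a k + (\<Sum>j\<in>B. y j * X j k) = v k" if "k \<in> B" for k
    using y[OF that] by (simp add: ya_def left_diff_distrib right_diff_distrib sum_subtractf sum_distrib_right mult.assoc algebra_simps)
  ultimately show ?case
    by (intro exI[of _ y']) (auto simp: s)
qed simp

lemma left_right_inverse_unique:
  fixes X :: "'j \<Rightarrow> 'j \<Rightarrow> 'a::ring_1"
  assumes A: "finite A" and r: "\<And>i k. i \<in> A \<Longrightarrow> k \<in> A \<Longrightarrow> (\<Sum>j\<in>A. X i j * Y j k) = (if i = k then 1 else 0)"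
    and l: "\<And>i k. i \<in> A \<Longrightarrow> k \<in> A \<Longrightarrow> (\<Sum>j\<in>A. Z i j * X j k) = (if i = k then 1 else 0)"
    and ik: "i \<in> A" "k \<in> A"
  shows "Z i k = Y i k"
proof -
  have "Z i k = (\<Sum>j\<in>A. if j = k then Z i j else 0)"
    using A ik by simp
  also have "\<dots> = (\<Sum>j\<in>A. Z i j * (\<Sum>l\<in>A. X j l * Y l k))"
    using ik by (intro sum.cong refl) (simp add: r)
  also have "\<dots> = (\<Sum>l\<in>A. (\<Sum>j\<in>A. Z i j * X j l) * Y l k)"
    unfolding sum_distrib_left sum_distrib_right by (subst sum.swap) (simp add: mult.assoc)
  also have "\<dots> = (\<Sum>l\<in>A. if l = i then Y l k else 0)"
    using ik by (intro sum.cong refl) (simp add: l)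
  finally show ?thesis
    using A ik by simp
qed

theorem triangular_inverse:
  assumes A: "finite A" and X: "triangular A X"
  obtains Y where "\<And>i k. i \<in> A \<Longrightarrow> k \<in> A \<Longrightarrow> (\<Sum>j\<in>A. X i j * Y j k) = (if i = k then 1 else 0)"
    "\<And>i k. i \<in> A \<Longrightarrow> k \<in> A \<Longrightarrow> (\<Sum>j\<in>A. Y i j * X j k) = (if i = k then 1 else 0)"
proof -
  have "\<forall>k. \<exists>y. \<forall>i\<in>A. (\<Sum>j\<in>A. X i j * y j) = (if i = k then 1 else 0)"
    by (rule allI) (rule triangular_solve_right[OF A X])
  then obtain Y0 where "\<forall>k. \<forall>i\<in>A. (\<Sum>j\<in>A. X i j * Y0 k j) = (if i = k then 1 else 0)"
    by metis
  then have Y: "i \<in> A \<Longrightarrow> k \<in> A \<Longrightarrow> (\<Sum>j\<in>A. X i j * Y0 k j) = (if i = k then 1 else 0)" for i k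
    by blast
  have "\<forall>i. \<exists>y. \<forall>k\<in>A. (\<Sum>j\<in>A. y j * X j k) = (if i = k then 1 else 0)"
    by (rule allI) (rule triangular_solve_left[OF A X])
  then obtain Z where "\<forall>i. \<forall>k\<in>A. (\<Sum>j\<in>A. Z i j * X j k) = (if i = k then 1 else 0)"
    by metis
  then have Z: "i \<in> A \<Longrightarrow> k \<in> A \<Longrightarrow> (\<Sum>j\<in>A. Z i j * X j k) = (if i = k then 1 else 0)" for i k
    by blast
  have eq: "i \<in> A \<Longrightarrow> k \<in> A \<Longrightarrow> Z i k = Y0 k i" for i k
    by (rule left_right_inverse_unique[OF A Y Z])
  show ?thesis
  proof (rule that[of Z])
    show "(\<Sum>j\<in>A. X i j * Z j k) = (if i = k then 1 else 0)" if "i \<in> A" "k \<in> A" for i k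
      using Y[OF that] that by (simp add: eq)
  qed (rule Z)
qed

end

text \<open>The Koszul sign of the product of even matrices is a coboundary.\<close>

definition tw :: "nat \<Rightarrow> nat \<Rightarrow> nat \<Rightarrow> 'a::ring_1" where
  "tw M i j = (if i \<le> M \<and> M < j then - 1 else 1)"

lemma tw_simps: "tw M i j * (tw M i j * x) = (x :: 'a::ring_1)" "x * (tw M i j * y) = tw M i j * (x * y)"
  by (auto simp: tw_def)

lemma smul_tw: "smul M N X Y i k = tw M i k * (\<Sum>j=1..M+N. (tw M i j * X i j) * (tw M j k * Y j k))"
proof -
  have "(-1) ^ (eparity M j k * eparity M i j) = tw M i k * (tw M i j * (tw M j k :: 'a))" for j
    by (auto simp: tw_def eparity_def parity_def)
  then show ?thesis
    unfolding smul_def sum_distrib_left by (intro sum.cong refl) (simp add: mult.assoc tw_simps(2)[of "X _ _"])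
qed

lemma sinverse_tw:
  "sinverse M N X Y \<longleftrightarrow> (\<forall>i\<in>{1..M+N}. \<forall>k\<in>{1..M+N}.
    (\<Sum>j=1..M+N. (tw M i j * X i j) * (tw M j k * Y j k)) = (if i = k then 1 else 0) \<and>
    (\<Sum>j=1..M+N. (tw M i j * Y i j) * (tw M j k * X j k)) = (if i = k then 1 else 0))"
proof -
  have "tw M i k * x = (if i = k then 1 else 0) \<longleftrightarrow> x = (if i = k then 1 else (0::'a))" for i k x
    by (auto simp: tw_def)
  then show ?thesis
    unfolding sinverse_def smul_tw by simp
qed

text \<open>The description in \<open>sinv\<close> denotes something as soon as an inverse exists:
  cut off outside the index range, it is unique.\<close>

theorem sinverse_sinv:
  fixes X :: "nat \<Rightarrow> nat \<Rightarrow> 'a::ring_1"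
  assumes "sinverse M N X Y"
  shows "sinverse M N X (sinv M N X)"
proof -
  let ?A = "{1..M+N}"
  let ?P = "\<lambda>Y. (\<forall>i j. i \<notin> ?A \<or> j \<notin> ?A \<longrightarrow> Y i j = 0) \<and>
     (\<forall>i\<in>?A. \<forall>j\<in>?A. smul M N X Y i j = sone M N i j \<and> smul M N Y X i j = sone M N i j)"
  have P: "?P Y \<longleftrightarrow> (\<forall>i j. i \<notin> ?A \<or> j \<notin> ?A \<longrightarrow> Y i j = 0) \<and> sinverse M N X Y" for Y
    by (auto simp: sinverse_def sone_def)
  have "\<exists>!Y. ?P Y"
  proof (rule ex1I)
    define Y' where "Y' = (\<lambda>i j. if i \<in> ?A \<and> j \<in> ?A then Y i j else 0)"
    have "sinverse M N X Y'"
      using assms by (simp add: sinverse_def smul_def Y'_def)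
    then show "?P Y'"
      unfolding P by (auto simp: Y'_def)
    fix Z assume Z: "?P Z"
    then have Z': "sinverse M N X Z"
      unfolding P by blast
    have "tw M i k * Z i k = tw M i k * Y' i k" if "i \<in> ?A" "k \<in> ?A" for i k
      by (rule nat_order.left_right_inverse_unique[of ?A "\<lambda>i j. tw M i j * X i j" "\<lambda>i j. tw M i j * Y' i j" "\<lambda>i j. tw M i j * Z i j"])
        (use Z' \<open>sinverse M N X Y'\<close> that in \<open>simp_all add: sinverse_tw\<close>)
    then have "Z i k = Y' i k" if "i \<in> ?A" "k \<in> ?A" for i k
      using that tw_simps(1)[of M i k] by metis
    then show "Z = Y'"
      using Z by (auto simp: fun_eq_iff Y'_def)
  qed
  then have "?P (sinv M N X)"
    unfolding sinv_def by (rule theI')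
  then show ?thesis
    unfolding P by blast
qed

theorem triangular_sinverse:
  fixes X :: "nat \<Rightarrow> nat \<Rightarrow> 'u::ring_1 fps"
  assumes lt: "index_order lt" and X: "index_order.triangular lt {1..M+N} X"
  shows "sinverse M N X (sinv M N X)"
proof -
  interpret index_order lt by fact
  have "triangular {1..M+N} (\<lambda>i j. tw M i j * X i j)"
    unfolding triangular_def
  proof (intro conjI ballI impI)
    fix i j assume "i \<in> {1..M+N}" "j \<in> {1..M+N}" "lt i j"
    then show "(tw M i j * X i j) $ 0 = 0"
      using X by (auto simp: triangular_def tw_def)
  next
    fix i assume "i \<in> {1..M+N}"
    then show "\<exists>y. y * (tw M i i * X i i) $ 0 = 1 \<and> (tw M i i * X i i) $ 0 * y = 1"
      using X by (auto simp: triangular_def tw_def)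
  qed
  then obtain Y where Y: "\<And>i k. i \<in> {1..M+N} \<Longrightarrow> k \<in> {1..M+N} \<Longrightarrow> (\<Sum>j=1..M+N. tw M i j * X i j * Y j k) = (if i = k then 1 else 0)"
    "\<And>i k. i \<in> {1..M+N} \<Longrightarrow> k \<in> {1..M+N} \<Longrightarrow> (\<Sum>j=1..M+N. Y i j * (tw M j k * X j k)) = (if i = k then 1 else 0)"
    using triangular_inverse[of "{1..M+N}" "\<lambda>i j. tw M i j * X i j"] by blast
  have "sinverse M N X (\<lambda>i j. tw M i j * Y i j)"
    unfolding sinverse_tw tw_simps(1) using Y by blast
  then show ?thesis
    by (rule sinverse_sinv)
qed

section \<open>Specialised spectral parameters\<close>

context qc_ring
begin

text \<open>Both variables become multiples of a single one. A coefficient is then a sum over an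
  antidiagonal, and the linear form turns into the number \<open>a * c2 + b * c1\<close> times that
  variable.\<close>

lemma lin_diagonal:
  "(\<Sum>i\<le>Suc n. usc (c1 ^ i * c2 ^ (Suc n - i)) * lin a b P (Suc n - i) i) =
    usc (a * c2 + b * c1) * (\<Sum>i\<le>n. usc (c1 ^ i * c2 ^ (n - i)) * P (n - i) i)"
proof -
  have "(\<Sum>i\<le>Suc n. usc (c1 ^ i * c2 ^ (Suc n - i)) * lin a b P (Suc n - i) i) =
    (\<Sum>i\<le>Suc n. if Suc n - i = 0 then 0 else usc (c1 ^ i * c2 ^ (Suc n - i) * a) * P (Suc n - i - 1) i) +
    (\<Sum>i\<le>Suc n. if i = 0 then 0 else usc (c1 ^ i * c2 ^ (Suc n - i) * b) * P (Suc n - i) (i - 1))"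
    unfolding sum.distrib[symmetric] by (intro sum.cong refl) (simp add: lin_def distrib_left usc.fuse)
  also have "(\<Sum>i\<le>Suc n. if Suc n - i = 0 then 0 else usc (c1 ^ i * c2 ^ (Suc n - i) * a) * P (Suc n - i - 1) i) =
    (\<Sum>i\<le>n. usc (c1 ^ i * c2 ^ (Suc n - i) * a) * P (n - i) i)"
    by (subst sum.atMost_Suc) (auto intro!: sum.cong simp: Suc_diff_le)
  also have "\<dots> = (\<Sum>i\<le>n. usc (a * c2) * (usc (c1 ^ i * c2 ^ (n - i)) * P (n - i) i))"
    by (intro sum.cong refl) (simp add: usc.fuse Suc_diff_le mult_ac)
  also have "(\<Sum>i\<le>Suc n. if i = 0 then 0 else usc (c1 ^ i * c2 ^ (Suc n - i) * b) * P (Suc n - i) (i - 1)) =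
    (\<Sum>i\<le>n. usc (c1 ^ Suc i * c2 ^ (n - i) * b) * P (n - i) i)"
    by (subst sum.atMost_Suc_shift) simp
  also have "\<dots> = (\<Sum>i\<le>n. usc (b * c1) * (usc (c1 ^ i * c2 ^ (n - i)) * P (n - i) i))"
    by (intro sum.cong refl) (simp add: usc.fuse mult_ac)
  finally show ?thesis
      by (simp only: usc.add distrib_right sum_distrib_left sum.distrib)
qed

lemma udil_mult_nth:
  "(udil c1 u * udil c2 v) $ n = (\<Sum>i\<le>n. usc (c1 ^ i * c2 ^ (n - i)) * (u $ i * v $ (n - i)))"
  "(udil c2 v * udil c1 u) $ n = (\<Sum>i\<le>n. usc (c1 ^ i * c2 ^ (n - i)) * (v $ (n - i) * u $ i))"
proof -
  show "(udil c1 u * udil c2 v) $ n = (\<Sum>i\<le>n. usc (c1 ^ i * c2 ^ (n - i)) * (u $ i * v $ (n - i)))"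
    by (simp add: fps_mult_nth udil_nth atLeast0AtMost mult.assoc usc.swap[where x = "u $ _"] usc.fuse)
  have "(udil c2 v * udil c1 u) $ n = (\<Sum>i\<le>n. usc (c2 ^ i * c1 ^ (n - i)) * (v $ i * u $ (n - i)))"
    by (simp add: fps_mult_nth udil_nth atLeast0AtMost mult.assoc usc.swap[where x = "v $ _"] usc.fuse)
  also have "\<dots> = (\<Sum>i\<le>n. usc (c1 ^ i * c2 ^ (n - i)) * (v $ (n - i) * u $ i))"
    by (rule sum.reindex_bij_witness[where i = "\<lambda>i. n - i" and j = "\<lambda>i. n - i"]) (auto simp: mult.commute)
  finally show "(udil c2 v * udil c1 u) $ n = (\<Sum>i\<le>n. usc (c1 ^ i * c2 ^ (n - i)) * (v $ (n - i) * u $ i))" .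
qed

lemma sc_const_mult_nth: "(sc \<epsilon> (1 * (kc x * kc a + kc y * kc b)) * emb_in F) $ \<mu> $ \<nu> = (if \<mu> = 0 then usc (a * x + b * y) * F $ \<nu> else 0)"
proof -
  have "1 * (kc x * kc a + kc y * kc b) = kc (a * x + b * y)"
    by (simp add: kc_simps mult.commute)
  then show ?thesis
    by (simp add: sc_kc emb_in_def)
qed

lemma emb_in_mult: "emb_in f * emb_in g = emb_in (f * g)"
  by (simp add: emb_in_def)

text \<open>Yields the relations between L(z q^e) and L(z q^f) in one variable, which make D and E
  antisymmetric. The functions \<open>\<alpha>\<close> and \<open>\<beta>\<close> let the two
  coefficients change places according to the sign.\<close>

theorem grll_inner:
  assumes qq: "q * q' = 1" and zw: "\<And>a b. \<kappa> * (\<alpha> a b * c2 + \<beta> a b * c1) = a * z0 + b * w0" and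
    rel: "\<And>\<mu> \<nu> i m k n. i \<in> {1..M+N} \<Longrightarrow> m \<in> {1..M+N} \<Longrightarrow> k \<in> {1..M+N} \<Longrightarrow> n \<in> {1..M+N} \<Longrightarrow>
      rel4 M q q' i m k n (\<lambda>a b u v. lin (\<alpha> a b) (\<beta> a b) (\<lambda>\<mu> \<nu>. u $ \<nu> * v $ \<mu>) \<mu> \<nu>) (\<lambda>a b u v. lin (\<alpha> a b) (\<beta> a b) (\<lambda>\<mu> \<nu>. v $ \<mu> * u $ \<nu>) \<mu> \<nu>) f f"
  shows "rtt.grll (<) M N (kc q) (kc q') (sc \<epsilon>) (sc \<epsilon>) 1 (kc z0) (kc w0)
      (\<lambda>i j. emb_in (udil c1 (f i j))) (\<lambda>i j. emb_in (udil c2 (f i j)))"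
proof (rule grll_series[where \<kappa> = "\<lambda>\<mu> \<nu>. \<kappa>", OF qq])
  have e: "usc (a * z0 + b * w0) * x = usc \<kappa> * (usc (\<alpha> a b * c2 + \<beta> a b * c1) * x)" for a b x
    by (simp add: usc.fuse zw)
  \<comment> \<open>The linear form raises the total degree by one, hence
    \<open>Suc \<nu>\<close>.\<close>
  show "(sc \<epsilon> (1 * (kc z0 * kc a + kc w0 * kc b)) * (emb_in (udil c1 (f i m)) * emb_in (udil c2 (f k n)))) $ \<mu> $ \<nu> =
    usc \<kappa> * (if \<mu> = 0 then \<Sum>p\<le>Suc \<nu>. usc (c1 ^ p * c2 ^ (Suc \<nu> - p)) * lin (\<alpha> a b) (\<beta> a b) (\<lambda>\<mu> \<nu>. f i m $ \<nu> * f k n $ \<mu>) (Suc \<nu> - p) p else 0)"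
    for a b i m k n \<mu> \<nu>
    unfolding emb_in_mult sc_const_mult_nth lin_diagonal udil_mult_nth(1) e by simp
  show "(sc \<epsilon> (1 * (kc z0 * kc a + kc w0 * kc b)) * (emb_in (udil c2 (f k n)) * emb_in (udil c1 (f i m)))) $ \<mu> $ \<nu> =
    usc \<kappa> * (if \<mu> = 0 then \<Sum>p\<le>Suc \<nu>. usc (c1 ^ p * c2 ^ (Suc \<nu> - p)) * lin (\<alpha> a b) (\<beta> a b) (\<lambda>\<mu> \<nu>. f k n $ \<mu> * f i m $ \<nu>) (Suc \<nu> - p) p else 0)"
    for a b i m k n \<mu> \<nu>
    unfolding emb_in_mult sc_const_mult_nth lin_diagonal udil_mult_nth(2) e by simp
  fix \<mu> \<nu> i m k n assume ix: "i \<in> {1..M+N}" "m \<in> {1..M+N}" "k \<in> {1..M+N}" "n \<in> {1..M+N}"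
  show "rel4 M q q' i m k n
     (\<lambda>a b u v. if \<mu> = 0 then \<Sum>p\<le>Suc \<nu>. usc (c1 ^ p * c2 ^ (Suc \<nu> - p)) * lin (\<alpha> a b) (\<beta> a b) (\<lambda>\<mu> \<nu>. u $ \<nu> * v $ \<mu>) (Suc \<nu> - p) p else 0)
     (\<lambda>a b u v. if \<mu> = 0 then \<Sum>p\<le>Suc \<nu>. usc (c1 ^ p * c2 ^ (Suc \<nu> - p)) * lin (\<alpha> a b) (\<beta> a b) (\<lambda>\<mu> \<nu>. v $ \<mu> * u $ \<nu>) (Suc \<nu> - p) p else 0) f f"
  proof (cases "\<mu> = 0")
    case True
    have "reld M q q' i m k n
     (\<lambda>a b u v. \<Sum>p\<le>Suc \<nu>. usc (c1 ^ p * c2 ^ (Suc \<nu> - p)) * lin (\<alpha> a b) (\<beta> a b) (\<lambda>\<mu> \<nu>. u $ \<nu> * v $ \<mu>) (Suc \<nu> - p) p)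
     (\<lambda>a b u v. \<Sum>p\<le>Suc \<nu>. usc (c1 ^ p * c2 ^ (Suc \<nu> - p)) * lin (\<alpha> a b) (\<beta> a b) (\<lambda>\<mu> \<nu>. v $ \<mu> * u $ \<nu>) (Suc \<nu> - p) p) f f = 0"
      unfolding reld_sum using rel[OF ix] unfolding rel4_reld by (intro sum.neutral) simp
    then show ?thesis
      by (simp only: rel4_reld True if_True simp_thms)
  next
    case False
    then show ?thesis
      by (simp add: rel4_reld reld_zero)
  qed
qed

end

section \<open>The centrality argument in abstract form\<close>

section \<open>Commutation with all matrix entries\<close>

context index_order
begin

lemma ring_prod_commute:
  assumes "\<And>e r c. e \<in> set es \<Longrightarrow> r \<in> set rs \<Longrightarrow> c \<in> set cs \<Longrightarrow> T e r c * y = y * (T e r c :: 'a::ring_1)"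
  shows "ring_prod T es rs cs * y = y * ring_prod T es rs cs"
  using assms
proof (induction T es rs cs rule: ring_prod.induct)
  case (1 T e es r rs c cs)
  then have "ring_prod T es rs cs * y = y * ring_prod T es rs cs" "T e r c * y = y * T e r c"
    by auto
  then show ?case
    by (simp add: mult.assoc) (simp add: mult.assoc[symmetric])
qed auto

lemma ring_minor_commute:
  assumes s: "central_hom s"
    and "\<And>e r c. e \<in> set es \<Longrightarrow> r \<in> A \<Longrightarrow> c \<in> set cs \<Longrightarrow> T e r c * y = y * (T e r c :: 'a::ring_1)"
  shows "ring_minor s t A T es cs * y = y * ring_minor s t A T es cs"
proof -
  interpret central_hom s by fact
  have "ring_prod T es rs cs * y = y * ring_prod T es rs cs" if "rs \<in> lists_on A (length es)" for rs
    by (rule ring_prod_commute) (use that assms(2) in \<open>auto simp: lists_on_def\<close>)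
  then show ?thesis
    by (auto simp: ring_minor_def sum_distrib_left sum_distrib_right mult.assoc swap intro: sum.cong)
qed

lemma wt_hom_cong:
  assumes "central_hom s" "central_hom s'" "s t = s' t"
  shows "s (wt t xs) = s' (wt t xs)"
  using assms by (simp add: wt_def central_hom.power central_hom.uminus central_hom.one central_hom.zero)

lemma antisym_ring_cong: "s t = s' t \<Longrightarrow> antisym_ring s t A X Y = antisym_ring s' t A X Y"
  by (simp add: antisym_ring_def)

lemma ring_minor_cong:
  assumes "central_hom s" "central_hom s'" "s t = s' t"
  shows "ring_minor s t A T es cs = ring_minor s' t A T es cs"
  by (simp add: ring_minor_def wt_hom_cong[OF assms])

end

lemma smul_opp: "smul M N (\<lambda>i j. Opp (X j i)) (\<lambda>i j. Opp (Y j i)) i k = Opp (smul M N Y X k i)"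
proof -
  have e: "unopp ((-1) ^ (eparity M j k * eparity M i j) * (Opp (X j i) * Opp (Y k j))) =
      (-1) ^ (eparity M j i * eparity M k j) * (Y k j * X j i)" for j
  proof -
    have u: "unopp ((-1) ^ e) = (-1) ^ e" for e
      by (induction e) auto
    have c: "x * (-1) ^ e = (-1) ^ e * x" for x :: 'a and e
      by (cases "even e") auto
    have "eparity M j k * eparity M i j = eparity M j i * eparity M k j"
      by (simp add: eparity_def mult.commute add.commute)
    then show ?thesis
      by (simp add: u c[of "Y k j * X j i"])
  qed
  show ?thesis
    unfolding smul_def opp_eq_iff unopp_sum opp.sel by (intro sum.cong refl) (rule e)
qed

lemma sinverse_opp: "sinverse M N X Y \<Longrightarrow> sinverse M N (\<lambda>i j. Opp (X j i)) (\<lambda>i j. Opp (Y j i))"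
  unfolding sinverse_def smul_opp by (auto simp: opp_eq_iff)

text \<open>Exponents of q, rising from 0 to 2M - 2; \<open>odd_shifts\<close> falls from 2M - 2 to
  2M - 2N, so that it begins where this list ends.\<close>

definition even_shifts :: "nat \<Rightarrow> int list" where
  "even_shifts M = map (\<lambda>k. 2 * int k) [0..<M]"

definition odd_shifts :: "nat \<Rightarrow> nat \<Rightarrow> int list" where
  "odd_shifts M N = map (\<lambda>k. 2 * int M - 2 - 2 * int k) [0..<N]"

lemma successively_map_upt:
  fixes f :: "nat \<Rightarrow> int"
  assumes "\<And>k. f (Suc k) = f k + c" "\<And>x. P x (x + c)"
  shows "successively P (map f [a..<b])"
proof (induction b)
  case (Suc b)
  have "P (f (b - 1)) (f b)" if "a < b"
    using assms(1)[of "b - 1"] assms(2) that by simp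
  with Suc show ?case
    by (cases "a < b"; cases "a = b") (auto simp: successively_append_iff last_map)
qed simp

lemma sorted_wrt_map_upt:
  "(\<And>k l. k < l \<Longrightarrow> P (f k) (f l)) \<Longrightarrow> sorted_wrt P (map f [a..<b])"
  by (induction b) (auto simp: sorted_wrt_append)

text \<open>E passes K with the scalars \<open>u\<close>, \<open>u'\<close> and D with
  \<open>v\<close>, \<open>v'\<close>; since \<open>u\<close> and \<open>u'\<close> are central,
  both steps combine without any cancellation.\<close>

lemma exchange_twice:
  fixes D E K u u' v v' :: "'a::ring_1"
  assumes cu: "\<And>x. u * x = x * u" and cu': "\<And>x. u' * x = x * u'"
    and EK: "u * (E * K) = u' * (K * E)" and KD: "v * (K * D) = v' * (D * K)"
  shows "u * (v' * (D * E * K)) = u' * (v * (K * (D * E)))"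
proof -
  have "u * (v' * (D * E * K)) = v' * (D * E * K) * u"
    by (rule cu)
  also have "\<dots> = v' * (D * (u * (E * K)))"
    by (simp only: mult.assoc cu[of "E * K"])
  also have "\<dots> = v' * (D * (u' * (K * E)))"
    by (simp only: EK)
  also have "\<dots> = v' * (D * K) * E * u'"
    by (simp only: mult.assoc cu'[of "K * E"])
  also have "\<dots> = v * (K * D) * E * u'"
    by (simp only: KD)
  also have "\<dots> = u' * (v * (K * (D * E)))"
    by (simp only: mult.assoc cu'[of "v * (K * (D * E))"])
  finally show ?thesis .
qed

text \<open>Collects the relations in a form stable under passage to the opposite ring, so that
  results on even rows yield results on even columns. \<open>z\<close> and \<open>w\<close> are the
  parameters in relations with \<open>mu\<close>; \<open>zl\<close> serves the relations among the
  \<open>lam\<close>, which live in one variable.\<close>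

locale berez = rtt lt M N p p'
  for lt :: "nat \<Rightarrow> nat \<Rightarrow> bool" (infix "\<prec>" 50) and M N :: nat and p p' :: "'k::comm_ring_1" +
  fixes s s' :: "'k \<Rightarrow> 'a::ring_1" and lam kk :: "int \<Rightarrow> nat \<Rightarrow> nat \<Rightarrow> 'a" and mu ka mi :: "nat \<Rightarrow> nat \<Rightarrow> 'a"
    and g h z zl :: "int \<Rightarrow> 'k" and w :: 'k and C0 C1 :: "nat list"
  assumes s: "central_hom s" and s': "central_hom s'" and sp: "s p' = s' p'"
    and pp_diff: "\<exists>l. l * (p - p') = 1"
    and z_step: "z (e + 2) = z e * p * p"
    and zl_step: "zl (e + 2) = zl e * p * p" and zl_unit: "\<exists>u. u * zl e = 1"
    and zl_sym: "e < f \<Longrightarrow> \<exists>u. u * (p * zl f - p' * zl e) = 1"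
    and ll: "grll s s 1 (zl e) (zl f) (lam e) (lam f)" "grll s' s' 1 (zl e) (zl f) (lam e) (lam f)"
    and lm: "grll s s' (g e) (z e) w (lam e) mu" and ml: "grll s s' (h e) w (z e) mu (lam e)"
    and lk: "sinverse M N (lam e) (kk e)" and mk: "sinverse M N mu ka"
    and lk_comm: "i \<in> {1..M} \<Longrightarrow> c \<in> {1..M} \<Longrightarrow> r \<in> {M+1..M+N} \<Longrightarrow> b \<in> {M+1..M+N} \<Longrightarrow>
      lam e i c * kk f r b = kk f r b * lam e i c"
    and mi: "i \<in> {1..M} \<Longrightarrow> k \<in> {1..M} \<Longrightarrow> (\<Sum>j\<in>{1..M}. mu i j * mi j k) = (if i = k then 1 else 0)"
      "i \<in> {1..M} \<Longrightarrow> k \<in> {1..M} \<Longrightarrow> (\<Sum>j\<in>{1..M}. mi i j * mu j k) = (if i = k then 1 else 0)"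
    and C0: "sorted_wrt (\<prec>) C0" "set C0 = {1..M}" and C1: "sorted_wrt (\<lambda>x y. y \<prec> x) C1" "set C1 = {M+1..M+N}"
begin

abbreviation "I \<equiv> {1..M}"
abbreviation "J \<equiv> {M+1..M+N}"
abbreviation "ds \<equiv> even_shifts M"
abbreviation "js \<equiv> odd_shifts M N"

lemma Ix_split: "I \<union> J = Ix" "I \<inter> J = {}"
  by auto

lemma sum_Ix: "(\<Sum>n\<in>Ix. f n) = (\<Sum>n\<in>I. f n) + (\<Sum>n\<in>J. f n)" for f :: "nat \<Rightarrow> 'x::comm_monoid_add"
  using sum.union_disjoint[of I J f] Ix_split by simp

lemma sp': "s p = s' p"
proof -
  interpret s: central_hom s by (rule s)
  interpret s': central_hom s' by (rule s')
  have "s p = s p * (s' p' * s' p)"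
    using pp by (simp add: mult.commute flip: s'.mult)
  also have "\<dots> = s (p * p') * s' p"
    by (simp add: s.mult sp mult.assoc)
  finally show ?thesis
    using pp by simp
qed

lemma pp_diff': "\<exists>l. l * (p' - p) = 1"
  using pp_diff by (metis minus_diff_eq minus_mult_minus)

lemma z_step': "z (e - 2) = z e * p' * p'"
proof -
  have "z e = z (e - 2) * p * p"
    using z_step[of "e - 2"] by simp
  then have "z e * p' * p' = z (e - 2) * (p * p') * (p * p')"
    by (simp only: mult_ac)
  then show ?thesis
    using pp by simp
qed

lemma zl_step': "zl (e - 2) = zl e * p' * p'"
proof -
  have "zl e = zl (e - 2) * p * p"
    using zl_step[of "e - 2"] by simp
  then have "zl e * p' * p' = zl (e - 2) * (p * p') * (p * p')"
    by (simp only: mult_ac)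
  then show ?thesis
    using pp by simp
qed

lemma smul_even_odd: "i \<in> I \<Longrightarrow> b \<in> J \<Longrightarrow> smul M N X Y i b = (\<Sum>n\<in>Ix. X i n * Y n b)"
  "i \<in> I \<Longrightarrow> b \<in> J \<Longrightarrow> smul M N X Y b i = (\<Sum>n\<in>Ix. X b n * Y n i)"
  unfolding smul_def by (auto intro!: sum.cong simp: eparity_def parity_def)

lemma smul_odd_odd: "a \<in> J \<Longrightarrow> c \<in> J \<Longrightarrow> smul M N X Y a c = (\<Sum>n\<in>J. X a n * Y n c) - (\<Sum>n\<in>I. X a n * Y n c)"
proof -
  assume *: "a \<in> J" "c \<in> J"
  have "smul M N X Y a c = (\<Sum>n\<in>I. - (X a n * Y n c)) + (\<Sum>n\<in>J. X a n * Y n c)"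
    unfolding smul_def sum_Ix using * by (intro arg_cong2[where f = "(+)"] sum.cong refl) (auto simp: eparity_def parity_def)
  then show ?thesis
    by (simp add: sum_negf)
qed

lemma mu_ka_0: "i \<in> I \<Longrightarrow> b \<in> J \<Longrightarrow> (\<Sum>n\<in>I. mu i n * ka n b) + (\<Sum>n\<in>J. mu i n * ka n b) = 0"
  and ka_mu_0: "i \<in> I \<Longrightarrow> b \<in> J \<Longrightarrow> (\<Sum>n\<in>I. ka b n * mu n i) + (\<Sum>n\<in>J. ka b n * mu n i) = 0"
  using mk smul_even_odd(1)[of i b mu ka] smul_even_odd(2)[of i b ka mu] unfolding sinverse_def sum_Ix by force+

lemma mu_ka_1: "a \<in> J \<Longrightarrow> c \<in> J \<Longrightarrow> (\<Sum>n\<in>J. mu a n * ka n c) = (if a = c then 1 else 0) + (\<Sum>n\<in>I. mu a n * ka n c)"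
  and ka_mu_1: "a \<in> J \<Longrightarrow> c \<in> J \<Longrightarrow> (\<Sum>n\<in>J. ka a n * mu n c) = (if a = c then 1 else 0) + (\<Sum>n\<in>I. ka a n * mu n c)"
  using mk smul_odd_odd[of a c mu ka] smul_odd_odd[of a c ka mu] unfolding sinverse_def by (simp_all add: algebra_simps)

text \<open>The inverse of the odd block of \<open>ka\<close>, as a Schur complement.\<close>

definition ka' :: "nat \<Rightarrow> nat \<Rightarrow> 'a" where
  "ka' a b = mu a b + (\<Sum>n\<in>I. \<Sum>i\<in>I. mu a n * (mi n i * mu i b))"

lemma ka_ka': "a \<in> J \<Longrightarrow> c \<in> J \<Longrightarrow> (\<Sum>b\<in>J. ka a b * ka' b c) = (if a = c then 1 else 0)"
proof -
  assume *: "a \<in> J" "c \<in> J"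
  have "(\<Sum>b\<in>J. ka a b * (\<Sum>n\<in>I. \<Sum>i\<in>I. mu b n * (mi n i * mu i c))) = (\<Sum>n\<in>I. \<Sum>i\<in>I. (\<Sum>b\<in>J. ka a b * mu b n) * mi n i * mu i c)"
    unfolding sum_distrib_left sum_distrib_right
    by (subst sum.swap, rule sum.cong[OF refl], subst sum.swap, simp add: mult.assoc)
  also have "\<dots> = (\<Sum>n\<in>I. \<Sum>i\<in>I. - (\<Sum>m\<in>I. ka a m * mu m n) * mi n i * mu i c)"
    using ka_mu_0[OF _ *(1)] by (intro sum.cong refl arg_cong2[where f = "(*)"]) (simp add: eq_neg_iff_add_eq_0 add.commute)
  also have "\<dots> = (\<Sum>i\<in>I. \<Sum>n\<in>I. - (\<Sum>m\<in>I. ka a m * mu m n) * mi n i * mu i c)"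
    by (rule sum.swap)
  also have "\<dots> = - (\<Sum>i\<in>I. (\<Sum>m\<in>I. ka a m * (\<Sum>n\<in>I. mu m n * mi n i)) * mu i c)"
    unfolding sum_negf[symmetric]
    by (intro sum.cong refl) (simp add: sum_distrib_left sum_distrib_right sum_negf mult.assoc, rule sum.swap)
  also have "\<dots> = - (\<Sum>i\<in>I. (\<Sum>m\<in>I. if m = i then ka a m else 0) * mu i c)"
    by (intro arg_cong[where f = uminus] sum.cong refl arg_cong2[where f = "(*)"]) (simp add: mi(1) del: One_nat_def)
  also have "\<dots> = - (\<Sum>i\<in>I. ka a i * mu i c)"
    by simp
  finally show ?thesis
    unfolding ka'_def distrib_left sum.distrib ka_mu_1[OF *] by simp
qed

lemma rv_order: "index_order (\<lambda>x y. y \<prec> x)"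
  by (rule index_order_flip) unfold_locales

lemma D_antisym: "antisym_ring s p' I (lam e) (lam (e + 2))"
proof -
  obtain l u where "l * (p - p') = 1" "u * zl e = 1"
    using pp_diff zl_unit by blast
  then show ?thesis
    using ortt_antisym[OF s pp _ grll_ortt_even[OF ll(1)[of e "e + 2", unfolded zl_step]]] by blast
qed

lemma E_antisym: "index_order.antisym_ring (\<lambda>x y. y \<prec> x) s p J (\<lambda>b r. kk e r b) (\<lambda>b r. kk (e - 2) r b)"
proof -
  interpret rv: index_order "\<lambda>x y. y \<prec> x" by (rule rv_order)
  have "p' * p = 1"
    using pp by (simp add: mult.commute)
  moreover obtain l u where "l * (p' - p) = 1" "u * zl e = 1"
    using pp_diff' zl_unit by blast
  ultimately show ?thesis
    using rv.ortt_antisym[OF s _ _ grll_KK[OF s s ll(1)[of e "e - 2", unfolded zl_step'] lk lk]] by blast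
qed

sublocale half: half_berezinian lt s s' I J p p' lam kk mu ka ka' g h z w ds js C0 C1
proof (intro half_berezinian.intro half_berezinian_axioms.intro)
  show "index_order (\<prec>)"
    by unfold_locales
  show "central_hom s" "central_hom s'" by (rule s s')+
  show "length ds = card I" "length js = card J"
    by (simp_all add: even_shifts_def odd_shifts_def)
  show "p * p' = 1" "s p' = s' p'" by (rule pp sp)+
  show "successively (\<lambda>e f. antisym_ring s p' I (lam e) (lam f)) ds"
    unfolding even_shifts_def by (rule successively_map_upt[where c = 2]) (simp, rule D_antisym)
  show "successively (\<lambda>e f. index_order.antisym_ring (\<lambda>x y. y \<prec> x) s p J (\<lambda>b r. kk e r b) (\<lambda>b r. kk f r b)) js"
    unfolding odd_shifts_def by (rule successively_map_upt[where c = "-2"]) (simp, use E_antisym in simp)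
  show "successively (\<lambda>e f. z f = z e * p * p) ds"
    unfolding even_shifts_def by (rule successively_map_upt[where c = 2]) (simp, rule z_step)
  show "ortt s s' I p p' (g e) (z e) w (lam e) mu" for e
    by (rule grll_ortt_even[OF lm])
  show "s (g e * (z e - w)) * (ka r b * lam e i c) =
      s' (g e * diag p p' (z e) w c r) * (lam e i c * ka r b) +
      (if r = c then \<Sum>n\<in>I \<union> J - {c}. s' (g e * exch p p' (z e) w n c) * (lam e i n * ka n b) else 0)"
    if "i \<in> I" "c \<in> I" "r \<in> I \<union> J" "b \<in> J" for e i c r b
  proof -
    have "gdiag M p p' (z e) w c r = diag p p' (z e) w c r"
      using that by (simp add: gdiag_def diag_def qev_def)
    then show ?thesis
      using grll_KL[OF s s' lm mk, of i b c r] that unfolding Ix_split by (simp add: ep_even pr_even del: One_nat_def)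
  qed
  show "s (h e * (w - z e)) * (kk e r b * mu i c) = s' (h e * (w - z e)) * (mu i c * kk e r b)"
    if "i \<in> I" "c \<in> I \<union> J" "r \<in> J" "b \<in> J" "r \<noteq> c" for e i c r b
  proof -
    have "gdiag M p p' w (z e) c r = w - z e" "ep r b = 0 \<or> even (ep r b)"
      using that by (auto simp: gdiag_def eparity_def parity_def)
    then show ?thesis
      using grll_KL[OF s s' ml lk, of i b c r] that unfolding Ix_split by auto
  qed
  show "s (h e * (w - z e)) * (kk e r b * mu i r) =
      - (s' (h e * (z e * p - w * p')) * (mu i r * kk e r b) +
         (\<Sum>n\<in>I \<union> J - {r}. s' (h e * exch p p' w (z e) n r) * (mu i n * kk e n b)))"
    if "i \<in> I" "r \<in> J" "b \<in> J" for e i r b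
  proof -
    interpret s': central_hom s' by (rule s')
    have e: "gdiag M p p' w (z e) r r = - (z e * p - w * p')" "even (ep r b)" "(-1) ^ pr r = (-1 :: 'k)"
      using that by (auto simp: gdiag_def eparity_def parity_def qev_def)
    have "s (h e * (w - z e)) * (kk e r b * mu i r) =
       s' (h e * - (z e * p - w * p')) * (mu i r * kk e r b) +
       (\<Sum>n\<in>Ix - {r}. s' (h e * (- 1 * exch p p' w (z e) n r)) * (mu i n * kk e n b))"
      using grll_KL[OF s s' ml[of e] lk[of e], of i b r r, unfolded e] that e(2) by auto
    then show ?thesis
      unfolding Ix_split by (simp add: s'.uminus sum_negf del: minus_diff_eq One_nat_def)
  qed
  show "(\<Sum>n\<in>I \<union> J. mu i n * ka n b) = 0" if "i \<in> I" "b \<in> J" for i b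
    unfolding Ix_split sum_Ix by (rule mu_ka_0[OF that])
  show "(\<Sum>n\<in>I \<union> J. lam e i n * kk e n b) = 0" if "i \<in> I" "b \<in> J" for e i b
    using that smul_even_odd(1)[of i b "lam e" "kk e"] lk[of e] unfolding Ix_split sinverse_def by force
  show "(\<Sum>b\<in>J. ka a b * ka' b c) = (if a = c then 1 else 0)" if "a \<in> J" "c \<in> J" for a c
    by (rule ka_ka'[OF that])
  show "last ds = hd js" if "ds \<noteq> []" "js \<noteq> []"
    using that by (simp add: even_shifts_def odd_shifts_def last_map hd_map last_upt of_nat_diff)
qed (use C0 C1 in auto)

text \<open>The order, \<open>C0\<close> and \<open>C1\<close> are reversed and \<open>s\<close>,
  \<open>s'\<close> interchanged, but the shifts keep their order. The factors D and E of this
  instance are identified with the original ones through \<open>ring_minor_opp\<close>.\<close>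

lemma opp: "berez (\<lambda>x y. y \<prec> x) M N p p' (\<lambda>k. Opp (s' k)) (\<lambda>k. Opp (s k)) (\<lambda>e i j. Opp (lam e j i)) (\<lambda>e i j. Opp (kk e j i))
  (\<lambda>i j. Opp (mu j i)) (\<lambda>i j. Opp (ka j i)) (\<lambda>i j. Opp (mi j i)) g h z zl w (rev C0) (rev C1)"
proof -
  interpret rv: rtt "\<lambda>x y. y \<prec> x" M N p p'
    using rv_order pp by (simp add: rtt_def rtt_axioms_def)
  show ?thesis
  proof (intro berez.intro berez_axioms.intro)
    show "rtt (\<lambda>x y. y \<prec> x) p p'"
      by unfold_locales
    show "central_hom (\<lambda>k. Opp (s' k))" "central_hom (\<lambda>k. Opp (s k))"
      by (rule central_hom_opp, rule s s')+
    show "Opp (s' p') = Opp (s p')" by (simp add: sp)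
    show "rv.grll (\<lambda>k. Opp (s' k)) (\<lambda>k. Opp (s' k)) 1 (zl e) (zl f) (\<lambda>i j. Opp (lam e j i)) (\<lambda>i j. Opp (lam f j i))"
      "rv.grll (\<lambda>k. Opp (s k)) (\<lambda>k. Opp (s k)) 1 (zl e) (zl f) (\<lambda>i j. Opp (lam e j i)) (\<lambda>i j. Opp (lam f j i))" for e f
      by (rule grll_opp s s' ll)+
    show "rv.grll (\<lambda>k. Opp (s' k)) (\<lambda>k. Opp (s k)) (g e) (z e) w (\<lambda>i j. Opp (lam e j i)) (\<lambda>i j. Opp (mu j i))"
      "rv.grll (\<lambda>k. Opp (s' k)) (\<lambda>k. Opp (s k)) (h e) w (z e) (\<lambda>i j. Opp (mu j i)) (\<lambda>i j. Opp (lam e j i))" for e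
      by (rule grll_opp s s' lm ml)+
  qed (use pp_diff z_step zl_step zl_unit zl_sym sinverse_opp[OF lk] sinverse_opp[OF mk] lk_comm mi C0 C1 in
      \<open>auto simp: opp_eq_iff unopp_sum sorted_wrt_rev\<close>)
qed

text \<open>Follows from \<open>lk_comm\<close>. It is used because the opposite ring multiplies D
  and E in the other order.\<close>

lemma DE_commute: "half.D * half.E = half.E * half.D"
proof -
  have "half.D * kk f r b = kk f r b * half.D" if "r \<in> J" "b \<in> J" for f r b
    unfolding half.D_def by (rule ring_minor_commute[OF s]) (use lk_comm that C0 in auto)
  then show ?thesis
    unfolding half.E_def by (intro half.rv.ring_minor_commute[OF s, symmetric]) (use C1 in auto)
qed

text \<open>The scalar of \<open>qdet_commute\<close> for the odd block, with \<open>p\<close> and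
  \<open>p'\<close> interchanged and the arguments running through
  \<open>odd_shifts\<close>.\<close>

definition ka_factor :: 'k where
  "ka_factor = g (last js) * (z (last js) * p' - w * p) * (\<Prod>e\<leftarrow>butlast js. g e * (z e - w))"

lemma E_ka:
  assumes "a \<in> J" "b \<in> J"
  shows "s ka_factor * (half.E * ka a b) = s' ka_factor * (ka a b * half.E)"
proof -
  have "successively (\<lambda>e f. z f = z e * p' * p') js"
    unfolding odd_shifts_def by (rule successively_map_upt[where c = "-2"]) (simp, use z_step' in simp)
  moreover have "p' * p = 1"
    using pp by (simp add: mult.commute)
  moreover have "js \<noteq> []"
    using assms by (auto simp: odd_shifts_def)
  ultimately show ?thesis
    unfolding ka_factor_def half.E_def
    by (intro half.rv.qdet_commute[where T = "\<lambda>e b r. kk e r b" and \<mu> = "\<lambda>i j. ka j i"])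
      (use s s' sp' half.len half.E_antisym grll_KK[OF s s' lm lk mk] C1 assms in simp_all)
qed

text \<open>The bracket \<open>br\<close> with D E is a derivation. Applied to the equations saying
  that \<open>ka\<close> inverts \<open>mu\<close>, it turns the cases already settled into linear
  equations for the brackets still missing.\<close>

theorem mu_commute:
  assumes pI: "\<exists>u. u * (\<Sum>cs\<in>lists_on I M. wt p' cs * wt p' cs) = 1"
    and pJ: "\<exists>u. u * (\<Sum>cs\<in>lists_on J N. index_order.wt (\<lambda>x y. y \<prec> x) p cs * index_order.wt (\<lambda>x y. y \<prec> x) p cs) = 1"
    and c1: "\<And>x y. M > 0 \<Longrightarrow> s half.\<Gamma> * x = s' half.\<Gamma> * y \<Longrightarrow> x = y"
    and c2: "\<And>x y. N > 0 \<Longrightarrow> s ka_factor * (s' (\<Prod>e\<leftarrow>ds. half.x e) * x) = s' ka_factor * (s (\<Prod>e\<leftarrow>ds. half.x e) * y) \<Longrightarrow> x = y"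
    and ij: "i \<in> Ix" "j \<in> Ix"
  shows "half.D * half.E * mu i j = mu i j * (half.D * half.E)"
proof -
  interpret op: berez "\<lambda>x y. y \<prec> x" M N p p' "\<lambda>k. Opp (s' k)" "\<lambda>k. Opp (s k)" "\<lambda>e i j. Opp (lam e j i)" "\<lambda>e i j. Opp (kk e j i)"
    "\<lambda>i j. Opp (mu j i)" "\<lambda>i j. Opp (ka j i)" "\<lambda>i j. Opp (mi j i)" g h z zl w "rev C0" "rev C1"
    by (rule opp)
  let ?B = "half.D * half.E"
  have D': "op.half.D = Opp half.D"
  proof -
    obtain u where u: "u * (\<Sum>cs\<in>lists_on I (card I). wt p' cs * wt p' cs) = 1"
      using pI by auto
    have "sorted_wrt (\<lambda>e f. sym_pair s p' I (lam e) (lam f)) ds"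
      unfolding even_shifts_def
    proof (rule sorted_wrt_map_upt)
      fix k l :: nat assume "k < l"
      then obtain u where "u * (p * zl (2 * int l) - p' * zl (2 * int k)) = 1"
        using zl_sym[of "2 * int k" "2 * int l"] by auto
      then show "sym_pair s p' I (lam (2 * int k)) (lam (2 * int l))"
        by (rule ortt_sym_pair[OF s pp _ grll_ortt_even[OF ll(1)]])
    qed
    moreover have "successively (\<lambda>e f. half.rv.antisym_ring (\<lambda>k. Opp (s k)) p' I (\<lambda>i j. Opp (lam e j i)) (\<lambda>i j. Opp (lam f j i))) ds"
      using op.half.D_antisym half.rv.antisym_ring_cong[of "\<lambda>k. Opp (s' k)" p' "\<lambda>k. Opp (s k)"] sp by simp
    ultimately have "unopp (half.rv.ring_minor (\<lambda>k. Opp (s k)) p' I (\<lambda>e i j. Opp (lam e j i)) ds (rev C0)) = half.D"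
      unfolding half.D_def using ring_minor_opp[OF s _ half.len(1) half.D_antisym _ _ C0 u] by simp
    then show ?thesis
      unfolding op.half.D_def opp_eq_iff half.rv.ring_minor_cong[OF op.s op.s' op.sp] by simp
  qed
  have E': "op.half.E = Opp half.E"
  proof -
    obtain u where u: "u * (\<Sum>cs\<in>lists_on J (card J). half.rv.wt p cs * half.rv.wt p cs) = 1"
      using pJ by auto
    have pp2: "p' * p = 1"
      using pp by (simp add: mult.commute)
    have "sorted_wrt (\<lambda>e f. half.rv.sym_pair s p J (\<lambda>b r. kk e r b) (\<lambda>b r. kk f r b)) js"
      unfolding odd_shifts_def
    proof (rule sorted_wrt_map_upt)
      fix k l :: nat assume kl: "k < l"
      let ?e = "2 * int M - 2 - 2 * int k" and ?f = "2 * int M - 2 - 2 * int l"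
      obtain u where u: "u * (p * zl ?e - p' * zl ?f) = 1"
        using zl_sym[of ?f ?e] kl by auto
      have "- u * (p' * zl ?f - p * zl ?e) = 1"
        using u by (simp add: algebra_simps)
      then show "half.rv.sym_pair s p J (\<lambda>b r. kk ?e r b) (\<lambda>b r. kk ?f r b)"
        by (rule half.rv.ortt_sym_pair[OF s pp2 _ grll_KK[OF s s ll(1) lk lk]])
    qed
    moreover have "successively (\<lambda>e f. antisym_ring (\<lambda>k. Opp (s k)) p J (\<lambda>i j. Opp (kk e i j)) (\<lambda>i j. Opp (kk f i j))) js"
      using op.half.E_antisym antisym_ring_cong[of "\<lambda>k. Opp (s' k)" p "\<lambda>k. Opp (s k)"] sp' by simp
    ultimately have "unopp (ring_minor (\<lambda>k. Opp (s k)) p J (\<lambda>e i j. Opp (kk e i j)) js (rev C1)) = half.E"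
      unfolding half.E_def using half.rv.ring_minor_opp[where T = "\<lambda>e b r. kk e r b", OF s _ half.len(2) half.E_antisym _ _ C1 u] by simp
    then show ?thesis
      unfolding op.half.E_def opp_eq_iff ring_minor_cong[OF op.s op.s' op.sp'] by simp
  qed
  have r1: "?B * mu a b = mu a b * ?B" if "a \<in> I" "b \<in> Ix" for a b
    by (rule c1) (use half.DE_mu[of a b] that in \<open>auto simp: Ix_split simp del: One_nat_def\<close>)
  have r2: "?B * mu b a = mu b a * ?B" if "a \<in> I" "b \<in> Ix" for a b
  proof (rule c1)
    show "M > 0"
      using that by auto
    have bIJ: "b \<in> I \<union> J"
      using that by auto
    have "op.half.\<Gamma> = half.\<Gamma>"
      unfolding half.\<Gamma>_def op.half.\<Gamma>_def half.x_def op.half.x_def half.y_def op.half.y_def ..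
    then have "mu b a * (half.E * half.D) * s' half.\<Gamma> = half.E * half.D * mu b a * s half.\<Gamma>"
      using op.half.DE_mu[OF that(1) bIJ] unfolding D' E' by (simp add: opp_eq_iff mult.assoc)
    then show "s half.\<Gamma> * (?B * mu b a) = s' half.\<Gamma> * (mu b a * ?B)"
      unfolding DE_commute half.s.central[of half.\<Gamma>] half.s'.central[of half.\<Gamma>] by (rule sym)
  qed
  have r3: "?B * ka a b = ka a b * ?B" if "a \<in> J" "b \<in> J" for a b
  proof (rule c2)
    show "N > 0"
      using that by auto
    show "s ka_factor * (s' (\<Prod>e\<leftarrow>ds. half.x e) * (?B * ka a b)) = s' ka_factor * (s (\<Prod>e\<leftarrow>ds. half.x e) * (ka a b * ?B))"
      by (rule exchange_twice[OF half.s.central half.s'.central E_ka[OF that] half.ka_D[OF that]])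
  qed
  define br where "br = (\<lambda>x. ?B * x - x * ?B)"
  have br_add: "br (x + y) = br x + br y" and br_mult: "br (x * y) = br x * y + x * br y" for x y
    by (simp_all add: br_def algebra_simps)
  have br_sum: "br (\<Sum>x\<in>A. f x) = (\<Sum>x\<in>A. br (f x))" for f :: "nat \<Rightarrow> 'a" and A
    by (simp add: br_def sum_distrib_left sum_distrib_right sum_subtractf)
  have br01: "br 0 = 0" "br 1 = 0"
    by (simp_all add: br_def)
  have b1: "br (mu a b) = 0" if "a \<in> I \<or> b \<in> I" "a \<in> Ix" "b \<in> Ix" for a b
    using r1 r2 that by (auto simp: br_def)
  have b3: "br (ka a b) = 0" if "a \<in> J" "b \<in> J" for a b
    using r3 that by (auto simp: br_def)
  \<comment> \<open>Even rows of \<open>mu\<close> are orthogonal to odd columns of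
    \<open>ka\<close>. Bracketing this leaves a homogeneous system whose matrix, the even block of
    \<open>mu\<close>, is inverted by \<open>mi\<close>.\<close>
  have b2: "br (ka i b) = 0" if i: "i \<in> I" and b: "b \<in> J" for i b
  proof -
    have z: "(\<Sum>n\<in>I. mu k n * br (ka n b)) = 0" if k: "k \<in> I" for k
    proof -
      have "0 = br ((\<Sum>n\<in>I. mu k n * ka n b) + (\<Sum>n\<in>J. mu k n * ka n b))"
        using mu_ka_0[OF k b] br01 by simp
      also have "\<dots> = (\<Sum>n\<in>I. mu k n * br (ka n b)) + (\<Sum>n\<in>J. mu k n * br (ka n b))"
        unfolding br_add br_sum br_mult using k b1 by simp
      also have "(\<Sum>n\<in>J. mu k n * br (ka n b)) = 0"
        using b3 b by simp
      finally show ?thesis by simp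
    qed
    have "br (ka i b) = (\<Sum>n\<in>I. if n = i then br (ka n b) else 0)"
      using i by simp
    also have "\<dots> = (\<Sum>n\<in>I. (\<Sum>k\<in>I. mi i k * mu k n) * br (ka n b))"
      using i by (intro sum.cong refl) (simp add: mi(2) del: One_nat_def)
    also have "\<dots> = (\<Sum>k\<in>I. mi i k * (\<Sum>n\<in>I. mu k n * br (ka n b)))"
      unfolding sum_distrib_left sum_distrib_right by (subst sum.swap) (simp add: mult.assoc)
    finally show ?thesis
      using z by simp
  qed
  \<comment> \<open>Bracketing the odd block of the equation leaves a homogeneous system whose
    matrix, the odd block of \<open>ka\<close>, is inverted by \<open>ka'\<close>.\<close>
  have b4: "br (mu a c) = 0" if a: "a \<in> J" and c: "c \<in> J" for a c
  proof -
    have z: "(\<Sum>n\<in>J. br (mu a n) * ka n b) = 0" if b: "b \<in> J" for b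
    proof -
      have "(\<Sum>n\<in>J. br (mu a n) * ka n b) = br (\<Sum>n\<in>J. mu a n * ka n b)"
        unfolding br_sum br_mult using b3 b by simp
      also have "\<dots> = br (if a = b then 1 else 0) + (\<Sum>n\<in>I. br (mu a n) * ka n b + mu a n * br (ka n b))"
        unfolding mu_ka_1[OF a b] br_add br_sum br_mult ..
      also have "\<dots> = 0"
        using b1 b2 a b by (simp add: br01)
      finally show ?thesis .
    qed
    have "br (mu a c) = (\<Sum>n\<in>J. if n = c then br (mu a n) else 0)"
      using c by simp
    also have "\<dots> = (\<Sum>n\<in>J. br (mu a n) * (\<Sum>b\<in>J. ka n b * ka' b c))"
      using c by (intro sum.cong refl) (simp add: ka_ka' del: One_nat_def add_Suc_right)
    also have "\<dots> = (\<Sum>b\<in>J. (\<Sum>n\<in>J. br (mu a n) * ka n b) * ka' b c)"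
      unfolding sum_distrib_left sum_distrib_right by (subst sum.swap) (simp add: mult.assoc)
    finally show ?thesis
      using z by simp
  qed
  have "br (mu i j) = 0"
    using b1[of i j] b4[of i j] ij by fastforce
  then show ?thesis
    by (simp add: br_def)
qed

end

section \<open>Arithmetic in C(q) and products of scalar series\<close>

section \<open>The scalar factors\<close>

definition of_pol :: "complex poly \<Rightarrow> Cq" where "of_pol a = Fract a 1"

lemma of_pol_simps: "of_pol 1 = 1" "of_pol 0 = 0" "of_pol (a + b) = of_pol a + of_pol b" "of_pol (a * b) = of_pol a * of_pol b"
  "of_pol a = of_pol b \<longleftrightarrow> a = b" "of_pol (a ^ n) = of_pol a ^ n" "of_pol [:0, 1:] = qvar"
proof -
  show *: "of_pol 1 = 1" "of_pol 0 = 0" "of_pol (a + b) = of_pol a + of_pol b" "of_pol (a * b) = of_pol a * of_pol b"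
    "of_pol a = of_pol b \<longleftrightarrow> a = b" "of_pol [:0, 1:] = qvar" for a b
    by (simp_all add: of_pol_def One_fract_def Zero_fract_def eq_fract qvar_def)
  show "of_pol (a ^ n) = of_pol a ^ n"
    by (induction n) (simp_all add: *)
qed

lemma of_pol_sum: "of_pol (\<Sum>x\<in>A. f x) = (\<Sum>x\<in>A. of_pol (f x))"
  by (induction A rule: infinite_finite_induct) (auto simp: of_pol_simps)

text \<open>At q = 1 the sum becomes the number of its terms, nonzero in characteristic 0.\<close>

lemma qvar_power_sum_nonzero:
  assumes "finite A" "A \<noteq> {}"
  shows "(\<Sum>x\<in>A. qvar ^ m x) \<noteq> 0"
proof
  assume "(\<Sum>x\<in>A. qvar ^ m x) = 0"
  then have "of_pol (\<Sum>x\<in>A. [:0, 1:] ^ m x) = of_pol 0"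
    by (simp add: of_pol_sum of_pol_simps)
  then have "poly (\<Sum>x\<in>A. [:0, 1:] ^ m x) (1 :: complex) = 0"
    by (simp only: of_pol_simps(5) poly_0)
  then show False
    using assms by (simp add: poly_sum)
qed

text \<open>Multiplying by the highest power of q that occurs leads back to powers of q.\<close>

lemma qinv_power_sum_nonzero:
  assumes "finite A" "A \<noteq> {}"
  shows "(\<Sum>x\<in>A. qinv ^ m x) \<noteq> 0"
proof
  assume *: "(\<Sum>x\<in>A. qinv ^ m x) = 0"
  define K where "K = Max (m ` A)"
  have "qvar ^ (K - m x) = qvar ^ K * qinv ^ m x" if "x \<in> A" for x
  proof -
    have "m x \<le> K"
      using that assms by (simp add: K_def)
    then have "qvar ^ K = qvar ^ (K - m x) * qvar ^ m x"
      by (simp flip: power_add)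
    then show ?thesis
      using qvar_nonzero by (simp add: power_inverse)
  qed
  then have "(\<Sum>x\<in>A. qvar ^ (K - m x)) = qvar ^ K * (\<Sum>x\<in>A. qinv ^ m x)"
    by (simp add: sum_distrib_left)
  then show False
    using * qvar_power_sum_nonzero[OF assms, of "\<lambda>x. K - m x"] by simp
qed

text \<open>That q is not a root of unity is seen by evaluating at q = 0.\<close>

lemma qvar_power_eq_1: "qvar ^ n = 1 \<Longrightarrow> n = 0"
proof (rule ccontr)
  assume "qvar ^ n = 1" "n \<noteq> 0"
  then have "of_pol ([:0, 1:] ^ n) = of_pol 1"
    by (simp only: of_pol_simps)
  then have "poly ([:0, 1:] ^ n) 0 = poly 1 (0 :: complex)"
    by (simp only: of_pol_simps(5))
  with \<open>n \<noteq> 0\<close> show False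
    by (simp add: power_0_left)
qed

lemma qvar_powi_eq_1: "qvar powi k = 1 \<Longrightarrow> k = 0"
  using qvar_power_eq_1[of "nat k"] qvar_power_eq_1[of "nat (- k)"]
  by (auto simp: power_int_def power_inverse split: if_splits)

lemma qvar_powi_power_eq_1: "k \<noteq> 0 \<Longrightarrow> (qvar powi k) ^ n = 1 \<Longrightarrow> n = 0"
  using qvar_powi_eq_1[of "k * int n"] by (simp add: power_int_mult)

lemma powi_diff: "qvar powi (a - b) = qvar powi a * qvar powi (- b)" "qvar powi (a + b) = qvar powi a * qvar powi b"
  by (simp_all add: power_int_diff power_int_add power_int_minus divide_inverse qvar_nonzero)

lemma dil_dil: "dil a (dil b F) = dil (a * b) F" "dil 1 F = F"
  by (simp_all add: dil_def fps_eq_iff power_mult_distrib mult.assoc)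

lemma dil_const: "dil r F = F \<Longrightarrow> (\<And>n. r ^ n = 1 \<Longrightarrow> n = 0) \<Longrightarrow> F = fps_const (F $ 0)"
proof (rule fps_ext)
  fix n assume "dil r F = F" and r: "\<And>n. r ^ n = 1 \<Longrightarrow> n = 0"
  then have "r ^ n * F $ n = F $ n"
    by (simp add: dil_def fps_eq_iff)
  then have "(r ^ n - 1) * F $ n = 0"
    by (simp add: algebra_simps)
  then show "F $ n = fps_const (F $ 0) $ n"
    using r[of n] by (cases "n = 0") auto
qed

text \<open>Comparison of coefficients in \<open>dil c f = f * H\<close> with
  \<open>H $ 0 = 1\<close>: in degree n the unknown has the factor \<open>c ^ n - 1\<close>, and in
  degree 0 the value 1 is prescribed.\<close>

fun dil_solution :: "'a::field \<Rightarrow> 'a fps \<Rightarrow> nat \<Rightarrow> 'a" where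
  "dil_solution c H n = (if n = 0 then 1 else (\<Sum>i<n. dil_solution c H i * H $ (n - i)) / (c ^ n - 1))"

declare dil_solution.simps [simp del]

lemma dil_equation_unique:
  fixes c :: "'a::field"
  assumes c: "\<And>n. c ^ n = 1 \<Longrightarrow> n = 0" and H: "H $ 0 = 1"
  shows "\<exists>!f. f $ 0 = 1 \<and> dil c f = f * H"
proof -
  have split: "(f * H) $ n = (\<Sum>i<n. f $ i * H $ (n - i)) + f $ n" for f n
  proof -
    have "{0..n} = insert n {..<n}" by auto
    then show ?thesis
      by (simp add: fps_mult_nth H add.commute)
  qed
  have eq: "dil c f = f * H \<longleftrightarrow> (\<forall>n. f $ n * (c ^ n - 1) = (\<Sum>i<n. f $ i * H $ (n - i)))" for f
    unfolding fps_eq_iff split by (auto simp: dil_def algebra_simps)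
  have ne: "c ^ n - 1 \<noteq> 0" if "n \<noteq> 0" for n
    using c[of n] that by auto
  show ?thesis
  proof (rule ex1I)
    have "f $ n * (c ^ n - 1) = (\<Sum>i<n. f $ i * H $ (n - i))" if "f = Abs_fps (dil_solution c H)" for f n
      unfolding that using ne[of n] by (subst fps_nth_Abs_fps, subst dil_solution.simps) simp
    then show "Abs_fps (dil_solution c H) $ 0 = 1 \<and> dil c (Abs_fps (dil_solution c H)) = Abs_fps (dil_solution c H) * H"
      unfolding eq by (simp add: dil_solution.simps[of _ _ 0])
    fix f assume f: "f $ 0 = 1 \<and> dil c f = f * H"
    show "f = Abs_fps (dil_solution c H)"
    proof (rule fps_ext)
      fix n
      show "f $ n = Abs_fps (dil_solution c H) $ n"
      proof (induction n rule: less_induct)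
        case (less n)
        show ?case
        proof (cases "n = 0")
          case False
          have "f $ n = (\<Sum>i<n. f $ i * H $ (n - i)) / (c ^ n - 1)"
            using f ne[OF False] unfolding eq by (simp add: eq_divide_eq)
          also have "\<dots> = (\<Sum>i<n. dil_solution c H i * H $ (n - i)) / (c ^ n - 1)"
            using less by simp
          finally show ?thesis
            using False by (simp add: dil_solution.simps[of _ _ n])
        qed (use f in \<open>simp add: dil_solution.simps[of _ _ 0]\<close>)
      qed
    qed
  qed
qed

text \<open>For distinct M and N the dilation factor \<open>c\<close> is a nontrivial power of q, so
  the description of f denotes. Multiplying the equation by \<open>c\<close> removes the exponent 2N
  - 2M, which is that of the inverse of \<open>c\<close>.\<close>

lemma fser_equation:
  fixes M N :: nat
  assumes "M \<noteq> N"
  defines "c \<equiv> qvar powi (2 * int M - 2 * int N)"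
  shows "fser M N $ 0 = 1"
    "dil c (fser M N) * ((fps_X - 1) * (fps_const c * fps_X - 1)) =
      fser M N * ((fps_X - fps_const (qinv ^ 2)) * (fps_const c * fps_X - fps_const (qvar ^ 2)))"
proof -
  let ?a = "qvar powi (- 2)" and ?b = "qvar powi (2 * int N - 2 * int M + 2)" and ?d = "qvar powi (2 * int N - 2 * int M)"
  define P where "P = (fps_X - fps_const ?a) * (fps_X - fps_const ?b)"
  define D where "D = (fps_X - 1) * (fps_X - fps_const ?d)"
  have cd: "c * ?d = 1"
    unfolding c_def powi_diff(2)[symmetric] by simp
  have a: "?a = qinv ^ 2" and b: "?b = ?d * qvar ^ 2"
    by (simp_all add: power_int_minus powi_diff(2) power_inverse del: power_int_add)
  have D0: "D $ 0 \<noteq> 0"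
    using cd by (auto simp: D_def qvar_nonzero)
  have PD: "P $ 0 = D $ 0"
  proof -
    have "qinv ^ 2 * (?d * qvar ^ 2) = ?d"
      using qvar_nonzero by (simp add: power_inverse)
    then show ?thesis
      unfolding P_def D_def a b by simp
  qed
  have c: "c ^ n = 1 \<Longrightarrow> n = 0" for n
    unfolding c_def using assms by (intro qvar_powi_power_eq_1[of _ n]) auto
  have div: "P / D = P * inverse D"
    using D0 by (rule fps_divide_unit)
  have "(P / D) $ 0 = 1"
    using D0 PD by (simp add: div)
  from theI'[OF dil_equation_unique[OF c this]]
  have f: "fser M N $ 0 = 1 \<and> dil c (fser M N) = fser M N * (P / D)"
    unfolding fser_def fps_compose_linear c_def[symmetric] P_def[symmetric] D_def[symmetric] dil_def .
  then show "fser M N $ 0 = 1" by simp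
  have "dil c (fser M N) * D = fser M N * P"
    using f D0 by (simp add: div mult.assoc inverse_mult_eq_1)
  then have *: "fps_const c * (dil c (fser M N) * D) = fps_const c * (fser M N * P)"
    by simp
  have k: "fps_const c * fps_const ?d = 1"
    using cd by (simp add: fps_const_mult)
  have "fps_const c * D = (fps_X - 1) * (fps_const c * fps_X - fps_const c * fps_const ?d)"
    by (simp only: D_def algebra_simps)
  then have 1: "fps_const c * D = (fps_X - 1) * (fps_const c * fps_X - 1)"
    unfolding k .
  have "fps_const c * P = (fps_X - fps_const (qinv ^ 2)) * (fps_const c * fps_X - (fps_const c * fps_const ?d) * fps_const (qvar ^ 2))"
    unfolding P_def a b fps_const_mult[symmetric] by (simp only: algebra_simps)
  then have 2: "fps_const c * P = (fps_X - fps_const (qinv ^ 2)) * (fps_const c * fps_X - fps_const (qvar ^ 2))"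
    unfolding k by simp
  show "dil c (fser M N) * ((fps_X - 1) * (fps_const c * fps_X - 1)) =
      fser M N * ((fps_X - fps_const (qinv ^ 2)) * (fps_const c * fps_X - fps_const (qvar ^ 2)))"
    using * unfolding 1[symmetric] 2[symmetric] by (simp only: mult.left_commute)
qed

text \<open>Entries at an argument shifted by \<open>q\<^bsup>2k\<^esup>\<close> contribute the scalars \<open>a\<close>, \<open>b\<close>, \<open>c\<close>, \<open>d\<close>
  dilated by \<open>r\<^sup>k\<close>. The hypothesis \<open>link\<close> is where the functional equation of \<open>f\<close> enters; it
  makes the total scalar invariant under dilation by \<open>r\<close>, hence constant.\<close>

locale shifted_products =
  fixes r :: "'q::field" and M N :: nat and a b c d :: "'q fps"
  assumes r0: "r \<noteq> 0" and r: "\<And>n. r ^ n = 1 \<Longrightarrow> n = 0"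
    and nz: "a $ 0 \<noteq> 0" "b $ 0 \<noteq> 0" "c $ 0 \<noteq> 0" "d $ 0 \<noteq> 0"
    and loc: "dil r a * b * dil r c = a" and link: "b * dil (r powi (int M - int N)) c = 1"
    and loc': "dil r d = d * c * dil r b"
begin

definition sh :: "int \<Rightarrow> 'q fps \<Rightarrow> 'q fps" where "sh k F = dil (r powi k) F"

definition shp :: "'q fps \<Rightarrow> int \<Rightarrow> nat \<Rightarrow> 'q fps" where "shp F m n = (\<Prod>k<n. sh (m + int k) F)"

lemma sh_simps: "sh 0 F = F" "dil r (sh k F) = sh (k + 1) F" "sh k (dil r F) = sh (k + 1) F" "sh k (F * G) = sh k F * sh k G"
  using r0 by (simp_all add: sh_def dil_dil dil_mult power_int_add mult.commute)

lemma sh_nth0: "sh k F $ 0 = F $ 0"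
  by (simp add: sh_def dil_def)

lemma shp_nth0: "shp F m n $ 0 = (F $ 0) ^ n"
  unfolding shp_def by (induction n) (simp_all add: sh_nth0)

text \<open>Dilation moves the window of the product by one step: the first factor drops out and the
  next one enters.\<close>

lemma shp_step: "dil r (shp F m n) * sh m F = shp F m n * sh (m + int n) F"
proof (induction n)
  case (Suc n)
  have S: "shp F m (Suc n) = shp F m n * sh (m + int n) F"
    by (simp add: shp_def)
  have "dil r (shp F m (Suc n)) * sh m F = (dil r (shp F m n) * sh m F) * sh (m + int n + 1) F"
    by (simp add: S dil_mult sh_simps mult_ac)
  also have "m + int n + 1 = m + int (Suc n)"
    by simp
  finally show ?case
    unfolding Suc.IH S .
qed (simp add: shp_def)

lemma cancel: "F $ 0 \<noteq> 0 \<Longrightarrow> F * G = F * H \<Longrightarrow> G = H" for F G H :: "'q fps"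
  by auto

text \<open>This product is the scalar collected through D and E. A dilation changes its three parts
  by boundary factors only, and these cancel by \<open>loc\<close> and \<open>link\<close>.\<close>

theorem gamma_const:
  assumes "M > 0"
  shows "\<exists>k. k \<noteq> 0 \<and> sh (int M - 1) a * shp b 0 (M - 1) * shp c (int M - int N) N = fps_const k"
proof -
  define G where "G = sh (int M - 1) a * shp b 0 (M - 1) * shp c (int M - int N) N"
  let ?W = "sh (int M - 1) a * b * sh (int M - int N) c"
  have l: "sh (int M) a * sh (int M - 1) b * sh (int M) c = sh (int M - 1) a"
    using arg_cong[OF loc, of "sh (int M - 1)"] by (simp add: sh_simps)
  have L: "b * sh (int M - int N) c = 1"
    using link by (simp add: sh_def)
  have "dil r G * ?W = (sh (int M) a * sh (int M - 1) a) * (dil r (shp b 0 (M - 1)) * sh 0 b) * (dil r (shp c (int M - int N) N) * sh (int M - int N) c)"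
    by (simp add: G_def dil_mult sh_simps mult_ac)
  also have "\<dots> = (sh (int M) a * sh (int M - 1) a) * (shp b 0 (M - 1) * sh (int M - 1) b) * (shp c (int M - int N) N * sh (int M) c)"
    unfolding shp_step using assms by (simp add: of_nat_diff)
  also have "\<dots> = G * (sh (int M) a * sh (int M - 1) b * sh (int M) c)"
    by (simp only: G_def mult_ac)
  also have "\<dots> = G * ?W"
    unfolding l using L by (simp add: mult.assoc)
  finally have "?W * dil r G = ?W * G"
    by (simp add: mult.commute)
  moreover have "?W $ 0 \<noteq> 0"
    using nz by (simp add: sh_nth0)
  ultimately have "dil r G = G"
    by (rule cancel[rotated])
  then have "G = fps_const (G $ 0)"
    using r by (rule dil_const)
  moreover have "G $ 0 \<noteq> 0"
    using nz by (simp add: G_def sh_nth0 shp_nth0)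
  ultimately show ?thesis
    unfolding G_def by blast
qed

text \<open>Compares the scalars with which E and D pass the odd block of \<open>ka\<close>. Both
  change under dilation by boundary factors, which agree by \<open>loc'\<close> and
  \<open>link\<close>, so the quotient is constant.\<close>

theorem factor_const:
  assumes "N > 0"
  shows "\<exists>k. k \<noteq> 0 \<and> sh (int M - int N) d * shp b (int M - int N + 1) (N - 1) = fps_const k * shp b 0 M"
proof -
  define R where "R = sh (int M - int N) d * shp b (int M - int N + 1) (N - 1)"
  define P where "P = shp b 0 M"
  let ?n = "int M - int N"
  have "sh (?n + 1) d * b = sh ?n d * sh (?n + 1) b * (b * sh ?n c)"
    using arg_cong[OF loc', of "sh ?n"] by (simp add: sh_simps mult_ac)
  then have e: "sh (?n + 1) d * b = sh ?n d * sh (?n + 1) b"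
    using link by (simp add: sh_def)
  have R: "dil r R * (sh ?n d * sh (?n + 1) b) = R * (sh (?n + 1) d * sh (int M) b)"
  proof -
    have "dil r R * (sh ?n d * sh (?n + 1) b) = sh (?n + 1) d * sh ?n d * (dil r (shp b (?n + 1) (N - 1)) * sh (?n + 1) b)"
      by (simp add: R_def dil_mult sh_simps mult_ac)
    also have "\<dots> = sh (?n + 1) d * sh ?n d * (shp b (?n + 1) (N - 1) * sh (int M) b)"
      unfolding shp_step using assms by (simp add: of_nat_diff)
    finally show ?thesis
      by (simp only: R_def mult_ac)
  qed
  have P: "dil r P * b = P * sh (int M) b"
    using shp_step[of b 0 M] by (simp add: P_def sh_simps)
  have "(sh ?n d * sh (?n + 1) b * b) * (dil r R * P) = (dil r R * (sh ?n d * sh (?n + 1) b)) * P * b"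
    by (simp only: mult_ac)
  also have "\<dots> = R * (sh (?n + 1) d * b) * (P * sh (int M) b)"
    unfolding R by (simp only: mult_ac)
  also have "\<dots> = (sh ?n d * sh (?n + 1) b * b) * (R * dil r P)"
    unfolding e P[symmetric] by (simp only: mult_ac)
  finally have RP: "dil r R * P = R * dil r P"
    by (rule cancel[rotated]) (use nz in \<open>simp add: sh_nth0\<close>)
  have P0: "P $ 0 \<noteq> 0"
    using nz by (simp add: P_def shp_nth0)
  define F where "F = R * inverse P"
  have F: "F * P = R"
    using P0 by (simp add: F_def mult.assoc inverse_mult_eq_1)
  have "(P * dil r P) * dil r F = dil r (F * P) * P"
    by (simp only: dil_mult mult_ac)
  also have "\<dots> = (P * dil r P) * F"
    unfolding F RP by (simp only: F[symmetric] mult_ac)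
  finally have "dil r F = F"
    by (rule cancel[rotated]) (use P0 in \<open>simp add: dil_def\<close>)
  then have "F = fps_const (F $ 0)"
    using r by (rule dil_const)
  moreover have "F $ 0 \<noteq> 0"
    using nz P0 by (simp add: F_def R_def sh_nth0 shp_nth0)
  ultimately show ?thesis
    using F unfolding R_def P_def by metis
qed

end

abbreviation "Q \<equiv> fps_const qvar"
abbreviation "Q' \<equiv> fps_const qinv"

lemma QQ: "Q * Q' = 1"
  using qvar_nonzero by simp

text \<open>The inverse of \<open>g0\<close> times the unitarity scalar of R(1, x^(-1)), hence the
  prefactor of the relation with the two matrices exchanged.\<close>

definition u0 :: "nat \<Rightarrow> nat \<Rightarrow> Cq fps" where
  "u0 M N = inverse (fser M N * (Q * fps_X - Q'))"

text \<open>\<open>sA\<close> and \<open>sB\<close> are the prefactors times the off-diagonal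
  entries: z - w before the exchange of the two matrices and w - z after it, at z = 1 and w =
  x^(-1).\<close>

definition sA :: "nat \<Rightarrow> nat \<Rightarrow> Cq fps" where "sA M N = g0 M N * (1 - fps_X)"
definition sB :: "nat \<Rightarrow> nat \<Rightarrow> Cq fps" where "sB M N = u0 M N * (fps_X - 1)"

lemma g0_mult: "g0 M N * (Q - Q' * fps_X) = fser M N"
  by (simp add: g0_def mult.assoc inverse_mult_eq_1 qvar_nonzero)

context
  fixes M N :: nat
  assumes MN: "M \<noteq> N"
begin

lemma u0_mult: "u0 M N * (fser M N * (Q * fps_X - Q')) = 1"
  by (simp add: u0_def inverse_mult_eq_1 qvar_nonzero fser_equation(1)[OF MN])

lemma series_nth0: "g0 M N $ 0 \<noteq> 0" "u0 M N $ 0 \<noteq> 0" "sA M N $ 0 \<noteq> 0" "sB M N $ 0 \<noteq> 0"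
  by (simp_all add: g0_def u0_def sA_def sB_def qvar_nonzero fser_equation(1)[OF MN])

text \<open>The functional equation of f multiplied out: the denominators of \<open>sB\<close> and
  of the dilated \<open>sA\<close> combine to the quadratic factor on the right of
  \<open>fser_equation\<close>, up to sign.\<close>

lemma sB_link: "sB M N * dil (qvar powi (2 * int M - 2 * int N)) (sA M N) = 1"
proof -
  define c where "c = qvar powi (2 * int M - 2 * int N)"
  let ?f = "fser M N" and ?y = "fps_const c * fps_X"
  have c0: "c \<noteq> 0"
    by (simp add: c_def qvar_nonzero)
  have A: "dil c (sA M N) * (Q - Q' * ?y) = dil c ?f * (1 - ?y)"
  proof -
    have "sA M N * (Q - Q' * fps_X) = ?f * (1 - fps_X)"
      using g0_mult[of M N] by (simp add: sA_def mult_ac)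
    from arg_cong[OF this, of "dil c"] show ?thesis
      by (simp only: dil_mult dil_simps)
  qed
  have B: "sB M N * (?f * (Q * fps_X - Q')) = fps_X - 1"
    using u0_mult by (simp add: sB_def mult_ac)
  have QX: "(Q * fps_X - Q') * (Q - Q' * ?y) = - ((fps_X - fps_const (qinv ^ 2)) * (?y - fps_const (qvar ^ 2)))"
  proof -
    have "fps_const (qinv ^ 2) = Q' * Q'" "fps_const (qvar ^ 2) = Q * Q"
      by (simp_all add: power2_eq_square)
    then show ?thesis
      using QQ by algebra
  qed
  have "(?f * ((Q * fps_X - Q') * (Q - Q' * ?y))) * (sB M N * dil c (sA M N)) =
    (sB M N * (?f * (Q * fps_X - Q'))) * (dil c (sA M N) * (Q - Q' * ?y))"
    by (simp only: mult_ac)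
  also have "\<dots> = - (dil c ?f * ((fps_X - 1) * (?y - 1)))"
    unfolding A B by (simp add: algebra_simps)
  also have "\<dots> = (?f * ((Q * fps_X - Q') * (Q - Q' * ?y))) * 1"
    unfolding fser_equation(2)[OF MN, folded c_def] QX by (simp add: algebra_simps)
  finally have *: "(?f * ((Q * fps_X - Q') * (Q - Q' * ?y))) * (sB M N * dil c (sA M N)) = (?f * ((Q * fps_X - Q') * (Q - Q' * ?y))) * 1" .
  have "(?f * ((Q * fps_X - Q') * (Q - Q' * ?y))) $ 0 \<noteq> 0"
    by (simp add: qvar_nonzero fser_equation(1)[OF MN])
  then have "?f * ((Q * fps_X - Q') * (Q - Q' * ?y)) \<noteq> 0"
    by (metis fps_zero_nth)
  with * show ?thesis
    unfolding c_def by (simp only: mult_cancel_left simp_thms)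
qed

lemma shifted_relations:
  fixes r :: Cq
  defines "y \<equiv> fps_const r * fps_X"
  shows "dil r (sA M N) * (Q - Q' * y) = dil r (fser M N) * (1 - y)"
    "dil r (sB M N) * (dil r (fser M N) * (Q * y - Q')) = y - 1"
proof -
  have "sA M N * (Q - Q' * fps_X) = fser M N * (1 - fps_X)"
    using g0_mult[of M N] by (simp add: sA_def mult_ac)
  from arg_cong[OF this, of "dil r"] show "dil r (sA M N) * (Q - Q' * y) = dil r (fser M N) * (1 - y)"
    by (simp only: dil_mult dil_simps y_def)
  have "sB M N * (fser M N * (Q * fps_X - Q')) = fps_X - 1"
    using u0_mult by (simp add: sB_def mult_ac)
  from arg_cong[OF this, of "dil r"] show "dil r (sB M N) * (dil r (fser M N) * (Q * y - Q')) = y - 1"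
    by (simp only: dil_mult dil_simps y_def)
qed

lemma unshifted_relations:
  "sA M N * (Q - Q' * fps_X) = fser M N * (1 - fps_X)" "sB M N * (fser M N * (Q * fps_X - Q')) = fps_X - 1"
  using shifted_relations[of 1] by (simp_all add: dil_dil)

lemma fps_cancel: "K $ 0 \<noteq> 0 \<Longrightarrow> K * F = K * G \<Longrightarrow> F = G" for F G K :: "'q::field fps"
  by (metis fps_zero_nth mult_cancel_left)

text \<open>Negative series are dilated by q^2 when the argument is shifted by q^2. Their L is the
  second matrix of the mixed relation, so D is governed by the exchanged prefactor
  \<open>u0\<close>, and E by \<open>g0\<close>.\<close>

lemma shifted_minus:
  "shifted_products (qvar ^ 2) M N (inverse (fser M N)) (sB M N) (sA M N) (u0 M N * (Q' * fps_X - Q))"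
proof
  let ?r = "qvar ^ 2" and ?f = "fser M N" and ?X = "fps_X :: Cq fps"
  let ?y = "Q * Q * ?X"
  have y: "fps_const ?r * ?X = ?y"
    by (simp add: power2_eq_square)
  note R = shifted_relations[where r = ?r, unfolded y] and U = unshifted_relations
  show "?r \<noteq> 0"
    by (simp add: qvar_nonzero)
  show "n = 0" if "?r ^ n = 1" for n
    using that qvar_power_eq_1[of "2 * n"] by (simp add: power_mult)
  have f0: "?f $ 0 = 1" "dil ?r ?f $ 0 = 1"
    by (simp_all add: fser_equation(1)[OF MN] dil_def)
  have i: "inverse ?f * ?f = 1"
    by (simp add: inverse_mult_eq_1 f0)
  have ir: "dil ?r (inverse ?f) * dil ?r ?f = 1"
    using arg_cong[OF i, of "dil ?r"] by (simp add: dil_mult)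
  show "inverse ?f $ 0 \<noteq> 0" "sB M N $ 0 \<noteq> 0" "sA M N $ 0 \<noteq> 0" "(u0 M N * (Q' * ?X - Q)) $ 0 \<noteq> 0"
    by (simp_all add: f0 series_nth0 qvar_nonzero)
  show "dil ?r (inverse ?f) * sB M N * dil ?r (sA M N) = inverse ?f"
  proof (rule fps_cancel)
    \<comment> \<open>Clears the denominators of \<open>sB\<close> and of the dilated
      \<open>sA\<close>; what remains is a polynomial identity using \<open>QQ\<close>.\<close>
    let ?K = "?f * (Q * ?X - Q') * (Q - Q' * ?y)"
    have "?K * (dil ?r (inverse ?f) * sB M N * dil ?r (sA M N)) =
      dil ?r (inverse ?f) * (sB M N * (?f * (Q * ?X - Q'))) * (dil ?r (sA M N) * (Q - Q' * ?y))"
      by (simp only: mult_ac)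
    also have "\<dots> = (dil ?r (inverse ?f) * dil ?r ?f) * ((?X - 1) * (1 - ?y))"
      unfolding R U by (simp only: mult_ac)
    also have "\<dots> = (inverse ?f * ?f) * ((Q * ?X - Q') * (Q - Q' * ?y))"
      unfolding i ir using QQ by algebra
    finally show "?K * (dil ?r (inverse ?f) * sB M N * dil ?r (sA M N)) = ?K * inverse ?f"
      by (simp only: mult_ac)
  qed (simp add: f0 qvar_nonzero)
  have d: "u0 M N * (Q' * ?X - Q) * (?f * (Q * ?X - Q')) = Q' * ?X - Q"
    using u0_mult by (simp add: mult_ac)
  have dr: "dil ?r (u0 M N * (Q' * ?X - Q)) * (dil ?r ?f * (Q * ?y - Q')) = Q' * ?y - Q"
    using arg_cong[OF d, of "dil ?r"] by (simp only: dil_mult dil_simps y)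
  show "dil ?r (u0 M N * (Q' * ?X - Q)) = u0 M N * (Q' * ?X - Q) * sA M N * dil ?r (sB M N)"
  proof (rule fps_cancel)
    let ?K = "?f * (Q * ?X - Q') * (Q - Q' * ?X) * (dil ?r ?f * (Q * ?y - Q'))"
    have "?K * dil ?r (u0 M N * (Q' * ?X - Q)) = ?f * (Q * ?X - Q') * (Q - Q' * ?X) * (dil ?r (u0 M N * (Q' * ?X - Q)) * (dil ?r ?f * (Q * ?y - Q')))"
      by (simp only: mult_ac)
    also have "\<dots> = (Q' * ?X - Q) * (?f * (1 - ?X)) * (?y - 1)"
      unfolding dr using QQ by algebra
    also have "\<dots> = (u0 M N * (Q' * ?X - Q) * (?f * (Q * ?X - Q'))) * (sA M N * (Q - Q' * ?X)) * (dil ?r (sB M N) * (dil ?r ?f * (Q * ?y - Q')))"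
      unfolding R U d ..
    finally show "?K * dil ?r (u0 M N * (Q' * ?X - Q)) = ?K * (u0 M N * (Q' * ?X - Q) * sA M N * dil ?r (sB M N))"
      by (simp only: mult_ac)
  qed (simp add: f0 qvar_nonzero)
  have "?r powi (int M - int N) = qvar powi (2 * int M - 2 * int N)"
  proof -
    have "?r = qvar powi 2" by simp
    then show ?thesis
      by (simp only: power_int_mult[symmetric] right_diff_distrib)
  qed
  then show "sB M N * dil (?r powi (int M - int N)) (sA M N) = 1"
    using sB_link by simp
qed

text \<open>Positive series run in z^(-1), so the dilation is by q^(-2). Their L comes first in the
  mixed relation, and \<open>sA\<close>, \<open>sB\<close> trade places with respect to
  \<open>shifted_minus\<close>.\<close>

lemma shifted_plus:
  "shifted_products (qinv ^ 2) M N (fser M N) (sA M N) (sB M N) (g0 M N * (Q' - Q * fps_X))"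
proof
  let ?r = "qinv ^ 2" and ?f = "fser M N" and ?X = "fps_X :: Cq fps"
  let ?y = "Q' * Q' * ?X"
  have y: "fps_const ?r * ?X = ?y"
    by (simp add: power2_eq_square)
  note R = shifted_relations[where r = ?r, unfolded y] and U = unshifted_relations
  show "?r \<noteq> 0"
    by (simp add: qvar_nonzero)
  show "n = 0" if "?r ^ n = 1" for n
    using that qvar_power_eq_1[of "2 * n"] by (simp add: power_mult power_inverse)
  have f0: "?f $ 0 = 1" "dil ?r ?f $ 0 = 1"
    by (simp_all add: fser_equation(1)[OF MN] dil_def)
  show "?f $ 0 \<noteq> 0" "sB M N $ 0 \<noteq> 0" "sA M N $ 0 \<noteq> 0" "(g0 M N * (Q' - Q * ?X)) $ 0 \<noteq> 0"
    by (simp_all add: f0 series_nth0 qvar_nonzero)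
  show "dil ?r ?f * sA M N * dil ?r (sB M N) = ?f"
  proof (rule fps_cancel)
    let ?K = "(Q - Q' * ?X) * (Q * ?y - Q')"
    have "?K * (dil ?r ?f * sA M N * dil ?r (sB M N)) =
      (sA M N * (Q - Q' * ?X)) * (dil ?r (sB M N) * (dil ?r ?f * (Q * ?y - Q')))"
      by (simp only: mult_ac)
    also have "\<dots> = ?K * ?f"
      unfolding R U using QQ by algebra
    finally show "?K * (dil ?r ?f * sA M N * dil ?r (sB M N)) = ?K * ?f" .
  qed (simp add: f0 qvar_nonzero)
  have d: "g0 M N * (Q' - Q * ?X) * (Q - Q' * ?X) = ?f * (Q' - Q * ?X)"
    using g0_mult[of M N] by (simp add: mult_ac)
  have dr: "dil ?r (g0 M N * (Q' - Q * ?X)) * (Q - Q' * ?y) = dil ?r ?f * (Q' - Q * ?y)"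
    using arg_cong[OF d, of "dil ?r"] by (simp only: dil_mult dil_simps y)
  show "dil ?r (g0 M N * (Q' - Q * ?X)) = g0 M N * (Q' - Q * ?X) * sB M N * dil ?r (sA M N)"
  proof (rule fps_cancel)
    let ?K = "(Q - Q' * ?y) * (Q - Q' * ?X) * (?f * (Q * ?X - Q'))"
    have "?K * dil ?r (g0 M N * (Q' - Q * ?X)) = (dil ?r (g0 M N * (Q' - Q * ?X)) * (Q - Q' * ?y)) * ((Q - Q' * ?X) * (?f * (Q * ?X - Q')))"
      by (simp only: mult_ac)
    also have "\<dots> = (?f * (Q' - Q * ?X)) * (?X - 1) * (dil ?r ?f * (1 - ?y))"
      unfolding dr using QQ by algebra
    also have "\<dots> = (g0 M N * (Q' - Q * ?X) * (Q - Q' * ?X)) * (sB M N * (?f * (Q * ?X - Q'))) * (dil ?r (sA M N) * (Q - Q' * ?y))"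
      unfolding R U d ..
    finally show "?K * dil ?r (g0 M N * (Q' - Q * ?X)) = ?K * (g0 M N * (Q' - Q * ?X) * sB M N * dil ?r (sA M N))"
      by (simp only: mult_ac)
  qed (simp add: f0 qvar_nonzero)
  have "?r powi (int M - int N) * qvar powi (2 * int M - 2 * int N) = 1"
  proof -
    have "?r = qvar powi (- 2)" by (simp add: power_int_minus power_inverse)
    then have e: "?r powi (int M - int N) = qvar powi (- (2 * int M - 2 * int N))"
      by (simp only: power_int_mult[symmetric] right_diff_distrib minus_diff_eq) (simp add: algebra_simps)
    show ?thesis
      unfolding e powi_diff(2)[symmetric] by simp
  qed
  then show "sA M N * dil (?r powi (int M - int N)) (sB M N) = 1"
    using arg_cong[OF sB_link, of "dil (?r powi (int M - int N))"] by (simp add: dil_mult dil_dil mult.commute)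
qed

end

section \<open>Identification of D and E inside the algebra, and centrality\<close>

section \<open>The entries of the quantum Berezinian\<close>

lemma (in index_order) inversions_snoc: "inversions (xs @ [x]) = inversions xs + length (filter (\<lambda>y. x \<prec> y) xs)"
  by (induction xs) auto

lemma (in index_order) inversions_upt:
  "inversions (map f [a..<b]) = card {(i, j). a \<le> i \<and> i < j \<and> j < b \<and> f j \<prec> f i}"
proof (induction b)
  case (Suc b)
  show ?case
  proof (cases "a \<le> b")
    case True
    let ?S = "\<lambda>b. {(i, j). a \<le> i \<and> i < j \<and> j < b \<and> f j \<prec> f i}" and ?T = "{i \<in> {a..<b}. f b \<prec> f i}"
    have fin: "finite (?S b)"
      by (rule finite_subset[of _ "{a..<b} \<times> {a..<b}"]) auto
    have "?S (Suc b) = ?S b \<union> (\<lambda>i. (i, b)) ` ?T"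
      by (auto simp: less_Suc_eq)
    moreover have "?S b \<inter> (\<lambda>i. (i, b)) ` ?T = {}"
      by auto
    ultimately have "card (?S (Suc b)) = card (?S b) + card ((\<lambda>i. (i, b)) ` ?T)"
      using fin by (simp add: card_Un_disjoint)
    also have "card ((\<lambda>i. (i, b)) ` ?T) = card ?T"
      by (rule card_image) (auto simp: inj_on_def)
    also have "?T = set (filter (\<lambda>i. f b \<prec> f i) [a..<b])"
      by auto
    also have "card \<dots> = length (filter (\<lambda>i. f b \<prec> f i) [a..<b])"
      by (rule distinct_card) simp
    finally show ?thesis
      using True by (simp add: inversions_snoc Suc.IH filter_map comp_def)
  next
    case False
    then have *: "{(i, j). a \<le> i \<and> i < j \<and> j < Suc b \<and> f j \<prec> f i} = {}"
      by auto
    show ?thesis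
      unfolding * using False by simp
  qed
qed simp

lemma inversions_perm_length:
  "nat_order.inversions (map (\<lambda>j. a + \<sigma> j) [1..<Suc n]) = perm_length n \<sigma>"
  unfolding nat_order.inversions_upt perm_length_def
  by (rule arg_cong[where f = card]) auto

lemma inj_on_shift: "inj_on \<sigma> A \<Longrightarrow> inj_on (\<lambda>j. a + \<sigma> j :: nat) A"
  by (rule inj_onI, erule inj_onD) simp_all

text \<open>Words of length n without repetition over n consecutive letters are permutations shifted
  by \<open>a\<close>. Terms with repetitions drop out, as they do under \<open>wt\<close>.\<close>

lemma lists_on_perms:
  fixes F :: "nat list \<Rightarrow> 'a::comm_monoid_add"
  assumes "\<And>rs. rs \<in> lists_on {a+1..a+n} n \<Longrightarrow> \<not> distinct rs \<Longrightarrow> F rs = 0"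
  shows "(\<Sum>rs\<in>lists_on {a+1..a+n} n. F rs) = (\<Sum>\<sigma> | \<sigma> permutes {1..n}. F (map (\<lambda>j. a + \<sigma> j) [1..<Suc n]))"
proof -
  let ?h = "\<lambda>\<sigma>. map (\<lambda>j. a + \<sigma> j) [1..<Suc n]"
  have nth: "?h \<sigma> ! k = a + \<sigma> (Suc k)" if "k < n" for \<sigma> k
    using that by (simp del: upt_Suc)
  have bij: "bij_betw ?h {\<sigma>. \<sigma> permutes {1..n}} {rs \<in> lists_on {a+1..a+n} n. distinct rs}"
    unfolding bij_betw_def
  proof
    show "inj_on ?h {\<sigma>. \<sigma> permutes {1..n}}"
    proof (rule inj_onI, rule ext)
      fix \<sigma> \<tau> x assume *: "\<sigma> \<in> {\<sigma>. \<sigma> permutes {1..n}}" "\<tau> \<in> {\<sigma>. \<sigma> permutes {1..n}}" "?h \<sigma> = ?h \<tau>"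
      show "\<sigma> x = \<tau> x"
      proof (cases "x \<in> {1..n}")
        case True
        then have "x - 1 < n" "Suc (x - 1) = x" by auto
        then show ?thesis
          using nth[of "x - 1" \<sigma>] nth[of "x - 1" \<tau>] unfolding *(3) by simp
      next
        case False
        then show ?thesis
          using * by (simp add: permutes_def)
      qed
    qed
    show "?h ` {\<sigma>. \<sigma> permutes {1..n}} = {rs \<in> lists_on {a+1..a+n} n. distinct rs}"
    proof
      show "?h ` {\<sigma>. \<sigma> permutes {1..n}} \<subseteq> {rs \<in> lists_on {a+1..a+n} n. distinct rs}"
      proof
        fix rs assume "rs \<in> ?h ` {\<sigma>. \<sigma> permutes {1..n}}"
        then obtain \<sigma> where s: "\<sigma> permutes {1..n}" "rs = ?h \<sigma>" by blast
        have m: "\<sigma> j \<in> {1..n}" if "j \<in> {1..n}" for j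
          using s(1) that by (simp only: permutes_in_image)
        have inj: "inj_on (\<lambda>j. a + \<sigma> j) {1..n}"
          by (rule inj_on_shift[OF permutes_inj_on[OF s(1)]])
        have st: "set [1..<Suc n] = {1..n}"
          by (simp only: set_upt atLeastLessThanSuc_atLeastAtMost)
        have "set (?h \<sigma>) \<subseteq> {a+1..a+n}"
          unfolding set_map st using m by fastforce
        moreover have "distinct (?h \<sigma>)"
          unfolding distinct_map st using inj by simp
        moreover have "length (?h \<sigma>) = n"
          by (simp del: upt_Suc)
        ultimately show "rs \<in> {rs \<in> lists_on {a+1..a+n} n. distinct rs}"
          unfolding s(2) lists_on_def by blast
      qed
      show "{rs \<in> lists_on {a+1..a+n} n. distinct rs} \<subseteq> ?h ` {\<sigma>. \<sigma> permutes {1..n}}"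
      proof
        fix rs assume rs: "rs \<in> {rs \<in> lists_on {a+1..a+n} n. distinct rs}"
        then have len: "length rs = n" and set: "set rs \<subseteq> {a+1..a+n}" and d: "distinct rs"
          by (auto simp: lists_on_def)
        define \<sigma> where "\<sigma> = (\<lambda>j. if j \<in> {1..n} then rs ! (j - 1) - a else j)"
        have mem: "rs ! k \<in> {a+1..a+n}" if "k < n" for k
          using set len that by (meson nth_mem subsetD)
        have inj: "inj_on \<sigma> {1..n}"
        proof (rule inj_onI)
          fix x y assume *: "x \<in> {1..n}" "y \<in> {1..n}" "\<sigma> x = \<sigma> y"
          then have "x - 1 < n" "y - 1 < n" by auto
          then have "rs ! (x - 1) = rs ! (y - 1)"
            using * mem[of "x - 1"] mem[of "y - 1"] by (simp add: \<sigma>_def, arith)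
          then have "x - 1 = y - 1"
            using d len \<open>x - 1 < n\<close> \<open>y - 1 < n\<close> by (simp add: nth_eq_iff_index_eq)
          then show "x = y" using * by auto
        qed
        have "\<sigma> ` {1..n} \<subseteq> {1..n}"
        proof
          fix y assume "y \<in> \<sigma> ` {1..n}"
          then obtain x where "x \<in> {1..n}" "y = rs ! (x - 1) - a" by (auto simp: \<sigma>_def)
          then have "rs ! (x - 1) \<in> {a+1..a+n}"
            by (intro mem) auto
          then show "y \<in> {1..n}"
            unfolding \<open>y = rs ! (x - 1) - a\<close> atLeastAtMost_iff by linarith
        qed
        then have "\<sigma> ` {1..n} = {1..n}"
          using inj by (intro card_subset_eq) (auto simp: card_image)
        then have "bij_betw \<sigma> {1..n} {1..n}"
          using inj by (simp add: bij_betw_def)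
        then have "\<sigma> permutes {1..n}"
          by (rule bij_imp_permutes) (auto simp: \<sigma>_def)
        moreover have "rs = ?h \<sigma>"
        proof (rule nth_equalityI)
          show "length rs = length (?h \<sigma>)"
            using len by (simp del: upt_Suc)
          fix k assume "k < length rs"
          then show "rs ! k = ?h \<sigma> ! k"
            using mem[of k] len nth[of k \<sigma>] by (auto simp: \<sigma>_def)
        qed
        ultimately show "rs \<in> ?h ` {\<sigma>. \<sigma> permutes {1..n}}" by blast
      qed
    qed
  qed
  have "(\<Sum>rs\<in>lists_on {a+1..a+n} n. F rs) = (\<Sum>rs\<in>{rs \<in> lists_on {a+1..a+n} n. distinct rs}. F rs)"
    by (rule sum.mono_neutral_right) (use assms in auto)
  also have "\<dots> = (\<Sum>\<sigma> | \<sigma> permutes {1..n}. F (?h \<sigma>))"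
    by (rule sum.reindex_bij_betw[OF bij, symmetric])
  finally show ?thesis .
qed

lemma ring_prod_map:
  "ring_prod T (map e xs) (map r xs) (map c xs) = prod_list (map (\<lambda>x. T (e x) (r x) (c x)) xs)"
  by (induction xs) auto

text \<open>The factor by which the series variable is multiplied when z becomes z q^e: a positive
  series runs in z^(-1), so the exponent changes sign.\<close>

definition shiftc :: "sgn \<Rightarrow> int \<Rightarrow> Cq" where
  "shiftc s e = qvar powi (case s of Plus \<Rightarrow> - e | Minus \<Rightarrow> e)"

lemma Lmat_udil: "Lmat s e i j = uq.udil (shiftc s e) (Lser s i j)"
  by (cases s) (simp_all add: fps_eq_iff Lmat_def uq.udil_nth shiftc_def Lser_def flip: power_int_mult power_int_of_nat)

context qc_ring
begin

lemma udil_mult: "udil c (u * v) = udil c u * udil c v"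
proof (rule fps_ext)
  fix n
  have "(udil c u * udil c v) $ n = (\<Sum>i\<le>n. usc (c ^ n) * (u $ i * v $ (n - i)))"
    unfolding udil_mult_nth(1) by (intro sum.cong refl) (simp flip: power_add)
  then show "udil c (u * v) $ n = (udil c u * udil c v) $ n"
    by (simp add: udil_nth fps_mult_nth sum_distrib_left atLeast0AtMost)
qed

lemma udil_add: "udil c (u + v) = udil c u + udil c v" and udil_one: "udil c 1 = 1" "udil 1 u = u"
  by (simp_all add: fps_eq_iff udil_nth distrib_left)

end

lemma emb_out_hom:
  fixes u v :: "'u::ring_1 fps"
  shows emb_out_mult: "emb_out (u * v) = emb_out u * emb_out v"
  and emb_out_add: "emb_out (u + v) = emb_out u + emb_out v" and emb_out_one: "emb_out (1 :: 'u fps) = 1"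
proof -
  have c: "fps_const (\<Sum>i\<in>A. f i) = (\<Sum>i\<in>A. fps_const (f i :: 'u))" for A :: "nat set" and f
    by (induction A rule: infinite_finite_induct) (simp_all flip: fps_const_add)
  show "emb_out (u * v) = emb_out u * emb_out v"
  proof (rule fps_ext)
    fix n
    have "emb_out (u * v) $ n = (\<Sum>i=0..n. fps_const (u $ i) * fps_const (v $ (n - i)))"
      by (simp add: emb_out_def fps_mult_nth[of u] c)
    then show "emb_out (u * v) $ n = (emb_out u * emb_out v) $ n"
      by (simp only: emb_out_def fps_mult_nth[of "Abs_fps _"] fps_nth_Abs_fps)
  qed
qed (simp_all add: fps_eq_iff emb_out_def)

lemma emb_in_hom: "emb_in (u * v) = emb_in u * emb_in v" "emb_in (u + v) = emb_in u + emb_in v" "emb_in 1 = 1" "emb_in 0 = 0"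
  by (simp_all add: emb_in_def)

lemma emb_in_prod_list: "emb_in (prod_list xs) = prod_list (map emb_in xs)"
  by (induction xs) (simp_all add: emb_in_hom)

lemma emb_in_sum: "emb_in (\<Sum>x\<in>A. f x) = (\<Sum>x\<in>A. emb_in (f x))"
  by (induction A rule: infinite_finite_induct) (simp_all add: emb_in_hom)

lemma sinverse_map:
  fixes \<phi> :: "'a::ring_1 \<Rightarrow> 'b::ring_1"
  assumes add: "\<And>x y. \<phi> (x + y) = \<phi> x + \<phi> y" and mult: "\<And>x y. \<phi> (x * y) = \<phi> x * \<phi> y" and one: "\<phi> 1 = 1"
    and XY: "sinverse M N X Y"
  shows "sinverse M N (\<lambda>i j. \<phi> (X i j)) (\<lambda>i j. \<phi> (Y i j))"
proof -
  have z: "\<phi> 0 = 0"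
    using add[of 0 0] by simp
  have m: "\<phi> (- x) = - \<phi> x" for x
    using add[of x "- x"] z by (simp add: eq_neg_iff_add_eq_0 add.commute)
  have s: "\<phi> (\<Sum>x\<in>A. f x) = (\<Sum>x\<in>A. \<phi> (f x))" for A :: "nat set" and f
    by (induction A rule: infinite_finite_induct) (simp_all add: z add)
  have n: "\<phi> ((-1) ^ e * x) = (-1) ^ e * \<phi> x" for e x
    by (cases "even e") (simp_all add: m)
  have "smul M N (\<lambda>i j. \<phi> (X i j)) (\<lambda>i j. \<phi> (Y i j)) i k = \<phi> (smul M N X Y i k)" for X Y i k
    unfolding smul_def s n by (simp only: mult)
  then show ?thesis
    using XY by (auto simp: sinverse_def one z)
qed

lemma sinverse_unique:
  assumes "sinverse M N X Y" "sinverse M N X Z" "i \<in> {1..M+N}" "k \<in> {1..M+N}"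
  shows "Y i k = Z i k"
proof -
  have "tw M i k * Z i k = tw M i k * Y i k"
    by (rule nat_order.left_right_inverse_unique[of "{1..M+N}" "\<lambda>i j. tw M i j * X i j" "\<lambda>i j. tw M i j * Y i j" "\<lambda>i j. tw M i j * Z i j"])
      (use assms in \<open>simp_all add: sinverse_tw\<close>)
  then show ?thesis
    using tw_simps(1)[of M i k] by metis
qed

text \<open>The order for which the zero modes are triangular: those of L^+ vanish below the
  diagonal, those of L^- above it.\<close>

definition lts :: "sgn \<Rightarrow> nat \<Rightarrow> nat \<Rightarrow> bool" where
  "lts s = (case s of Plus \<Rightarrow> (\<lambda>x y. y < x) | Minus \<Rightarrow> (<))"

lemma lts_order: "index_order (lts s)"
  using index_order_flip[OF nat_order.index_order_axioms] nat_order.index_order_axioms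
  by (cases s) (simp_all add: lts_def)

lemma Lser_triangular:
  assumes "A \<subseteq> {1..LENGTH('m::len0)+LENGTH('n::len0)}"
  shows "index_order.triangular (lts s) A (Lser s :: nat \<Rightarrow> nat \<Rightarrow> ('m, 'n) uq fps)"
proof -
  interpret index_order "lts s" by (rule lts_order)
  have d: "ul Minus i i 0 * ul Plus i i 0 = (1 :: ('m, 'n) uq)" "ul Plus i i 0 * ul Minus i i 0 = (1 :: ('m, 'n) uq)"
    if "i \<in> A" for i
    using abs_uq_eq_0[where 'm = 'm and 'n = 'n, OF rels.diag[of i]] abs_uq_eq_0[where 'm = 'm and 'n = 'n, OF rels.diag'[of i]] that assms
    by (auto simp: abs_uq_diff abs_uq_mult abs_uq_01 ul.abs_eq)
  have z: "ul s i j 0 = (0 :: ('m, 'n) uq)" if "i \<in> A" "j \<in> A" "lts s i j" for i j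
    using that(3) subsetD[OF assms that(1)] subsetD[OF assms that(2)] abs_uq_eq_0[where 'm = 'm and 'n = 'n, OF rels.upper[of j i]] abs_uq_eq_0[where 'm = 'm and 'n = 'n, OF rels.lower[of i j]]
    by (cases s) (auto simp: lts_def ul.abs_eq)
  have "\<exists>y. y * Lser s i i $ 0 = 1 \<and> Lser s i i $ 0 * y = (1 :: ('m, 'n) uq)" if "i \<in> A" for i
    using d[OF that] by (cases s; intro exI[of _ "ul (case s of Plus \<Rightarrow> Minus | Minus \<Rightarrow> Plus) i i 0"]) (simp_all add: Lser_def)
  then show ?thesis
    unfolding triangular_def using z by (auto simp: Lser_def)
qed

definition Lv :: "sgn \<Rightarrow> nat \<Rightarrow> nat \<Rightarrow> ('m::len0, 'n::len0) uq fps" where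
  "Lv s = sinv LENGTH('m) LENGTH('n) (Lser s)"

lemma Lv_inverse: "sinverse LENGTH('m::len0) LENGTH('n::len0) (Lser s) (Lv s :: nat \<Rightarrow> nat \<Rightarrow> ('m, 'n) uq fps)"
  unfolding Lv_def by (rule triangular_sinverse[OF lts_order Lser_triangular]) simp

text \<open>Dilation is a ring homomorphism and inverses are unique, so inverting commutes with
  shifting the argument.\<close>

lemma Linv_udil:
  assumes "i \<in> {1..LENGTH('m::len0)+LENGTH('n::len0)}" "j \<in> {1..LENGTH('m)+LENGTH('n)}"
  shows "Linv s e i j = uq.udil (shiftc s e) (Lv s i j :: ('m, 'n) uq fps)"
proof -
  have "sinverse LENGTH('m) LENGTH('n) (Lmat s e) (\<lambda>i j. uq.udil (shiftc s e) (Lv s i j :: ('m, 'n) uq fps))"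
    unfolding Lmat_udil by (rule sinverse_map[OF uq.udil_add uq.udil_mult uq.udil_one(1) Lv_inverse])
  then show ?thesis
    unfolding Linv_def using sinverse_unique[OF sinverse_sinv _ assms] by blast
qed

definition lamS :: "sgn \<Rightarrow> int \<Rightarrow> nat \<Rightarrow> nat \<Rightarrow> ('m::len0, 'n::len0) uq fps fps" where
  "lamS s e i j = emb_in (uq.udil (shiftc s e) (Lser s i j))"
definition kkS :: "sgn \<Rightarrow> int \<Rightarrow> nat \<Rightarrow> nat \<Rightarrow> ('m::len0, 'n::len0) uq fps fps" where
  "kkS s e i j = emb_in (uq.udil (shiftc s e) (Lv s i j))"
definition muS :: "sgn \<Rightarrow> nat \<Rightarrow> nat \<Rightarrow> ('m::len0, 'n::len0) uq fps fps" where
  "muS s i j = emb_out (Lser s i j)"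
definition kaS :: "sgn \<Rightarrow> nat \<Rightarrow> nat \<Rightarrow> ('m::len0, 'n::len0) uq fps fps" where
  "kaS s i j = emb_out (Lv s i j)"

definition DS :: "sgn \<Rightarrow> int \<Rightarrow> ('m::len0, 'n::len0) uq fps fps" where
  "DS s \<epsilon> = nat_order.ring_minor (uq.sc \<epsilon>) (kc qinv) {1..LENGTH('m)} (lamS s) (even_shifts LENGTH('m)) [1..<Suc LENGTH('m)]"

definition ES :: "sgn \<Rightarrow> int \<Rightarrow> nat list \<Rightarrow> ('m::len0, 'n::len0) uq fps fps" where
  "ES s \<epsilon> cs = index_order.ring_minor (\<lambda>x y. y < x) (uq.sc \<epsilon>) (kc qvar) {LENGTH('m)+1..LENGTH('m)+LENGTH('n)}
     (\<lambda>e b r. kkS s e r b) (odd_shifts LENGTH('m) LENGTH('n)) cs"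

lemma upt_shift: "map f [0..<n] = map (\<lambda>j. f (j - 1)) [1..<Suc n]"
  using map_Suc_upt[of 0 n, symmetric] by (simp add: comp_def del: upt_Suc)

lemma kc_power: "kc c ^ n = kc (c ^ n)"
  by (induction n) (simp_all add: kc_simps)

lemma qpow_neg: "(- qinv) ^ n = (- qvar) powi (- int n)"
  by (simp add: power_int_minus power_inverse flip: inverse_minus_eq)

text \<open>The right-hand side is free of \<open>\<epsilon>\<close>, because the weights are
  constants.\<close>

theorem DS_eq: "(DS s \<epsilon> :: ('m::len0, 'n::len0) uq fps fps) = emb_in (\<Sum>\<sigma> | \<sigma> permutes {1..LENGTH('m)}.
   perm_coeff LENGTH('m) \<sigma> * prod_list (map (\<lambda>j. Lmat s (2 * int j - 2) (\<sigma> j) j) [1..<Suc LENGTH('m)]))"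
proof -
  let ?M = "LENGTH('m)"
  interpret sc: central_hom "uq.sc \<epsilon> :: Cq fps fps \<Rightarrow> ('m, 'n) uq fps fps" by (rule uq.sc_hom)
  have len: "length (even_shifts ?M) = ?M"
    by (simp add: even_shifts_def)
  have es: "even_shifts ?M = map (\<lambda>j. 2 * int j - 2) [1..<Suc ?M]"
    unfolding even_shifts_def upt_shift by (rule map_cong) (auto simp: of_nat_diff)
  have "DS s \<epsilon> = (\<Sum>\<sigma> | \<sigma> permutes {1..?M}. uq.sc \<epsilon> (nat_order.wt (kc qinv) (map (\<lambda>j. 0 + \<sigma> j) [1..<Suc ?M])) *
      (ring_prod (lamS s) (even_shifts ?M) (map (\<lambda>j. 0 + \<sigma> j) [1..<Suc ?M]) [1..<Suc ?M] :: ('m, 'n) uq fps fps))"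
    unfolding DS_def nat_order.ring_minor_def len
    using lists_on_perms[of 0 ?M "\<lambda>rs. uq.sc \<epsilon> (nat_order.wt (kc qinv) rs) * (ring_prod (lamS s) (even_shifts ?M) rs [1..<Suc ?M] :: ('m, 'n) uq fps fps)"]
    by (simp add: nat_order.wt_def del: upt_Suc)
  also have "\<dots> = emb_in (\<Sum>\<sigma> | \<sigma> permutes {1..?M}. perm_coeff ?M \<sigma> * prod_list (map (\<lambda>j. Lmat s (2 * int j - 2) (\<sigma> j) j) [1..<Suc ?M]))"
    unfolding emb_in_sum
  proof (rule sum.cong[OF refl])
    fix \<sigma> assume "\<sigma> \<in> {\<sigma>. \<sigma> permutes {1..?M}}"
    then have "inj_on \<sigma> {1..?M}"
      by (simp add: permutes_inj_on)
    then have d: "distinct (map (\<lambda>j. 0 + \<sigma> j) [1..<Suc ?M])"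
      unfolding distinct_map set_upt atLeastLessThanSuc_atLeastAtMost by (simp only: distinct_upt inj_on_shift simp_thms)
    have w: "uq.sc \<epsilon> (nat_order.wt (kc qinv) (map (\<lambda>j. 0 + \<sigma> j) [1..<Suc ?M])) = emb_in (perm_coeff ?M \<sigma> :: ('m, 'n) uq fps)"
      using d unfolding nat_order.wt_def inversions_perm_length
      by (simp add: perm_coeff_def emb_in_def uq.sc_kc qpow_neg[symmetric] kc_power flip: kc_simps(6))
    have "ring_prod (lamS s) (even_shifts ?M) (map (\<lambda>j. 0 + \<sigma> j) [1..<Suc ?M]) (map (\<lambda>j. j) [1..<Suc ?M]) =
      (emb_in (prod_list (map (\<lambda>j. Lmat s (2 * int j - 2) (\<sigma> j) j) [1..<Suc ?M])) :: ('m, 'n) uq fps fps)"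
      unfolding es ring_prod_map emb_in_prod_list by (simp add: comp_def lamS_def Lmat_udil del: upt_Suc)
    then show "uq.sc \<epsilon> (nat_order.wt (kc qinv) (map (\<lambda>j. 0 + \<sigma> j) [1..<Suc ?M])) * ring_prod (lamS s) (even_shifts ?M) (map (\<lambda>j. 0 + \<sigma> j) [1..<Suc ?M]) [1..<Suc ?M] =
      (emb_in (perm_coeff ?M \<sigma> * prod_list (map (\<lambda>j. Lmat s (2 * int j - 2) (\<sigma> j) j) [1..<Suc ?M])) :: ('m, 'n) uq fps fps)"
      unfolding emb_in_hom(1) w by simp
  qed
  finally show ?thesis .
qed

text \<open>E is antisymmetrised with weight q in the decreasing order and so counts the pairs that
  are not inversions, whereas the Berezinian counts inversions with q^(-1). Both counts add up to
  \<open>T\<close>, the number of pairs, and the quotient is (-q)^T.\<close>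

theorem ES_eq:
  fixes s :: sgn and \<epsilon> :: int
  shows "\<exists>k. k \<noteq> 0 \<and> (ES s \<epsilon> [LENGTH('m::len0)+1..<Suc (LENGTH('m)+LENGTH('n::len0))] :: ('m, 'n) uq fps fps) = uq.sc \<epsilon> (kc k) * emb_in (\<Sum>\<tau> | \<tau> permutes {1..LENGTH('n)}.
   perm_coeff LENGTH('n) \<tau> * prod_list (map (\<lambda>k. Linv s (2 * int LENGTH('m) - 2 * int k) (LENGTH('m) + k) (LENGTH('m) + \<tau> k)) [1..<Suc LENGTH('n)]))"
proof -
  let ?M = "LENGTH('m)" and ?N = "LENGTH('n)"
  interpret sc: central_hom "uq.sc \<epsilon> :: Cq fps fps \<Rightarrow> ('m, 'n) uq fps fps" by (rule uq.sc_hom)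
  interpret rv: index_order "(\<lambda>x y. y < x) :: nat \<Rightarrow> nat \<Rightarrow> bool"
    by (rule index_order_flip[OF nat_order.index_order_axioms])
  define T where "T = card {(i, j). 1 \<le> i \<and> i < j \<and> j < Suc ?N}"
  have len: "length (odd_shifts ?M ?N) = ?N"
    by (simp add: odd_shifts_def)
  have es: "odd_shifts ?M ?N = map (\<lambda>k. 2 * int ?M - 2 * int k) [1..<Suc ?N]"
    unfolding odd_shifts_def upt_shift by (rule map_cong) (auto simp: of_nat_diff)
  have cs: "[?M+1..<Suc (?M+?N)] = map (\<lambda>k. ?M + k) [1..<Suc ?N]"
    by (rule nth_equalityI) (simp_all del: upt_Suc)
  let ?cs = "[?M+1..<Suc (?M+?N)]"
  have "ES s \<epsilon> ?cs = (\<Sum>\<tau> | \<tau> permutes {1..?N}. uq.sc \<epsilon> (rv.wt (kc qvar) (map (\<lambda>j. ?M + \<tau> j) [1..<Suc ?N])) *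
      (ring_prod (\<lambda>e b r. kkS s e r b) (odd_shifts ?M ?N) (map (\<lambda>j. ?M + \<tau> j) [1..<Suc ?N]) ?cs :: ('m, 'n) uq fps fps))"
    unfolding ES_def rv.ring_minor_def len
    using lists_on_perms[of ?M ?N "\<lambda>rs. uq.sc \<epsilon> (rv.wt (kc qvar) rs) * (ring_prod (\<lambda>e b r. kkS s e r b) (odd_shifts ?M ?N) rs ?cs :: ('m, 'n) uq fps fps)"]
    by (simp add: rv.wt_def del: upt_Suc)
  also have "\<dots> = (\<Sum>\<tau> | \<tau> permutes {1..?N}. uq.sc \<epsilon> (kc ((- qvar) ^ T)) *
     emb_in (perm_coeff ?N \<tau> * prod_list (map (\<lambda>k. Linv s (2 * int ?M - 2 * int k) (?M + k) (?M + \<tau> k)) [1..<Suc ?N])))"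
  proof (rule sum.cong[OF refl])
    fix \<tau> assume t: "\<tau> \<in> {\<tau>. \<tau> permutes {1..?N}}"
    have inj: "inj_on \<tau> {1..?N}"
      using t by (simp add: permutes_inj_on)
    have rng: "\<tau> k \<in> {1..?N}" if "k \<in> {1..?N}" for k
      using t that by (simp add: permutes_in_image del: atLeastAtMost_iff)
    have d: "distinct (map (\<lambda>j. ?M + \<tau> j) [1..<Suc ?N])"
      unfolding distinct_map set_upt atLeastLessThanSuc_atLeastAtMost by (simp only: distinct_upt inj_on_shift[OF inj] simp_thms)
    let ?R = "{(i, j). 1 \<le> i \<and> i < j \<and> j < Suc ?N \<and> ?M + \<tau> i < ?M + \<tau> j}" and ?P = "{(i, j). 1 \<le> i \<and> i < j \<and> j \<le> ?N \<and> \<tau> j < \<tau> i}"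
    have fin: "finite ?R" "finite ?P"
      by (rule finite_subset[of _ "{0..?N} \<times> {0..?N}"]; clarsimp)+
    have "?R \<union> ?P = {(i, j). 1 \<le> i \<and> i < j \<and> j < Suc ?N}"
    proof -
      have "\<tau> i \<noteq> \<tau> j" if "1 \<le> i" "i < j" "j < Suc ?N" for i j
        using inj_onD[OF inj, of i j] that by auto
      then show ?thesis by (auto simp: linorder_neq_iff)
    qed
    moreover have "?R \<inter> ?P = {}" by auto
    ultimately have RP: "rv.inversions (map (\<lambda>j. ?M + \<tau> j) [1..<Suc ?N]) + perm_length ?N \<tau> = T"
      unfolding rv.inversions_upt perm_length_def T_def using card_Un_disjoint[OF fin] by simp
    have "(- qvar) ^ rv.inversions (map (\<lambda>j. ?M + \<tau> j) [1..<Suc ?N]) = (- qvar) ^ T * (- qvar) powi (- int (perm_length ?N \<tau>))"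
      unfolding RP[symmetric] by (simp add: power_add power_int_minus qvar_nonzero)
    then have w: "uq.sc \<epsilon> (rv.wt (kc qvar) (map (\<lambda>j. ?M + \<tau> j) [1..<Suc ?N])) = uq.sc \<epsilon> (kc ((- qvar) ^ T)) * emb_in (perm_coeff ?N \<tau> :: ('m, 'n) uq fps)"
      using d by (simp add: rv.wt_def perm_coeff_def emb_in_def uq.sc_kc kc_power uq.usc.mult del: upt_Suc flip: kc_simps(6))
    have "ring_prod (\<lambda>e b r. kkS s e r b) (odd_shifts ?M ?N) (map (\<lambda>j. ?M + \<tau> j) [1..<Suc ?N]) ?cs =
      (emb_in (prod_list (map (\<lambda>k. Linv s (2 * int ?M - 2 * int k) (?M + k) (?M + \<tau> k)) [1..<Suc ?N])) :: ('m, 'n) uq fps fps)"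
      unfolding es cs ring_prod_map emb_in_prod_list map_map
    proof (rule arg_cong[where f = prod_list], rule map_cong[OF refl])
      fix k assume "k \<in> set [1..<Suc ?N]"
      then have "?M + k \<in> {1..?M+?N}" "?M + \<tau> k \<in> {1..?M+?N}"
        using rng[of k] by auto
      then show "kkS s (2 * int ?M - 2 * int k) (?M + k) (?M + \<tau> k) =
          ((emb_in \<circ> (\<lambda>k. Linv s (2 * int ?M - 2 * int k) (?M + k) (?M + \<tau> k))) k :: ('m, 'n) uq fps fps)"
        by (simp add: kkS_def Linv_udil)
    qed
    then show "uq.sc \<epsilon> (rv.wt (kc qvar) (map (\<lambda>j. ?M + \<tau> j) [1..<Suc ?N])) *
        ring_prod (\<lambda>e b r. kkS s e r b) (odd_shifts ?M ?N) (map (\<lambda>j. ?M + \<tau> j) [1..<Suc ?N]) ?cs =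
      (uq.sc \<epsilon> (kc ((- qvar) ^ T)) * emb_in (perm_coeff ?N \<tau> * prod_list (map (\<lambda>k. Linv s (2 * int ?M - 2 * int k) (?M + k) (?M + \<tau> k)) [1..<Suc ?N])) :: ('m, 'n) uq fps fps)"
      unfolding w emb_in_hom(1) by (simp add: mult.assoc)
  qed
  finally show ?thesis
    unfolding sum_distrib_left[symmetric] emb_in_sum[symmetric] by (intro exI[of _ "(- qvar) ^ T"]) (simp add: qvar_nonzero)
qed

section \<open>Centrality\<close>

lemma kc_mult: "kc a * kc b = kc (a * b)"
  by (simp add: kc_simps)

lemma kc_unit: "x \<noteq> 0 \<Longrightarrow> kc (inverse x) * kc x = 1"
  by (simp add: kc_mult kc_simps(1))

lemma qpow_add: "qvar powi a * qvar powi b = qvar powi (a + b)"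
  by (simp add: powi_diff(2))

lemma qpow_nonzero: "qvar powi a \<noteq> 0"
  by (simp add: qvar_nonzero)

lemma shiftc_simps: "shiftc Plus e = qvar powi (- e)" "shiftc Minus e = qvar powi e"
  by (simp_all add: shiftc_def)

lemma shiftc_unit: "shiftc Plus e * qvar powi e = 1"
  by (simp add: shiftc_simps qpow_add)

context
  fixes M N :: nat
  assumes MN: "LENGTH('m::len0) \<noteq> LENGTH('n::len0)"
  defines M: "M \<equiv> LENGTH('m)" and N: "N \<equiv> LENGTH('n)"
begin

lemma g00: "g0 LENGTH('m) LENGTH('n) $ 0 \<noteq> 0"
  by (rule series_nth0(1)[OF MN])

lemma lamS_eq: "lamS s e = (\<lambda>i j. emb_in (uq.udil (shiftc s e) (Lser s i j)) :: ('m, 'n) uq fps fps)"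
  "muS s = (\<lambda>i j. emb_out (Lser s i j) :: ('m, 'n) uq fps fps)"
  by (simp_all add: fun_eq_iff lamS_def muS_def)

lemma inner_grll:
  "rtt.grll (<) M N (kc qvar) (kc qinv) (uq.sc \<epsilon>) (uq.sc \<epsilon>) 1 (kc (qvar powi e)) (kc (qvar powi f))
    (lamS s e) (lamS s f :: nat \<Rightarrow> nat \<Rightarrow> ('m, 'n) uq fps fps)"
proof (cases s)
  case Plus
  \<comment> \<open>In the variable z^(-1) the two parameters appear as q^(-f) and q^(-e); the
    factor q^(e + f) restores q^e and q^f.\<close>
  have zw: "qvar powi (e + f) * (a * shiftc Plus f + b * shiftc Plus e) = a * qvar powi e + b * qvar powi f" for a b
  proof -
    have "qvar powi (e + f) * shiftc Plus f = qvar powi e" "qvar powi (e + f) * shiftc Plus e = qvar powi f"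
      unfolding shiftc_simps qpow_add by simp_all
    then show ?thesis
      by (simp only: distrib_left mult.left_commute)
  qed
  show ?thesis
    unfolding Plus lamS_eq M N
    by (rule uq.grll_inner[where \<alpha> = "\<lambda>a b. a" and \<beta> = "\<lambda>a b. b", OF qvar_inv zw]) (rule plus_rel4[OF _ _ _ _ g00])
next
  case Minus
  have zw: "1 * (b * shiftc Minus f + a * shiftc Minus e) = a * qvar powi e + b * qvar powi f" for a b
    unfolding shiftc_simps by simp
  show ?thesis
    unfolding Minus lamS_eq M N
    by (rule uq.grll_inner[where \<alpha> = "\<lambda>a b. b" and \<beta> = "\<lambda>a b. a", OF qvar_inv zw]) (rule minus_rel4[OF _ _ _ _ g00])
qed

text \<open>The parameters of \<open>grll_plus\<close> and \<open>grll_minus\<close>; for the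
  positive sign each matrix carries the variable of the other.\<close>

definition zs :: "sgn \<Rightarrow> int \<Rightarrow> Cq fps fps" where
  "zs s e = kc (qvar powi e) * (case s of Plus \<Rightarrow> fps_X | Minus \<Rightarrow> Zv)"
definition ws :: "sgn \<Rightarrow> Cq fps fps" where
  "ws s = (case s of Plus \<Rightarrow> Zv | Minus \<Rightarrow> fps_X)"

lemma same_grll:
  "rtt.grll (<) M N (kc qvar) (kc qinv) (uq.sc 0) (uq.sc 0) 1 (zs s e) (ws s) (lamS s e) (muS s :: nat \<Rightarrow> nat \<Rightarrow> ('m, 'n) uq fps fps)"
  "rtt.grll (<) M N (kc qvar) (kc qinv) (uq.sc 0) (uq.sc 0) 1 (ws s) (zs s e) (muS s) (lamS s e :: nat \<Rightarrow> nat \<Rightarrow> ('m, 'n) uq fps fps)"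
proof -
  show "rtt.grll (<) M N (kc qvar) (kc qinv) (uq.sc 0) (uq.sc 0) 1 (zs s e) (ws s) (lamS s e) (muS s :: nat \<Rightarrow> nat \<Rightarrow> ('m, 'n) uq fps fps)"
  proof (cases s)
    case Plus
    show ?thesis
      unfolding Plus lamS_eq M N zs_def ws_def sgn.case
      by (rule uq.grll_plus(1)[OF qvar_inv shiftc_unit]) (rule plus_rel4[OF _ _ _ _ g00])
  next
    case Minus
    have c: "shiftc Minus e * qvar powi (- e) = 1"
      by (simp add: shiftc_simps qpow_add)
    show ?thesis
      unfolding Minus lamS_eq M N zs_def ws_def sgn.case shiftc_simps(2)[symmetric]
      by (rule uq.grll_minus(1)[OF qvar_inv c]) (rule minus_rel4[OF _ _ _ _ g00])
  qed
  show "rtt.grll (<) M N (kc qvar) (kc qinv) (uq.sc 0) (uq.sc 0) 1 (ws s) (zs s e) (muS s) (lamS s e :: nat \<Rightarrow> nat \<Rightarrow> ('m, 'n) uq fps fps)"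
  proof (cases s)
    case Plus
    show ?thesis
      unfolding Plus lamS_eq M N zs_def ws_def sgn.case
      by (rule uq.grll_plus(2)[OF qvar_inv shiftc_unit]) (rule plus_rel4[OF _ _ _ _ g00])
  next
    case Minus
    have c: "shiftc Minus e * qvar powi (- e) = 1"
      by (simp add: shiftc_simps qpow_add)
    show ?thesis
      unfolding Minus lamS_eq M N zs_def ws_def sgn.case shiftc_simps(2)[symmetric]
      by (rule uq.grll_minus(2)[OF qvar_inv c]) (rule minus_rel4[OF _ _ _ _ g00])
  qed
qed

lemma mixed_grll:
  "rtt.grll (<) M N (kc qvar) (kc qinv) (uq.sc 1) (uq.sc (-1)) (kc (shiftc Plus e) * tsub (dil (shiftc Plus e) (g0 M N))) (kc (qvar powi e)) (tsub fps_X)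
     (lamS Plus e) (muS Minus :: nat \<Rightarrow> nat \<Rightarrow> ('m, 'n) uq fps fps)"
  "rtt.grll (<) M N (kc qvar) (kc qinv) (uq.sc 1) (uq.sc (-1)) (tsub (dil (shiftc Minus e) (g0 M N))) 1 (kc (shiftc Minus e) * tsub fps_X)
     (muS Plus) (lamS Minus e :: nat \<Rightarrow> nat \<Rightarrow> ('m, 'n) uq fps fps)"
proof -
  show "rtt.grll (<) M N (kc qvar) (kc qinv) (uq.sc 1) (uq.sc (-1)) (kc (shiftc Plus e) * tsub (dil (shiftc Plus e) (g0 M N))) (kc (qvar powi e)) (tsub fps_X)
     (lamS Plus e) (muS Minus :: nat \<Rightarrow> nat \<Rightarrow> ('m, 'n) uq fps fps)"
    unfolding lamS_eq M N
  proof (rule uq.grll_mixed_in[OF qvar_inv shiftc_unit])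
    fix \<mu> \<nu> i m k n :: nat
    assume ix: "i \<in> {1..LENGTH('m) + LENGTH('n)}" "m \<in> {1..LENGTH('m) + LENGTH('n)}" "k \<in> {1..LENGTH('m) + LENGTH('n)}" "n \<in> {1..LENGTH('m) + LENGTH('n)}"
    have mm: "min \<mu> \<nu> = min \<nu> \<mu>" by (rule min.commute)
    show "uq.rel4 LENGTH('m) qvar qinv i m k n
      (\<lambda>a b u v. uq.conv (g0 LENGTH('m) LENGTH('n)) 1 a b (\<lambda>p. u $ (\<nu> - p) * v $ (\<mu> - p)) (min \<mu> \<nu>))
      (\<lambda>a b u v. uq.conv (g0 LENGTH('m) LENGTH('n)) (-1) a b (\<lambda>p. v $ (\<mu> - p) * u $ (\<nu> - p)) (min \<mu> \<nu>))
      (Lser Plus) (Lser Minus :: nat \<Rightarrow> nat \<Rightarrow> ('m, 'n) uq fps)"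
      unfolding mm by (rule mixed_rel4[OF ix])
  qed
  show "rtt.grll (<) M N (kc qvar) (kc qinv) (uq.sc 1) (uq.sc (-1)) (tsub (dil (shiftc Minus e) (g0 M N))) 1 (kc (shiftc Minus e) * tsub fps_X)
     (muS Plus) (lamS Minus e :: nat \<Rightarrow> nat \<Rightarrow> ('m, 'n) uq fps fps)"
    unfolding lamS_eq M N by (rule uq.grll_mixed_out[OF qvar_inv]) (rule mixed_rel4)
qed

text \<open>Scalars that do not annihilate anything nonzero. For equal signs this permits
  cancellation, as both sides carry the same scalar under the same map.\<close>

definition good :: "Cq fps fps \<Rightarrow> bool" where
  "good F \<longleftrightarrow> (\<forall>H :: ('m, 'n) uq fps fps. uq.sc 0 F * H = 0 \<longrightarrow> H = 0)"

lemma good_mult: "good F \<Longrightarrow> good G \<Longrightarrow> good (F * G)"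
proof -
  interpret sc: central_hom "uq.sc 0 :: Cq fps fps \<Rightarrow> ('m, 'n) uq fps fps" by (rule uq.sc_hom)
  show "good F \<Longrightarrow> good G \<Longrightarrow> good (F * G)"
    unfolding good_def sc.mult mult.assoc by blast
qed

lemma good_one: "good 1"
proof -
  interpret sc: central_hom "uq.sc 0 :: Cq fps fps \<Rightarrow> ('m, 'n) uq fps fps" by (rule uq.sc_hom)
  show ?thesis
    by (simp add: good_def)
qed

lemma good_uminus: "good F \<Longrightarrow> good (- F)"
proof -
  interpret sc: central_hom "uq.sc 0 :: Cq fps fps \<Rightarrow> ('m, 'n) uq fps fps" by (rule uq.sc_hom)
  show "good F \<Longrightarrow> good (- F)"
    unfolding good_def sc.uminus mult_minus_left neg_equal_0_iff_equal by blast
qed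

lemma good_prod_list: "(\<And>x. x \<in> set xs \<Longrightarrow> good (f x)) \<Longrightarrow> good (\<Prod>x\<leftarrow>xs. f x)"
  by (induction xs) (auto intro: good_one good_mult)

text \<open>The outer variable has a unit coefficient and the other summand raises the inner degree.
  So the coefficients of \<open>H\<close> vanish by induction on the inner degree, for all outer
  degrees at once.\<close>

lemma good_linear: "a \<noteq> 0 \<Longrightarrow> good (fps_X * kc a + Zv * kc b)"
  unfolding good_def
proof (intro allI impI)
  fix H :: "('m, 'n) uq fps fps"
  assume a: "a \<noteq> 0" and H: "uq.sc 0 (fps_X * kc a + Zv * kc b) * H = 0"
  have "H $ m $ n = 0" for m n
  proof (induction n arbitrary: m rule: less_induct)
    case (less n)
    have "0 = (uq.sc 0 (fps_X * kc a + Zv * kc b) * H) $ Suc m $ n"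
      by (simp add: H)
    also have "\<dots> = uscal a * H $ m $ n"
      unfolding uq.sc_linear_mult_nth using less[of "n - 1" "Suc m"] by (cases n) auto
    finally have "uscal (inverse a) * (uscal a * H $ m $ n) = 0"
      by simp
    then show ?case
      using a by (simp add: uq.usc.fuse)
  qed
  then show "H = 0"
    by (simp add: fps_eq_iff)
qed

lemma good_zs: "\<alpha> \<noteq> 0 \<Longrightarrow> \<beta> \<noteq> 0 \<Longrightarrow> good (zs s e * kc \<alpha> - ws s * kc \<beta>)"
proof -
  assume "\<alpha> \<noteq> 0" "\<beta> \<noteq> 0"
  have "zs s e * kc \<alpha> - ws s * kc \<beta> = (case s of Plus \<Rightarrow> fps_X * kc (qvar powi e * \<alpha>) + Zv * kc (- \<beta>)
      | Minus \<Rightarrow> fps_X * kc (- \<beta>) + Zv * kc (qvar powi e * \<alpha>))"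
    by (cases s) (simp_all add: zs_def ws_def kc_simps algebra_simps)
  then show ?thesis
    using \<open>\<alpha> \<noteq> 0\<close> \<open>\<beta> \<noteq> 0\<close> by (cases s) (simp_all add: good_linear qvar_nonzero)
qed

lemma good_zs1: "good (zs s e - ws s)" "good (ws s - zs s e)"
  using good_zs[of 1 1 s e] good_uminus[OF good_zs[of 1 1 s e]] by (simp_all add: kc_simps)

lemma good_cancel: "good F \<Longrightarrow> uq.sc 0 F * x = uq.sc 0 F * y \<Longrightarrow> x = (y :: ('m, 'n) uq fps fps)"
proof -
  assume F: "good F" and e: "uq.sc 0 F * x = uq.sc 0 F * y"
  have "uq.sc 0 F * (x - y) = 0"
    using e by (simp add: right_diff_distrib)
  then show ?thesis
    using F unfolding good_def by auto
qed

text \<open>In \<open>grll_KL\<close> the even column \<open>c\<close> and the odd row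
  \<open>r\<close> never coincide, so no exchange term arises and \<open>z - w\<close> cancels.
  Comparing single coefficients makes the result independent of shifts.\<close>

lemma Lser_Lv_commute:
  assumes "i \<in> {1..M}" "c \<in> {1..M}" "r \<in> {M+1..M+N}" "b \<in> {M+1..M+N}"
  shows "Lser s i c $ x * Lv s r b $ y = Lv s r b $ y * (Lser s i c $ x :: ('m, 'n) uq)"
proof -
  interpret R: rtt "(<)" M N "kc qvar" "kc qinv"
    by unfold_locales (simp add: kc_mult qvar_nonzero kc_simps(1))
  have V: "sinverse M N (muS s) (\<lambda>i j. emb_out (Lv s i j) :: ('m, 'n) uq fps fps)"
    unfolding lamS_eq M N by (rule sinverse_map[OF emb_out_add emb_out_mult emb_out_one Lv_inverse])
  have ix: "c \<in> {1..M+N}" "r \<in> {1..M+N}" "r \<noteq> c" "R.ep i c = 0" "gdiag M (kc qvar) (kc qinv) (zs s 0) (ws s) c r = zs s 0 - ws s"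
    using assms by (auto simp: eparity_def parity_def gdiag_def)
  have "uq.sc 0 (zs s 0 - ws s) * (emb_out (Lv s r b) * lamS s 0 i c) = uq.sc 0 (zs s 0 - ws s) * (lamS s 0 i c * emb_out (Lv s r b) :: ('m, 'n) uq fps fps)"
    using R.grll_KL[OF uq.sc_hom uq.sc_hom same_grll(1) V assms(1,4) ix(1,2)] ix by simp
  then have "emb_out (Lv s r b) * lamS s 0 i c = (lamS s 0 i c * emb_out (Lv s r b) :: ('m, 'n) uq fps fps)"
    by (rule good_cancel[OF good_zs1(1)])
  moreover have "lamS s 0 i c = (emb_in (Lser s i c) :: ('m, 'n) uq fps fps)"
    by (cases s) (simp_all add: lamS_def shiftc_def uq.udil_one)
  ultimately have "(emb_in (Lser s i c) * emb_out (Lv s r b)) $ y $ x = (emb_out (Lv s r b) * emb_in (Lser s i c :: ('m, 'n) uq fps)) $ y $ x"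
    by (simp only:)
  then show ?thesis
    by (simp only: emb_nth)
qed

text \<open>An inverse of the even block, which is again triangular in its constant terms; it enters
  the Schur complement \<open>ka'\<close>.\<close>

definition mi0 :: "sgn \<Rightarrow> nat \<Rightarrow> nat \<Rightarrow> ('m, 'n) uq fps" where
  "mi0 t = (SOME Y. \<forall>i\<in>{1..M}. \<forall>k\<in>{1..M}. (\<Sum>j\<in>{1..M}. Lser t i j * Y j k) = (if i = k then 1 else 0) \<and>
     (\<Sum>j\<in>{1..M}. Y i j * Lser t j k) = (if i = k then 1 else 0))"

lemma mi0: "i \<in> {1..M} \<Longrightarrow> k \<in> {1..M} \<Longrightarrow> (\<Sum>j\<in>{1..M}. Lser t i j * mi0 t j k) = (if i = k then 1 else 0)"
  "i \<in> {1..M} \<Longrightarrow> k \<in> {1..M} \<Longrightarrow> (\<Sum>j\<in>{1..M}. mi0 t i j * Lser t j k) = (if i = k then 1 else 0)"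
proof -
  interpret index_order "lts t" by (rule lts_order)
  obtain Y :: "nat \<Rightarrow> nat \<Rightarrow> ('m, 'n) uq fps" where "\<And>i k. i \<in> {1..M} \<Longrightarrow> k \<in> {1..M} \<Longrightarrow> (\<Sum>j\<in>{1..M}. Lser t i j * Y j k) = (if i = k then 1 else 0)"
    "\<And>i k. i \<in> {1..M} \<Longrightarrow> k \<in> {1..M} \<Longrightarrow> (\<Sum>j\<in>{1..M}. Y i j * Lser t j k) = (if i = k then 1 else 0)"
    by (rule triangular_inverse[OF _ Lser_triangular, of "{1..M}"]) (auto simp: M)
  then have "\<exists>Y :: nat \<Rightarrow> nat \<Rightarrow> ('m, 'n) uq fps. \<forall>i\<in>{1..M}. \<forall>k\<in>{1..M}. (\<Sum>j\<in>{1..M}. Lser t i j * Y j k) = (if i = k then 1 else 0) \<and>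
     (\<Sum>j\<in>{1..M}. Y i j * Lser t j k) = (if i = k then 1 else 0)"
    by (intro exI[of _ Y]) blast
  from someI_ex[OF this]
  show "i \<in> {1..M} \<Longrightarrow> k \<in> {1..M} \<Longrightarrow> (\<Sum>j\<in>{1..M}. Lser t i j * mi0 t j k) = (if i = k then 1 else 0)"
    "i \<in> {1..M} \<Longrightarrow> k \<in> {1..M} \<Longrightarrow> (\<Sum>j\<in>{1..M}. mi0 t i j * Lser t j k) = (if i = k then 1 else 0)"
    unfolding mi0_def[symmetric] by blast+
qed

lemma emb_out_sum: "emb_out (\<Sum>x\<in>A. f x) = (\<Sum>x\<in>A. emb_out (f x) :: ('m, 'n) uq fps fps)"
proof -
  have "emb_out 0 = (0 :: ('m, 'n) uq fps fps)"
    by (simp add: fps_eq_iff emb_out_def)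
  then show ?thesis
    by (induction A rule: infinite_finite_induct) (simp_all add: emb_out_add)
qed

lemma berez_intro:
  assumes z_step: "\<And>e. z (e + 2) = z e * kc qvar * kc qvar"
    and lm: "\<And>e. rtt.grll (<) M N (kc qvar) (kc qinv) (uq.sc \<epsilon>) (uq.sc \<epsilon>') (g e) (z e) w (lamS s e) (muS t :: nat \<Rightarrow> nat \<Rightarrow> ('m, 'n) uq fps fps)"
    and ml: "\<And>e. rtt.grll (<) M N (kc qvar) (kc qinv) (uq.sc \<epsilon>) (uq.sc \<epsilon>') (h e) w (z e) (muS t) (lamS s e :: nat \<Rightarrow> nat \<Rightarrow> ('m, 'n) uq fps fps)"
  shows "berez (<) M N (kc qvar) (kc qinv) (uq.sc \<epsilon>) (uq.sc \<epsilon>') (lamS s) (kkS s) (muS t) (kaS t) (\<lambda>i j. emb_out (mi0 t i j)) g h z (\<lambda>e. kc (qvar powi e)) w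
    [1..<Suc M] (rev [M+1..<Suc (M+N)])"
proof (intro berez.intro berez_axioms.intro)
  interpret R: rtt "(<)" M N "kc qvar" "kc qinv"
    by unfold_locales (simp add: kc_mult qvar_nonzero kc_simps(1))
  show "rtt (<) (kc qvar) (kc qinv)" by (rule R.rtt_axioms)
  show "central_hom (uq.sc \<epsilon>)" "central_hom (uq.sc \<epsilon>')" by (rule uq.sc_hom)+
  show "uq.sc \<epsilon> (kc qinv) = uq.sc \<epsilon>' (kc qinv)" by (simp add: uq.sc_kc)
  have "qvar - qinv \<noteq> 0"
  proof
    assume "qvar - qinv = 0"
    then have "qvar ^ 2 = 1"
      using qvar_inv by (simp add: power2_eq_square)
    then show False
      using qvar_power_eq_1[of 2] by simp
  qed
  then show "\<exists>l. l * (kc qvar - kc qinv) = 1"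
    using kc_unit[of "qvar - qinv"] by (auto simp: kc_simps)
  show "kc (qvar powi (e + 2)) = kc (qvar powi e) * kc qvar * kc qvar" for e
    by (simp add: kc_mult powi_diff(2) power2_eq_square mult.assoc)
  show "\<exists>u. u * kc (qvar powi e) = 1" for e
    using kc_unit[OF qpow_nonzero] by blast
  show "\<exists>u. u * (kc qvar * kc (qvar powi f) - kc qinv * kc (qvar powi e)) = 1" if "e < f" for e f :: int
  proof -
    \<comment> \<open>Equality would give q^(2 + f - e) = 1, impossible for
      \<open>e < f\<close>.\<close>
    have "qvar * qvar powi f - qinv * qvar powi e \<noteq> 0"
    proof
      assume "qvar * qvar powi f - qinv * qvar powi e = 0"
      then have "qvar * (qvar * qvar powi f) * qvar powi (- e) = qvar * (qinv * qvar powi e) * qvar powi (- e)"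
        by simp
      also have "\<dots> = (qvar * qinv) * (qvar powi e * qvar powi (- e))"
        by (simp only: mult_ac)
      also have "\<dots> = 1"
        unfolding qvar_inv qpow_add by simp
      also have "qvar * (qvar * qvar powi f) * qvar powi (- e) = qvar powi 2 * (qvar powi f * qvar powi (- e))"
        by (simp add: power2_eq_square mult.assoc)
      finally have "qvar powi (2 + (f + - e)) = 1"
        unfolding qpow_add .
      then show False
        using qvar_powi_eq_1 that by fastforce
    qed
    then show ?thesis
      using kc_unit[of "qvar * qvar powi f - qinv * qvar powi e"] by (auto simp: kc_simps)
  qed
  show "R.grll (uq.sc \<epsilon>) (uq.sc \<epsilon>) 1 (kc (qvar powi e)) (kc (qvar powi f)) (lamS s e) (lamS s f :: nat \<Rightarrow> nat \<Rightarrow> ('m, 'n) uq fps fps)"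
    "R.grll (uq.sc \<epsilon>') (uq.sc \<epsilon>') 1 (kc (qvar powi e)) (kc (qvar powi f)) (lamS s e) (lamS s f :: nat \<Rightarrow> nat \<Rightarrow> ('m, 'n) uq fps fps)" for e f
    by (rule inner_grll)+
  show "sinverse M N (lamS s e) (kkS s e :: nat \<Rightarrow> nat \<Rightarrow> ('m, 'n) uq fps fps)" for e
  proof -
    have "sinverse M N (\<lambda>i j. uq.udil (shiftc s e) (Lser s i j)) (\<lambda>i j. uq.udil (shiftc s e) (Lv s i j :: ('m, 'n) uq fps))"
      unfolding M N by (rule sinverse_map[OF uq.udil_add uq.udil_mult uq.udil_one(1) Lv_inverse])
    from sinverse_map[where \<phi> = emb_in, OF emb_in_hom(2,1,3) this] show ?thesis
      by (simp add: lamS_def[abs_def] kkS_def[abs_def])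
  qed
  show "sinverse M N (muS t) (kaS t :: nat \<Rightarrow> nat \<Rightarrow> ('m, 'n) uq fps fps)"
    unfolding muS_def[abs_def] kaS_def[abs_def] M N by (rule sinverse_map[OF emb_out_add emb_out_mult emb_out_one Lv_inverse])
  show "lamS s e i c * kkS s f r b = kkS s f r b * (lamS s e i c :: ('m, 'n) uq fps fps)"
    if "i \<in> {1..M}" "c \<in> {1..M}" "r \<in> {M+1..M+N}" "b \<in> {M+1..M+N}" for e f i c r b
  proof -
    have "uq.udil c1 (Lser s i c) * uq.udil c2 (Lv s r b) = uq.udil c2 (Lv s r b) * (uq.udil c1 (Lser s i c) :: ('m, 'n) uq fps)" for c1 c2
      by (rule fps_ext) (simp only: uq.udil_mult_nth(1)[of c1 "Lser s i c" c2] uq.udil_mult_nth(2)[where ?c1.0 = c1 and ?c2.0 = c2] Lser_Lv_commute[OF that])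
    then show ?thesis
      by (simp add: lamS_def kkS_def flip: emb_in_hom(1))
  qed
  show "(\<Sum>j\<in>{1..M}. muS t i j * emb_out (mi0 t j k)) = (if i = k then 1 else 0)" if "i \<in> {1..M}" "k \<in> {1..M}" for i k
    using arg_cong[OF mi0(1)[OF that, of t], of emb_out] by (auto simp: muS_def emb_out_sum emb_out_mult emb_out_one) (simp add: emb_out_def fps_eq_iff)
  show "(\<Sum>j\<in>{1..M}. emb_out (mi0 t i j) * muS t j k) = (if i = k then 1 else 0)" if "i \<in> {1..M}" "k \<in> {1..M}" for i k
    using arg_cong[OF mi0(2)[OF that, of t], of emb_out] by (auto simp: muS_def emb_out_sum emb_out_mult emb_out_one) (simp add: emb_out_def fps_eq_iff)
  show "sorted_wrt (<) [1..<Suc M]" "set [1..<Suc M] = {1..M}"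
    by (simp_all del: upt_Suc add: set_upt atLeastLessThanSuc_atLeastAtMost)
  show "sorted_wrt (\<lambda>x y. y < x) (rev [M+1..<Suc (M+N)])" "set (rev [M+1..<Suc (M+N)]) = {M+1..M+N}"
    by (simp_all del: upt_Suc add: sorted_wrt_rev atLeastLessThanSuc_atLeastAtMost)
qed (rule z_step lm ml)+

text \<open>The sum of squared weights is the Poincare polynomial of a symmetric group at
  \<open>c ^ 2\<close>, a nonempty sum of powers of \<open>c\<close>.\<close>

lemma poincare_unit:
  fixes lt :: "nat \<Rightarrow> nat \<Rightarrow> bool"
  assumes lt: "index_order lt" and A: "finite A" and c: "\<And>B (m :: nat list \<Rightarrow> nat). finite B \<Longrightarrow> B \<noteq> {} \<Longrightarrow> (\<Sum>x\<in>B. c ^ m x) \<noteq> 0"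
  shows "\<exists>u. u * (\<Sum>cs\<in>lists_on A (card A). index_order.wt lt (kc (c :: Cq)) cs * index_order.wt lt (kc c) cs) = 1"
proof -
  interpret index_order lt by fact
  let ?B = "{cs \<in> lists_on A (card A). distinct cs}"
  have w: "wt (kc c) cs * wt (kc c) cs = kc (if distinct cs then c ^ (2 * inversions cs) else 0)" for cs
  proof -
    have "(- kc c) ^ n * (- kc c) ^ n = kc (c ^ (2 * n))" for n
      by (simp add: power_mult power2_eq_square flip: power_mult_distrib kc_power) (simp add: kc_mult)
    then show ?thesis
      by (simp add: wt_def kc_simps)
  qed
  have ks: "kc (\<Sum>x\<in>B. f x) = (\<Sum>x\<in>B. kc (f x :: Cq))" for B :: "nat list set" and f
    by (induction B rule: infinite_finite_induct) (simp_all add: kc_simps)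
  have "(\<Sum>cs\<in>lists_on A (card A). wt (kc c) cs * wt (kc c) cs) = kc (\<Sum>cs\<in>lists_on A (card A). if distinct cs then c ^ (2 * inversions cs) else 0)"
    unfolding w ks ..
  also have "(\<Sum>cs\<in>lists_on A (card A). if distinct cs then c ^ (2 * inversions cs) else 0) = (\<Sum>cs\<in>?B. c ^ (2 * inversions cs))"
    using A by (intro sum.mono_neutral_cong_right) auto
  finally have e: "(\<Sum>cs\<in>lists_on A (card A). wt (kc c) cs * wt (kc c) cs) = kc (\<Sum>cs\<in>?B. c ^ (2 * inversions cs))" .
  obtain xs where "set xs = A" "distinct xs"
    using A finite_distinct_list by blast
  then have "xs \<in> ?B"
    by (auto simp: lists_on_def distinct_card)
  then have "(\<Sum>cs\<in>?B. c ^ (2 * inversions cs)) \<noteq> 0"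
    using A by (intro c) auto
  then show ?thesis
    unfolding e using kc_unit by blast
qed

text \<open>The Berezinian is placed in the inner and L in the outer variable, so commutation of the
  two series is commutation of all pairs of coefficients.\<close>

lemma berez_commute:
  assumes b: "berez (<) M N (kc qvar) (kc qinv) (uq.sc \<epsilon>) (uq.sc \<epsilon>') (lamS s :: int \<Rightarrow> nat \<Rightarrow> nat \<Rightarrow> ('m, 'n) uq fps fps) (kkS s) (muS t) (kaS t) mi g h z zl w
      [1..<Suc M] (rev [M+1..<Suc (M+N)])"
    and c1: "\<And>x y :: ('m, 'n) uq fps fps. M > 0 \<Longrightarrow> uq.sc \<epsilon> (half_berezinian.\<Gamma> (kc qvar) (kc qinv) g h z w (even_shifts M) (odd_shifts M N)) * x =
        uq.sc \<epsilon>' (half_berezinian.\<Gamma> (kc qvar) (kc qinv) g h z w (even_shifts M) (odd_shifts M N)) * y \<Longrightarrow> x = y"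
    and c2: "\<And>x y :: ('m, 'n) uq fps fps. N > 0 \<Longrightarrow>
        uq.sc \<epsilon> (berez.ka_factor M N (kc qvar) (kc qinv) g z w) * (uq.sc \<epsilon>' (\<Prod>e\<leftarrow>even_shifts M. half_berezinian.x g z w e) * x) =
        uq.sc \<epsilon>' (berez.ka_factor M N (kc qvar) (kc qinv) g z w) * (uq.sc \<epsilon> (\<Prod>e\<leftarrow>even_shifts M. half_berezinian.x g z w e) * y) \<Longrightarrow> x = y"
    and ij: "i \<in> {1..M+N}" "j \<in> {1..M+N}"
  shows "(berezinian s :: ('m, 'n) uq fps) $ r * ul t i j n = ul t i j n * berezinian s $ r"
proof -
  interpret b: berez "(<)" M N "kc qvar" "kc qinv" "uq.sc \<epsilon>" "uq.sc \<epsilon>'" "lamS s" "kkS s" "muS t :: nat \<Rightarrow> nat \<Rightarrow> ('m, 'n) uq fps fps" "kaS t" mi g h z zl w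
      "[1..<Suc M]" "rev [M+1..<Suc (M+N)]" by (rule b)
  have pI: "\<exists>u. u * (\<Sum>cs\<in>lists_on b.I M. nat_order.wt (kc qinv) cs * nat_order.wt (kc qinv) cs) = 1"
    using poincare_unit[OF nat_order.index_order_axioms _ qinv_power_sum_nonzero, of b.I] by simp
  have pJ: "\<exists>u. u * (\<Sum>cs\<in>lists_on b.J N. b.half.rv.wt (kc qvar) cs * b.half.rv.wt (kc qvar) cs) = 1"
    using poincare_unit[OF b.rv_order _ qvar_power_sum_nonzero, of b.J] by simp
  have DE: "b.half.D * b.half.E * muS t i j = muS t i j * (b.half.D * b.half.E)"
    by (rule b.mu_commute[OF pI pJ c1 c2 ij])
  have DS: "b.half.D = DS s \<epsilon>"
    unfolding b.half.D_def unfolding DS_def M ..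
  have D: "b.half.D = emb_in (\<Sum>\<sigma> | \<sigma> permutes {1..M}. perm_coeff M \<sigma> * prod_list (map (\<lambda>j. Lmat s (2 * int j - 2) (\<sigma> j) j) [1..<Suc M]))"
    unfolding DS unfolding DS_eq M ..
  let ?L = "[M+1..<Suc (M+N)]"
  define E0 :: "('m, 'n) uq fps" where "E0 = (\<Sum>\<tau> | \<tau> permutes {1..N}. perm_coeff N \<tau> *
     prod_list (map (\<lambda>k. Linv s (2 * int M - 2 * int k) (M + k) (M + \<tau> k)) [1..<Suc N]))"
  obtain k where k: "k \<noteq> 0" "ES s \<epsilon> ?L = uq.sc \<epsilon> (kc k) * emb_in E0"
    using ES_eq[of s \<epsilon>, where 'm = 'm and 'n = 'n] unfolding E0_def M N by blast
  have "?L \<in> lists_on b.J (card b.J)"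
    by (auto simp: lists_on_def simp del: upt_Suc)
  \<comment> \<open>The abstract argument lists the odd indices in decreasing order, the Berezinian
    in increasing order; the minors differ by a weight.\<close>
  then have "ES s \<epsilon> ?L = uq.sc \<epsilon> (b.half.rv.wt (kc qvar) ?L) * b.half.E"
    unfolding ES_def M[symmetric] N[symmetric] b.half.E_def
    by (intro b.half.rv.ring_minor_normal_form[OF b.s _ b.half.len(2) b.half.E_antisym b.C1]) auto
  then have "uq.sc \<epsilon> (kc (inverse k)) * (uq.sc \<epsilon> (kc k) * emb_in E0) = uq.sc \<epsilon> (kc (inverse k)) * (uq.sc \<epsilon> (b.half.rv.wt (kc qvar) ?L) * b.half.E)"
    using k(2) by simp
  then obtain x where E: "emb_in E0 = uq.sc \<epsilon> x * b.half.E"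
    unfolding b.half.s.fuse kc_unit[OF k(1)] by auto
  have B: "emb_in (berezinian s) = uq.sc \<epsilon> x * (b.half.D * b.half.E)"
  proof -
    have "berezinian s = (\<Sum>\<sigma> | \<sigma> permutes {1..M}. perm_coeff M \<sigma> * prod_list (map (\<lambda>j. Lmat s (2 * int j - 2) (\<sigma> j) j) [1..<Suc M])) * E0"
      by (simp only: berezinian_def Let_def E0_def M N)
    then have "emb_in (berezinian s) = b.half.D * (uq.sc \<epsilon> x * b.half.E)"
      by (simp only: emb_in_hom(1) D E)
    then show ?thesis
      by (simp only: b.half.s.swap[of b.half.D])
  qed
  have "emb_in (berezinian s) * emb_out (Lser t i j) = emb_out (Lser t i j) * (emb_in (berezinian s) :: ('m, 'n) uq fps fps)"
    using DE unfolding B muS_def by (simp add: mult.assoc b.half.s.swap[of "emb_out _"])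
  then have "(emb_in (berezinian s) * emb_out (Lser t i j)) $ n $ r = (emb_out (Lser t i j) * emb_in (berezinian s :: ('m, 'n) uq fps)) $ n $ r"
    by simp
  then have "berezinian s $ r * Lser t i j $ n = Lser t i j $ n * (berezinian s $ r :: ('m, 'n) uq)"
    by (simp only: emb_nth)
  then show ?thesis
    by (simp add: Lser_def)
qed

lemma prod_list_upt: "(\<Prod>e\<leftarrow>map f [0..<n]. F e) = (\<Prod>k<n. F (f k))"
  by (induction n) (simp_all add: mult.commute)

lemma tsub_prod: "(\<Prod>k<n. tsub (f k)) = tsub (\<Prod>k<n. f k)" for f :: "nat \<Rightarrow> Cq fps"
  by (induction n) (simp_all add: tsub_mult)

lemma shifts_last: "M > 0 \<Longrightarrow> last (even_shifts M) = 2 * (int M - 1)" "butlast (even_shifts M) = map (\<lambda>k. 2 * int k) [0..<M - 1]"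
  "N > 0 \<Longrightarrow> last (odd_shifts M N) = 2 * (int M - int N)" "butlast (odd_shifts M N) = map (\<lambda>k. 2 * int M - 2 - 2 * int k) [0..<N - 1]"
proof -
  have "butlast (map f [0..<n]) = map f [0..<n - 1]" for f :: "nat \<Rightarrow> int" and n
    by (cases n) (simp_all add: butlast_append)
  then show "M > 0 \<Longrightarrow> last (even_shifts M) = 2 * (int M - 1)" "butlast (even_shifts M) = map (\<lambda>k. 2 * int k) [0..<M - 1]"
    "N > 0 \<Longrightarrow> last (odd_shifts M N) = 2 * (int M - int N)" "butlast (odd_shifts M N) = map (\<lambda>k. 2 * int M - 2 - 2 * int k) [0..<N - 1]"
    by (simp_all add: even_shifts_def odd_shifts_def last_map of_nat_diff)
qed

text \<open>Turns products over the lists of shifts into the windows \<open>shp\<close>. The list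
  \<open>odd_shifts\<close> is decreasing, hence the reindexing for it.\<close>

lemma shifted_factors:
  fixes X Y A0 D0 :: "int \<Rightarrow> Cq fps fps"
  assumes sp: "shifted_products r M N a b c d"
    and X: "\<And>k. X (2 * k) = tsub (shifted_products.sh r k b)" and Y: "\<And>k. Y (2 * k) = tsub (shifted_products.sh r k c)"
    and A0: "\<And>k. A0 (2 * k) = tsub (shifted_products.sh r k a)" and D0: "\<And>k. D0 (2 * k) = tsub (shifted_products.sh r k d)"
  shows "M > 0 \<Longrightarrow> \<exists>k. k \<noteq> 0 \<and> A0 (last (even_shifts M)) * (\<Prod>e\<leftarrow>butlast (even_shifts M). X e) * (\<Prod>e\<leftarrow>odd_shifts M N. Y e) = kc k"
    "N > 0 \<Longrightarrow> \<exists>k. k \<noteq> 0 \<and> D0 (last (odd_shifts M N)) * (\<Prod>e\<leftarrow>butlast (odd_shifts M N). X e) = kc k * (\<Prod>e\<leftarrow>even_shifts M. X e)"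
    "\<exists>u. u * (\<Prod>e\<leftarrow>even_shifts M. X e) = 1"
proof -
  interpret shifted_products r M N a b c d by fact
  have ds: "(\<Prod>e\<leftarrow>map (\<lambda>k. 2 * int k) [0..<n]. X e) = tsub (shp b 0 n)" for n
    unfolding prod_list_upt X tsub_prod shp_def by simp
  have js: "(\<Prod>e\<leftarrow>map (\<lambda>k. 2 * int M - 2 - 2 * int k) [0..<n]. F e) = tsub (shp f (int M - int n) n)"
    if F: "\<And>k. F (2 * k) = tsub (sh k f)" for F f n
  proof -
    have "(\<Prod>k<n. F (2 * int M - 2 - 2 * int k)) = (\<Prod>k<n. (\<lambda>k. tsub (sh (int M - int n + int k) f)) (n - Suc k))"
    proof (rule prod.cong[OF refl])
      fix k assume "k \<in> {..<n}"
      then have "2 * int M - 2 - 2 * int k = 2 * (int M - int n + int (n - Suc k))"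
        by auto
      then show "F (2 * int M - 2 - 2 * int k) = (\<lambda>k. tsub (sh (int M - int n + int k) f)) (n - Suc k)"
        by (simp only: F)
    qed
    also have "\<dots> = (\<Prod>k<n. tsub (sh (int M - int n + int k) f))"
      by (rule prod.nat_diff_reindex)
    finally show ?thesis
      unfolding prod_list_upt tsub_prod shp_def .
  qed
  show "\<exists>k. k \<noteq> 0 \<and> A0 (last (even_shifts M)) * (\<Prod>e\<leftarrow>butlast (even_shifts M). X e) * (\<Prod>e\<leftarrow>odd_shifts M N. Y e) = kc k" if M0: "M > 0"
  proof -
    obtain k where "k \<noteq> 0" "sh (int M - 1) a * shp b 0 (M - 1) * shp c (int M - int N) N = fps_const k"
      using gamma_const[OF M0] by blast
    moreover have "(\<Prod>e\<leftarrow>odd_shifts M N. Y e) = tsub (shp c (int M - int N) N)"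
      unfolding odd_shifts_def by (rule js[OF Y])
    ultimately show ?thesis
      unfolding shifts_last(1)[OF M0] shifts_last(2) ds A0 by (intro exI[of _ k]) (simp flip: tsub_mult)
  qed
  have P: "(\<Prod>e\<leftarrow>even_shifts M. X e) = tsub (shp b 0 M)"
    unfolding even_shifts_def by (rule ds)
  show "\<exists>k. k \<noteq> 0 \<and> D0 (last (odd_shifts M N)) * (\<Prod>e\<leftarrow>butlast (odd_shifts M N). X e) = kc k * (\<Prod>e\<leftarrow>even_shifts M. X e)" if N0: "N > 0"
  proof -
    obtain k where k: "k \<noteq> 0" "sh (int M - int N) d * shp b (int M - int N + 1) (N - 1) = fps_const k * shp b 0 M"
      using factor_const[OF N0] by blast
    have e: "int M - int (N - 1) = int M - int N + 1"
      using N0 by simp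
    show ?thesis
      unfolding shifts_last(3)[OF N0] shifts_last(4) js[OF X] P D0 e tsub_mult[symmetric] k(2)
      using k(1) by (intro exI[of _ k]) (simp add: tsub_mult)
  qed
  have "inverse (shp b 0 M) * shp b 0 M = 1"
    using nz(2) by (intro inverse_mult_eq_1) (simp add: shp_nth0)
  then show "\<exists>u. u * (\<Prod>e\<leftarrow>even_shifts M. X e) = 1"
    unfolding P by (intro exI[of _ "tsub (inverse (shp b 0 M))"]) (simp flip: tsub_mult)
qed

lemma sc_kc_cancel: "k \<noteq> 0 \<Longrightarrow> uq.sc \<epsilon> (kc k) * x = uq.sc \<epsilon>' (kc k) * y \<Longrightarrow> x = (y :: ('m, 'n) uq fps fps)"
proof -
  interpret sc: central_hom "uq.sc \<epsilon> :: Cq fps fps \<Rightarrow> ('m, 'n) uq fps fps" by (rule uq.sc_hom)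
  assume k: "k \<noteq> 0" and e: "uq.sc \<epsilon> (kc k) * x = uq.sc \<epsilon>' (kc k) * y"
  have "uq.sc \<epsilon> (kc (inverse k)) * (uq.sc \<epsilon> (kc k) * x) = uq.sc \<epsilon> (kc (inverse k)) * (uq.sc \<epsilon> (kc k) * y)"
    using e by (simp add: uq.sc_kc)
  then show ?thesis
    unfolding sc.fuse kc_unit[OF k] by simp
qed

lemma mixed_commute:
  assumes b: "berez (<) M N (kc qvar) (kc qinv) (uq.sc 1) (uq.sc (-1)) (lamS s :: int \<Rightarrow> nat \<Rightarrow> nat \<Rightarrow> ('m, 'n) uq fps fps) (kkS s) (muS t) (kaS t) mi g h z zl w
      [1..<Suc M] (rev [M+1..<Suc (M+N)])"
    and sp: "shifted_products r M N a b c d"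
    and X: "\<And>k. g (2 * k) * (z (2 * k) - w) = tsub (shifted_products.sh r k b)"
    and Y: "\<And>k. h (2 * k) * (w - z (2 * k)) = tsub (shifted_products.sh r k c)"
    and A0: "\<And>k. g (2 * k) * (z (2 * k) * kc qvar - w * kc qinv) = tsub (shifted_products.sh r k a)"
    and D0: "\<And>k. g (2 * k) * (z (2 * k) * kc qinv - w * kc qvar) = tsub (shifted_products.sh r k d)"
    and ij: "i \<in> {1..M+N}" "j \<in> {1..M+N}"
  shows "(berezinian s :: ('m, 'n) uq fps) $ r' * ul t i j n = ul t i j n * berezinian s $ r'"
proof (rule berez_commute[OF b _ _ ij])
  interpret b: berez "(<)" M N "kc qvar" "kc qinv" "uq.sc 1" "uq.sc (-1)" "lamS s :: int \<Rightarrow> nat \<Rightarrow> nat \<Rightarrow> ('m, 'n) uq fps fps" "kkS s" "muS t" "kaS t" mi g h z zl w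
      "[1..<Suc M]" "rev [M+1..<Suc (M+N)]" by (rule b)
  note f = shifted_factors[where X = "\<lambda>e. g e * (z e - w)" and Y = "\<lambda>e. h e * (w - z e)" and ?A0.0 = "\<lambda>e. g e * (z e * kc qvar - w * kc qinv)"
      and ?D0.0 = "\<lambda>e. g e * (z e * kc qinv - w * kc qvar)", OF sp X Y A0 D0]
  show "x = y" if M0: "M > 0" and G: "uq.sc 1 b.half.\<Gamma> * x = uq.sc (-1) b.half.\<Gamma> * y" for x y :: "('m, 'n) uq fps fps"
  proof -
    have "even_shifts M \<noteq> []"
      using M0 by (simp add: even_shifts_def)
    then obtain k where "k \<noteq> 0" "b.half.\<Gamma> = kc k"
      using f(1)[OF M0] unfolding b.half.\<Gamma>_def b.half.x_def b.half.y_def by auto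
    with G show ?thesis
      using sc_kc_cancel[of k 1 x "-1" y] by simp
  qed
  let ?P = "\<Prod>e\<leftarrow>even_shifts M. b.half.x e"
  show "x = y" if N0: "N > 0" and G: "uq.sc 1 b.ka_factor * (uq.sc (-1) ?P * x) = uq.sc (-1) b.ka_factor * (uq.sc 1 ?P * y)" for x y :: "('m, 'n) uq fps fps"
  proof -
    obtain k where k: "k \<noteq> 0" "b.ka_factor = kc k * ?P"
      using f(2)[OF N0] unfolding b.ka_factor_def b.half.x_def by auto
    obtain u where u: "u * ?P = 1"
      using f(3) unfolding b.half.x_def by auto
    \<comment> \<open>\<open>ka_factor\<close> is a constant times \<open>?P\<close>. So both sides
      carry \<open>?P\<close> once under each of the two maps, and these factors cancel along with
      the constant.\<close>
    have "uq.sc 1 (kc k) * (uq.sc 1 ?P * (uq.sc (-1) ?P * x)) = uq.sc (-1) (kc k) * (uq.sc (-1) ?P * (uq.sc 1 ?P * y))"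
      using G unfolding k(2) b.half.s.mult b.half.s'.mult by (simp only: mult.assoc)
    then have "uq.sc 1 ?P * (uq.sc (-1) ?P * x) = uq.sc (-1) ?P * (uq.sc 1 ?P * y)"
      by (rule sc_kc_cancel[OF k(1)])
    also have "\<dots> = uq.sc 1 ?P * (uq.sc (-1) ?P * y)"
      by (rule b.half.s.swap)
    finally have "uq.sc 1 u * (uq.sc 1 ?P * (uq.sc (-1) ?P * x)) = uq.sc 1 u * (uq.sc 1 ?P * (uq.sc (-1) ?P * y))"
      by simp
    then have "uq.sc (-1) u * (uq.sc (-1) ?P * x) = uq.sc (-1) u * (uq.sc (-1) ?P * y)"
      unfolding b.half.s.fuse u by simp
    then show ?thesis
      unfolding b.half.s'.fuse u by simp
  qed
qed

lemma same_commute: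
  assumes ij: "i \<in> {1..M+N}" "j \<in> {1..M+N}"
  shows "(berezinian s :: ('m, 'n) uq fps) $ r * ul s i j n = ul s i j n * berezinian s $ r"
proof -
  have b: "berez (<) M N (kc qvar) (kc qinv) (uq.sc 0) (uq.sc 0) (lamS s :: int \<Rightarrow> nat \<Rightarrow> nat \<Rightarrow> ('m, 'n) uq fps fps) (kkS s) (muS s) (kaS s) (\<lambda>i j. emb_out (mi0 s i j)) (\<lambda>_. 1) (\<lambda>_. 1) (zs s)
    (\<lambda>e. kc (qvar powi e)) (ws s) [1..<Suc M] (rev [M+1..<Suc (M+N)])"
  proof (rule berez_intro[OF _ same_grll])
    have "kc (qvar powi (e + 2)) = kc (qvar powi e) * kc qvar * kc qvar" for e
      by (simp add: kc_mult powi_diff(2) power2_eq_square mult.assoc)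
    then show "zs s (e + 2) = zs s e * kc qvar * kc qvar" for e
      unfolding zs_def by (simp only: mult_ac)
  qed
  interpret b: berez "(<)" M N "kc qvar" "kc qinv" "uq.sc 0" "uq.sc 0" "lamS s :: int \<Rightarrow> nat \<Rightarrow> nat \<Rightarrow> ('m, 'n) uq fps fps" "kkS s" "muS s" "kaS s" "\<lambda>i j. emb_out (mi0 s i j)" "\<lambda>_. 1" "\<lambda>_. 1"
    "zs s" "\<lambda>e. kc (qvar powi e)" "ws s" "[1..<Suc M]" "rev [M+1..<Suc (M+N)]" by (rule b)
  have x: "good (b.half.x e)" and y: "good (b.half.y e)" for e
    unfolding b.half.x_def b.half.y_def mult_1 by (rule good_zs1)+
  show ?thesis
  proof (rule berez_commute[OF b _ _ ij])
    have "good b.half.\<Gamma>"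
      unfolding b.half.\<Gamma>_def
      by (auto intro!: good_mult good_one good_prod_list x y good_zs simp: qvar_nonzero)
    then show "x = y" if "uq.sc 0 b.half.\<Gamma> * x = uq.sc 0 b.half.\<Gamma> * y" for x y :: "('m, 'n) uq fps fps"
      using that by (rule good_cancel)
    have "good (b.ka_factor * (\<Prod>e\<leftarrow>even_shifts M. b.half.x e))"
      unfolding b.ka_factor_def b.half.x_def mult_1
      by (auto intro!: good_mult good_one good_prod_list good_zs good_zs1 simp: qvar_nonzero)
    then show "x = y" if "uq.sc 0 b.ka_factor * (uq.sc 0 (\<Prod>e\<leftarrow>even_shifts M. b.half.x e) * x) =
        uq.sc 0 b.ka_factor * (uq.sc 0 (\<Prod>e\<leftarrow>even_shifts M. b.half.x e) * y)" for x y :: "('m, 'n) uq fps fps"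
      using that unfolding b.half.s.fuse by (rule good_cancel)
  qed
qed

lemma sh_plus: "shifted_products.sh (qinv ^ 2) k F = dil (shiftc Plus (2 * k)) F"
  and sh_minus: "shifted_products.sh (qvar ^ 2) k F = dil (shiftc Minus (2 * k)) F"
proof -
  have "qinv ^ 2 = qvar powi (- 2)" "qvar ^ 2 = qvar powi 2"
    by (simp_all add: power_int_minus power_inverse)
  then have "(qinv ^ 2) powi k = qvar powi (- 2 * k)" "(qvar ^ 2) powi k = qvar powi (2 * k)"
    by (simp_all only: power_int_mult)
  then show "shifted_products.sh (qinv ^ 2) k F = dil (shiftc Plus (2 * k)) F"
    "shifted_products.sh (qvar ^ 2) k F = dil (shiftc Minus (2 * k)) F"
    by (simp_all add: shifted_products.sh_def[OF shifted_plus[OF MN]] shifted_products.sh_def[OF shifted_minus[OF MN]] shiftc_simps)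
qed

lemma MN': "M \<noteq> N"
  using MN by (simp add: M N)

text \<open>The defining mixed relation has L^+ in the first place; the relation with L^- first,
  required as well, comes from \<open>grll_swap\<close> with the prefactor
  \<open>u0\<close>.\<close>

lemma plus_minus_commute:
  assumes ij: "i \<in> {1..M+N}" "j \<in> {1..M+N}"
  shows "(berezinian Plus :: ('m, 'n) uq fps) $ r * ul Minus i j n = ul Minus i j n * berezinian Plus $ r"
proof -
  let ?c = "\<lambda>e. shiftc Plus e" and ?z = "\<lambda>e. kc (qvar powi e)" and ?w = "tsub (fps_X :: Cq fps)"
  let ?G = "\<lambda>F e. kc (?c e) * tsub (dil (?c e) F)"
  have cc: "kc (?c e) * (?z e * x) = x" for e x
    by (simp add: mult.assoc[symmetric] kc_mult shiftc_unit kc_simps(1))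
  have cc': "?z e * (kc (?c e) * x) = x" for e x
    by (simp add: mult.left_commute[of "?z e"] cc)
  have lin: "?G F e * (?z e * kc \<alpha> - ?w * kc \<beta>) = tsub (dil (?c e) (F * (fps_const \<alpha> - fps_const \<beta> * fps_X)))" for F e \<alpha> \<beta>
    by (simp add: dil_mult tsub_mult algebra_simps kc_simps(4) cc cc')
  have lin1: "?G F e * (?z e - ?w) = tsub (dil (?c e) (F * (1 - fps_X)))" for F e
    using lin[where F = F and e = e and \<alpha> = 1 and \<beta> = 1] by (simp add: kc_simps)
  have lin': "?G F e * (?w * kc \<beta> - ?z e * kc \<alpha>) = tsub (dil (?c e) (F * (fps_const \<beta> * fps_X - fps_const \<alpha>)))" for F e \<alpha> \<beta>
  proof -
    have "?G F e * (?w * kc \<beta> - ?z e * kc \<alpha>) = - (?G F e * (?z e * kc \<alpha> - ?w * kc \<beta>))"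
      by (simp add: algebra_simps)
    also have "\<dots> = tsub (dil (?c e) (F * (fps_const \<beta> * fps_X - fps_const \<alpha>)))"
      unfolding lin by (simp add: dil_mult tsub_mult algebra_simps)
    finally show ?thesis .
  qed
  have lin1': "?G F e * (?w - ?z e) = tsub (dil (?c e) (F * (fps_X - 1)))" for F e
    using lin'[where F = F and e = e and \<alpha> = 1 and \<beta> = 1] by (simp add: kc_simps)
  interpret R: rtt "(<)" M N "kc qvar" "kc qinv"
    by unfold_locales (simp add: kc_mult qvar_nonzero kc_simps(1))
  have nrm: "?G (u0 M N) e * (?G (g0 M N) e * R.nrm (?z e) ?w) = 1" for e
  proof -
    have "?G (u0 M N) e * (?G (g0 M N) e * R.nrm (?z e) ?w) =
      (?G (g0 M N) e * (?z e * kc qvar - ?w * kc qinv)) * (?G (u0 M N) e * (?w * kc qvar - ?z e * kc qinv))"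
      by (simp only: R.nrm_def mult_ac)
    also have "\<dots> = tsub (dil (?c e) (u0 M N * (fser M N * (Q * fps_X - Q'))))"
      unfolding lin lin' g0_mult by (simp only: dil_mult tsub_mult mult_ac)
    finally show ?thesis
      by (simp add: u0_mult[OF MN'])
  qed
  have b: "berez (<) M N (kc qvar) (kc qinv) (uq.sc 1) (uq.sc (-1)) (lamS Plus :: int \<Rightarrow> nat \<Rightarrow> nat \<Rightarrow> ('m, 'n) uq fps fps) (kkS Plus) (muS Minus) (kaS Minus)
    (\<lambda>i j. emb_out (mi0 Minus i j)) (?G (g0 M N)) (?G (u0 M N)) ?z (\<lambda>e. kc (qvar powi e)) ?w [1..<Suc M] (rev [M+1..<Suc (M+N)])"
  proof (rule berez_intro[OF _ mixed_grll(1)])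
    show "kc (qvar powi (e + 2)) = kc (qvar powi e) * kc qvar * kc qvar" for e
      by (simp add: kc_mult powi_diff(2) power2_eq_square mult.assoc)
    show "R.grll (uq.sc 1) (uq.sc (-1)) (?G (u0 M N) e) ?w (?z e) (muS Minus) (lamS Plus e :: nat \<Rightarrow> nat \<Rightarrow> ('m, 'n) uq fps fps)" for e
      by (rule R.grll_swap[OF uq.sc_hom uq.sc_hom mixed_grll(1) nrm])
  qed
  show ?thesis
    by (rule mixed_commute[OF b shifted_plus[OF MN'] _ _ _ _ ij])
      (simp_all only: sh_plus lin lin1 lin1' g0_mult sA_def sB_def)
qed

text \<open>Here the matrix with shifted arguments is the second one in the defining relation, so
  \<open>g0\<close> and \<open>u0\<close> exchange their roles.\<close>

lemma minus_plus_commute: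
  assumes ij: "i \<in> {1..M+N}" "j \<in> {1..M+N}"
  shows "(berezinian Minus :: ('m, 'n) uq fps) $ r * ul Plus i j n = ul Plus i j n * berezinian Minus $ r"
proof -
  let ?c = "\<lambda>e. shiftc Minus e" and ?z = "\<lambda>e. kc (shiftc Minus e) * tsub (fps_X :: Cq fps)"
  let ?G = "\<lambda>F e. tsub (dil (?c e) F)"
  have lin: "?G F e * (?z e * kc \<alpha> - 1 * kc \<beta>) = ?G (F * (fps_const \<alpha> * fps_X - fps_const \<beta>)) e" for F e \<alpha> \<beta>
    by (simp add: dil_mult tsub_mult algebra_simps kc_simps(4))
  have lin': "?G F e * (1 * kc \<beta> - ?z e * kc \<alpha>) = ?G (F * (fps_const \<beta> - fps_const \<alpha> * fps_X)) e" for F e \<alpha> \<beta>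
    by (simp add: dil_mult tsub_mult algebra_simps kc_simps(4))
  have lin1: "?G F e * (?z e - 1) = ?G (F * (fps_X - 1)) e" "?G F e * (1 - ?z e) = ?G (F * (1 - fps_X)) e" for F e
    using lin[where F = F and e = e and \<alpha> = 1 and \<beta> = 1] lin'[where F = F and e = e and \<alpha> = 1 and \<beta> = 1] by (simp_all add: kc_simps)
  interpret R: rtt "(<)" M N "kc qvar" "kc qinv"
    by unfold_locales (simp add: kc_mult qvar_nonzero kc_simps(1))
  have ui: "u0 M N * (Q * fps_X - Q') = inverse (fser M N)"
  proof (rule fps_cancel[OF MN'])
    show "fser M N $ 0 \<noteq> 0" by (simp add: fser_equation(1)[OF MN'])
    show "fser M N * (u0 M N * (Q * fps_X - Q')) = fser M N * inverse (fser M N)"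
      using u0_mult[OF MN'] by (simp add: mult_ac inverse_mult_eq_1' fser_equation(1)[OF MN'])
  qed
  have nrm: "?G (u0 M N) e * (?G (g0 M N) e * R.nrm 1 (?z e)) = 1" for e
  proof -
    have "?G (u0 M N) e * (?G (g0 M N) e * R.nrm 1 (?z e)) =
      (?G (g0 M N) e * (1 * kc qvar - ?z e * kc qinv)) * (?G (u0 M N) e * (?z e * kc qvar - 1 * kc qinv))"
      by (simp only: R.nrm_def mult_ac)
    also have "\<dots> = tsub (dil (?c e) (u0 M N * (fser M N * (Q * fps_X - Q'))))"
      unfolding lin lin' g0_mult by (simp only: dil_mult tsub_mult mult_ac)
    finally show ?thesis
      by (simp add: u0_mult[OF MN'])
  qed
  have b: "berez (<) M N (kc qvar) (kc qinv) (uq.sc 1) (uq.sc (-1)) (lamS Minus :: int \<Rightarrow> nat \<Rightarrow> nat \<Rightarrow> ('m, 'n) uq fps fps) (kkS Minus) (muS Plus) (kaS Plus)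
    (\<lambda>i j. emb_out (mi0 Plus i j)) (?G (u0 M N)) (?G (g0 M N)) ?z (\<lambda>e. kc (qvar powi e)) 1 [1..<Suc M] (rev [M+1..<Suc (M+N)])"
  proof (rule berez_intro[OF _ _ mixed_grll(2)])
    have "kc (qvar powi (e + 2)) = kc (qvar powi e) * kc qvar * kc qvar" for e
      by (simp add: kc_mult powi_diff(2) power2_eq_square mult.assoc)
    then show "?z (e + 2) = ?z e * kc qvar * kc qvar" for e
      unfolding shiftc_simps by (simp only: mult_ac)
    show "R.grll (uq.sc 1) (uq.sc (-1)) (?G (u0 M N) e) (?z e) 1 (lamS Minus e) (muS Plus :: nat \<Rightarrow> nat \<Rightarrow> ('m, 'n) uq fps fps)" for e
      by (rule R.grll_swap[OF uq.sc_hom uq.sc_hom mixed_grll(2) nrm])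
  qed
  show ?thesis
    by (rule mixed_commute[OF b shifted_minus[OF MN'] _ _ _ _ ij])
      (simp_all only: sh_minus lin lin1 ui sA_def sB_def)
qed

end

theorem corollary3p5:
  fixes s :: sgn and r :: nat
  assumes "LENGTH('m::len0) \<noteq> LENGTH('n::len0)"
  shows "fps_nth (berezinian s :: ('m, 'n) uq fps) r \<in> center"
proof -
  have L: "berezinian s $ r * ul t i j n = ul t i j n * (berezinian s :: ('m, 'n) uq fps) $ r" for t i j n
  proof (cases "i \<in> {1..LENGTH('m)+LENGTH('n)} \<and> j \<in> {1..LENGTH('m)+LENGTH('n)}")
    case True
    then show ?thesis
      using same_commute[OF assms, of i j s r n] plus_minus_commute[OF assms, of i j r n] minus_plus_commute[OF assms, of i j r n]
      by (cases s; cases t) auto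
  next
    case False
    then have "ul t i j n = (0 :: ('m, 'n) uq)"
      using abs_uq_eq_0[where 'm = 'm and 'n = 'n, OF rels.out_of_range[where i = i and j = j and s = t and r = n]] by (auto simp: ul.abs_eq)
    then show ?thesis by simp
  qed
  have "berezinian s $ r * abs_uq (fgen g) = abs_uq (fgen g) * (berezinian s :: ('m, 'n) uq fps) $ r" for g
    using L qc_gens(3,4)[of "berezinian s $ r", symmetric] by (cases g) (simp_all add: ul.abs_eq)
  then show ?thesis
    unfolding center_def by (auto intro: uq_commute_gens)
qed

end
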